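(* Let $\mathcal{B}$ be a finite alphabet, let $(w_n)_{n\in\mathbb{N}}$ be a uniformly computable sequence of words of $\mathcal{B}^{*}$, and assume there exists a word $u$ that does not appear as a subword in any of the $w_n$. Then there is a cellular automaton $F:\mathcal{B}^{\mathbb{Z}}\to\mathcal{B}^{\mathbb{Z}}$ such that for any measure $\mu\in\mathcal{M}_{\sigma\text{-mix}}^{\mathrm{full}}(\mathcal{B}^{\mathbb{Z}})$, $\mathcal{V}(F,\mu)=\mathcal{V}((w_n)_{n\in\mathbb{N}})$.
   Context: For a finite alphabet $\mathcal{B}$: $\mathcal{B}^{\mathbb{Z}}$ carries the product topology, $\mathcal{B}^{*}$ is the set of finite words, $\sigma(x)_i=x_{i+1}$ is the shift, and for a word $u$, $[u]=\{x: x_0\cdots x_{|u|-1}=u\}$. $\mathcal{M}_\sigma(\mathcal{B}^{\mathbb{Z}})$ is the set of $\sigma$-invariant Borel probability measures with the weak$^*$ topology. A cellular automaton is a continuous map $F:\mathcal{B}^{\mathbb{Z}}\to\mathcal{B}^{\mathbb{Z}}$ commuting with $\sigma$; $F_*\mu(E)=\mu(F^{-1}(E))$. $\mathcal{V}(F,\mu)$ is the set of weak$^*$ limit points of the sequence $(F_*^t\mu)_{t\in\mathbb{N}}$. For $U\subset\mathbb{Z}$ let $\mathfrak{B}_U$ be the $\sigma$-algebra generated by cylinders on finite subsets of $U$, and let $$\psi_\mu(n)=\sup\left\{\left|\frac{\mu(A\cap B)}{\mu(A)\mu(B)}-1\right| : A\in\mathfrak{B}_{]-\infty,0]},\ B\in\mathfrak{B}_{[n,\infty[},\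 \mu(A)>0,\ \mu(B)>0\right\}.$$ $\mu\in\mathcal{M}_\sigma(\mathcal{B}^{\mathbb{Z}})$ is $\psi$-mixing if $\psi_\mu(n)\to0$, and has full support if $\mu([u])>0$ for all $u\in\mathcal{B}^*$; $\mathcal{M}_{\sigma\text{-mix}}^{\mathrm{full}}(\mathcal{B}^{\mathbb{Z}})$ is the set of $\psi$-mixing measures with full support. A sequence of (nonempty) words $(w_n)$ is uniformly computable if $n\mapsto w_n$ is a computable function. For a nonempty word $w$, $\widehat{\delta_w}=\frac1{|w|}\sum_{i=0}^{|w|-1}\delta_{\sigma^i({}^\infty w^\infty)}$ is the $\sigma$-invariant measure supported by the orbit of the periodic configuration ${}^\infty w^\infty$. For words $u,v$, $[\widehat{\delta_u},\widehat{\delta_v}]=\{s\widehat{\delta_u}+(1-s)\widehat{\delta_v}:s\in[0,1]\}$, and $$\mathcal{V}((w_n)_{n\in\mathbb{N}})=\bigcap_{N>0}\overline{\bigcup_{n\ge N}[\widehat{\delta_{w_n}},\widehat{\delta_{w_{n+1}}}]}.$$ *)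

theory Defs
  imports "HOL-Probability.Probability" "HOL-Library.Sublist"
begin

text \<open>
  A finite alphabet is a type of class \<open>finite\<close> with the discrete topology. On the
  function type \<open>int \<Rightarrow> 'b\<close> the instance of \<open>topological_space\<close> is then the product topology,
  and \<open>borel\<close> is the Borel \<open>\<sigma>\<close>-algebra of the full shift.
\<close>

type_synonym 'b configuration = "int \<Rightarrow> 'b"

definition shift_map :: "'b configuration \<Rightarrow> 'b configuration" where
  "shift_map x = (\<lambda>i. x (i + 1))"

definition cylinder :: "'b list \<Rightarrow> 'b configuration set" where
  "cylinder u = {x. \<forall>i < length u. x (int i) = u ! i}"

definition cellular_automaton ::
    "('b::topological_space configuration \<Rightarrow> 'b configuration) \<Rightarrow> bool" where
  "cellular_automaton F \<longleftrightarrow> continuous_on UNIV F \<and> F \<circ> shift_map = shift_map \<circ> F"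


subsection \<open>Invariant measures and the weak* topology\<close>

definition pushforward ::
    "('b::topological_space configuration \<Rightarrow> 'b configuration)
      \<Rightarrow> 'b configuration measure \<Rightarrow> 'b configuration measure" where
  "pushforward F \<mu> = distr \<mu> borel F"

definition invariant_measures :: "'b::topological_space configuration measure set" where
  "invariant_measures =
     {\<mu>. sets \<mu> = sets borel \<and> prob_space \<mu> \<and> pushforward shift_map \<mu> = \<mu>}"

definition weak_star :: "'b::topological_space configuration measure topology" where
  "weak_star = topology_generated_by
     {{\<mu> \<in> invariant_measures. (\<integral>x. f x \<partial>\<mu>) \<in> U} |
        (f :: 'b configuration \<Rightarrow> real) U. continuous_on UNIV f \<and> open U}"

lemma topspace_weak_star: "topspace weak_star = invariant_measures"
proof -
  have "\<exists>(f :: 'a configuration \<Rightarrow> real) U. invariant_measures =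
          {\<mu> \<in> invariant_measures. (\<integral>x. f x \<partial>\<mu>) \<in> U} \<and> continuous_on UNIV f \<and> open U"
    by (rule exI[of _ "\<lambda>_. 0"], rule exI[of _ UNIV]) auto
  then show ?thesis
    unfolding weak_star_def topology_generated_by_topspace by blast
qed

text \<open>Limit points of the sequence of iterated images, in the sense of cluster points.\<close>

definition limit_measures ::
    "('b::topological_space configuration \<Rightarrow> 'b configuration)
      \<Rightarrow> 'b configuration measure \<Rightarrow> 'b configuration measure set" where
  "limit_measures F \<mu> =
     {\<nu> \<in> topspace weak_star. \<forall>U. openin weak_star U \<and> \<nu> \<in> U \<longrightarrow>
        (\<exists>\<^sub>F t in sequentially. (pushforward F ^^ t) \<mu> \<in> U)}"


subsection \<open>Mixing and full support\<close>

definition cylinder_algebra :: "int set \<Rightarrow> 'b configuration set set" where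
  "cylinder_algebra U =
     sigma_sets UNIV {{x. \<forall>i\<in>V. x i = a i} | V a. finite V \<and> V \<subseteq> U}"

text \<open>The supremum is taken in the extended reals since it may be infinite.\<close>

definition psi_coefficient :: "'b configuration measure \<Rightarrow> nat \<Rightarrow> ereal" where
  "psi_coefficient \<mu> n =
     Sup {ereal \<bar>measure \<mu> (A \<inter> B) / (measure \<mu> A * measure \<mu> B) - 1\<bar> | A B.
            A \<in> cylinder_algebra {..0} \<and> B \<in> cylinder_algebra {int n..} \<and>
            measure \<mu> A > 0 \<and> measure \<mu> B > 0}"

definition psi_mixing :: "'b configuration measure \<Rightarrow> bool" where
  "psi_mixing \<mu> \<longleftrightarrow> psi_coefficient \<mu> \<longlonglongrightarrow> 0"

definition full_support :: "'b configuration measure \<Rightarrow> bool" where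
  "full_support \<mu> \<longleftrightarrow> (\<forall>u. measure \<mu> (cylinder u) > 0)"

definition full_mixing_measures :: "'b::topological_space configuration measure set" where
  "full_mixing_measures = {\<mu> \<in> invariant_measures. psi_mixing \<mu> \<and> full_support \<mu>}"


subsection \<open>Measures supported by periodic orbits\<close>

definition periodic :: "'b list \<Rightarrow> 'b configuration" where
  "periodic w = (\<lambda>i. w ! nat (i mod int (length w)))"

definition periodic_measure :: "'b::topological_space list \<Rightarrow> 'b configuration measure" where
  "periodic_measure w = measure_of UNIV (sets borel)
     (\<lambda>E. (\<Sum>i<length w. emeasure (return borel ((shift_map ^^ i) (periodic w))) E)
            / of_nat (length w))"

definition convex_combination ::
    "real \<Rightarrow> 'b::topological_space configuration measure \<Rightarrow> 'b configuration measure
      \<Rightarrow> 'b configuration measure" where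
  "convex_combination s \<mu> \<nu> = measure_of UNIV (sets borel)
     (\<lambda>E. ennreal s * emeasure \<mu> E + ennreal (1 - s) * emeasure \<nu> E)"

text \<open>
  As \<open>measure_of\<close> degenerates to the zero measure when its argument is not a measure, the two
  facts below confirm that the set functions above are the intended ones.
\<close>

lemma emeasure_periodic_measure:
  fixes w :: "'b::topological_space list"
  assumes "E \<in> sets borel"
  shows "emeasure (periodic_measure w) E =
    (\<Sum>i<length w. emeasure (return borel ((shift_map ^^ i) (periodic w))) E) / of_nat (length w)"
  unfolding periodic_measure_def
proof (rule emeasure_measure_of_sigma)
  show "sigma_algebra UNIV (sets (borel :: 'b configuration measure))"
    using sets.sigma_algebra_axioms[of "borel :: 'b configuration measure"] by simp
  show "positive (sets (borel :: 'b configuration measure))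
    (\<lambda>E. (\<Sum>i<length w. emeasure (return borel ((shift_map ^^ i) (periodic w))) E)
            / of_nat (length w))"
    by (simp add: positive_def)
  show "countably_additive (sets (borel :: 'b configuration measure))
    (\<lambda>E. (\<Sum>i<length w. emeasure (return borel ((shift_map ^^ i) (periodic w))) E)
            / of_nat (length w))"
  proof (rule countably_additiveI)
    fix A :: "nat \<Rightarrow> 'b configuration set"
    assume A: "range A \<subseteq> sets borel" "disjoint_family A"
    have "(\<Sum>j. emeasure (return borel x) (A j)) = emeasure (return borel x) (\<Union>j. A j)" for x
      using A by (intro suminf_emeasure) auto
    then show "(\<Sum>j. (\<Sum>i<length w. emeasure (return borel ((shift_map ^^ i) (periodic w))) (A j))
              / of_nat (length w)) =
          (\<Sum>i<length w. emeasure (return borel ((shift_map ^^ i) (periodic w))) (\<Union>j. A j))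
              / of_nat (length w)"
      by (simp add: divide_ennreal_def ennreal_suminf_multc suminf_sum)
  qed
qed fact

lemma emeasure_convex_combination:
  fixes \<mu> \<nu> :: "'b::topological_space configuration measure"
  assumes "sets \<mu> = sets borel" "sets \<nu> = sets borel" "E \<in> sets borel"
  shows "emeasure (convex_combination s \<mu> \<nu>) E =
    ennreal s * emeasure \<mu> E + ennreal (1 - s) * emeasure \<nu> E"
  unfolding convex_combination_def
proof (rule emeasure_measure_of_sigma)
  show "sigma_algebra UNIV (sets (borel :: 'b configuration measure))"
    using sets.sigma_algebra_axioms[of "borel :: 'b configuration measure"] by simp
  show "positive (sets (borel :: 'b configuration measure))
    (\<lambda>E. ennreal s * emeasure \<mu> E + ennreal (1 - s) * emeasure \<nu> E)"
    by (simp add: positive_def)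
  show "countably_additive (sets (borel :: 'b configuration measure))
    (\<lambda>E. ennreal s * emeasure \<mu> E + ennreal (1 - s) * emeasure \<nu> E)"
  proof (rule countably_additiveI)
    fix A :: "nat \<Rightarrow> 'b configuration set"
    assume A: "range A \<subseteq> sets borel" "disjoint_family A"
    have "(\<Sum>j. emeasure \<mu> (A j)) = emeasure \<mu> (\<Union>j. A j)"
         "(\<Sum>j. emeasure \<nu> (A j)) = emeasure \<nu> (\<Union>j. A j)"
      using A assms by (auto intro!: suminf_emeasure)
    then show "(\<Sum>j. ennreal s * emeasure \<mu> (A j) + ennreal (1 - s) * emeasure \<nu> (A j)) =
          ennreal s * emeasure \<mu> (\<Union>j. A j) + ennreal (1 - s) * emeasure \<nu> (\<Union>j. A j)"
      by (simp add: suminf_add[symmetric])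
  qed
qed fact+

definition measure_segment ::
    "'b::topological_space list \<Rightarrow> 'b list \<Rightarrow> 'b configuration measure set" where
  "measure_segment u v =
     (\<lambda>s. convex_combination s (periodic_measure u) (periodic_measure v)) ` {0..1}"

definition limit_of_words ::
    "(nat \<Rightarrow> 'b::topological_space list) \<Rightarrow> 'b configuration measure set" where
  "limit_of_words w =
     (\<Inter>N\<in>{0<..}. weak_star closure_of (\<Union>n\<in>{N..}. measure_segment (w n) (w (n + 1))))"


subsection \<open>Computable sequences of words\<close>

text \<open>
  Computability is Turing computability, for deterministic machines with one two-sided tape.
  A machine is a finite partial table of instructions, so it uses finitely many states (named by
  natural numbers, with initial state \<open>0\<close>) and finitely many symbols: the blank, the letters
  of the alphabet and auxiliary marks. It halts when no instruction applies. The input \<open>n\<close> is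
  given in unary by \<open>n\<close> copies of \<open>Mark 0\<close>; the output is the content of the tape
  read from the final head position.
\<close>

datatype 'b tape_symbol = Blank | Letter 'b | Mark nat

datatype direction = Go_Left | Stay | Go_Right

fun offset :: "direction \<Rightarrow> int" where
  "offset Go_Left = -1"
| "offset Stay = 0"
| "offset Go_Right = 1"

type_synonym 'b machine =
  "nat \<times> 'b tape_symbol \<Rightarrow> (nat \<times> 'b tape_symbol \<times> direction) option"

type_synonym 'b machine_state = "nat \<times> int \<times> (int \<Rightarrow> 'b tape_symbol)"

inductive machine_step :: "'b machine \<Rightarrow> 'b machine_state \<Rightarrow> 'b machine_state \<Rightarrow> bool"
  for M :: "'b machine" where
  "M (q, T h) = Some (q', a, d) \<Longrightarrow> machine_step M (q, h, T) (q', h + offset d, T(h := a))"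

definition input_tape :: "nat \<Rightarrow> int \<Rightarrow> 'b tape_symbol" where
  "input_tape n = (\<lambda>i. if 0 \<le> i \<and> i < int n then Mark 0 else Blank)"

definition output_tape :: "'b list \<Rightarrow> int \<Rightarrow> int \<Rightarrow> 'b tape_symbol" where
  "output_tape v h =
     (\<lambda>i. if h \<le> i \<and> i < h + int (length v) then Letter (v ! nat (i - h)) else Blank)"

definition uniformly_computable :: "(nat \<Rightarrow> 'b list) \<Rightarrow> bool" where
  "uniformly_computable w \<longleftrightarrow>
     (\<exists>M :: 'b machine. finite (dom M) \<and>
        (\<forall>n. \<exists>q h. (machine_step M)\<^sup>*\<^sup>* (0, 0, input_tape n) (q, h, output_tape (w n) h) \<and>
                   M (q, output_tape (w n) h h) = None))"

end

theory Submission
 imports Defs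
begin

text \<open>
 Fix a word \<open>u\<close> that occurs in no periodic configuration built from a \<open>w n\<close>. It serves to build
 marked blocks of fixed length that carry states of a finite set; such a block never occurs by
 accident in the letters that the automaton writes, and no new block is ever created. Maximal runs of
 adjacent blocks form trains. A train of \<open>K\<close> blocks is a \<open>K\<close>-bit counter that moves one cell to the
 left at each overflow, that is with speed \<open>2\<close> to the power \<open>-K\<close>, while letters outside the blocks move
 left at speed \<open>1\<close>. Short trains are faster; a train that reaches the one on its left loses its front block,
 so at time \<open>t\<close> only the trains of length at least about the logarithm of \<open>t\<close> matter. Each train
 simulates the machine computing \<open>w\<close> and fills the space on its left with long stretches of
 the periodic repetition of \<open>w (idx K)\<close>, the last word that is computed within \<open>K\<close> steps.

 A mass transport argument bounds the probability that a cell is badly written by the density of long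
 trains times a polynomial in their length; by mixing and full support this density
 decays exponentially and longer trains are much rarer than shorter ones. Hence at time \<open>t\<close> a large
 window is, with high probability, filled by one train whose length lies in a bounded range, so the image
 measure is close to a point of the segment between the measures of two consecutive words. Since the
 automaton locally acts as the shift, the image measures move slowly, and a discrete intermediate value argument
 shows that whole segments are followed.
\<close>

section \<open>Trains of blocks\<close>

text \<open>The random configuration also fixes the initial contents of every block, so no train can
  be told when or from what state to start. The construction is therefore self-stabilising: the
  clocks of an array fall into step from any state, and a train of \<open>K\<close> blocks whose
  leader has led for about \<open>8 * (K + 1) ^ 2\<close> steps emits the right word whatever it
  held before. Speeds are known only up to additive errors; in the lower bounds these do not pile up
  under repeated erosion, because a new leader travels about \<open>L\<close> cells before it is
  lost, and \<open>L \<ge> 40\<close> outweighs the errors. Densities of long trains are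
  exponentially small, so they are compared by a mixing error relative to the product of
  probabilities, as \<open>\<psi>\<close>-mixing gives it. The train sizes that matter at a given
  time range over \<open>r\<close> values, \<open>r\<close> fixed; the simulated machine idles for
  \<open>n\<close> steps in round \<open>n\<close>, so such a range eventually meets at most two
  consecutive words. The weight with which the two words occur is one number for all test functions,
  so an intermediate value argument for a single function controls all of them.\<close>

text \<open>
 A placement \<open>\<beta>\<close> gives the state of the block that starts at a position. Consecutive blocks of a train
 are at distance \<open>L\<close> or \<open>L + 1\<close>; the leftmost block leads. The digit \<open>dg\<close> and the carry \<open>cb\<close> make the train a
 binary counter fed with a carry at its tail; the leading block hops when it emits a carry, and the
 gap of one cell that it opens then travels to the tail.
\<close>

locale placement =
 fixes L :: int and cb dg :: "'s => bool"
  and upd :: "'s option => 's => 's option => bool => 's"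
 assumes L40: "40 \<le> L"
  and cb_upd: "cb (upd l s r h) \<longleftrightarrow> dg s \<and> (case r of None => True | Some s' => cb s')"
  and dg_upd: "dg (upd l s r h) \<longleftrightarrow> dg s \<noteq> (case r of None => True | Some s' => cb s')"
begin

definition occ :: "(int => 's option) => int => bool" where
 "occ \<beta> p \<longleftrightarrow> \<beta> p \<noteq> None"

definition sep :: "(int => 's option) => bool" where
 "sep \<beta> \<longleftrightarrow> (\<forall>p q. occ \<beta> p --> occ \<beta> q --> p < q --> p + L \<le> q)"

text \<open>For a leading block the fallback \<open>p - L - 1\<close> is unoccupied, so looking up
  \<open>\<beta> (lp \<beta> p)\<close> yields \<open>None\<close> there; \<open>rp\<close> behaves
  likewise at the tail.\<close>

definition lp :: "(int => 's option) => int => int" where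
 "lp \<beta> p = (if occ \<beta> (p - L) then p - L else p - L - 1)"

definition rp :: "(int => 's option) => int => int" where
 "rp \<beta> p = (if occ \<beta> (p + L) then p + L else p + L + 1)"

definition lead :: "(int => 's option) => int => bool" where
 "lead \<beta> p \<longleftrightarrow> \<not> occ \<beta> (p - L) \<and> \<not> occ \<beta> (p - L - 1)"

definition tail :: "(int => 's option) => int => bool" where
 "tail \<beta> p \<longleftrightarrow> \<not> occ \<beta> (p + L) \<and> \<not> occ \<beta> (p + L + 1)"

text \<open>A surviving leader has a gap of at least 4 to the next train (\<open>lead_far\<close>)
  and a step shrinks it by at most 1, so a gap of 3 is noticed before the gaps 1 and 0, at which two
  trains would become linked. Gap 2 is included for the sake of arbitrary initial
  placements.\<close>

definition near :: "(int => 's option) => int => bool" where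
 "near \<beta> p \<longleftrightarrow> lead \<beta> p \<and> (occ \<beta> (p - L - 2) \<or> occ \<beta> (p - L - 3))"

definition hop :: "(int => 's option) => int => bool" where
 "hop \<beta> p \<longleftrightarrow> (if lead \<beta> p then \<not> near \<beta> p \<and> cb (the (\<beta> p)) else occ \<beta> (p - L - 1))"

definition mv :: "(int => 's option) => int => int" where
 "mv \<beta> p = (if hop \<beta> p then p - 1 else p)"

definition surv :: "(int => 's option) => int => bool" where
 "surv \<beta> p \<longleftrightarrow> occ \<beta> p \<and> \<not> near \<beta> p"

definition nst :: "(int => 's option) => int => 's" where
 "nst \<beta> p = upd (\<beta> (lp \<beta> p)) (the (\<beta> p)) (\<beta> (rp \<beta> p)) (hop \<beta> p)"

definition step :: "(int => 's option) => int => 's option" where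
 "step \<beta> q = (if surv \<beta> q \<and> mv \<beta> q = q then Some (nst \<beta> q)
   else if surv \<beta> (q + 1) \<and> mv \<beta> (q + 1) = q then Some (nst \<beta> (q + 1)) else None)"

lemma sepD: "sep \<beta> ==> occ \<beta> p ==> occ \<beta> q ==> p < q ==> p + L \<le> q"
 by (auto simp: sep_def)

lemma sep_close: "sep \<beta> ==> occ \<beta> p ==> occ \<beta> q ==> \<bar>p - q\<bar> < L ==> p = q"
 using sepD[of \<beta> p q] sepD[of \<beta> q p] by (cases p q rule: linorder_cases) auto

lemma mv_le: "mv \<beta> p \<le> p" and mv_ge: "p - 1 \<le> mv \<beta> p"
 by (auto simp: mv_def)

text \<open>The only case without slack is \<open>q = p + L\<close>; there \<open>q\<close> follows
  \<open>p\<close> with gap 0 and does not hop.\<close>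

lemma mv_sep:
 assumes "sep \<beta>" "occ \<beta> p" "occ \<beta> q" "p < q"
 shows "mv \<beta> p + L \<le> mv \<beta> q"
proof (cases "q = p + L")
 case True
 hence "\<not> occ \<beta> (q - L - 1)" using sep_close[OF assms(1) assms(2), of "q - L - 1"] L40 by auto
 moreover have "\<not> lead \<beta> q" using True assms by (simp add: lead_def)
 ultimately have "\<not> hop \<beta> q" by (simp add: hop_def)
 thus ?thesis using True mv_le[of \<beta> p] by (simp add: mv_def)
next
 case False
 thus ?thesis using sepD[OF assms] mv_le[of \<beta> p] mv_ge[of q \<beta>] by linarith
qed

lemma step_mv:
 assumes "sep \<beta>" "surv \<beta> p" shows "step \<beta> (mv \<beta> p) = Some (nst \<beta> p)"
proof (cases "hop \<beta> p")
 case False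
 thus ?thesis using assms by (simp add: step_def mv_def)
next
 case True
 hence m: "mv \<beta> p = p - 1" by (simp add: mv_def)
 have "\<not> occ \<beta> (p - 1)" using sep_close[OF assms(1), of p "p - 1"] assms(2) L40 by (auto simp: surv_def)
 hence "\<not> surv \<beta> (p - 1)" by (simp add: surv_def)
 thus ?thesis using assms m by (simp add: step_def)
qed

lemma occ_step_iff:
 assumes "sep \<beta>" shows "occ (step \<beta>) q \<longleftrightarrow> (\<exists>p. surv \<beta> p \<and> mv \<beta> p = q)"
proof
 assume "occ (step \<beta>) q"
 thus "\<exists>p. surv \<beta> p \<and> mv \<beta> p = q" unfolding occ_def step_def by (auto split: if_splits)
next
 assume "\<exists>p. surv \<beta> p \<and> mv \<beta> p = q"
 thus "occ (step \<beta>) q" using step_mv[OF assms] by (auto simp: occ_def)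
qed

lemma surv_occ: "surv \<beta> p ==> occ \<beta> p" by (simp add: surv_def)

lemma sep_step: assumes "sep \<beta>" shows "sep (step \<beta>)"
 unfolding sep_def
proof (intro allI impI)
 fix q q' assume a: "occ (step \<beta>) q" "occ (step \<beta>) q'" "q < q'"
 obtain p p' where p: "surv \<beta> p" "mv \<beta> p = q" "surv \<beta> p'" "mv \<beta> p' = q'"
  using a occ_step_iff[OF assms] by blast
 have "p \<noteq> p'" using p a by auto
 then consider "p < p'" | "p' < p" by linarith
 thus "q + L \<le> q'"
 proof cases
  case 1 thus ?thesis using mv_sep[OF assms, of p p'] p by (auto simp: surv_def)
 next
  case 2 thus ?thesis using mv_sep[OF assms, of p' p] p a L40 by (auto simp: surv_def)
 qed
qed

text \<open>The equation for \<open>mv \<beta> q\<close> is the mechanism of motion: after a step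
  the gap behind a block is 1 exactly if the block has just hopped, so an opened gap travels one
  block per step towards the tail.\<close>

lemma link:
 assumes "sep \<beta>" "occ \<beta> p" "\<not> tail \<beta> p"
 defines "q \<equiv> rp \<beta> p"
 shows "occ \<beta> q" "\<not> lead \<beta> q" "lp \<beta> q = p" "surv \<beta> q" "q = p + L \<or> q = p + L + 1"
  "mv \<beta> q = mv \<beta> p + L + (if hop \<beta> p then 1 else 0)" "p < q"
proof -
 show o: "occ \<beta> q" and d: "q = p + L \<or> q = p + L + 1" using assms(3) by (auto simp: q_def rp_def tail_def)
 show l: "\<not> lead \<beta> q" using d assms(2) by (auto simp: lead_def)
 thus s: "surv \<beta> q" using o by (simp add: surv_def near_def)
 show "p < q" using d L40 by auto
 have "q = p + L + 1 ==> \<not> occ \<beta> (q - L)"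
  using sep_close[OF assms(1,2), of "p + 1"] L40 by auto
 thus "lp \<beta> q = p" using d assms(2) by (auto simp: lp_def)
 have "q = p + L ==> \<not> occ \<beta> (q - L - 1)"
  using sep_close[OF assms(1,2), of "p - 1"] L40 by auto
 hence "hop \<beta> q \<longleftrightarrow> q = p + L + 1" using l d assms(2) by (auto simp: hop_def)
 thus "mv \<beta> q = mv \<beta> p + L + (if hop \<beta> p then 1 else 0)" using d by (auto simp: mv_def)
qed

lemma lead_far:
 assumes "sep \<beta>" "surv \<beta> q" "lead \<beta> q" "occ \<beta> p" "p < q"
 shows "p + L + 4 \<le> q"
proof -
 have "p + L \<le> q" using sepD[OF assms(1,4) _ assms(5)] assms(2) by (simp add: surv_def)
 moreover have "p \<noteq> q - L" "p \<noteq> q - L - 1" "p \<noteq> q - L - 2" "p \<noteq> q - L - 3"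
  using assms(2,3,4) by (auto simp: lead_def surv_def near_def)
 ultimately show ?thesis by linarith
qed

lemma lead_or_link:
 assumes "sep \<beta>" "occ \<beta> q" "\<not> lead \<beta> q"
 shows "occ \<beta> (lp \<beta> q)" "\<not> tail \<beta> (lp \<beta> q)" "rp \<beta> (lp \<beta> q) = q"
proof -
 show o: "occ \<beta> (lp \<beta> q)" using assms(3) by (auto simp: lead_def lp_def)
 have d: "q = lp \<beta> q + L \<or> q = lp \<beta> q + L + 1" by (auto simp: lp_def)
 thus "\<not> tail \<beta> (lp \<beta> q)" using assms(2) by (auto simp: tail_def)
 have "\<not> occ \<beta> (q - 1)" using sep_close[OF assms(1,2), of "q - 1"] L40 by auto
 moreover have "q = lp \<beta> q + L + 1 ==> lp \<beta> q + L = q - 1" by linarith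
 ultimately have "q = lp \<beta> q + L + 1 ==> \<not> occ \<beta> (lp \<beta> q + L)" by metis
 thus "rp \<beta> (lp \<beta> q) = q" using d assms(2) by (auto simp: rp_def)
qed

text \<open>Links are neither created nor broken behind a survivor: a surviving leader is too far
  from the next train to close the gap in one step, and a linked successor, not being a leader,
  survives.\<close>

lemma tail_step:
 assumes "sep \<beta>" "surv \<beta> p"
 shows "tail (step \<beta>) (mv \<beta> p) \<longleftrightarrow> tail \<beta> p"
proof
 assume t: "tail \<beta> p"
 { fix q' assume q': "occ (step \<beta>) q'" "q' = mv \<beta> p + L \<or> q' = mv \<beta> p + L + 1"
  then obtain q where q: "surv \<beta> q" "mv \<beta> q = q'" using occ_step_iff[OF assms(1)] by blast
  have "p < q" using mv_sep[OF assms(1), of q p] q q' assms(2) L40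
   by (cases p q rule: linorder_cases) (auto simp: surv_def)
  hence False
  proof (cases "lead \<beta> q")
   case True
   have "p + L + 4 \<le> q" using lead_far[OF assms(1) q(1) True _ \<open>p < q\<close>] assms(2) by (simp add: surv_def)
   thus False using q' q mv_le[of \<beta> p] mv_ge[of q \<beta>] by linarith
  next
   case False
   have *: "occ \<beta> (lp \<beta> q)" "rp \<beta> (lp \<beta> q) = q" "\<not> tail \<beta> (lp \<beta> q)"
    using lead_or_link[OF assms(1) surv_occ[OF q(1)] False] by auto
   hence "lp \<beta> q \<noteq> p" using t by auto
   have "q = lp \<beta> q + L \<or> q = lp \<beta> q + L + 1" by (auto simp: lp_def)
   hence "p < lp \<beta> q \<or> lp \<beta> q < p" "lp \<beta> q \<le> q - L" "q - L - 1 \<le> lp \<beta> q" using \<open>lp \<beta> q \<noteq> p\<close> by auto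
   hence "p + L \<le> lp \<beta> q \<or> lp \<beta> q + L \<le> p"
    using sepD[OF assms(1) surv_occ[OF assms(2)] *(1)] sepD[OF assms(1) *(1) surv_occ[OF assms(2)]] by auto
   thus False using \<open>p < q\<close> \<open>lp \<beta> q \<le> q - L\<close> \<open>q - L - 1 \<le> lp \<beta> q\<close> q q' mv_le[of \<beta> p] mv_ge[of q \<beta>] L40
     sepD[OF assms(1) surv_occ[OF assms(2)] surv_occ[OF q(1)]] by linarith
  qed }
 thus "tail (step \<beta>) (mv \<beta> p)" by (auto simp: tail_def)
next
 assume t: "tail (step \<beta>) (mv \<beta> p)"
 show "tail \<beta> p"
 proof (rule ccontr)
  assume n: "\<not> tail \<beta> p"
  note l = link[OF assms(1) surv_occ[OF assms(2)] n]
  have "occ (step \<beta>) (mv \<beta> (rp \<beta> p))" using l(4) occ_step_iff[OF assms(1)] by blast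
  thus False using t l(6) by (auto simp: tail_def split: if_splits)
 qed
qed

lemma rp_step:
 assumes "sep \<beta>" "surv \<beta> p" "\<not> tail \<beta> p"
 shows "rp (step \<beta>) (mv \<beta> p) = mv \<beta> (rp \<beta> p)"
proof -
 note l = link[OF assms(1) surv_occ[OF assms(2)] assms(3)]
 have o: "occ (step \<beta>) (mv \<beta> (rp \<beta> p))" using l(4) occ_step_iff[OF assms(1)] by blast
 show ?thesis
 proof (cases "hop \<beta> p")
  case False
  thus ?thesis using o l(6) by (simp add: rp_def)
 next
  case True
  hence "\<not> occ (step \<beta>) (mv \<beta> p + L)" using o l(6) sep_close[OF sep_step[OF assms(1)] o, of "mv \<beta> p + L"] L40 by auto
  thus ?thesis using l(6) True by (simp add: rp_def)
 qed
qed

lemma carry_step: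
 assumes "sep \<beta>" "surv \<beta> p"
 defines "cin \<equiv> tail \<beta> p \<or> cb (the (\<beta> (rp \<beta> p)))"
 shows "cb (the (step \<beta> (mv \<beta> p))) \<longleftrightarrow> dg (the (\<beta> p)) \<and> cin"
  "dg (the (step \<beta> (mv \<beta> p))) \<longleftrightarrow> dg (the (\<beta> p)) \<noteq> cin"
proof -
 have "(case \<beta> (rp \<beta> p) of None => True | Some s' => cb s') = cin"
 proof (cases "tail \<beta> p")
  case True
  hence "\<beta> (rp \<beta> p) = None" by (auto simp: tail_def rp_def occ_def)
  thus ?thesis using True by (simp add: cin_def)
 next
  case False
  thus ?thesis using link(1)[OF assms(1) surv_occ[OF assms(2)] False] by (auto simp: cin_def occ_def)
 qed
 thus "cb (the (step \<beta> (mv \<beta> p))) \<longleftrightarrow> dg (the (\<beta> p)) \<and> cin"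
  "dg (the (step \<beta> (mv \<beta> p))) \<longleftrightarrow> dg (the (\<beta> p)) \<noteq> cin"
  using step_mv[OF assms(1,2)] by (auto simp: nst_def cb_upd dg_upd)
qed

end

section \<open>World lines of blocks and trains\<close>

locale evolution = placement L cb dg upd
 for L :: int and cb dg :: "'s => bool"
  and upd :: "'s option => 's => 's option => bool => 's" +
 fixes bt :: "nat => int => 's option"
 assumes sep0: "sep (bt 0)" and btS: "bt (Suc t) = step (bt t)"
begin

lemma sept: "sep (bt t)"
 by (induction t) (auto simp: sep0 btS sep_step)

text \<open>The recursion runs on after the death of a block; the value is meaningful only together
  with \<open>al\<close>.\<close>

primrec wl :: "nat => int => int" where
 "wl 0 p = p"
| "wl (Suc t) p = mv (bt t) (wl t p)"

primrec al :: "nat => int => bool" where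
 "al 0 p = occ (bt 0) p"
| "al (Suc t) p = (al t p \<and> \<not> near (bt t) (wl t p))"

lemma al_occ: "al t p ==> occ (bt t) (wl t p)"
proof (induction t)
 case (Suc t)
 hence "surv (bt t) (wl t p)" by (auto simp: surv_def)
 thus ?case using occ_step_iff[OF sept] by (auto simp: btS)
qed simp

lemma al_surv: "al (Suc t) p ==> surv (bt t) (wl t p)"
 using al_occ[of t p] by (auto simp: surv_def)

lemma al_antimono: "al t p ==> s \<le> t ==> al s p"
 by (induction t) (auto simp: le_Suc_eq)

lemma ancestor: "occ (bt t) q ==> \<exists>p. al t p \<and> wl t p = q"
proof (induction t arbitrary: q)
 case (Suc t)
 then obtain p where p: "surv (bt t) p" "mv (bt t) p = q" using occ_step_iff[OF sept] by (auto simp: btS)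
 then obtain p0 where "al t p0" "wl t p0 = p" using Suc.IH surv_occ by blast
 thus ?case using p by (intro exI[of _ p0]) (auto simp: surv_def)
qed simp

lemma wl_sep: "p < q ==> al t p ==> al t q ==> wl t p + L \<le> wl t q"
proof (induction t)
 case 0 thus ?case using sepD[OF sep0] by simp
next
 case (Suc t)
 hence "wl t p < wl t q" using L40 by auto
 thus ?case using mv_sep[OF sept] Suc.prems al_occ by auto
qed

lemma wl_less_iff: "al t p ==> al t q ==> wl t p < wl t q \<longleftrightarrow> p < q"
 using wl_sep[of p q t] wl_sep[of q p t] L40 by (cases p q rule: linorder_cases) auto

lemma wl_inj: "al t p ==> al t q ==> wl t p = wl t q ==> p = q"
 using wl_less_iff[of t p q] wl_less_iff[of t q p] by linarith

lemma wl_antimono: "s \<le> t ==> wl t p \<le> wl s p"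
proof (induction t)
 case (Suc t)
 thus ?case using mv_le[of "bt t" "wl t p"] by (cases "s = Suc t") auto
qed simp

text \<open>Only leaders are erased, so a living block keeps its right neighbour alive, and links
  are preserved by \<open>tail_step\<close> and \<open>rp_step\<close>.\<close>

lemma right_link:
 assumes "al t p" "\<not> tail (bt 0) p"
 shows "al t (rp (bt 0) p) \<and> \<not> tail (bt t) (wl t p) \<and> rp (bt t) (wl t p) = wl t (rp (bt 0) p)"
 using assms(1)
proof (induction t)
 case 0
 thus ?case using link(1)[OF sep0 _ assms(2)] assms(2) by simp
next
 case (Suc t)
 hence a: "al t p" and IH: "al t (rp (bt 0) p)" "\<not> tail (bt t) (wl t p)" "rp (bt t) (wl t p) = wl t (rp (bt 0) p)" by auto
 have s: "surv (bt t) (wl t p)" using al_surv Suc.prems by blast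
 have "surv (bt t) (wl t (rp (bt 0) p))" using link(4)[OF sept surv_occ[OF s] IH(2)] IH(3) by simp
 thus ?case using IH a tail_step[OF sept s] rp_step[OF sept s] by (auto simp: btS surv_def)
qed

lemma tail_pres: "al t p ==> tail (bt 0) p ==> tail (bt t) (wl t p)"
proof (induction t)
 case (Suc t)
 hence "surv (bt t) (wl t p)" using al_surv by blast
 thus ?case using Suc tail_step[OF sept] by (auto simp: btS)
qed simp

lemma tail_iff: "al t p ==> tail (bt t) (wl t p) \<longleftrightarrow> tail (bt 0) p"
 using tail_pres right_link by blast

text \<open>A train is named by the initial position \<open>e\<close> of its tail; its blocks are numbered from the tail.\<close>

primrec ini :: "int => nat => int" where
 "ini e 0 = e"
| "ini e (Suc i) = lp (bt 0) (ini e i)"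

text \<open>Indices start at 0: this says that the train with tail \<open>e\<close> has at least
  \<open>i + 1\<close> blocks at time 0. The number of blocks may be larger.\<close>

definition train :: "int => nat => bool" where
 "train e i \<longleftrightarrow> tail (bt 0) e \<and> (\<forall>j\<le>i. occ (bt 0) (ini e j))"

definition alive :: "nat => int => nat => bool" where
 "alive t e i \<longleftrightarrow> train e i \<and> al t (ini e i)"

definition pos :: "nat => int => nat => int" where
 "pos t e i = wl t (ini e i)"

lemma train_mono: "train e i ==> j \<le> i ==> train e j"
 by (auto simp: train_def)

lemma alive_0: "alive 0 e i \<longleftrightarrow> train e i"
 by (auto simp: alive_def train_def)

lemma ini_link:
 assumes "train e (Suc i)"
 shows "\<not> tail (bt 0) (ini e (Suc i))" "rp (bt 0) (ini e (Suc i)) = ini e i"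
proof -
 have o: "occ (bt 0) (ini e i)" "occ (bt 0) (ini e (Suc i))" using assms by (auto simp: train_def)
 hence "\<not> lead (bt 0) (ini e i)" by (auto simp: lead_def lp_def split: if_splits)
 thus "\<not> tail (bt 0) (ini e (Suc i))" "rp (bt 0) (ini e (Suc i)) = ini e i"
  using lead_or_link[OF sep0 o(1)] by auto
qed

lemma alive_Suc:
 assumes "alive t e (Suc i)"
 shows "alive t e i" "rp (bt t) (pos t e (Suc i)) = pos t e i" "\<not> tail (bt t) (pos t e (Suc i))"
proof -
 have tr: "train e (Suc i)" and a: "al t (ini e (Suc i))" using assms by (auto simp: alive_def)
 have "al t (rp (bt 0) (ini e (Suc i))) \<and> \<not> tail (bt t) (wl t (ini e (Suc i)))
   \<and> rp (bt t) (wl t (ini e (Suc i))) = wl t (rp (bt 0) (ini e (Suc i)))"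
  using right_link[OF a] ini_link[OF tr] by blast
 thus "alive t e i" "rp (bt t) (pos t e (Suc i)) = pos t e i" "\<not> tail (bt t) (pos t e (Suc i))"
  using ini_link[OF tr] train_mono[OF tr, of i] by (auto simp: alive_def pos_def)
qed

lemma alive_mono: "alive t e i ==> j \<le> i ==> alive t e j"
 by (induction i) (auto simp: le_Suc_eq dest: alive_Suc(1))

lemma alive_antimono: "alive t e i ==> s \<le> t ==> alive s e i"
 using al_antimono by (auto simp: alive_def)

lemma alive_occ: "alive t e i ==> occ (bt t) (pos t e i)"
 using al_occ by (auto simp: alive_def pos_def)

lemma alive_surv: "alive (Suc t) e i ==> surv (bt t) (pos t e i)"
 using al_surv by (auto simp: alive_def pos_def)

lemma alive_dist: "alive t e (Suc i) ==> pos t e i = pos t e (Suc i) + L \<or> pos t e i = pos t e (Suc i) + L + 1"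
 using link(5)[OF sept alive_occ alive_Suc(3)] alive_Suc(2) by metis

lemma alive_span:
 "alive t e i ==> pos t e i + int i * L \<le> pos t e 0 \<and> pos t e 0 \<le> pos t e i + int i * (L + 1)"
proof (induction i)
 case (Suc i)
 thus ?case using alive_dist[OF Suc.prems] alive_Suc(1)[OF Suc.prems] by (auto simp: algebra_simps)
qed simp

text \<open>A left neighbour at time \<open>t\<close> is linked already at time 0, because links are
  never created; hence it is block \<open>i + 1\<close> of the same train.\<close>

lemma lead_iff:
 assumes "alive t e i" shows "lead (bt t) (pos t e i) \<longleftrightarrow> \<not> alive t e (Suc i)"
proof
 assume "lead (bt t) (pos t e i)"
 thus "\<not> alive t e (Suc i)" using alive_Suc[of t e i] link(2)[OF sept alive_occ alive_Suc(3), of t e i] by auto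
next
 assume n: "\<not> alive t e (Suc i)"
 show "lead (bt t) (pos t e i)"
 proof (rule ccontr)
  assume "\<not> lead (bt t) (pos t e i)"
  note l = lead_or_link[OF sept alive_occ[OF assms] this]
  obtain p where p: "al t p" "wl t p = lp (bt t) (pos t e i)" using ancestor l(1) by blast
  hence nt: "\<not> tail (bt 0) p" using l(2) tail_pres by metis
  have r: "al t (rp (bt 0) p)" "wl t (rp (bt 0) p) = pos t e i" using right_link[OF p(1) nt] p l(3) by auto
  hence "rp (bt 0) p = ini e i" using wl_inj assms by (auto simp: alive_def pos_def)
  moreover have o: "occ (bt 0) p" using al_antimono[OF p(1), of 0] by simp
  ultimately have "lp (bt 0) (ini e i) = p" using link(3)[OF sep0 o nt] by simp
  hence "train e (Suc i)" "ini e (Suc i) = p" using assms o by (auto simp: alive_def train_def le_Suc_eq)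
  thus False using n p by (auto simp: alive_def)
 qed
qed

lemma alive_tail: "alive t e 0 ==> tail (bt t) (pos t e 0)"
 using tail_pres by (auto simp: alive_def pos_def train_def)

lemma tail_train:
 assumes "occ (bt t) q" "tail (bt t) q" shows "\<exists>e. alive t e 0 \<and> pos t e 0 = q"
proof -
 obtain p where p: "al t p" "wl t p = q" using ancestor assms by blast
 thus ?thesis using tail_iff[OF p(1)] assms al_antimono[OF p(1), of 0]
  by (intro exI[of _ p]) (auto simp: alive_def pos_def train_def)
qed

definition cA :: "nat => int => nat => bool" where "cA t e i = cb (the (bt t (pos t e i)))"
definition dA :: "nat => int => nat => bool" where "dA t e i = dg (the (bt t (pos t e i)))"
definition hA :: "nat => int => nat => bool" where "hA t e i = hop (bt t) (pos t e i)"

lemma pos_Suc: "pos (Suc t) e i = pos t e i - (if hA t e i then 1 else 0)"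
 by (simp add: pos_def hA_def mv_def)

lemma carry_rec:
 assumes "alive (Suc t) e i"
 shows "cA (Suc t) e i \<longleftrightarrow> dA t e i \<and> (i = 0 \<or> cA t e (i - 1))"
  "dA (Suc t) e i \<longleftrightarrow> dA t e i \<noteq> (i = 0 \<or> cA t e (i - 1))"
proof -
 have a: "alive t e i" using alive_antimono[OF assms] by simp
 have s: "surv (bt t) (pos t e i)" using alive_surv[OF assms] .
 have m: "pos (Suc t) e i = mv (bt t) (pos t e i)" by (simp add: pos_def)
 have c: "(tail (bt t) (pos t e i) \<or> cb (the (bt t (rp (bt t) (pos t e i))))) = (i = 0 \<or> cA t e (i - 1))"
 proof (cases i)
  case 0 thus ?thesis using alive_tail a by auto
 next
  case (Suc j) thus ?thesis using alive_Suc[of t e j] a by (auto simp: cA_def)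
 qed
 show "cA (Suc t) e i \<longleftrightarrow> dA t e i \<and> (i = 0 \<or> cA t e (i - 1))"
  "dA (Suc t) e i \<longleftrightarrow> dA t e i \<noteq> (i = 0 \<or> cA t e (i - 1))"
  using carry_step[OF sept s] c by (auto simp: cA_def dA_def m btS)
qed

lemma hop_lead: "alive (Suc t) e i ==> \<not> alive t e (Suc i) ==> hA t e i \<longleftrightarrow> cA t e i"
 using lead_iff[of t e i] alive_antimono[of "Suc t" e i t] alive_surv[of t e i]
 by (auto simp: hA_def hop_def cA_def surv_def)

lemma hop_nonlead:
 assumes "alive t e (Suc i)"
 shows "hA t e i \<longleftrightarrow> pos t e i = pos t e (Suc i) + L + 1"
proof -
 have a: "alive t e i" using alive_Suc[OF assms] by simp
 have l: "\<not> lead (bt t) (pos t e i)" using lead_iff[OF a] assms by simp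
 note o = alive_occ[OF assms]
 have "pos t e i = pos t e (Suc i) + L ==> \<not> occ (bt t) (pos t e i - L - 1)"
  using sep_close[OF sept o, of "pos t e (Suc i) - 1"] L40 by auto
 thus ?thesis using alive_dist[OF assms] o l by (auto simp: hA_def hop_def)
qed

text \<open>A follower hops exactly when it sees the gap opened by the previous hop of the block
  ahead, so hops run down the train with a delay of one step per block.\<close>

lemma hop_shift: "alive (Suc t) e (Suc i) ==> hA (Suc t) e i \<longleftrightarrow> hA t e (Suc i)"
proof -
 assume a: "alive (Suc t) e (Suc i)"
 have a': "alive t e (Suc i)" using alive_antimono[OF a] by simp
 show ?thesis using hop_nonlead[OF a] hop_nonlead[OF a'] alive_dist[OF a']
  by (auto simp: pos_Suc split: if_splits)
qed

lemma alive_step: "alive (Suc t) e i \<longleftrightarrow> alive t e i \<and> \<not> near (bt t) (pos t e i)"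
 by (auto simp: alive_def pos_def)

lemma near_lead: "alive t e i ==> near (bt t) (pos t e i) ==> \<not> alive t e (Suc i)"
 using lead_iff by (auto simp: near_def)

end

section \<open>Displacement and erosion\<close>

context evolution
begin

definition cN :: "int => nat => nat => nat => real" where
 "cN e i s T = (\<Sum>\<tau><T. of_bool (cA (s + \<tau>) e i))"
definition hN :: "int => nat => nat => nat => real" where
 "hN e i s T = (\<Sum>\<tau><T. of_bool (hA (s + \<tau>) e i))"

lemma hN_pos: "hN e i s T = of_int (pos s e i - pos (s + T) e i)"
 by (induction T) (auto simp: hN_def pos_Suc)

lemma hN_nonneg: "0 \<le> hN e i s T"
 by (auto simp: hN_def intro!: sum_nonneg)

lemma hN_split: "hN e i s (a + b) = hN e i s a + hN e i (s + a) b"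
 by (simp add: hN_pos add.assoc)

lemma hN_1: "hN e i s (Suc 0) \<le> 1"
 by (simp add: hN_def)

text \<open>Each block conserves carries: incoming ones equal twice the outgoing ones plus the
  change of the digit. So a block halves the rate of its right neighbour at an error of 3, and since
  \<open>(3 + 3) / 2 = 3\<close> the bound is uniform in \<open>i\<close>.\<close>

lemma cN_bound:
 assumes "alive (s + T) e i"
 shows "\<bar>cN e i s T - real T / 2 ^ (i + 1)\<bar> \<le> 3"
 using assms
proof (induction i)
 have rec: "\<And>i m. alive (s + m) e i ==>
   2 * (\<Sum>\<tau><m. of_bool (cA (s + Suc \<tau>) e i)) + of_bool (dA (s + m) e i)
   = of_bool (dA s e i) + (\<Sum>\<tau><m. of_bool (i = 0 \<or> cA (s + \<tau>) e (i - 1)) :: real)"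
 proof -
  fix i m assume "alive (s + m) e i"
  thus "2 * (\<Sum>\<tau><m. of_bool (cA (s + Suc \<tau>) e i)) + of_bool (dA (s + m) e i)
   = of_bool (dA s e i) + (\<Sum>\<tau><m. of_bool (i = 0 \<or> cA (s + \<tau>) e (i - 1)) :: real)"
  proof (induction m)
   case (Suc m)
   have a: "alive (s + m) e i" using alive_antimono[OF Suc.prems] by simp
   have b: "alive (Suc (s + m)) e i" using Suc.prems by simp
   show ?case using Suc.IH[OF a] carry_rec[OF b] by (auto simp: of_bool_def split: if_splits)
  qed simp
 qed
 have tele: "\<And>i. cN e i s T = (\<Sum>\<tau><T. of_bool (cA (s + Suc \<tau>) e i)) + of_bool (cA s e i) - of_bool (cA (s + T) e i)"
  unfolding cN_def by (induction T) auto
 have key: "\<And>i. alive (s + T) e i ==>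
   \<bar>2 * cN e i s T - (\<Sum>\<tau><T. of_bool (i = 0 \<or> cA (s + \<tau>) e (i - 1)) :: real)\<bar> \<le> 3"
  using rec[of T] tele by (smt (verit, best) of_bool_eq(1,2) of_bool_less_eq_one zero_less_eq_of_bool)
 { case 0
  show ?case using key[OF 0] by (simp add: abs_le_iff) }
 { case (Suc i)
  have "\<bar>cN e i s T - real T / 2 ^ (i + 1)\<bar> \<le> 3" using Suc alive_mono[of _ _ "Suc i" i] by simp
  moreover have "\<bar>2 * cN e (Suc i) s T - cN e i s T\<bar> \<le> 3" using key[OF Suc.prems] by (simp add: cN_def)
  moreover have "\<And>x y t :: real. \<bar>x - t\<bar> \<le> 3 ==> \<bar>2 * y - x\<bar> \<le> 3 ==> \<bar>y - t / 2\<bar> \<le> 3" by linarith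
  ultimately have "\<bar>cN e (Suc i) s T - (real T / 2 ^ (i + 1)) / 2\<bar> \<le> 3" by blast
  thus ?case by simp }
qed

lemma hN_lead:
 assumes "\<not> alive s e (Suc i)" "alive (s + T) e i" shows "hN e i s T = cN e i s T"
 unfolding hN_def cN_def
proof (intro sum.cong refl arg_cong[of _ _ of_bool])
 fix \<tau> assume "\<tau> \<in> {..<T}"
 hence "alive (Suc (s + \<tau>)) e i" "\<not> alive (s + \<tau>) e (Suc i)"
  using alive_antimono[OF assms(2), of "Suc (s + \<tau>)"] assms(1) alive_antimono[of "s + \<tau>" e "Suc i" s] by auto
 thus "hA (s + \<tau>) e i = cA (s + \<tau>) e i" by (rule hop_lead)
qed

lemma hN_shift:
 assumes "alive (s + T) e (Suc i)" shows "hN e i (Suc s) T = hN e (Suc i) s T"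
 unfolding hN_def
proof (intro sum.cong refl arg_cong[of _ _ of_bool])
 fix \<tau> assume "\<tau> \<in> {..<T}"
 hence "alive (Suc (s + \<tau>)) e (Suc i)" using alive_antimono[OF assms, of "Suc (s + \<tau>)"] by auto
 thus "hA (Suc s + \<tau>) e i = hA (s + \<tau>) e (Suc i)" using hop_shift by simp
qed

lemma removal:
 assumes "alive s e i" "\<not> alive (s + T) e i"
 obtains a where "a < T" "alive (s + a) e i" "\<not> alive (Suc (s + a)) e i" "near (bt (s + a)) (pos (s + a) e i)"
  "\<not> alive (s + a) e (Suc i)"
proof -
 have "\<exists>a<T. alive (s + a) e i \<and> \<not> alive (Suc (s + a)) e i"
  using assms(2)
 proof (induction T)
  case 0 thus ?case using assms by simp
 next
  case (Suc T)
  thus ?case by (cases "alive (s + T) e i") (auto intro: less_SucI)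
 qed
 thus ?thesis using that alive_step near_lead by blast
qed

text \<open>The lost block leaves a hole of its own length: whatever block \<open>j\<close> meets on
  its left later was, at the time \<open>s\<close> of the loss, still left of the lost
  block.\<close>

lemma left_bound:
 assumes "alive s e (Suc j)" "near (bt s) (pos s e (Suc j))" "s < t" "alive t e j" "al t p" "wl t p < pos t e j"
 shows "wl s p \<le> pos s e (Suc j) - L - 2"
proof -
 have as: "al s p" using al_antimono[OF assms(5)] assms(3) by simp
 have aj: "alive s e j" using alive_Suc[OF assms(1)] by simp
 have "p < ini e j" using wl_less_iff[OF assms(5), of "ini e j"] assms(4,6) by (auto simp: alive_def pos_def)
 hence "wl s p + L \<le> pos s e j" using wl_sep[of p "ini e j" s] as aj by (auto simp: alive_def pos_def)
 hence "wl s p \<le> pos s e (Suc j) + 1" using alive_dist[OF assms(1)] by auto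
 moreover have "wl s p \<noteq> pos s e (Suc j)"
 proof
  assume "wl s p = pos s e (Suc j)"
  hence "p = ini e (Suc j)" using wl_inj[OF as, of "ini e (Suc j)"] assms(1) by (auto simp: alive_def pos_def)
  moreover have "\<not> al (Suc s) (ini e (Suc j))" using assms(2) by (auto simp: pos_def)
  ultimately show False using al_antimono[OF assms(5), of "Suc s"] assms(3) by auto
 qed
 ultimately have "wl s p < pos s e (Suc j)"
  using sep_close[OF sept al_occ[OF as] alive_occ[OF assms(1)]] L40 by (cases "wl s p = pos s e (Suc j) + 1") auto
 hence "wl s p + L \<le> pos s e (Suc j)" using sepD[OF sept al_occ[OF as] alive_occ[OF assms(1)]] by auto
 moreover have "wl s p \<noteq> pos s e (Suc j) - L" "wl s p \<noteq> pos s e (Suc j) - L - 1"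
  using assms(2) al_occ[OF as] by (auto simp: near_def lead_def)
 ultimately show ?thesis by linarith
qed

text \<open>Between two successive erosions the front block has to regain the length of the lost block.\<close>

lemma erosion_gap:
 assumes "alive s e (Suc j)" "near (bt s) (pos s e (Suc j))" "s < t" "alive t e j" "near (bt t) (pos t e j)"
 shows "of_int L - 2 \<le> hN e j (Suc s) (t - Suc s)"
proof -
 obtain q where q: "occ (bt t) q" "q = pos t e j - L - 2 \<or> q = pos t e j - L - 3"
  using assms(5) by (auto simp: near_def)
 obtain p where p: "al t p" "wl t p = q" using ancestor q by blast
 have "wl t p < pos t e j" using q p L40 by auto
 from left_bound[OF assms(1-4) p(1) this] have "q \<le> pos s e (Suc j) - L - 2"
  using wl_antimono[of s t p] p assms(3) by auto
 moreover have "pos (Suc s) e j \<ge> pos s e (Suc j) + L - 1"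
  using alive_dist[OF assms(1)] by (auto simp: pos_Suc)
 ultimately have "pos (Suc s) e j - pos t e j \<ge> L - 2" using q by auto
 moreover have "Suc s + (t - Suc s) = t" using assms(3) by auto
 ultimately show ?thesis unfolding hN_pos by simp
qed

lemma pow_mono_div: "a \<le> b ==> real T / 2 ^ b \<le> real T / 2 ^ a"
 by (simp add: divide_left_mono power_increasing)

text \<open>Every change of leader costs a bounded error. By \<open>erosion_gap\<close> the front
  covers at least \<open>L - 2\<close> cells between two losses, and this surplus pays for the
  errors, so the constant 7 does not depend on the number of losses.\<close>

lemma lead_lower:
 assumes "alive (s + T) e i" "\<not> alive (s + T) e (Suc i)" "\<not> alive s e k"
 shows "real T / 2 ^ k - 7 \<le> hN e i s T"
 using assms
proof (induction "k - i" arbitrary: i T rule: less_induct)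
 case less
 have ik: "i < k" using alive_mono[OF alive_antimono[OF less.prems(1), of s], of k] less.prems(3) by force
 show ?case
 proof (cases "alive s e (Suc i)")
  case False
  thus ?thesis using hN_lead[OF False less.prems(1)] cN_bound[OF less.prems(1)]
   pow_mono_div[of "i+1" k T] ik by auto
 next
  case True
  then obtain a where a: "a < T" "alive (s + a) e (Suc i)" "\<not> alive (Suc (s + a)) e (Suc i)"
   "near (bt (s + a)) (pos (s + a) e (Suc i))" "\<not> alive (s + a) e (Suc (Suc i))"
   using removal[OF True less.prems(2)] by blast
  have ik2: "Suc i < k" using True less.prems(3) alive_mono[of s e "Suc i" k] by force
  define b where "b = T - 1 - a"
  have T: "T = Suc 0 + (a + b)" using a(1) by (simp add: b_def)
  have end1: "Suc s + a + b = s + T" using T by simp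
  have "hN e i s T \<ge> hN e i (Suc s) a + hN e i (Suc s + a) b"
   unfolding T hN_split using hN_nonneg[of e i s "Suc 0"] by simp
  moreover have "hN e i (Suc s) a = hN e (Suc i) s a" by (rule hN_shift[OF a(2)])
  moreover have "hN e i (Suc s + a) b = cN e i (Suc s + a) b"
   using a(3) less.prems(1) end1 by (intro hN_lead) (simp_all only: add_Suc not_False_eq_True)
  moreover have "cN e i (Suc s + a) b \<ge> real b / 2 ^ (i+1) - 3"
   using cN_bound[of "Suc s + a" b e i, unfolded end1, OF less.prems(1)] by (simp only: abs_le_iff) linarith
  moreover have "real b / 2 ^ (i+1) \<ge> real b / 2 ^ k" using pow_mono_div[of "i + 1" k b] ik by linarith
  ultimately have main: "hN e i s T \<ge> hN e (Suc i) s a + real b / 2 ^ k - 3" by linarith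
  have Tr: "real T / 2 ^ k = real a / 2 ^ k + real b / 2 ^ k + 1 / 2 ^ k" unfolding T by (simp add: add_divide_distrib)
  have one: "(1::real) / 2 ^ k \<le> 1" by simp
  show ?thesis
  proof (cases "alive s e (Suc (Suc i))")
   case False
   have "hN e (Suc i) s a \<ge> real a / 2 ^ (Suc i + 1) - 3"
    using hN_lead[OF False a(2)] cN_bound[OF a(2)] by auto
   moreover have "real a / 2 ^ (Suc i + 1) \<ge> real a / 2 ^ k" using pow_mono_div[of "Suc i + 1" k a] ik2 by auto
   ultimately show ?thesis using main Tr one by linarith
  next
   case True2: True
   then obtain a' where a': "a' < a" "alive (s + a') e (Suc (Suc i))" "\<not> alive (Suc (s + a')) e (Suc (Suc i))"
    "near (bt (s + a')) (pos (s + a') e (Suc (Suc i)))" "\<not> alive (s + a') e (Suc (Suc (Suc i)))"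
    using removal[OF True2 a(5)] by blast
   have ik3: "Suc (Suc i) < k" using True2 less.prems(3) alive_mono[of s e "Suc (Suc i)" k] by force
   define d where "d = a - 1 - a'"
   have A: "a = Suc 0 + (a' + d)" using a'(1) by (simp add: d_def)
   \<comment> \<open>The hops of this phase number at least \<open>L - 2\<close> and at least
     \<open>D - 3\<close>, hence at least the mean of both. As \<open>k \<ge> i + 3\<close>,
     \<open>D / 2\<close> already reaches \<open>d / 2 ^ k\<close>; the remaining 17 or more
     compensate the losses 7 and 3 of the other phases.\<close>
   define D where "D = real d / 2 ^ (Suc i + 1)"
   have "hN e (Suc i) s a \<ge> hN e (Suc i) (Suc s) a' + hN e (Suc i) (Suc s + a') d"
    unfolding A hN_split using hN_nonneg[of e "Suc i" s "Suc 0"] by simp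
   moreover have "hN e (Suc i) (Suc s) a' = hN e (Suc (Suc i)) s a'" by (rule hN_shift[OF a'(2)])
   moreover have "hN e (Suc (Suc i)) s a' \<ge> real a' / 2 ^ k - 7"
    by (rule less.hyps[OF _ a'(2,5) less.prems(3)]) (use ik3 in auto)
   moreover have "hN e (Suc i) (Suc s + a') d \<ge> of_int L - 2"
    using erosion_gap[OF a'(2,4), of "s + a"] a a'(1) by (simp add: d_def)
   moreover have "hN e (Suc i) (Suc s + a') d = cN e (Suc i) (Suc s + a') d"
    by (rule hN_lead) (use a'(3) a(2) A in \<open>auto simp: add.assoc\<close>)
   moreover have "D \<le> cN e (Suc i) (Suc s + a') d + 3"
   proof -
    have "\<bar>cN e (Suc i) (Suc s + a') d - D\<bar> \<le> 3" unfolding D_def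
     by (rule cN_bound) (use a(2) A in \<open>auto simp: add.assoc\<close>)
    thus ?thesis by linarith
   qed
   moreover have "real d / 2 ^ k \<le> D / 2" unfolding D_def
    using pow_mono_div[of "Suc i + 2" k d] ik3 by simp
   moreover have "real a / 2 ^ k = real a' / 2 ^ k + real d / 2 ^ k + 1 / 2 ^ k" unfolding A by (simp add: add_divide_distrib)
   moreover have "of_int L \<ge> (40::real)" using L40 by simp
   ultimately show ?thesis using main Tr one by linarith
  qed
 qed
qed

text \<open>The hops of the leader reach block \<open>i\<close> with one step of delay per block.
  Fewer than \<open>k\<close> blocks are passed at a speed taken as \<open>1 / 2 ^ k\<close>, and
  \<open>k < 2 ^ k\<close>, so the delay costs at most 1 on top of
  \<open>lead_lower\<close>.\<close>

lemma lower_disp: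
 assumes "alive (s + T) e i" "\<not> alive s e k"
 shows "real T / 2 ^ k - 8 \<le> hN e i s T"
proof -
 have "(real T - real (k - i)) / 2 ^ k - 7 \<le> hN e i s T"
  using assms
 proof (induction "k - i" arbitrary: i T rule: less_induct)
  case less
  have ik: "i < k" using alive_mono[OF alive_antimono[OF less.prems(1), of s], of k] less.prems(2) by force
  show ?case
  proof (cases "alive (s + T) e (Suc i)")
   case False
   have "(real T - real (k - i)) / 2 ^ k \<le> real T / 2 ^ k" by (simp add: divide_right_mono)
   thus ?thesis using lead_lower[OF less.prems(1) False less.prems(2)] by linarith
  next
   case True
   show ?thesis
   proof (cases T)
    case 0
    have "0 \<le> real (k - i) / 2 ^ k" by simp
    moreover have "(real T - real (k - i)) / 2 ^ k = - (real (k - i) / 2 ^ k)" unfolding 0 by simp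
    ultimately show ?thesis using hN_nonneg[of e i s T] by linarith
   next
    case (Suc T')
    have al': "alive (s + T') e (Suc i)" using alive_antimono[OF True, of "s + T'"] Suc by simp
    have "hN e i s T \<ge> hN e i (Suc s) T'" unfolding Suc using hN_split[of e i s 1 T'] hN_nonneg[of e i s 1] by simp
    moreover have "hN e i (Suc s) T' = hN e (Suc i) s T'" by (rule hN_shift[OF al'])
    moreover have "(real T' - real (k - Suc i)) / 2 ^ k - 7 \<le> hN e (Suc i) s T'"
     by (rule less.hyps[OF _ al' less.prems(2)]) (use ik in auto)
    moreover have "real T' - real (k - Suc i) = real T - real (k - i)" using ik Suc by (simp add: of_nat_diff)
    ultimately show ?thesis by simp
   qed
  qed
 qed
 moreover have "real (k - i) / 2 ^ k \<le> 1"
 proof -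
  have "k - i \<le> k" by simp
  also have "k < 2 ^ k" by (rule less_exp)
  finally have "real (k - i) < 2 ^ k" by (metis of_nat_less_iff of_nat_numeral of_nat_power)
  thus ?thesis by simp
 qed
 moreover have "(real T - real (k - i)) / 2 ^ k = real T / 2 ^ k - real (k - i) / 2 ^ k" by (rule diff_divide_distrib)
 ultimately show ?thesis by linarith
qed

text \<open>In contrast to \<open>lower_disp\<close> the error grows with the number of blocks
  ahead: each of them contributes at most 3 from \<open>cN_bound\<close> and one step of
  delay.\<close>

lemma upper_disp:
 assumes "alive (s + T) e i" "\<not> alive s e h"
 shows "hN e i s T \<le> real T / 2 ^ (i + 1) + 4 * real (h - i)"
 using assms
proof (induction "h - i" arbitrary: i T rule: less_induct)
 case less
 have ih: "i < h" using alive_mono[OF alive_antimono[OF less.prems(1), of s], of h] less.prems(2) by force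
 have hi: "real (h - i) = real (h - Suc i) + 1" using ih by (simp add: of_nat_diff)
 show ?case
 proof (cases "alive s e (Suc i)")
  case False
  thus ?thesis using hN_lead[OF False less.prems(1)] cN_bound[OF less.prems(1)] hi by auto
 next
  case True
  show ?thesis
  proof (cases "alive (s + T) e (Suc i)")
   case al: True
   show ?thesis
   proof (cases T)
    case 0 thus ?thesis by (simp add: hN_def)
   next
    case (Suc T')
    have al': "alive (s + T') e (Suc i)" using alive_antimono[OF al, of "s + T'"] Suc by simp
    have "hN e i s T \<le> 1 + hN e i (Suc s) T'" unfolding Suc using hN_split[of e i s 1 T'] hN_1[of e i s] by simp
    moreover have "hN e i (Suc s) T' = hN e (Suc i) s T'" by (rule hN_shift[OF al'])
    moreover have "hN e (Suc i) s T' \<le> real T' / 2 ^ (Suc i + 1) + 4 * real (h - Suc i)"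
     by (rule less.hyps[OF _ al' less.prems(2)]) (use ih in auto)
    moreover have "real T' / 2 ^ (Suc i + 1) \<le> real T / 2 ^ (i + 1)"
     using pow_mono_div[of "i + 1" "Suc i + 1" T'] Suc by (simp add: field_simps)
    ultimately show ?thesis using hi by linarith
   qed
  next
   case False
   then obtain a where a: "a < T" "alive (s + a) e (Suc i)" "\<not> alive (Suc (s + a)) e (Suc i)"
    using removal[OF True False] by blast
   define b where "b = T - 1 - a"
   have T: "T = Suc 0 + (a + b)" using a(1) by (simp add: b_def)
   have end1: "Suc s + a + b = s + T" using T by simp
   have "hN e i s T \<le> 1 + hN e i (Suc s) a + hN e i (Suc s + a) b"
    unfolding T hN_split using hN_1[of e i s] by simp
   moreover have "hN e i (Suc s) a = hN e (Suc i) s a" by (rule hN_shift[OF a(2)])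
   moreover have "hN e i (Suc s + a) b = cN e i (Suc s + a) b"
    using a(3) less.prems(1) end1 by (intro hN_lead) (simp_all only: add_Suc not_False_eq_True)
   moreover have "cN e i (Suc s + a) b \<le> real b / 2 ^ (i+1) + 3"
    using cN_bound[of "Suc s + a" b e i, unfolded end1, OF less.prems(1)] by (simp only: abs_le_iff) linarith
   moreover have "hN e (Suc i) s a \<le> real a / 2 ^ (Suc i + 1) + 4 * real (h - Suc i)"
    by (rule less.hyps[OF _ a(2) less.prems(2)]) (use ih in auto)
   moreover have "real a / 2 ^ (Suc i + 1) \<le> real a / 2 ^ (i + 1)" by (rule pow_mono_div) simp
   moreover have "real T / 2 ^ (i+1) = real a / 2 ^ (i+1) + real b / 2 ^ (i+1) + 1 / 2 ^ (i+1)"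
    unfolding T by (simp add: add_divide_distrib)
   moreover have "(0::real) \<le> 1 / 2 ^ (i+1)" by simp
   ultimately show ?thesis using hi by linarith
  qed
 qed
qed

definition touches :: "nat => int => nat => int => bool" where
 "touches s e i e' \<longleftrightarrow> alive s e i \<and> \<not> alive s e (Suc i) \<and> alive s e' 0 \<and>
   (pos s e' 0 = pos s e i - L - 2 \<or> pos s e' 0 = pos s e i - L - 3)"

lemma near_touches:
 assumes "alive s e i" "near (bt s) (pos s e i)"
 obtains e' where "touches s e i e'"
proof -
 obtain q where q: "occ (bt s) q" "q = pos s e i - L - 2 \<or> q = pos s e i - L - 3"
  using assms(2) by (auto simp: near_def)
 have "\<not> occ (bt s) (q + L)" "\<not> occ (bt s) (q + L + 1)"
  using sep_close[OF sept alive_occ[OF assms(1)], of "q + L"] sep_close[OF sept alive_occ[OF assms(1)], of "q + L + 1"] q(2) L40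
  by auto
 then obtain e' where "alive s e' 0" "pos s e' 0 = q" using tail_train[OF q(1)] by (auto simp: tail_def)
 thus ?thesis using that near_lead[OF assms] assms q by (auto simp: touches_def)
qed

lemma touches_left: "touches s e i e' ==> e' < ini e i"
 using wl_less_iff[of s e' "ini e i"] L40 by (auto simp: touches_def alive_def pos_def)

lemma ini_le: "train e i ==> ini e i + int i * L \<le> e"
 using alive_span[of 0 e i] by (simp add: alive_0 pos_def)

text \<open>Just after losing block \<open>j + 1\<close>, block \<open>j\<close> is at least
  \<open>2 * L + 1\<close> cells right of the tail \<open>e'\<close>, at contact at most
  \<open>L + 3\<close>. A train of at most \<open>j + 1\<close> blocks is no slower than one led by
  block \<open>j\<close>, up to the errors 3 and 8, and could not let it gain the
  \<open>L - 2\<close> cells in between.\<close>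

lemma touches_big:
 assumes t: "touches s e j e'" "train e (Suc j)"
 shows "train e' (Suc j)"
proof (rule ccontr)
 assume n: "\<not> train e' (Suc j)"
 have a: "alive s e j" "\<not> alive s e (Suc j)" "alive s e' 0" using t by (auto simp: touches_def)
 have "alive 0 e (Suc j)" using t(2) alive_0 by simp
 then obtain s' where s': "s' < s" "alive s' e (Suc j)" "\<not> alive (Suc s') e (Suc j)"
  "near (bt s') (pos s' e (Suc j))" using removal[of 0 e "Suc j" s] a(2) by auto
 have b: "alive (Suc s') e j" "alive (Suc s') e' 0" using alive_antimono[OF a(1)] alive_antimono[OF a(3)] s'(1) by auto
 have "wl s e' < pos s e j" using t L40 by (auto simp: touches_def pos_def)
 hence "e' < ini e j" using wl_less_iff[of s e' "ini e j"] a by (auto simp: alive_def pos_def)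
 hence "wl (Suc s') e' < pos (Suc s') e j" using wl_less_iff[of "Suc s'" e' "ini e j"] b by (auto simp: alive_def pos_def)
 hence "wl s' e' \<le> pos s' e (Suc j) - L - 2"
  using left_bound[OF s'(2,4), of "Suc s'" e'] b by (auto simp: alive_def)
 hence y: "pos (Suc s') e' 0 \<le> pos s' e (Suc j) - L - 2"
  using wl_antimono[of s' "Suc s'" e'] by (auto simp: pos_def)
 have z: "pos (Suc s') e j \<ge> pos s' e (Suc j) + L - 1"
  using alive_dist[OF s'(2)] by (auto simp: pos_Suc)
 define T where "T = s - Suc s'"
 have sT: "s = Suc s' + T" using s'(1) by (simp add: T_def)
 have "hN e j (Suc s') T = cN e j (Suc s') T" by (rule hN_lead) (use s'(3) a(1) sT in auto)
 hence zd: "hN e j (Suc s') T \<le> real T / 2 ^ (j + 1) + 3" using cN_bound[of "Suc s'" T e j] a(1) sT by auto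
 have "\<not> alive (Suc s') e' (Suc j)" using n by (auto simp: alive_def)
 hence yd: "hN e' 0 (Suc s') T \<ge> real T / 2 ^ (Suc j) - 8" using lower_disp[of "Suc s'" T e' 0 "Suc j"] a(3) sT by auto
 have "pos s e j - pos s e' 0 \<le> L + 3" using t by (auto simp: touches_def)
 hence "of_int (pos s e j) - of_int (pos s e' 0) \<le> (of_int L + 3 :: real)" by linarith
 moreover have "of_int (pos (Suc s') e j) - of_int (pos (Suc s') e' 0) \<ge> (2 * of_int L + 1 :: real)" using y z by linarith
 moreover have "of_int L \<ge> (40::real)" using L40 by simp
 ultimately show False using zd yd unfolding hN_pos sT[symmetric] by simp
qed

text \<open>A train that has lost nothing may touch a shorter one that was close to it from the
  beginning, but only early: the shorter one gains \<open>s / 2 ^ (k + 1)\<close> cells, and 12 of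
  them exceed the errors 3 and 8 and the unit by which the gap at contact may exceed the initial
  gap. This is the origin of 24.\<close>

lemma touches_late_big:
 assumes t: "touches s e i e'" and k: "k \<le> i" "train e k" and late: "24 * 2 ^ k < real s"
 shows "train e' k"
proof (cases "train e (Suc i)")
 case True
 thus ?thesis using touches_big[OF t] train_mono k by fastforce
next
 case False
 show ?thesis
 proof (rule ccontr)
  assume n: "\<not> train e' k"
  have a: "alive s e i" "\<not> alive s e (Suc i)" "alive s e' 0" using t by (auto simp: touches_def)
  have a0: "alive 0 e i" "\<not> alive 0 e (Suc i)" using alive_antimono[OF a(1)] False alive_0 by auto
  have "hN e i 0 s = cN e i 0 s" by (rule hN_lead) (use a0 a in auto)
  hence "hN e i 0 s \<le> real s / 2 ^ (i + 1) + 3" using cN_bound[of 0 s e i] a by auto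
  hence zd: "hN e i 0 s \<le> real s / 2 ^ (k + 1) + 3" using pow_mono_div[of "k + 1" "i + 1" s] k by auto
  have yd: "hN e' 0 0 s \<ge> real s / 2 ^ k - 8" using lower_disp[of 0 s e' 0 k] a n alive_0 by auto
  have o: "occ (bt 0) e'" "lead (bt 0) (ini e i)" "e' < ini e i"
   using alive_antimono[OF a(3), of 0] lead_iff[OF a0(1)] a0 touches_left[OF t] by (auto simp: alive_def pos_def)
  hence "e' + L \<le> ini e i" using sepD[OF sep0 o(1), of "ini e i"] a0 alive_occ[OF a0(1)] by (simp add: pos_def)
  moreover have "e' \<noteq> ini e i - L" "e' \<noteq> ini e i - L - 1" using o by (auto simp: lead_def)
  ultimately have "pos 0 e i - pos 0 e' 0 \<ge> L + 2" by (simp add: pos_def)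
  hence "of_int (pos 0 e i) - of_int (pos 0 e' 0) \<ge> (of_int L + 2 :: real)" by linarith
  moreover have "pos s e i - pos s e' 0 \<le> L + 3" using t by (auto simp: touches_def)
  hence "of_int (pos s e i) - of_int (pos s e' 0) \<le> (of_int L + 3 :: real)" by linarith
  moreover have "real s / 2 ^ k = 2 * (real s / 2 ^ (k + 1))" by simp
  moreover have "real s / 2 ^ (k + 1) > 12" using late by (simp add: field_simps)
  ultimately show False using zd yd unfolding hN_pos by simp
 qed
qed

text \<open>For a train that has a block \<open>j\<close>, this is the last moment up to
  \<open>t\<close> at which the block is alive.\<close>

definition dth :: "nat => int => nat => nat" where
 "dth t e j = (LEAST s. s = t \<or> \<not> alive (Suc s) e j)"

text \<open>A potential that is constant along a motion at the speed of a train of size \<open>j + 1\<close>.\<close>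

definition Phi :: "nat => int => nat => real" where
 "Phi t e j = of_int (pos (dth t e j) e j) + real (dth t e j) / 2 ^ Suc j"

lemma dth_le: "dth t e j \<le> t"
 unfolding dth_def by (rule Least_le) simp

lemma dth_end: "dth t e j = t \<or> \<not> alive (Suc (dth t e j)) e j"
 unfolding dth_def by (rule LeastI[of _ t]) simp

lemma dth_alive: assumes "train e j" shows "alive (dth t e j) e j"
proof (cases "dth t e j")
 case 0 thus ?thesis using assms alive_0 by simp
next
 case (Suc s)
 hence "s < dth t e j" by simp
 hence "\<not> (s = t \<or> \<not> alive (Suc s) e j)" unfolding dth_def by (rule not_less_Least)
 thus ?thesis using Suc by simp
qed

lemma dth_eq: "train e j ==> dth t e j = t \<longleftrightarrow> alive t e j"
 using dth_alive[of e j t] dth_end[of t e j] dth_le[of t e j] alive_antimono[of t e j "Suc (dth t e j)"]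
 by (cases "dth t e j = t") auto

lemma Phi_heavy: "alive t e j ==> Phi t e j = of_int (pos t e j) + real t / 2 ^ Suc j"
 using dth_eq[of e j t] by (auto simp: Phi_def alive_def)

lemma disp_eq: "s \<le> s' ==> (of_int (pos s e i) :: real) = of_int (pos s' e i) + hN e i s (s' - s)"
 by (simp add: hN_pos)

lemma span_real:
 assumes "alive t e i" "i < h"
 shows "(of_int (pos t e 0) :: real) \<le> of_int (pos t e i) + real h * (of_int L + 1) - 1"
proof -
 have "pos t e 0 \<le> pos t e i + int i * (L + 1)" using alive_span[OF assms(1)] by simp
 moreover have "int i * (L + 1) + (L + 1) \<le> int h * (L + 1)"
  using assms(2) L40 mult_right_mono[of "int i + 1" "int h" "L + 1"] by (simp add: algebra_simps)
 ultimately have "pos t e 0 \<le> pos t e i + int h * (L + 1) - 1" using L40 by linarith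
 hence "(of_int (pos t e 0) :: real) \<le> of_int (pos t e i + int h * (L + 1) - 1)" by (simp only: of_int_le_iff)
 thus ?thesis by simp
qed

text \<open>The summands: \<open>h * (L + 1)\<close> bounds the span of a train of at most
  \<open>h\<close> blocks, \<open>4 * h\<close> is the error of \<open>upper_disp\<close>,
  \<open>L + 3\<close> the distance at contact, and 9 absorbs the error 8 of
  \<open>lower_disp\<close> and one step.\<close>

definition b1 :: "nat => int" where "b1 h = int h * (L + 5) + L + 12"

text \<open>Before the death of block \<open>j\<close> the train is slow and the potential almost
  nondecreasing (\<open>upper_disp\<close>); afterwards it is fast and the potential almost
  nonincreasing (\<open>lower_disp\<close>). So \<open>Phi\<close>, taken at the death, is nearly
  the maximum over time.\<close>

lemma touch_Phi:
 assumes a: "alive s e 0" "s \<le> t" and tr: "train e j" "\<not> train e h"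
 shows "Phi t e j \<ge> of_int (pos s e 0) + real s / 2 ^ Suc j - (of_int (b1 h) - of_int L - 3)"
proof -
 define \<theta> where "\<theta> = dth t e j"
 have jh: "j < h" using tr train_mono by (meson not_le)
 have B: "of_int (b1 h) - of_int L - 3 = real h * (of_int L + 1) + 4 * real h + 9" by (simp add: b1_def algebra_simps)
 have al: "alive \<theta> e j" unfolding \<theta>_def by (rule dth_alive[OF tr(1)])
 show ?thesis
 proof (cases "s \<le> \<theta>")
  case True
  have "alive s e j" using alive_antimono[OF al True] .
  note sp = span_real[OF this jh]
  have "hN e j s (\<theta> - s) \<le> real (\<theta> - s) / 2 ^ (j + 1) + 4 * real (h - j)"
   by (rule upper_disp) (use al True tr(2) in \<open>auto simp: alive_def\<close>)
  moreover have "real (h - j) \<le> real h" by simp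
  moreover have "real (\<theta> - s) / 2 ^ (j + 1) = real \<theta> / 2 ^ Suc j - real s / 2 ^ Suc j" using True by (simp add: diff_divide_distrib)
  ultimately show ?thesis using sp disp_eq[OF True, of e j] unfolding Phi_def \<theta>_def[symmetric] B by linarith
 next
  case False
  hence ne: "\<theta> \<noteq> t" using a(2) by simp
  hence n: "\<not> alive (Suc \<theta>) e (Suc j)" using dth_end[of t e j] alive_mono[of _ _ "Suc j" j] by (auto simp: \<theta>_def)
  have le: "Suc \<theta> \<le> s" using False by simp
  have "hN e 0 (Suc \<theta>) (s - Suc \<theta>) \<ge> real (s - Suc \<theta>) / 2 ^ Suc j - 8"
   by (rule lower_disp) (use a(1) le n in auto)
  moreover have "real (s - Suc \<theta>) / 2 ^ Suc j = real s / 2 ^ Suc j - real \<theta> / 2 ^ Suc j - 1 / 2 ^ Suc j"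
   using le by (simp add: of_nat_diff diff_divide_distrib add_divide_distrib)
  moreover have "(1::real) / 2 ^ Suc j \<le> 1" using one_le_power[of "2::real" "Suc j"] by simp
  moreover have "(of_int (pos \<theta> e 0) :: real) \<ge> of_int (pos (Suc \<theta>) e 0)" using pos_Suc[of \<theta> e 0] by simp
  ultimately show ?thesis using span_real[OF al jh] disp_eq[OF le, of e 0] unfolding Phi_def \<theta>_def[symmetric] B by linarith
 qed
qed

lemma tail_left:
 assumes "tail (bt 0) f" "occ (bt 0) f" "f < e" "train e i" shows "f < ini e i"
 using assms(4)
proof (induction i)
 case (Suc i)
 have tr: "train e i" using Suc.prems train_mono by simp
 have o: "occ (bt 0) (ini e i)" "occ (bt 0) (ini e (Suc i))" using Suc.prems by (auto simp: train_def)
 have "f + L \<le> ini e i" using sepD[OF sep0 assms(2) o(1)] Suc.IH[OF tr] by simp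
 moreover have "ini e i = ini e (Suc i) + L \<or> ini e i = ini e (Suc i) + L + 1" by (simp add: lp_def)
 moreover have "f \<noteq> ini e (Suc i)" using ini_link(1)[OF Suc.prems] assms(1) by auto
 moreover have "f \<noteq> ini e (Suc i) + 1" using sep_close[OF sep0 o(2) assms(2)] L40 by auto
 ultimately show ?case by linarith
qed (use assms in simp)

lemma train_occ: "train e i ==> occ (bt 0) e \<and> tail (bt 0) e"
 by (force simp: train_def)

lemma alive_train: "alive s e i ==> train e i" by (simp add: alive_def)

text \<open>At contact the two trains are separated by at most 3 cells, which leaves no room for
  another block.\<close>

lemma no_between:
 assumes "touches s e i e'" "e' < f" "f < e" "s \<le> t" shows "\<not> alive t f 0"
proof
 assume "alive t f 0"
 hence f: "alive s f 0" using alive_antimono assms(4) by blast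
 have a: "alive s e i" "alive s e' 0" using assms(1) by (auto simp: touches_def)
 have "f < ini e i" using tail_left[of f e i] assms(3) train_occ[of f 0] alive_train[OF f] alive_train[OF a(1)] by auto
 hence "pos s f 0 + L \<le> pos s e i" using wl_sep[of f "ini e i" s] f a by (auto simp: alive_def pos_def)
 moreover have "pos s e' 0 + L \<le> pos s f 0" using wl_sep[of e' f s] assms(2) f a by (auto simp: alive_def pos_def)
 ultimately show False using assms(1) L40 by (auto simp: touches_def)
qed

lemma touch_next:
 assumes t: "touches s e i e'" "s \<le> t" and big: "train e (Suc j)" "j \<le> i" and late: "i = j \<or> 24 * 2 ^ Suc j < real s"
  and h: "train e' (Suc j) ==> \<not> train e' h"
 shows "train e' (Suc j)" "e' < e" "Phi t e' j \<ge> of_int (pos s e i) + real s / 2 ^ Suc j - of_int (b1 h)"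
  "\<And>f. e' < f ==> f < e ==> \<not> alive t f 0" "pos s e i - L - 3 \<le> e'"
proof -
 show tr: "train e' (Suc j)"
 proof (cases "i = j")
  case True thus ?thesis using touches_big[of s e j e'] t(1) big(1) by simp
 next
  case False thus ?thesis using touches_late_big[OF t(1), of "Suc j"] big late by auto
 qed
 have a: "alive s e' 0" "alive s e i" "pos s e i - L - 3 \<le> pos s e' 0" using t(1) by (auto simp: touches_def)
 show "e' < e" using touches_left[OF t(1)] ini_le[of e i] alive_train[OF a(2)] L40
  by (smt (verit) mult_nonneg_nonneg of_nat_0_le_iff)
 have "(of_int (pos s e' 0) :: real) \<ge> of_int (pos s e i - L - 3)" using a(3) by (simp only: of_int_le_iff)
 thus "Phi t e' j \<ge> of_int (pos s e i) + real s / 2 ^ Suc j - of_int (b1 h)"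
  using touch_Phi[OF a(1) t(2), of j h] train_mono[OF tr, of j] h[OF tr] by simp
 show "\<And>f. e' < f ==> f < e ==> \<not> alive t f 0" using no_between[OF t(1)] t(2) by blast
 show "pos s e i - L - 3 \<le> e'" using a(3) wl_antimono[of 0 s e'] by (simp add: pos_def)
qed

definition bigs :: "nat => int => int => int set" where
 "bigs j a b = {f. train f (Suc j) \<and> a < f \<and> f \<le> b}"

lemma bigs_fin: "finite (bigs j a b)"
 by (rule finite_subset[of _ "{a<..b}"]) (auto simp: bigs_def)

lemma bigs_mono: "a' \<le> a ==> b \<le> b' ==> card (bigs j a b) \<le> card (bigs j a' b')"
 by (rule card_mono[OF bigs_fin]) (auto simp: bigs_def)

lemma b1_pos: "L + 3 \<le> b1 h" "0 < b1 h"
proof -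
 have "0 \<le> int h * (L + 5)" using L40 by simp
 thus "L + 3 \<le> b1 h" "0 < b1 h" using L40 unfolding b1_def by linarith+
qed

text \<open>A train whose block \<open>j\<close> is dead at \<open>t\<close> was eroded by a train
  on its left, to which the argument passes. Each passage costs \<open>b1 h\<close> of potential and
  consumes one train of at least \<open>j + 2\<close> blocks; the last hypothesis puts
  \<open>Y\<close> so far left that the walk ends before reaching it.\<close>

lemma chain:
 assumes "train e (Suc j)" "Y < e" "e \<le> X"
  and reg: "\<And>f. train f (Suc j) ==> Y < f ==> f \<le> X ==> \<not> train f h"
  and "of_int Y < Phi t e j - real t / 2 ^ Suc j - of_int (b1 h) * real (card (bigs j Y e))"
 shows "\<exists>r. Y < r \<and> r \<le> e \<and> train r (Suc j) \<and> alive t r j \<and> (\<forall>f. r < f \<and> f \<le> e --> \<not> alive t f j)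
   \<and> Phi t r j \<ge> Phi t e j - of_int (b1 h) * real (card (bigs j r e))"
 using assms(1,2,3,5)
proof (induction "card (bigs j Y e)" arbitrary: e rule: less_induct)
 case less
 show ?case
 proof (cases "alive t e j")
  case True
  thus ?thesis using less.prems b1_pos[of h] by (intro exI[of _ e]) auto
 next
  case False
  define \<theta> where "\<theta> = dth t e j"
  have tj: "train e j" using train_mono[OF less.prems(1)] by simp
  have al: "alive \<theta> e j" "\<theta> \<le> t" unfolding \<theta>_def using dth_alive[OF tj] dth_le by auto
  have "\<theta> \<noteq> t" using False dth_eq[OF tj] by (simp add: \<theta>_def)
  hence "near (bt \<theta>) (pos \<theta> e j)" using dth_end[of t e j] al alive_step by (auto simp: \<theta>_def)
  then obtain e' where e': "touches \<theta> e j e'" using near_touches[OF al(1)] by blast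
  have ein: "e \<in> bigs j Y e" using less.prems by (auto simp: bigs_def)
  hence c1: "card (bigs j Y e) \<ge> 1" using bigs_fin[of j Y e] by (metis card_gt_0_iff empty_iff less_eq_Suc_le One_nat_def)
  have b1c: "of_int (b1 h) \<le> of_int (b1 h) * real (card (bigs j Y e))"
   using c1 b1_pos[of h] mult_left_mono[of 1 "real (card (bigs j Y e))" "of_int (b1 h)"] by simp
  have PhiE: "Phi t e j = of_int (pos \<theta> e j) + real \<theta> / 2 ^ Suc j" by (simp add: Phi_def \<theta>_def)
  have \<theta>t: "real \<theta> / 2 ^ Suc j \<le> real t / 2 ^ Suc j" using al(2) by (simp add: divide_right_mono)
  have e'Y: "Y < e'"
  proof -
   have "e' \<ge> pos \<theta> e' 0" using wl_antimono[of 0 \<theta> e'] by (simp add: pos_def)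
   hence "pos \<theta> e j - L - 3 \<le> e'" using e' by (auto simp: touches_def)
   hence "of_int (pos \<theta> e j - L - 3) \<le> (of_int e' :: real)" by (simp only: of_int_le_iff)
   moreover have "(of_int (L + 3) :: real) \<le> of_int (b1 h)" using b1_pos by (simp only: of_int_le_iff)
   ultimately have "(of_int Y :: real) < of_int e'" using less.prems(4) b1c PhiE \<theta>t by simp
   thus ?thesis by simp
  qed
  have el: "e' < e" using touches_left[OF e'] ini_le[OF tj] L40 by (smt (verit) mult_nonneg_nonneg of_nat_0_le_iff)
  have rg: "train e' (Suc j) ==> \<not> train e' h" using reg[of e'] e'Y el less.prems(3) by simp
  note nx = touch_next[OF e' al(2) less.prems(1) order_refl _ rg]
  have ph: "Phi t e' j \<ge> Phi t e j - of_int (b1 h)" using nx(3) PhiE by simp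
  have ss: "insert e (bigs j r e') \<subseteq> bigs j r e" if "r < e" for r using less.prems(1) el that by (auto simp: bigs_def)
  have ni: "e \<notin> bigs j r e'" for r using el by (auto simp: bigs_def)
  have cc: "card (bigs j r e') + 1 \<le> card (bigs j r e)" if "r < e" for r
   using card_mono[OF bigs_fin ss[OF that]] ni bigs_fin by simp
  hence cY: "card (bigs j Y e') + 1 \<le> card (bigs j Y e)" using less.prems(2) by simp
  have "of_int (b1 h) * (real (card (bigs j Y e')) + 1) \<le> of_int (b1 h) * real (card (bigs j Y e))"
   using cY b1_pos[of h] by (intro mult_left_mono) auto
  hence pr: "of_int Y < Phi t e' j - real t / 2 ^ Suc j - of_int (b1 h) * real (card (bigs j Y e'))"
   using less.prems(4) ph by (simp add: algebra_simps)
  obtain r where r: "Y < r" "r \<le> e'" "train r (Suc j)" "alive t r j" "\<forall>f. r < f \<and> f \<le> e' --> \<not> alive t f j"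
   "Phi t r j \<ge> Phi t e' j - of_int (b1 h) * real (card (bigs j r e'))"
   using less.hyps[OF _ nx(1) e'Y _ pr] cY el less.prems(3) by auto
  have "of_int (b1 h) * (real (card (bigs j r e')) + 1) \<le> of_int (b1 h) * real (card (bigs j r e))"
   using cc[of r] r(2) el b1_pos[of h] by (intro mult_left_mono) auto
  hence "Phi t r j \<ge> Phi t e j - of_int (b1 h) * real (card (bigs j r e))" using r(6) ph by (simp add: algebra_simps)
  moreover have "\<not> alive t f j" if fr: "r < f" "f \<le> e" for f
  proof -
   consider "f \<le> e'" | "e' < f \<and> f < e" | "f = e" using fr by linarith
   thus ?thesis using r(5) fr nx(4) False alive_mono[of t f j 0] by cases auto
  qed
  ultimately show ?thesis using r el by (intro exI[of _ r]) auto
 qed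
qed

end

section \<open>Covered cells and cells that become free\<close>

context placement
begin

text \<open>The gap cell between two linked blocks is included, so that the cells covered by a train
  form an interval.\<close>

definition cov :: "(int => 's option) => int => bool" where
 "cov \<beta> z \<longleftrightarrow> (\<exists>p. occ \<beta> p \<and> p \<le> z \<and> (z < p + L \<or> z = p + L \<and> occ \<beta> (p + L + 1)))"

text \<open>The emission of a letter: free letters move left while this leader stays, so cell
  \<open>p - 1\<close> in front of it has to receive a new letter.\<close>

definition em :: "(int => 's option) => int => bool" where
 "em \<beta> p \<longleftrightarrow> surv \<beta> p \<and> lead \<beta> p \<and> \<not> hop \<beta> p"

lemma cov_occ: "occ \<beta> p ==> p \<le> z ==> z < p + L ==> cov \<beta> z"
 by (auto simp: cov_def)

text \<open>Blocks and gaps of a train move as one interval, so a cell is uncovered only in front of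
  a leader that stays or at a place where a block is erased.\<close>

lemma open_cases:
 assumes "sep \<beta>" "\<not> cov (step \<beta>) y" "cov \<beta> (y + 1)"
 shows "em \<beta> (y + 1) \<or> (\<exists>p. occ \<beta> p \<and> near \<beta> p \<and> p - 1 \<le> y \<and> y < p + L)"
proof -
 obtain p where p: "occ \<beta> p" "p \<le> y + 1" "y + 1 < p + L \<or> y + 1 = p + L \<and> occ \<beta> (p + L + 1)"
  using assms(3) by (auto simp: cov_def)
 show ?thesis
 proof (cases "near \<beta> p")
  case True thus ?thesis using p by (intro disjI2 exI[of _ p]) auto
 next
  case False
  hence s: "surv \<beta> p" using p by (simp add: surv_def)
  hence o: "occ (step \<beta>) (mv \<beta> p)" using occ_step_iff[OF assms(1)] by blast
  have nc: "\<not> (mv \<beta> p \<le> y \<and> y < mv \<beta> p + L)" using cov_occ[OF o] assms(2) by blast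
  show ?thesis
  proof (cases "hop \<beta> p")
   case True
   hence m: "mv \<beta> p = p - 1" by (simp add: mv_def)
   hence y: "y + 1 = p + L" "occ \<beta> (p + L + 1)" using nc p by auto
   have "\<not> tail \<beta> p" using y(2) by (simp add: tail_def)
   note l = link[OF assms(1) p(1) this]
   have "occ (step \<beta>) (mv \<beta> (rp \<beta> p))" using l(4) occ_step_iff[OF assms(1)] by blast
   hence "occ (step \<beta>) (mv \<beta> p + L + 1)" using l(6) True by simp
   hence "cov (step \<beta>) y" unfolding cov_def using o m y(1) L40 by (intro exI[of _ "mv \<beta> p"]) auto
   thus ?thesis using assms(2) by blast
  next
   case hf: False
   hence m: "mv \<beta> p = p" by (simp add: mv_def)
   hence y: "y + 1 = p" using nc p by auto
   show ?thesis
   proof (cases "lead \<beta> p")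
    case True thus ?thesis using y s hf by (simp add: em_def)
   next
    case nl: False
    note q = lead_or_link[OF assms(1) p(1) nl]
    have g: "lp \<beta> p = p - L" using hf nl by (auto simp: hop_def lp_def lead_def)
    show ?thesis
    proof (cases "near \<beta> (lp \<beta> p)")
     case True
     thus ?thesis using q(1) g y L40 by (intro disjI2 exI[of _ "lp \<beta> p"]) auto
    next
     case False
     hence sq: "surv \<beta> (lp \<beta> p)" using q(1) by (simp add: surv_def)
     have oq: "occ (step \<beta>) (mv \<beta> (lp \<beta> p))" using sq occ_step_iff[OF assms(1)] by blast
     have mm: "p = mv \<beta> (lp \<beta> p) + L + (if hop \<beta> (lp \<beta> p) then 1 else 0)"
      using link(6)[OF assms(1) q(1,2)] q(3) m by simp
     have "cov (step \<beta>) y"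
     proof (cases "hop \<beta> (lp \<beta> p)")
      case True
      hence "y = mv \<beta> (lp \<beta> p) + L" "occ (step \<beta>) (mv \<beta> (lp \<beta> p) + L + 1)" using mm y o m by auto
      thus ?thesis unfolding cov_def using oq L40 by (intro exI[of _ "mv \<beta> (lp \<beta> p)"]) auto
     next
      case False
      thus ?thesis using mm y cov_occ[OF oq, of y] L40 by auto
     qed
     thus ?thesis using assms(2) by blast
    qed
   qed
  qed
 qed
qed

lemma em_cov: "em \<beta> p ==> cov \<beta> p"
 using L40 by (auto simp: em_def surv_def intro!: cov_occ[of \<beta> p])

end

section \<open>Origin of the letters\<close>

context evolution
begin

text \<open>Follows a letter back along its diagonal to the emission that wrote it, given by time
  and position of the leader. \<open>None\<close> stands for initial letters and for diagonals that
  run into a covered cell without an emission.\<close>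

primrec src :: "nat => int => (nat \<times> int) option" where
 "src 0 z = None"
| "src (Suc t) z = (if em (bt t) (z + 1) then Some (t, z + 1)
   else if cov (bt t) (z + 1) then None else src t (z + 1))"

definition path :: "nat => int => nat => bool" where
 "path t z u \<longleftrightarrow> u \<le> t \<and> (\<forall>v\<le>u. \<not> cov (bt (t - v)) (z + int v))"

lemma path_le: "path t z u ==> v \<le> u ==> path t z v"
 by (auto simp: path_def)

lemma src_path: "path t z u ==> src t z = src (t - u) (z + int u)"
proof (induction u)
 case (Suc u)
 have p: "path t z u" using path_le[OF Suc.prems, of u] by simp
 have s: "t - u = Suc (t - Suc u)" using Suc.prems by (auto simp: path_def)
 have c: "\<not> cov (bt (t - Suc u)) (z + int u + 1)" using Suc.prems by (auto simp: path_def algebra_simps)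
 hence "\<not> em (bt (t - Suc u)) (z + int u + 1)" using em_cov by blast
 hence "src (t - u) (z + int u) = src (t - Suc u) (z + int u + 1)" unfolding s using c by simp
 thus ?case using Suc.IH[OF p] by (simp add: algebra_simps)
qed simp

text \<open>Backwards in time the path moves right by one cell per step and the block by at most
  one; to pass the block it would have to enter the cells that the block covers.\<close>

lemma path_right:
 assumes "path t z u" "al t p" "z < wl t p" shows "z + int u < wl (t - u) p"
 using assms(1)
proof (induction u)
 case (Suc u)
 have p: "path t z u" using path_le[OF Suc.prems, of u] by simp
 have a: "al (t - Suc u) p" using al_antimono[OF assms(2)] by simp
 have "z + int (Suc u) \<le> wl (t - Suc u) p"
  using Suc.IH[OF p] wl_antimono[of "t - Suc u" "t - u" p] by force
 moreover have "z + int (Suc u) \<noteq> wl (t - Suc u) p"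
  using Suc.prems cov_occ[OF al_occ[OF a], of "z + int (Suc u)"] L40 by (auto simp: path_def)
 ultimately show ?case by linarith
qed (use assms in simp)

lemma path_left:
 assumes "path t z u" "al t p" "wl (t - u) p \<le> z + int u" shows "wl t p + L \<le> z"
 using assms(1,3)
proof (induction u)
 case 0
 thus ?case using cov_occ[OF al_occ[OF assms(2)], of z] by (force simp: path_def)
next
 case (Suc u)
 have p: "path t z u" using path_le[OF Suc.prems(1), of u] by simp
 have a: "al (t - Suc u) p" using al_antimono[OF assms(2)] by simp
 have "wl (t - Suc u) p + L \<le> z + int (Suc u)"
  using Suc.prems cov_occ[OF al_occ[OF a], of "z + int (Suc u)"] unfolding path_def by force
 moreover have "wl (t - u) p \<le> wl (t - Suc u) p" using wl_antimono[of "t - Suc u" "t - u" p] by auto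
 ultimately show ?case using Suc.IH[OF p] L40 by auto
qed

text \<open>The path stays left of the world line of \<open>p\<close>, hence left of cell
  \<open>p\<close>, and gains one cell per step; so it meets a covered cell before time 0 if
  \<open>t \<ge> p - z\<close>.\<close>

lemma path_ends:
 assumes "al t p" "z < wl t p" "\<not> cov (bt t) z" "p - z \<le> int t"
 obtains u where "path t z u" "u < t" "cov (bt (t - Suc u)) (z + int u + 1)" "z + int u < p"
proof -
 have "\<exists>u. path t z u \<and> (u < t --> cov (bt (t - Suc u)) (z + int u + 1)) \<and> u \<le> t"
 proof (rule ccontr)
  assume n: "\<nexists>u. path t z u \<and> (u < t --> cov (bt (t - Suc u)) (z + int u + 1)) \<and> u \<le> t"
  have "path t z u" if "u \<le> t" for u
   using that
  proof (induction u)
   case 0 thus ?case using assms(3) by (simp add: path_def)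
  next
   case (Suc u)
   hence "path t z u" "u < t" by auto
   hence "\<not> cov (bt (t - Suc u)) (z + int u + 1)" using n by auto
   thus ?case using \<open>path t z u\<close> \<open>u < t\<close> unfolding path_def by (auto simp: le_Suc_eq algebra_simps)
  qed
  thus False using n by blast
 qed
 then obtain u where u: "path t z u" "u < t --> cov (bt (t - Suc u)) (z + int u + 1)" "u \<le> t" by blast
 have "z + int u < p"
  using path_right[OF u(1) assms(1,2)] wl_antimono[of 0 "t - u" p] by simp
 hence "u < t" using assms(4) u(3) by auto
 thus ?thesis using that u \<open>z + int u < p\<close> by blast
qed

lemma find_train:
 assumes "occ (bt 0) p" "occ (bt 0) g" "tail (bt 0) g" "p \<le> g"
 shows "\<exists>e i. train e i \<and> ini e i = p \<and> e \<le> g"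
 using assms(1,4)
proof (induction "nat (g - p)" arbitrary: p rule: less_induct)
 case less
 show ?case
 proof (cases "tail (bt 0) p")
  case True
  thus ?thesis using less.prems by (intro exI[of _ p] exI[of _ 0]) (auto simp: train_def)
 next
  case False
  note l = link[OF sep0 less.prems(1) False]
  have "p \<noteq> g" using False assms(3) by auto
  hence pg: "p + L \<le> g" using sepD[OF sep0 less.prems(1) assms(2)] less.prems(2) by simp
  have "rp (bt 0) p \<le> g"
  proof (rule ccontr)
   assume "\<not> rp (bt 0) p \<le> g"
   hence "g = p + L" "rp (bt 0) p = p + L + 1" using l(5) pg by auto
   thus False using assms(2) by (auto simp: rp_def split: if_splits)
  qed
  then obtain e i where e: "train e i" "ini e i = rp (bt 0) p" "e \<le> g"
   using less.hyps[of "rp (bt 0) p"] l(1,7) by (auto simp: zless_nat_conj)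
  hence "ini e (Suc i) = p" using l(3) by simp
  moreover have "train e (Suc i)" using e(1) less.prems(1) \<open>ini e (Suc i) = p\<close> unfolding train_def by (metis le_Suc_eq)
  ultimately show ?thesis using e(3) by blast
 qed
qed

end

lemma rank_exists:
 fixes S :: "int set"
 assumes "finite S" "i < card S"
 shows "\<exists>T\<in>S. card {f \<in> S. f < T} = i"
 using assms
proof (induction "card S" arbitrary: S)
 case (Suc n)
 hence ne: "S \<noteq> {}" by auto
 define M where "M = Max S"
 have M: "M \<in> S" "\<And>f. f \<in> S ==> f \<le> M" using Suc.prems ne by (auto simp: M_def)
 have c: "card (S - {M}) = n" using Suc M by simp
 show ?case
 proof (cases "i = n")
  case True
  have "{f \<in> S. f < M} = S - {M}" using M by fastforce
  hence "card {f \<in> S. f < M} = i" using c True by simp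
  thus ?thesis using M(1) by blast
 next
  case False
  then obtain T where T: "T \<in> S - {M}" "card {f \<in> S - {M}. f < T} = i"
   using Suc.hyps(1)[of "S - {M}"] c Suc.prems Suc.hyps(2) by auto
  have "{f \<in> S - {M}. f < T} = {f \<in> S. f < T}" using T M by fastforce
  hence "card {f \<in> S. f < T} = i" using T(2) by simp
  thus ?thesis using T(1) by blast
 qed
qed simp

context evolution
begin

text \<open>Per train, this pays for one passage of \<open>chain\<close> and for the offset between
  a bad cell and the potential of the train at which the chain starts.\<close>

definition b2 :: "nat => nat => int" where "b2 h st = 2 * b1 h + int st + 2"

text \<open>The trains charged for a badly written cell: the cell is charged to the train whose rank, counted
 from the last surviving long train \<open>r\<close> on its left, matches its distance from \<open>r\<close>.\<close>

definition charged :: "nat => nat => int => int => int => int => bool" where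
 "charged t j B M z T \<longleftrightarrow> (\<exists>r. train r (Suc j) \<and> alive t r j \<and> T - M < r \<and> r < T \<and> (\<forall>f. r < f \<and> f < T --> \<not> alive t f j)
   \<and> int (card (bigs j r (T - 1))) * B \<le> z - pos t r 0 \<and> z - pos t r 0 < (int (card (bigs j r (T - 1))) + 1) * B)"

lemma charged_card:
 assumes "0 \<le> B" shows "finite {z. charged t j B M z T} \<and> int (card {z. charged t j B M z T}) \<le> B"
proof (cases "\<exists>z. charged t j B M z T")
 case True
 then obtain r where r: "alive t r j" "r < T" "\<forall>f. r < f \<and> f < T --> \<not> alive t f j" by (auto simp: charged_def)
 define a where "a = pos t r 0 + int (card (bigs j r (T - 1))) * B"
 have "{z. charged t j B M z T} \<subseteq> {a..<a + B}"
 proof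
  fix z assume "z \<in> {z. charged t j B M z T}"
  then obtain r' where r': "alive t r' j" "r' < T" "\<forall>f. r' < f \<and> f < T --> \<not> alive t f j"
   "int (card (bigs j r' (T - 1))) * B \<le> z - pos t r' 0" "z - pos t r' 0 < (int (card (bigs j r' (T - 1))) + 1) * B"
   by (auto simp: charged_def)
  have "r' = r" using r r' by (cases r r' rule: linorder_cases) auto
  thus "z \<in> {a..<a + B}" using r' by (auto simp: a_def algebra_simps)
 qed
 from finite_subset[OF this] card_mono[OF _ this] have "finite {z. charged t j B M z T}"
  "card {z. charged t j B M z T} \<le> card {a..<a + B}" by auto
 moreover have "card {a..<a + B} = nat B" by simp
 ultimately show ?thesis using assms by auto
qed (use assms in auto)

lemma b2_pos: "2 * b1 h + int st + 2 \<le> b2 h st" "0 < b2 h st"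
 using b1_pos[of h] by (auto simp: b2_def)

text \<open>Here \<open>e\<close> is the train at which the path of \<open>z\<close> ends, and the
  chain starts at \<open>e0\<close>, either \<open>e\<close> itself or the train that eroded it. The
  chain ends at a survivor \<open>r\<close>, and \<open>z\<close> is less than \<open>b2\<close>
  times the number of long trains in \<open>(r, e]\<close> away from it, so one of these trains has
  the matching rank.\<close>

lemma charged_ex:
 assumes reg: "\<And>f. train f (Suc j) ==> Y < f ==> f \<le> X ==> \<not> train f h"
  and e: "train e0 (Suc j)" "Y < e0" "e0 \<le> e" "e \<le> X" "train e (Suc j)"
  and clean: "\<And>f. e0 < f ==> f < e ==> \<not> alive t f j"
  and strict: "e0 = e ==> \<not> alive t e j"
  and room: "Y < - (b2 h st * (int (card (bigs j Y X)) + 1))"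
  and z0: "0 \<le> z" and zPhi: "of_int z \<le> Phi t e0 j - real t / 2 ^ Suc j + (if e0 = e then of_int (b1 h) + 1 else 2 * of_int (b1 h) + real st + 1)"
  and zr: "\<And>r. r \<le> e0 ==> r < e ==> alive t r 0 ==> pos t r 0 \<le> z"
 shows "\<exists>T. train T (Suc j) \<and> Y < T \<and> T \<le> X \<and> charged t j (b2 h st) (X - Y) z T"
proof -
 have bp: "0 < (of_int (b1 h) :: real)" using b1_pos by simp
 have b2r: "(of_int (b2 h st) :: real) = 2 * of_int (b1 h) + real st + 2" by (simp add: b2_def)
 have cm: "card (bigs j Y e0) \<le> card (bigs j Y X)" using e by (intro bigs_mono) auto
 have m: "of_int (b1 h) * real (card (bigs j Y e0)) \<le> of_int (b2 h st) * real (card (bigs j Y X))"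
  using cm bp b2r by (intro mult_mono) auto
 have "(of_int Y :: real) < of_int (- (b2 h st * (int (card (bigs j Y X)) + 1)))" using room by (simp only: of_int_less_iff)
 hence "(of_int Y :: real) < - (of_int (b2 h st) * real (card (bigs j Y X))) - of_int (b2 h st)" by (simp add: algebra_simps)
 hence "of_int Y < Phi t e0 j - real t / 2 ^ Suc j - of_int (b1 h) * real (card (bigs j Y e0))"
  using zPhi m z0 b2r bp by (auto split: if_splits)
 from chain[OF e(1,2) _ reg this] e obtain r where r: "Y < r" "r \<le> e0" "train r (Suc j)" "alive t r j"
  "\<forall>f. r < f \<and> f \<le> e0 --> \<not> alive t f j" "Phi t r j \<ge> Phi t e0 j - of_int (b1 h) * real (card (bigs j r e0))" by force
 have re: "r < e" using r e strict by (cases "r = e") auto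
 define n where "n = card (bigs j r e)"
 define d where "d = z - pos t r 0"
 have cle: "card (bigs j r e0) + (if e0 = e then 0 else 1) \<le> n"
 proof (cases "e0 = e")
  case False
  hence "insert e (bigs j r e0) \<subseteq> bigs j r e" "e \<notin> bigs j r e0" using e re by (auto simp: bigs_def)
  thus ?thesis unfolding n_def using card_mono[OF bigs_fin, of "insert e (bigs j r e0)" j r e] bigs_fin False by simp
 qed (simp add: n_def)
 have n1: "1 \<le> n"
 proof -
  have "e \<in> bigs j r e" using re e by (auto simp: bigs_def)
  thus ?thesis unfolding n_def using bigs_fin by (metis card_gt_0_iff empty_iff less_eq_Suc_le One_nat_def)
 qed
 have ph: "Phi t r j = of_int (pos t r j) + real t / 2 ^ Suc j" by (rule Phi_heavy[OF r(4)])
 have "pos t r j \<le> pos t r 0" using alive_span[OF r(4)] L40 by (smt (verit) mult_nonneg_nonneg of_nat_0_le_iff)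
 hence pj: "(of_int (pos t r j) :: real) \<le> of_int (pos t r 0)" by simp
 have "of_int d < (of_int (int n * b2 h st) :: real)"
 proof (cases "e0 = e")
  case True
  have "of_int (b1 h) * real (card (bigs j r e0)) \<le> of_int (b1 h) * real n" using cle True bp by (intro mult_left_mono) auto
  moreover have "1 \<le> real n" using n1 by simp
  moreover from this have "of_int (b1 h) * 1 \<le> of_int (b1 h) * real n" using bp by (intro mult_left_mono) auto
  moreover have "of_int (int n * b2 h st) = (2 * of_int (b1 h) + real st + 2) * real n" by (simp add: b2r)
  moreover have "\<dots> = 2 * (of_int (b1 h) * real n) + real st * real n + 2 * real n" by (simp add: algebra_simps)
  moreover have "0 \<le> real st * real n" by simp
  moreover have "of_int z \<le> Phi t e0 j - real t / 2 ^ Suc j + (of_int (b1 h) + 1)" using zPhi True by simp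
  ultimately show ?thesis using r(6) ph pj unfolding d_def of_int_diff by linarith
 next
  case False
  have "of_int (b1 h) * (real (card (bigs j r e0)) + 1) \<le> of_int (b1 h) * real n" using cle False bp by (intro mult_left_mono) auto
  moreover have "1 \<le> real n" using n1 by simp
  moreover from this have "of_int (b1 h) * 1 \<le> of_int (b1 h) * real n" using bp by (intro mult_left_mono) auto
  moreover have "real st * 1 \<le> real st * real n" using n1 by (intro mult_left_mono) auto
  moreover have "of_int (int n * b2 h st) = (2 * of_int (b1 h) + real st + 2) * real n" by (simp add: b2r)
  moreover have "\<dots> = 2 * (of_int (b1 h) * real n) + real st * real n + 2 * real n" by (simp add: algebra_simps)
  moreover have "of_int z \<le> Phi t e0 j - real t / 2 ^ Suc j + (2 * of_int (b1 h) + real st + 1)" using zPhi False by simp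
  ultimately show ?thesis using r(6) ph pj unfolding d_def of_int_diff distrib_left by linarith
 qed
 hence dn: "d < int n * b2 h st" by (simp only: of_int_less_iff)
 have d0: "0 \<le> d" using zr[OF r(2) re] alive_mono[OF r(4), of 0] by (simp add: d_def)
 \<comment> \<open>The definition of \<open>charged\<close> forces this rank; \<open>dn\<close>
   shows that it is less than \<open>n\<close>, so that a train of this rank exists.\<close>
 define i where "i = nat (d div b2 h st)"
 have i1: "int i = d div b2 h st" using d0 b2_pos[of h st] by (simp add: i_def pos_imp_zdiv_nonneg_iff)
 have dm: "(d div b2 h st) * b2 h st \<le> d" "d < (d div b2 h st + 1) * b2 h st"
  using div_mult_mod_eq[of d "b2 h st"] pos_mod_sign[OF b2_pos(2), of d h st] pos_mod_bound[OF b2_pos(2), of d h st]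
  unfolding distrib_right by linarith+
 have "int i < int n"
 proof (rule ccontr)
  assume "\<not> int i < int n"
  hence "int n * b2 h st \<le> (d div b2 h st) * b2 h st" unfolding i1 using b2_pos[of h st] by (intro mult_right_mono) auto
  thus False using dm dn by linarith
 qed
 hence "i < card (bigs j r e)" by (simp add: n_def)
 from rank_exists[OF bigs_fin this] obtain T where T: "T \<in> bigs j r e" "card {f \<in> bigs j r e. f < T} = i" by blast
 have "{f \<in> bigs j r e. f < T} = bigs j r (T - 1)" using T(1) by (auto simp: bigs_def)
 hence ci: "int (card (bigs j r (T - 1))) = d div b2 h st" using T(2) i1 by simp
 have tb: "train T (Suc j)" "r < T" "T \<le> e" using T(1) by (auto simp: bigs_def)
 have "\<not> alive t f j" if fr: "r < f" "f < T" for f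
 proof -
  consider "f \<le> e0" | "e0 < f \<and> f < e" using fr tb by linarith
  thus ?thesis using r(5) fr clean by cases auto
 qed
 hence "charged t j (b2 h st) (X - Y) z T"
  unfolding charged_def using r tb e ci dm by (intro exI[of _ r]) (auto simp: d_def)
 thus ?thesis using tb r(1) e(4) by (intro exI[of _ T]) auto
qed

text \<open>The condition at time \<open>s - st\<close> says that block \<open>i\<close> has been
  leading for \<open>st\<close> steps, so that the size of the train has been constant long enough
  for its contents to get in order.\<close>

definition good :: "nat => nat => nat => nat => int => bool" where
 "good j h st t z \<longleftrightarrow> (\<exists>s e i. src t z = Some (s, pos s e i) \<and> alive s e i \<and> \<not> alive s e (Suc i) \<and> j \<le> i \<and> i < h
   \<and> st \<le> s \<and> \<not> alive (s - st) e (Suc i))"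

text \<open>Either the train at the end of the path is already reduced to at most \<open>j\<close>
  blocks, or it was in contact with another one within the last \<open>st\<close> steps. In both
  cases the position of \<open>z\<close> is bounded by the potential of a long train,
  \<open>e\<close> or the touched \<open>e'\<close>, and \<open>charged_ex\<close> applies.\<close>

lemma bad_charged:
 assumes reg: "\<And>f. train f (Suc j) ==> Y < f ==> f \<le> X ==> \<not> train f h"
  and room: "Y < - (b2 h st * (int (card (bigs j Y X)) + 1))"
  and z0: "0 \<le> z" and pth: "path t z u" "u < t" and s: "s = t - Suc u" and y: "y = z + int u"
  and e: "train e (Suc j)" "Y < e" "e \<le> X" and a: "alive s e i" "pos s e i \<le> y + 1" "y \<le> pos s e i + L"
  and bad: "\<not> alive s e j \<or> (\<exists>s0 i0 e'. s0 \<le> s \<and> s - s0 \<le> st \<and> touches s0 e i0 e' \<and> j \<le> i0 \<and> (i0 = j \<or> 24 * 2 ^ Suc j < real s0))"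
 shows "\<exists>T. train T (Suc j) \<and> Y < T \<and> T \<le> X \<and> charged t j (b2 h st) (X - Y) z T"
proof -
 have st: "s < t" "t - u = Suc s" using pth s by auto
 have tr: "train e i" using alive_train[OF a(1)] .
 have zr: "pos t r 0 \<le> z" if "r < e" "alive t r 0" for r
 proof -
  have ar: "alive s r 0" "alive (Suc s) r 0" using alive_antimono[OF that(2)] st by auto
  have "r < ini e i" using tail_left[OF _ _ that(1) tr] train_occ[OF alive_train[OF that(2)]] by blast
  hence "pos s r 0 + L \<le> pos s e i" using wl_sep[of r "ini e i" s] ar a by (auto simp: alive_def pos_def)
  hence "pos (Suc s) r 0 \<le> y" using wl_antimono[of s "Suc s" r] a L40 by (auto simp: pos_def)
  hence "wl (t - u) r \<le> z + int u" using y st by (simp add: pos_def)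
  hence "wl t r + L \<le> z" using path_left[OF pth(1), of r] that by (auto simp: alive_def)
  thus ?thesis using L40 by (simp add: pos_def)
 qed
 have zy: "(of_int z :: real) = of_int y - (real t - real s - 1)" using y s pth by (simp add: of_nat_diff)
 \<comment> \<open>Letters move at speed 1, at least the speed \<open>1 / 2 ^ Suc j\<close> built
   into \<open>Phi\<close>, so the potential of a letter only decreases on its way to
   \<open>z\<close>.\<close>
 have ts: "real t / 2 ^ Suc j - real s0 / 2 ^ Suc j \<le> real t - real s0" if "s0 \<le> t" for s0
 proof -
  have "1 \<le> (2::real) ^ Suc j" by (rule one_le_power) simp
  hence "(real t - real s0) / 2 ^ Suc j \<le> (real t - real s0) / 1" using that by (intro divide_left_mono) auto
  thus ?thesis by (simp add: diff_divide_distrib)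
 qed
 have sp: "(of_int (pos s e 0) :: real) \<ge> of_int (pos s e i)"
  using alive_span[OF a(1)] L40 by (smt (verit) mult_nonneg_nonneg of_int_le_iff of_nat_0_le_iff)
 have yr: "(of_int y :: real) \<le> of_int (pos s e 0) + of_int L" using a(3) sp by linarith
 show ?thesis
 proof (cases "alive s e j")
  case False
  define \<theta> where "\<theta> = dth t e j"
  have tj: "train e j" using train_mono[OF e(1)] by simp
  have al: "alive \<theta> e j" unfolding \<theta>_def by (rule dth_alive[OF tj])
  have le: "Suc \<theta> \<le> s" using False alive_antimono[OF al, of s] by force
  have n: "\<not> alive (Suc \<theta>) e (Suc j)" using dth_end[of t e j] alive_mono[of _ _ "Suc j" j] le st by (auto simp: \<theta>_def)
  have jh: "j < h" using reg[OF e] tj train_mono by (meson not_le)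
  have "hN e 0 (Suc \<theta>) (s - Suc \<theta>) \<ge> real (s - Suc \<theta>) / 2 ^ Suc j - 8"
   by (rule lower_disp) (use alive_mono[OF a(1), of 0] le n in auto)
  moreover have "real (s - Suc \<theta>) / 2 ^ Suc j = real s / 2 ^ Suc j - real \<theta> / 2 ^ Suc j - 1 / 2 ^ Suc j"
   using le by (simp add: of_nat_diff diff_divide_distrib add_divide_distrib)
  moreover have "(1::real) / 2 ^ Suc j \<le> 1" using one_le_power[of "2::real" "Suc j"] by simp
  moreover have "(of_int (pos \<theta> e 0) :: real) \<ge> of_int (pos (Suc \<theta>) e 0)" using pos_Suc[of \<theta> e 0] by simp
  moreover have "of_int (b1 h) = real h * (of_int L + 5) + of_int L + 12" by (simp add: b1_def)
  moreover have "real h * (of_int L + 5) \<ge> real h * (of_int L + 1)" by (intro mult_left_mono) auto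
  ultimately have "of_int y \<le> Phi t e j - real s / 2 ^ Suc j + of_int (b1 h)"
   using span_real[OF al jh] disp_eq[OF le, of e 0] yr unfolding Phi_def \<theta>_def[symmetric] by linarith
  hence zP: "of_int z \<le> Phi t e j - real t / 2 ^ Suc j + (of_int (b1 h) + 1)"
   using zy ts[of s] st by linarith
  have "\<not> alive t e j" using False alive_antimono st by (meson less_imp_le)
  thus ?thesis using zP charged_ex[OF reg e(1,2) order_refl e(3,1) _ _ room z0, of t] zr by auto
 next
  case True
  then obtain s0 i0 e' where s0: "s0 \<le> s" "s - s0 \<le> st" "touches s0 e i0 e'" "j \<le> i0" "i0 = j \<or> 24 * 2 ^ Suc j < real s0"
   using bad by blast
  have a0: "alive s0 e i0" using s0(3) by (auto simp: touches_def)
  have i0h: "i0 < h" using reg[OF e] alive_train[OF a0] train_mono by (meson not_le)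
  have pz: "(of_int z :: real) \<le> of_int (pos s0 e i0) + real h * (of_int L + 1) - 1 + of_int L - (real t - real s - 1)"
  proof -
   have "pos s e 0 \<le> pos s0 e 0" using wl_antimono[OF s0(1)] by (simp add: pos_def)
   hence "(of_int (pos s e 0) :: real) \<le> of_int (pos s0 e 0)" by simp
   thus ?thesis using span_real[OF a0 i0h] yr zy by linarith
  qed
  have s0r: "real s - real s0 \<le> real st" "0 \<le> real s - real s0" "0 < real t - real s" using s0 st by (auto simp: of_nat_diff)
  have e'Y: "Y < e'"
  proof -
   have "pos s0 e i0 - L - 3 \<le> pos s0 e' 0" using s0(3) by (auto simp: touches_def)
   hence "pos s0 e i0 - L - 3 \<le> e'" using wl_antimono[of 0 s0 e'] by (simp add: pos_def)
   hence "(of_int e' :: real) \<ge> of_int (pos s0 e i0) - of_int L - 3" by linarith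
   moreover have "of_int (b2 h st) \<ge> 2 * (real h * (of_int L + 1)) + 2 * of_int L + 26"
    by (simp add: b2_def b1_def algebra_simps)
   moreover have "0 \<le> real h * (of_int L + 1)" using L40 by simp
   moreover have "(of_int z :: real) \<ge> 0" using z0 by simp
   ultimately have "(of_int e' :: real) > - of_int (b2 h st)" using pz s0r by linarith
   moreover have "b2 h st * 1 \<le> b2 h st * (int (card (bigs j Y X)) + 1)" using b2_pos[of h st] by (intro mult_left_mono) auto
   ultimately show ?thesis using room by linarith
  qed
  have el: "e' < e" using touches_left[OF s0(3)] ini_le[OF alive_train[OF a0]] L40 by (smt (verit) mult_nonneg_nonneg of_nat_0_le_iff)
  have s0t: "s0 \<le> t" using s0 st by simp
  note nx = touch_next[OF s0(3) s0t e(1) s0(4,5) reg[of e']]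
  have nx': "train e' (Suc j)" "Phi t e' j \<ge> of_int (pos s0 e i0) + real s0 / 2 ^ Suc j - of_int (b1 h)"
    "\<And>f. e' < f ==> f < e ==> \<not> alive t f j"
   using nx e'Y el e(3) alive_mono[of t _ j 0] by force+
  have "real t / 2 ^ Suc j - real s0 / 2 ^ Suc j \<le> (real t - real s) + real st"
   using ts[OF s0t] s0r by linarith
  moreover have "of_int (b1 h) = real h * (of_int L + 5) + of_int L + 12" by (simp add: b1_def)
  moreover have "real h * (of_int L + 5) \<ge> real h * (of_int L + 1)" by (intro mult_left_mono) auto
  ultimately have "of_int z \<le> Phi t e' j - real t / 2 ^ Suc j + (2 * of_int (b1 h) + real st + 1)"
   using pz nx'(2) by linarith
  thus ?thesis using charged_ex[OF reg nx'(1) e'Y _ e(3,1) nx'(3) _ room z0] zr el by auto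
 qed
qed

lemma src_em: "src t z = Some (s, y) ==> s < t \<and> em (bt s) y \<and> y = z + int (t - s)"
proof (induction t arbitrary: z)
 case (Suc t)
 show ?case
 proof (cases "em (bt t) (z + 1)")
  case True thus ?thesis using Suc.prems by auto
 next
  case False
  hence "src t (z + 1) = Some (s, y)" using Suc.prems by (simp split: if_splits)
  from Suc.IH[OF this] show ?thesis by (intro conjI; linarith | blast)
 qed
qed simp

lemma ini_le_0: "train e i ==> ini e i \<le> e"
proof -
 assume "train e i"
 hence "ini e i + int i * L \<le> e" by (rule ini_le)
 moreover have "0 \<le> int i * L" using L40 by simp
 ultimately show ?thesis by linarith
qed

lemma pos_le_0: "alive s e i ==> pos s e i \<le> pos s e 0"
proof -
 assume "alive s e i"
 hence "pos s e i + int i * L \<le> pos s e 0" using alive_span by blast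
 moreover have "0 \<le> int i * L" using L40 by simp
 ultimately show ?thesis by linarith
qed

lemma em_stays: assumes "em (bt v) y" shows "occ (bt (Suc v)) y"
proof -
 have "surv (bt v) y \<and> mv (bt v) y = y" using assms by (simp add: em_def mv_def)
 thus ?thesis unfolding btS occ_step_iff[OF sept] by blast
qed

text \<open>The letter directly in front of a leader is the last one it emitted: each hop of the
  leader keeps pace with the letter, so only hops lie in between.\<close>

lemma src_lead:
 assumes "al v p" "wl v p = y + 1" "lead (bt v) (y + 1)" "\<not> cov (bt v) y" "src v y = Some (s, l)"
 shows "s < v \<and> wl s p = l \<and> (\<forall>w. s < w \<and> w < v --> hop (bt w) (wl w p))"
 using assms
proof (induction v arbitrary: y)
 case (Suc w)
 have a: "al w p" "\<not> near (bt w) (wl w p)" using Suc.prems by auto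
 hence s: "surv (bt w) (wl w p)" using al_occ by (simp add: surv_def)
 show ?case
 proof (cases "hop (bt w) (wl w p)")
  case False
  hence y: "wl w p = y + 1" using Suc.prems by (simp add: mv_def)
  have "lead (bt w) (y + 1)"
  proof (rule ccontr)
   assume n: "\<not> lead (bt w) (y + 1)"
   hence "\<not> em (bt w) (y + 1)" by (simp add: em_def)
   moreover have "cov (bt w) (y + 1)" using cov_occ[OF al_occ[OF a(1)], of "y + 1"] y L40 by auto
   ultimately show False using Suc.prems(5) by simp
  qed
  hence "em (bt w) (y + 1)" using s False y by (simp add: em_def)
  thus ?thesis using Suc.prems(5) y by auto
 next
  case True
  hence y: "wl w p = y + 2" using Suc.prems by (simp add: mv_def)
  have ne: "\<not> em (bt w) (y + 1)"
  proof
   assume "em (bt w) (y + 1)"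
   hence "occ (bt w) (y + 1)" by (simp add: em_def surv_def)
   thus False using sep_close[OF sept al_occ[OF a(1)], of "y + 1"] y L40 by auto
  qed
  hence nc: "\<not> cov (bt w) (y + 1)" and sr: "src w (y + 1) = Some (s, l)" using Suc.prems(5) by (auto split: if_splits)
  have "lead (bt w) (y + 2)"
  proof (rule ccontr)
   assume "\<not> lead (bt w) (y + 2)"
   hence "occ (bt w) (y + 2 - L - 1)" using True y by (simp add: hop_def)
   hence "cov (bt w) (y + 1)" unfolding cov_def
    using al_occ[OF a(1), unfolded y] L40 by (intro exI[of _ "y + 2 - L - 1"]) (simp add: add.commute)
   thus False using nc by blast
  qed
  hence "s < w \<and> wl s p = l \<and> (\<forall>v. s < v \<and> v < w --> hop (bt v) (wl v p))"
   using Suc.IH[of "y + 1", OF a(1) _ _ nc sr] y by (simp add: add.assoc)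
  thus ?thesis using True by (auto simp: less_Suc_eq)
 qed
qed simp

text \<open>The two letters are followed back in parallel until the right one is emitted; at that
  moment the left one is directly in front of the leader and \<open>src_lead\<close> takes
  over.\<close>

lemma src_next:
 assumes "src t z = Some (s, l)" "src t (z + 1) = Some (s', l')" "\<not> cov (bt t) z" "\<not> cov (bt t) (z + 1)"
  "al s' p" "wl s' p = l'"
 shows "s < s' \<and> wl s p = l \<and> (\<forall>w. s < w \<and> w < s' --> hop (bt w) (wl w p))"
 using assms(1-4)
proof (induction t arbitrary: z)
 case (Suc v)
 have "\<not> em (bt v) (z + 1)"
 proof
  assume "em (bt v) (z + 1)"
  hence "cov (bt (Suc v)) (z + 1)" using em_stays L40 by (intro cov_occ) auto
  thus False using Suc.prems(4) by blast
 qed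
 hence nc: "\<not> cov (bt v) (z + 1)" and sr: "src v (z + 1) = Some (s, l)"
  using Suc.prems(1) by (simp_all split: if_splits)
 have z2: "z + 1 + 1 = z + 2" by simp
 show ?case
 proof (cases "em (bt v) (z + 2)")
  case True
  hence e: "s' = v" "l' = z + 2" using Suc.prems(2) unfolding src.simps z2 by simp_all
  have w: "al v p" "wl v p = z + 1 + 1" "lead (bt v) (z + 1 + 1)"
   using assms(5,6) e True unfolding z2 by (simp_all add: em_def)
  show ?thesis using src_lead[OF w nc sr] e by simp
 next
  case False
  hence "\<not> cov (bt v) (z + 1 + 1)" "src v (z + 1 + 1) = Some (s', l')"
   using Suc.prems(2) unfolding src.simps z2 by (simp_all split: if_splits)
  from Suc.IH[OF sr this(2) nc this(1)] show ?thesis .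
 qed
qed simp

text \<open>Starting from the rightmost cell, \<open>src_next\<close> transfers the emitting block
  from each cell to its left neighbour, so the whole window belongs to one leader.\<close>

lemma good_window:
 assumes "0 < n" and g: "\<And>z. z < n ==> \<not> cov (bt t) (int z) \<and> good j h st t (int z)"
 obtains e i sq where "j \<le> i" "i < h" "st \<le> sq 0" "\<not> alive (sq 0 - st) e (Suc i)" "alive (sq (n - 1)) e i"
  "\<And>z. z < n ==> src t (int z) = Some (sq z, pos (sq z) e i)"
  "\<And>z. Suc z < n ==> sq z < sq (Suc z) \<and> (\<forall>w. sq z < w \<and> w < sq (Suc z) --> hA w e i)"
proof -
 have "\<exists>s y. src t (int z) = Some (s, y)" if "z < n" for z using g[OF that] by (auto simp: good_def)
 then obtain sq y where sq: "\<And>z. z < n ==> src t (int z) = Some (sq z, y z)" by metis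
 define N where "N = n - 1"
 have N: "N < n" "n = Suc N" using assms(1) by (auto simp: N_def)
 obtain e i where ei: "y N = pos (sq N) e i" "alive (sq N) e i" "\<not> alive (sq N) e (Suc i)" "j \<le> i" "i < h"
  using g[OF N(1)] sq[OF N(1)] by (auto simp: good_def)
 have step: "sq z < sq (Suc z) \<and> y z = pos (sq z) e i \<and> (\<forall>w. sq z < w \<and> w < sq (Suc z) --> hA w e i)"
  if "Suc z < n" "y (Suc z) = pos (sq (Suc z)) e i" "alive (sq (Suc z)) e i" for z
 proof -
  have i: "int (Suc z) = int z + 1" by simp
  have a: "src t (int z) = Some (sq z, y z)" "src t (int z + 1) = Some (sq (Suc z), y (Suc z))"
   "\<not> cov (bt t) (int z)" "\<not> cov (bt t) (int z + 1)"
   using sq[of z] sq[OF that(1)] g[of z] g[OF that(1)] that(1) unfolding i by simp_all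
  have b: "al (sq (Suc z)) (ini e i)" "wl (sq (Suc z)) (ini e i) = y (Suc z)"
   using that(2,3) by (simp_all add: alive_def pos_def)
  show ?thesis using src_next[OF a b] by (simp add: pos_def hA_def)
 qed
 have all: "y (N - d) = pos (sq (N - d)) e i \<and> alive (sq (N - d)) e i" if "d \<le> N" for d
  using that
 proof (induction d)
  case 0 thus ?case using ei by simp
 next
  case (Suc d)
  have e: "N - d = Suc (N - Suc d)" using Suc.prems by simp
  have "Suc (N - Suc d) < n" using N Suc.prems by linarith
  from step[OF this] Suc e have "sq (N - Suc d) < sq (N - d)" "y (N - Suc d) = pos (sq (N - Suc d)) e i" by auto
  thus ?case using Suc alive_antimono[of "sq (N - d)" e i "sq (N - Suc d)"] by auto
 qed
 have yz: "y z = pos (sq z) e i \<and> alive (sq z) e i" if "z < n" for z using all[of "N - z"] that N by simp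
 have z0: "\<exists>e' i'. y 0 = pos (sq 0) e' i' \<and> alive (sq 0) e' i' \<and> \<not> alive (sq 0) e' (Suc i') \<and> st \<le> sq 0 \<and> \<not> alive (sq 0 - st) e' (Suc i')"
  using g[of 0] sq[of 0] assms(1) by (auto simp: good_def)
 then obtain e' i' where e': "y 0 = pos (sq 0) e' i'" "alive (sq 0) e' i'" "st \<le> sq 0" "\<not> alive (sq 0 - st) e' (Suc i')" by blast
 have ini: "ini e i = ini e' i'" using wl_inj[of "sq 0" "ini e i" "ini e' i'"] yz[OF assms(1)] e' by (auto simp: alive_def pos_def)
 have lead_e: "\<not> alive (sq 0 - st) e (Suc i)"
 proof
  assume a: "alive (sq 0 - st) e (Suc i)"
  have a1: "alive (sq 0 - st) e i" "alive (sq 0 - st) e' i'" using alive_mono[OF a, of i] alive_antimono[OF e'(2), of "sq 0 - st"] by auto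
  have "pos (sq 0 - st) e i = pos (sq 0 - st) e' i'" using ini by (simp add: pos_def)
  thus False using lead_iff[OF a1(1)] lead_iff[OF a1(2)] a e'(4) by simp
 qed
 show ?thesis
 proof (rule that[of i sq e])
  show "j \<le> i" "i < h" "st \<le> sq 0" using ei e' by blast+
  show "\<not> alive (sq 0 - st) e (Suc i)" by (rule lead_e)
  show "alive (sq (n - 1)) e i" using ei(2) by (simp add: N_def)
  show "src t (int z) = Some (sq z, pos (sq z) e i)" if "z < n" for z using sq[OF that] yz[OF that] by simp
  show "sq z < sq (Suc z) \<and> (\<forall>w. sq z < w \<and> w < sq (Suc z) --> hA w e i)" if "Suc z < n" for z
   using step[OF that] yz[OF that] by blast
 qed
qed

text \<open>\<open>D\<close> is the way of a train of \<open>j + 2\<close> blocks in time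
  \<open>t\<close>. The chain from \<open>q\<close>, which has at least \<open>j + 3\<close> blocks
  and starts beyond \<open>11 / 10 * D\<close>, ends at a survivor still right of the window, so the
  window is not reached from further right. Trains of at most \<open>j + 1\<close> blocks that start
  before \<open>12 / 10 * D\<close> travel about \<open>2 * D\<close> and have passed. What remains
  are trains of \<open>j + 2\<close> to \<open>h\<close> blocks.\<close>

theorem cell_dichotomy:
 fixes D :: real
 assumes D: "D = real t / 2 ^ Suc (Suc j)"
  and q: "train q (Suc (Suc j))" "11 / 10 * D \<le> of_int q" "q \<le> X" and X: "of_int X \<le> 12 / 10 * D"
  and reg: "\<And>f. Y < f ==> f \<le> X ==> \<not> train f h"
  and room: "Y < - (b2 h st * (int (card (bigs j Y X)) + 1))"
  and room2: "of_int (b2 h st * (int (card (bigs j Y X)) + 1)) + real n \<le> D / 20"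
  and z: "0 \<le> z" "z < int n"
 shows "\<not> cov (bt t) z \<and> good j h st t z \<or>
  (\<exists>T. train T (Suc j) \<and> Y < T \<and> T \<le> X \<and> (charged t j (b2 h st) (X - Y) z T \<or>
    alive t T 0 \<and> - (int h * (L + 1)) \<le> z - pos t T 0 \<and> z - pos t T 0 \<le> L))"
proof -
 have reg': "\<And>f. train f (Suc j) ==> Y < f ==> f \<le> X ==> \<not> train f h"
  "\<And>f. train f (Suc (Suc j)) ==> Y < f ==> f \<le> X ==> \<not> train f h" using reg by auto
 have b2D: "real_of_int (b2 h st) \<le> D / 20" "(of_int (b2 h st * (int (card (bigs j Y X)) + 1)) :: real) \<ge> of_int (b2 h st)"
 proof -
  have "b2 h st * 1 \<le> b2 h st * (int (card (bigs j Y X)) + 1)" using b2_pos[of h st] by (intro mult_left_mono) auto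
  thus "(of_int (b2 h st * (int (card (bigs j Y X)) + 1)) :: real) \<ge> of_int (b2 h st)" by (metis mult.right_neutral of_int_le_iff)
  thus "real_of_int (b2 h st) \<le> D / 20" using room2 by linarith
 qed
 have bL: "2 * of_int L + 6 \<le> (of_int (b2 h st) :: real)" "2 * of_int (b1 h) + real st + 2 \<le> (of_int (b2 h st) :: real)"
  using b1_pos[of h] by (auto simp: b2_def)
 have D0: "20 * (2 * of_int L + 6) \<le> D" using b2D(1) bL(1) by argo
 have L40r: "40 \<le> (of_int L :: real)" using L40 by simp
 have Y0: "Y < - b2 h st"
 proof -
  have "b2 h st * 1 \<le> b2 h st * (int (card (bigs j Y X)) + 1)" using b2_pos[of h st] by (intro mult_left_mono) auto
  thus ?thesis using room by linarith
 qed
 have YL: "Y < - L - 1" using Y0 b2_pos(1)[of h st] b1_pos[of h] L40 by linarith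
 have Dp: "1720 \<le> D" using D0 L40r by argo
 have "0 < (of_int q :: real)" using q(2) Dp by argo
 hence qpos: "0 < q" by simp
 have tD: "real t = 4 * 2 ^ j * D" using D by simp
 have p1: "1 \<le> (2::real) ^ j" by simp
 have tD4: "4 * D \<le> real t"
 proof -
  have "1 * (4 * D) \<le> 2 ^ j * (4 * D)" using p1 D0 L40r by (intro mult_right_mono) auto
  thus ?thesis using tD by simp
 qed
 have "alive 0 q 0" using train_mono[OF q(1), of 0] alive_0 by simp
 from touch_Phi[OF this, of t "Suc j" h] train_mono[OF q(1), of "Suc j"] reg q(3) Y0 qpos b2_pos(2)[of h st]
 have Pq: "Phi t q (Suc j) \<ge> of_int q - of_int (b1 h)" using L40r by (auto simp: pos_def)
 have cq: "card (bigs (Suc j) Y q) \<le> card (bigs j Y X)"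
  using q(3) by (intro card_mono[OF bigs_fin]) (auto simp: bigs_def intro: train_mono)
 have b1p: "0 < (of_int (b1 h) :: real)" using b1_pos by simp
 have m: "of_int (b1 h) * real (card (bigs (Suc j) Y q)) + of_int (b1 h) \<le> D / 20"
 proof -
  have "of_int (b1 h) * (real (card (bigs (Suc j) Y q)) + 1) \<le> of_int (b2 h st) * (real (card (bigs j Y X)) + 1)"
   using cq b1p bL by (intro mult_mono) auto
  thus ?thesis using room2 by (simp add: algebra_simps)
 qed
 have "of_int Y < Phi t q (Suc j) - real t / 2 ^ Suc (Suc j) - of_int (b1 h) * real (card (bigs (Suc j) Y q))"
 proof -
  have "(of_int Y :: real) < 0" using Y0 b2_pos(2)[of h st] by simp
  thus ?thesis unfolding D[symmetric] using Pq q(2) m Dp by argo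
 qed
 from chain[OF q(1) _ q(3) reg'(2) this] Y0 qpos b2_pos(2)[of h st]
 obtain r where r: "r \<le> q" "train r (Suc (Suc j))" "alive t r (Suc j)"
  "Phi t r (Suc j) \<ge> Phi t q (Suc j) - of_int (b1 h) * real (card (bigs (Suc j) r q))" "Y < r" by auto
 define \<rho> where "\<rho> = ini r (Suc j)"
 have "card (bigs (Suc j) r q) \<le> card (bigs (Suc j) Y q)" using r(5) by (intro bigs_mono) auto
 hence "of_int (b1 h) * real (card (bigs (Suc j) r q)) \<le> of_int (b1 h) * real (card (bigs (Suc j) Y q))"
  using b1p by (intro mult_left_mono) auto
 hence "of_int (pos t r (Suc j)) \<ge> D / 20" using r(4) Pq Phi_heavy[OF r(3)] m q(2) D D0 L40r by linarith
 moreover have "(of_int z :: real) < D / 20"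
 proof -
  have "(of_int z :: real) < real n" using z(2) by (metis of_int_less_iff of_int_of_nat_eq)
  moreover have "(0::real) < of_int (b2 h st)" using b2_pos by simp
  ultimately show ?thesis using room2 b2D(2) by linarith
 qed
 ultimately have zr: "z < wl t \<rho>" by (simp add: pos_def \<rho>_def)
 have al\<rho>: "al t \<rho>" using r(3) by (auto simp: alive_def \<rho>_def)
 have \<rho>r: "\<rho> \<le> r" "\<rho> \<le> X" using ini_le_0[OF train_mono[OF r(2), of "Suc j"]] r(1) q(3) unfolding \<rho>_def by simp_all
 have owner: "\<exists>e i. alive s e i \<and> pos s e i = p \<and> e \<le> X" if op: "occ (bt s) p" and "p \<le> wl s \<rho>" "s \<le> t" for s p
 proof -
  obtain p0 where p0: "al s p0" "wl s p0 = p" using ancestor[OF op] by blast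
  have "p0 \<le> \<rho>" using wl_less_iff[of s \<rho> p0] p0 al_antimono[OF al\<rho> that(3)] that(2) by linarith
  hence "p0 \<le> r" using \<rho>r by simp
  then obtain e i where "train e i" "ini e i = p0" "e \<le> r"
   using find_train[of p0 r] train_occ[OF r(2)] al_antimono[OF p0(1), of 0] by auto
  thus ?thesis using p0 r(1) q(3) by (intro exI[of _ e] exI[of _ i]) (auto simp: alive_def pos_def)
 qed
 have Yb: "Y < e" if "alive s e i" "- L - 1 \<le> pos s e i" for s e i
  using that(2) ini_le_0[OF alive_train[OF that(1)]] wl_antimono[of 0 s "ini e i"] YL
  unfolding pos_def by simp
 \<comment> \<open>A train of at most \<open>j + 1\<close> blocks covers almost \<open>2 * D\<close>
   by time \<open>s\<close>, more than the distance \<open>12 / 10 * D\<close> from \<open>X\<close>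
   to the window.\<close>
 have notsmall: "train e (Suc j)" if "alive s e i" "- L - 1 \<le> pos s e i" "e \<le> X" "s \<le> t" "real t - 12/10 * D - 1 \<le> real s" for s e i
 proof (rule ccontr)
  assume n: "\<not> train e (Suc j)"
  have a: "alive (0 + s) e 0" using alive_mono[OF that(1), of 0] by simp
  have "hN e 0 0 s \<ge> real s / 2 ^ Suc j - 8" by (rule lower_disp[OF a]) (use n alive_0 in simp)
  moreover have "pos s e i \<le> pos s e 0" by (rule pos_le_0[OF that(1)])
  hence "- L - 1 \<le> pos s e 0" using that(2) by linarith
  hence "(of_int (- L - 1) :: real) \<le> of_int (pos s e 0)" by (simp only: of_int_le_iff)
  moreover have "hN e 0 0 s = of_int e - of_int (pos s e 0)" by (simp add: hN_pos pos_def)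
  moreover have "(of_int e :: real) \<le> of_int X" using that(3) by simp
  moreover have "real s / 2 ^ Suc j \<ge> (real t - 12/10 * D - 1) / 2 ^ Suc j" using that(5) by (simp add: divide_right_mono)
  moreover have "(real t - 12/10 * D - 1) / 2 ^ Suc j = 2 * D - (12/10 * D + 1) / 2 ^ Suc j"
   unfolding D by (simp add: diff_divide_distrib add_divide_distrib)
  moreover have "(12/10 * D + 1) / 2 ^ Suc j \<le> (12/10 * D + 1) / 2 ^ 1"
   using D0 L40r by (intro divide_left_mono power_increasing) auto
  moreover have False if "a1 - 8 \<le> H" "- of_int L - 1 \<le> p" "H = e' - p" "e' \<le> of_int X" "r \<le> a1" "r = 2 * D - a2"
   "a2 \<le> (12/10 * D + 1) / 2" for a1 H p e' r a2 :: real
   using that X D0 L40r by argo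
  ultimately show False unfolding power_one_right of_int_diff of_int_minus of_int_1 by blast
 qed
 show ?thesis
 proof (cases "cov (bt t) z")
  case True
  then obtain p where p: "occ (bt t) p" "p \<le> z" "z \<le> p + L" by (auto simp: cov_def)
  obtain e i where e: "alive t e i" "pos t e i = p" "e \<le> X" using owner[OF p(1)] zr p(2) by auto
  have pL: "- L - 1 \<le> pos t e i" using p z e by linarith
  have big: "train e (Suc j)" using notsmall[OF e(1) pL e(3)] D0 L40r by auto
  have ih: "i < h" using reg[OF Yb[OF e(1) pL] e(3)] alive_train[OF e(1)] train_mono by (meson not_le)
  have "(of_int (pos t e 0) :: real) \<le> of_int (pos t e i) + real h * (of_int L + 1) - 1" by (rule span_real[OF e(1) ih])
  hence "(of_int (pos t e 0) :: real) \<le> of_int (pos t e i + int h * (L + 1) - 1)" by simp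
  hence "pos t e 0 \<le> pos t e i + int h * (L + 1) - 1" by (simp only: of_int_le_iff)
  moreover have "pos t e i \<le> pos t e 0" by (rule pos_le_0[OF e(1)])
  ultimately have "- (int h * (L + 1)) \<le> z - pos t e 0 \<and> z - pos t e 0 \<le> L" using p e(2) by linarith
  thus ?thesis using big Yb[OF e(1) pL] e alive_mono[OF e(1), of 0] by blast
 next
  case False
  have "(of_int \<rho> :: real) \<le> of_int X" using \<rho>r by simp
  hence \<rho>D: "of_int \<rho> \<le> 12/10 * D" using X by linarith
  have "real_of_int (\<rho> - z) \<le> real_of_int (int t)" using \<rho>D tD4 D0 L40r z(1) by simp
  hence rt: "\<rho> - z \<le> int t" by (simp only: of_int_le_iff)
  obtain u where u: "path t z u" "u < t" "cov (bt (t - Suc u)) (z + int u + 1)" "z + int u < \<rho>"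
   by (rule path_ends[OF al\<rho> zr False rt])
  define s where "s = t - Suc u"
  define y where "y = z + int u"
  have st: "s < t" "t - u = Suc s" "Suc s \<le> t" using u(2) by (auto simp: s_def)
  have c: "cov (bt s) (y + 1)" "\<not> cov (bt (Suc s)) y" using u(1,3) st by (auto simp: s_def y_def path_def)
  have yr: "y < wl (Suc s) \<rho>" using path_right[OF u(1) al\<rho> zr] st by (simp add: y_def)
  hence yr2: "y + 1 \<le> wl s \<rho>" using wl_antimono[of s "Suc s" \<rho>] by auto
  have sbig: "real t - 12/10 * D - 1 \<le> real s"
  proof -
   have "int u < \<rho>" using u(4) z(1) by linarith
   hence "real_of_int (int u) < of_int \<rho>" by (simp only: of_int_less_iff)
   thus ?thesis using \<rho>D u(2) by (simp add: s_def of_nat_diff)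
  qed
  have stD: "real st + 2 \<le> D / 20" using b2D bL b1p by linarith
  \<comment> \<open>The path is much shorter than \<open>t\<close>, so even \<open>st\<close> steps
    before its end the time is large enough for \<open>touches_late_big\<close>.\<close>
  have late: "24 * 2 ^ Suc j < real s0" if "s \<le> s0 + st" for s0
  proof -
   have "real s \<le> real s0 + real st" using that by (metis of_nat_add of_nat_le_iff)
   hence a: "real t - 13/10 * D \<le> real s0" using sbig stD by linarith
   have "2 ^ j * 13 \<le> 2 ^ j * D" using D0 L40r by (intro mult_left_mono) auto
   moreover have "D * 1 \<le> D * 2 ^ j" using p1 D0 L40r by (intro mult_left_mono) auto
   moreover have "2 ^ j * 100 \<le> 2 ^ j * D" using D0 L40r by (intro mult_left_mono) auto
   moreover have "real t = 4 * (2 ^ j * D)" "D * 2 ^ j = 2 ^ j * D" "24 * 2 ^ Suc j = 48 * (2::real) ^ j" using tD by simp_all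
   ultimately show ?thesis using a p1 by linarith
  qed
  have y0: "0 \<le> y" using z by (simp add: y_def)
  obtain p where p: "occ (bt s) p" "em (bt s) p \<and> p = y + 1 \<or> near (bt s) p \<and> p - 1 \<le> y \<and> y < p + L"
   using open_cases[OF sept, of s y] c by (auto simp: btS em_def surv_def)
  have py: "p \<le> y + 1" "y \<le> p + L" using p(2) L40 by auto
  obtain e i where e: "alive s e i" "pos s e i = p" "e \<le> X" using owner[OF p(1)] yr2 py st by auto
  have pL: "- L - 1 \<le> pos s e i" using py y0 e by linarith
  have big: "train e (Suc j)" using notsmall[OF e(1) pL e(3) _ sbig] st by simp
  have eY: "Y < e" by (rule Yb[OF e(1) pL])
  have ih: "i < h" using reg[OF eY e(3)] alive_train[OF e(1)] train_mono by (meson not_le)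
  have ld: "\<not> alive s e (Suc i)" using p(2) lead_iff[OF e(1)] e(2) by (auto simp: em_def near_def)
  have py': "pos s e i \<le> y + 1" "y \<le> pos s e i + L" using py e(2) by auto
  have bc: "\<exists>T. train T (Suc j) \<and> Y < T \<and> T \<le> X \<and> charged t j (b2 h st) (X - Y) z T"
   if "\<not> alive s e j \<or> (\<exists>s0 i0 e'. s0 \<le> s \<and> s - s0 \<le> st \<and> touches s0 e i0 e' \<and> j \<le> i0 \<and> (i0 = j \<or> 24 * 2 ^ Suc j < real s0))"
   by (rule bad_charged[OF _ room z(1) u(1,2) s_def y_def big eY e(3,1) py' that]) (rule reg'(1))
  have bc': "\<exists>T. train T (Suc j) \<and> Y < T \<and> T \<le> X \<and> charged t j (b2 h st) (X - Y) z T"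
   if "s0 \<le> s" "s - s0 \<le> st" "touches s0 e i0 e'" "j \<le> i0" for s0 i0 e'
   using that late[of s0] by (intro bc disjI2 exI[of _ s0] exI[of _ i0] exI[of _ e']) simp
  show ?thesis
  proof (cases "alive s e j")
   case False
   thus ?thesis using bc by blast
  next
   case aj: True
   have ji: "j \<le> i" using ld aj alive_mono[of s e j "Suc i"] by force
   show ?thesis
   proof (cases "near (bt s) p")
    case True
    then obtain e' where "touches s e i e'" using near_touches[OF e(1)] e(2) by auto
    from bc'[OF _ _ this ji] show ?thesis by auto
   next
    case False
    hence emp: "em (bt s) p" "p = y + 1" using p(2) by auto
    show ?thesis
    proof (cases "alive (s - st) e (Suc i)")
     case True
     \<comment> \<open>Block \<open>i\<close> was not yet leading at \<open>s - st\<close>, hence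
       block \<open>i + 1\<close> was eroded in between; this contact is recent enough to be
       charged.\<close>
     define s1 where "s1 = s - st"
     have s1: "s = s1 + (s - s1)" "s - s1 \<le> st" by (auto simp: s1_def)
     obtain a where a: "a < s - s1" "alive (s1 + a) e (Suc i)" "near (bt (s1 + a)) (pos (s1 + a) e (Suc i))"
      using removal[of s1 e "Suc i" "s - s1"] True ld s1(1) unfolding s1_def[symmetric] by metis
     obtain e' where e': "touches (s1 + a) e (Suc i) e'" using near_touches[OF a(2,3)] by blast
     have "s1 + a \<le> s" "s - (s1 + a) \<le> st" using a(1) s1 by auto
     from bc'[OF this e'] ji show ?thesis by auto
    next
     case nst: False
     have "st \<le> s"
     proof -
      have "real st \<le> real s" using sbig stD tD4 D0 L40r by linarith
      thus ?thesis by simp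
     qed
     moreover have "src t z = Some (s, pos s e i)"
      using src_path[OF u(1)] st emp e(2) by (simp add: y_def)
     ultimately have "good j h st t z" unfolding good_def using e ld ji ih nst by blast
     thus ?thesis using \<open>\<not> cov (bt t) z\<close> by blast
    qed
   qed
  qed
 qed
qed

end

section \<open>Cellular automata moving coded blocks\<close>

definition occurs :: "'b list => (int => 'b) => int => bool" where
 "occurs v x p \<longleftrightarrow> (\<forall>i<length v. x (p + int i) = v ! i)"

lemma occursD: "occurs v x p ==> i < length v ==> x (p + int i) = v ! i"
 by (simp add: occurs_def)

lemma occurs_inj: "occurs v x p ==> occurs w x p ==> length v = length w ==> v = w"
 by (auto simp: occurs_def intro: nth_equalityI)

lemma find_no: "(\<And>d. d < n ==> \<not> P d) ==> find P [0..<n] = None"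
 by (simp add: find_None_iff)

lemma find_unique:
 assumes "d < n" "P d" "\<And>d'. d' < n ==> P d' ==> d' = d" shows "find P [0..<n] = Some d"
proof (cases "find P [0..<n]")
 case None
 hence "\<not> P d" using assms(1) unfolding find_None_iff by simp
 thus ?thesis using assms(2) by blast
next
 case (Some d')
 then obtain i where "i < n" "P ([0..<n] ! i)" "d' = [0..<n] ! i" unfolding find_Some_iff by auto
 hence "P d'" "d' < n" by simp_all
 thus ?thesis using assms(3) Some by simp
qed

text \<open>The shape of the words, with \<open>b\<close> at positions 0 and \<open>r - 1\<close>
  and only \<open>a\<close> on the second half, excludes overlaps. The common suffix
  \<open>m\<close> ends in \<open>a\<close>, the letter that \<open>flt\<close> may replace.
  \<open>filler\<close> has the same shape without being a code word; it overwrites erased blocks,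
  so that their remains are not read as blocks.\<close>

locale coding =
 fixes S :: "'s set" and code :: "'s => 'b list" and filler m :: "'b list" and a b :: 'b and r :: nat
  and cb dg :: "'s => bool" and upd :: "'s option => 's => 's option => bool => 's" and out :: "'s => 'b"
 assumes r20: "20 \<le> r" and ab: "a \<noteq> b"
  and wf: "v \<in> insert filler (code ` S) ==> length v = 2 * r \<and> v ! 0 = b \<and> v ! (r - 1) = b \<and> (\<forall>i. r \<le> i \<and> i < 2 * r --> v ! i = a)"
  and inj: "inj_on code S" and filler: "filler \<notin> code ` S"
  and m: "s \<in> S ==> suffix m (code s)" "m \<noteq> []" "last m = a"
  and upd_S: "s \<in> S ==> (\<And>l'. l = Some l' ==> l' \<in> S) ==> (\<And>r'. rr = Some r' ==> r' \<in> S) ==> upd l s rr h \<in> S"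
  and cb_upd': "cb (upd l s rr h) \<longleftrightarrow> dg s \<and> (case rr of None => True | Some s' => cb s')"
  and dg_upd': "dg (upd l s rr h) \<longleftrightarrow> dg s \<noteq> (case rr of None => True | Some s' => cb s')"

sublocale coding \<subseteq> placement "2 * int r" cb dg upd
 using r20 cb_upd' dg_upd' by unfold_locales auto

context coding
begin

definition L :: int where "L = 2 * int r"

definition B :: "(int => 'b) => int => 's option" where
 "B x p = (if \<exists>s\<in>S. occurs (code s) x p then Some (THE s. s \<in> S \<and> occurs (code s) x p) else None)"

text \<open>Every code word ends in \<open>m\<close>; spoiling the last letter of each completed \<open>m\<close> keeps the emitted letters
 from forming a new code word.\<close>

definition flt :: "(int => 'b) => int => 'b => 'b" where
 "flt x z e = (if occurs (butlast m) x (z + 2 - int (length m)) \<and> e = a then b else e)"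

text \<open>In order of priority: a block of the new placement, an emitted letter, the filler over
  an erased block, \<open>b\<close> where the letter to be shifted in belongs to a covered cell, and
  the plain shift. The filler starts at \<open>p - 1\<close> since free letters move left in the
  same step.\<close>

definition F :: "(int => 'b) => int => 'b" where
 "F x z = (let \<beta> = B x in
   case find (\<lambda>d. occ (step \<beta>) (z - int d)) [0..<2 * r] of
    Some d => code (the (step \<beta> (z - int d))) ! d
   | None => if em \<beta> (z + 1) then flt x z (out (the (\<beta> (z + 1)))) else
     (case find (\<lambda>d. occ \<beta> (z + 1 - int d) \<and> near \<beta> (z + 1 - int d)) [0..<2 * r] of
      Some d => filler ! d
     | None => if cov \<beta> (z + 1) then b else x (z + 1)))"

definition Q :: "(int => 'b) => int => bool" where
 "Q x p \<longleftrightarrow> (\<exists>v \<in> insert filler (code ` S). occurs v x p)"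

lemma Q_letters:
 assumes "Q x p" shows "x p = b" "x (p + int r - 1) = b" "\<And>i. int r \<le> i ==> i < L ==> x (p + i) = a"
proof -
 obtain v where v: "v \<in> insert filler (code ` S)" "occurs v x p" using assms by (auto simp: Q_def)
 note w = wf[OF v(1)]
 show "x p = b" using occursD[OF v(2), of 0] w r20 by simp
 show "x (p + int r - 1) = b" using occursD[OF v(2), of "r - 1"] w r20 by (simp add: of_nat_diff algebra_simps)
 show "x (p + i) = a" if "int r \<le> i" "i < L" for i
  using occursD[OF v(2), of "nat i"] w that by (simp add: L_def)
qed

text \<open>If the words overlap, then the position 0 or the position \<open>r - 1\<close> of the
  second, which carries \<open>b\<close>, falls into the run of letters \<open>a\<close> of the
  first.\<close>

lemma Q_sep: assumes "Q x p" "Q x q" "p < q" shows "p + L \<le> q"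
proof (rule ccontr)
 assume "\<not> p + L \<le> q"
 hence d: "q - p < L" by simp
 show False
 proof (cases "int r \<le> q - p")
  case True
  thus ?thesis using Q_letters(3)[OF assms(1), of "q - p"] Q_letters(1)[OF assms(2)] d ab by simp
 next
  case False
  have e: "p + (q - p + int r - 1) = q + int r - 1" by simp
  show ?thesis using Q_letters(3)[OF assms(1), of "q - p + int r - 1"] Q_letters(2)[OF assms(2)] False assms(3) d ab
   unfolding e L_def by auto
 qed
qed

lemma Q_sep2: "Q x p ==> Q x q ==> \<bar>p - q\<bar> < L ==> p = q"
 using Q_sep[of x p q] Q_sep[of x q p] by (cases p q rule: linorder_cases) auto

lemma code_inj: "s \<in> S ==> s' \<in> S ==> occurs (code s) x p ==> occurs (code s') x p ==> s = s'"
 using occurs_inj[of "code s" x p "code s'"] wf inj by (auto dest: inj_onD)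

lemma B_iff: "B x p = Some s \<longleftrightarrow> s \<in> S \<and> occurs (code s) x p"
proof
 assume l: "B x p = Some s"
 then obtain s' where s': "s' \<in> S" "occurs (code s') x p" by (auto simp: B_def split: if_splits)
 have "(THE s. s \<in> S \<and> occurs (code s) x p) = s'" using s' code_inj by (intro the_equality) auto
 thus "s \<in> S \<and> occurs (code s) x p" using l s' by (auto simp: B_def split: if_splits)
next
 assume r: "s \<in> S \<and> occurs (code s) x p"
 have "(THE s. s \<in> S \<and> occurs (code s) x p) = s" using r code_inj by (intro the_equality) auto
 thus "B x p = Some s" using r by (auto simp: B_def)
qed

lemma B_Q: "occ (B x) p ==> Q x p"
 by (auto simp: occ_def B_iff Q_def)

lemma sep_B: "sep (B x)"
 unfolding sep_def using Q_sep B_Q unfolding L_def by blast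

lemma step_S: assumes "step (B x) q = Some s" shows "s \<in> S"
proof -
 have "nst (B x) p \<in> S" if "surv (B x) p" for p
 proof -
  have "B x p = Some (the (B x p))" using that by (simp add: surv_def occ_def)
  hence "the (B x p) \<in> S" using B_iff by blast
  thus ?thesis unfolding nst_def by (intro upd_S) (auto simp: B_iff)
 qed
 thus ?thesis using assms by (auto simp: step_def split: if_splits)
qed

lemma near_mv: "near \<beta> p ==> mv \<beta> p = p"
 by (auto simp: mv_def hop_def near_def)

lemma F_block:
 assumes "step (B x) q = Some s" shows "occurs (code s) (F x) q"
 unfolding occurs_def
proof (intro allI impI)
 fix i assume i: "i < length (code s)"
 have "s \<in> S" using step_S assms by blast
 hence i2: "i < 2 * r" using wf i by auto
 have o: "occ (step (B x)) q" using assms by (simp add: occ_def)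
 have "find (\<lambda>d. occ (step (B x)) (q + int i - int d)) [0..<2 * r] = Some i"
 proof (rule find_unique[OF i2])
  show "occ (step (B x)) (q + int i - int i)" using o by simp
  show "d' = i" if "d' < 2 * r" "occ (step (B x)) (q + int i - int d')" for d'
   using sep_close[OF sep_step[OF sep_B] o that(2)] that(1) i2 by linarith
 qed
 thus "F x (q + int i) = code s ! i" using assms by (simp add: F_def)
qed

lemma near_apart:
 assumes "occ (B x) p" "near (B x) p" "occ (step (B x)) q"
 shows "q + L \<le> p \<or> p + L \<le> q"
proof -
 obtain p' where p': "surv (B x) p'" "mv (B x) p' = q" using assms(3) occ_step_iff[OF sep_B] by blast
 hence o: "occ (B x) p'" "p' \<noteq> p" using assms(2) by (auto simp: surv_def)
 then consider "p' < p" | "p < p'" by linarith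
 thus ?thesis
  using mv_sep[OF sep_B o(1) assms(1)] mv_sep[OF sep_B assms(1) o(1)] near_mv[OF assms(2)] p'(2)
  by cases (auto simp: L_def)
qed

lemma F_filler:
 assumes "occ (B x) p" "near (B x) p" shows "occurs filler (F x) (p - 1)"
 unfolding occurs_def
proof (intro allI impI)
 fix i assume i: "i < length filler"
 hence i2: "i < 2 * r" using wf by auto
 have 1: "find (\<lambda>d. occ (step (B x)) (p - 1 + int i - int d)) [0..<2 * r] = None"
 proof (rule find_no, rule notI)
  fix d assume d: "d < 2 * r" "occ (step (B x)) (p - 1 + int i - int d)"
  consider "p - 1 + int i - int d + L \<le> p" | "p + L \<le> p - 1 + int i - int d" using near_apart[OF assms d(2)] by blast
  thus False
  proof cases
   case 1
   \<comment> \<open>The only overlap left is one cell: a new block at \<open>p - L\<close> against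
     the filler starting at \<open>p - 1\<close>. Such a block would come from \<open>p - L\<close>,
     though \<open>p\<close> leads, or from \<open>p - L + 1\<close>, too close to
     \<open>p\<close>.\<close>
   hence e: "d = 2 * r - 1" "i = 0" using d(1) i2 by (auto simp: L_def)
   hence q: "p - 1 + int i - int d = p - L" using r20 by (auto simp: L_def)
   obtain p' where p': "surv (B x) p'" "mv (B x) p' = p - L" using d(2) unfolding q using occ_step_iff[OF sep_B] by blast
   have "p' = p - L \<or> p' = p - L + 1" using p'(2) by (auto simp: mv_def split: if_splits)
   moreover have "occ (B x) p'" using p'(1) by (simp add: surv_def)
   moreover have "p' \<noteq> p - L + 1" using sepD[OF sep_B \<open>occ (B x) p'\<close> assms(1)] r20 by (auto simp: L_def)
   ultimately show False using assms(2) by (auto simp: near_def lead_def L_def)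
  next
   case 2 thus ?thesis using i2 by (auto simp: L_def)
  qed
 qed
 have e: "p - 1 + int i + 1 = p + int i" by simp
 have ne: "\<not> em (B x) (p + int i)"
 proof
  assume "em (B x) (p + int i)"
  hence s: "occ (B x) (p + int i)" "\<not> near (B x) (p + int i)" by (auto simp: em_def surv_def)
  thus False using sep_close[OF sep_B assms(1) s(1)] i2 assms(2) by auto
 qed
 have 2: "find (\<lambda>d. occ (B x) (p + int i - int d) \<and> near (B x) (p + int i - int d)) [0..<2 * r] = Some i"
 proof (rule find_unique[OF i2])
  show "occ (B x) (p + int i - int i) \<and> near (B x) (p + int i - int i)" using assms by simp
  show "d' = i" if "d' < 2 * r" "occ (B x) (p + int i - int d') \<and> near (B x) (p + int i - int d')" for d'
   using sep_close[OF sep_B assms(1) conjunct1[OF that(2)]] that(1) i2 by linarith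
 qed
 show "F x (p - 1 + int i) = filler ! i" unfolding F_def Let_def e 1 2 using ne by (simp only: option.case if_False)
qed

definition placed :: "(int => 'b) => int => bool" where
 "placed x q \<longleftrightarrow> occ (step (B x)) q \<or> occ (B x) (q + 1) \<and> near (B x) (q + 1)"

lemma placed_Q: "placed x q ==> Q (F x) q"
proof -
 assume "placed x q"
 then consider s where "step (B x) q = Some s" | "occ (B x) (q + 1)" "near (B x) (q + 1)" by (auto simp: placed_def occ_def)
 thus ?thesis
 proof cases
  case 1 thus ?thesis using F_block[OF 1] step_S[OF 1] by (auto simp: Q_def)
 next
  case 2 thus ?thesis using F_filler[OF 2] by (auto simp: Q_def)
 qed
qed

lemma F_free:
 assumes "\<And>d. d < 2 * r ==> \<not> placed x (z - int d)"
 shows "F x z = (if em (B x) (z + 1) then flt x z (out (the (B x (z + 1)))) else if cov (B x) (z + 1) then b else x (z + 1))"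
proof -
 have 1: "find (\<lambda>d. occ (step (B x)) (z - int d)) [0..<2 * r] = None"
  using assms by (intro find_no) (auto simp: placed_def)
 have 2: "find (\<lambda>d. occ (B x) (z + 1 - int d) \<and> near (B x) (z + 1 - int d)) [0..<2 * r] = None"
  using assms by (intro find_no) (auto simp: placed_def algebra_simps)
 show ?thesis unfolding F_def Let_def 1 2 by simp
qed

text \<open>By \<open>open_cases\<close> cell \<open>z + 1\<close> either holds a leader that stays
  or is the first cell behind an erased block, and there the next block of its train starts after
  the step.\<close>

lemma cov_next_placed:
 assumes "cov (B x) (z + 1)" "\<And>d. d < 2 * r ==> \<not> placed x (z - int d)" "\<not> cov (step (B x)) z"
 shows "placed x (z + 1)"
proof -
 have pl: "\<not> placed x q" if "q \<le> z" "z < q + L" for q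
  using assms(2)[of "nat (z - q)"] that by (simp add: L_def)
 consider "em (B x) (z + 1)" | p where "occ (B x) p" "near (B x) p" "p - 1 \<le> z" "z < p + L"
  using open_cases[OF sep_B assms(3,1)] unfolding L_def by blast
 thus ?thesis
 proof cases
  case 1
  hence "surv (B x) (z + 1)" "mv (B x) (z + 1) = z + 1" by (auto simp: em_def mv_def)
  hence "occ (step (B x)) (z + 1)" using occ_step_iff[OF sep_B] by blast
  thus ?thesis by (auto simp: placed_def)
 next
  case 2
  have "\<not> z < p - 1 + L" using pl[of "p - 1"] 2 by (auto simp: placed_def)
  hence z: "z + 1 = p + L" using 2 by simp
  obtain p' where p': "occ (B x) p'" "p' \<le> z + 1" "z + 1 < p' + L \<or> z + 1 = p' + L \<and> occ (B x) (p' + L + 1)"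
   using assms(1) unfolding cov_def L_def by blast
  have "\<not> tail (B x) p"
  proof (cases "p' = p")
   case True
   hence "occ (B x) (p + L + 1)" using p'(3) z by auto
   thus ?thesis unfolding tail_def L_def by simp
  next
   case False
   have "\<not> p' < p" using sepD[OF sep_B p'(1) 2(1)] p'(3) z r20 by (auto simp: L_def)
   hence "p + L \<le> p'" using sepD[OF sep_B 2(1) p'(1)] False unfolding L_def by linarith
   hence "p' = p + L" using p'(2) z by simp
   thus ?thesis using p'(1) unfolding tail_def L_def by simp
  qed
  note l = link[OF sep_B 2(1) this]
  have "\<not> hop (B x) p" using 2(2) by (auto simp: hop_def near_def)
  hence "mv (B x) (rp (B x) p) = z + 1" using l(6) near_mv[OF 2(2)] unfolding z L_def by simp
  hence "occ (step (B x)) (z + 1)" using l(4) occ_step_iff[OF sep_B] by blast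
  thus ?thesis by (auto simp: placed_def)
 qed
qed

text \<open>Inside an occurrence that was not placed all letters but the last are copied. The last
  one is an \<open>a\<close>: if it is copied too, the code word stood in \<open>x\<close> one cell
  further right and its cells were covered; if it is emitted, it follows \<open>butlast m\<close>,
  and \<open>flt\<close> would have turned it into \<open>b\<close>.\<close>

lemma no_creation:
 assumes s: "s \<in> S" and o: "occurs (code s) (F x) q" shows "placed x q"
proof (rule ccontr)
 assume np: "\<not> placed x q"
 have Qq: "Q (F x) q" using assms by (auto simp: Q_def)
 have far: "\<not> placed x p" if "\<bar>p - q\<bar> < L" for p
 proof
  assume "placed x p"
  hence "p = q" using Q_sep2[OF placed_Q Qq that] by blast
  thus False using np \<open>placed x p\<close> by simp
 qed
 have len: "length (code s) = 2 * r" using wf s by auto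
 have inw: "\<not> placed x (q + i - int d)" if "0 \<le> i" "i < L" "d < 2 * r" for i d
  using far[of "q + i - int d"] that by (auto simp: L_def)
 have nc: "\<not> cov (step (B x)) (q + i)" if i: "0 \<le> i" "i < L" for i
 proof
  assume "cov (step (B x)) (q + i)"
  then obtain p where p: "occ (step (B x)) p" "p \<le> q + i" "q + i < p + L \<or> q + i = p + L \<and> occ (step (B x)) (p + L + 1)"
   unfolding cov_def L_def by blast
  show False
  proof (cases "q + i < p + L")
   case True
   thus ?thesis using inw[OF i, of "nat (q + i - p)"] p(1,2) unfolding placed_def L_def by (auto simp: nat_less_iff)
  next
   case False
   hence "p + L = q + i" "occ (step (B x)) (p + L + 1)" using p by auto
   thus ?thesis using far[of p] far[of "p + L + 1"] p(1) i r20 unfolding placed_def L_def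
    by (cases "i = 0") linarith+
  qed
 qed
 have open1: "\<not> cov (B x) (q + i + 1)" if i: "0 \<le> i" "i < L - 1" for i
 proof
  assume "cov (B x) (q + i + 1)"
  hence "placed x (q + i + 1)" using cov_next_placed[of x "q + i"] inw[of i] nc[of i] i by auto
  thus False using far[of "q + i + 1"] i by auto
 qed
 have copy: "F x (q + i) = x (q + i + 1)" if i: "0 \<le> i" "i < L - 1" for i
  using F_free[of x "q + i"] inw[of i] open1[OF i] em_cov[of "B x" "q + i + 1"] i by auto
 define z where "z = q + L - 1"
 have zi: "z = q + (L - 1)" by (simp add: z_def)
 have L1: "1 < L" using r20 by (simp add: L_def)
 have fz: "F x z = (if em (B x) (z + 1) then flt x z (out (the (B x (z + 1)))) else if cov (B x) (z + 1) then b else x (z + 1))"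
  using F_free[of x z] inw[of "L - 1"] L1 unfolding zi by auto
 have "F x z = a" using Q_letters(3)[OF Qq, of "L - 1"] r20 unfolding zi L_def by auto
 show False
 proof (cases "cov (B x) (z + 1)")
  case False
  hence "\<not> em (B x) (z + 1)" using em_cov by blast
  hence lz: "F x z = x (z + 1)" using fz False by simp
  have "occurs (code s) x (q + 1)" unfolding occurs_def
  proof (intro allI impI)
   fix i assume i: "i < length (code s)"
   have "F x (q + int i) = x (q + int i + 1)"
   proof (cases "int i = L - 1")
    case True thus ?thesis using lz by (simp add: zi)
   next
    case False thus ?thesis using copy[of "int i"] i len by (auto simp: L_def)
   qed
   thus "x (q + 1 + int i) = code s ! i" using occursD[OF o i] by (simp add: algebra_simps)
  qed
  hence "occ (B x) (q + 1)" using s by (auto simp: occ_def B_iff)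
  hence "cov (B x) (q + 0 + 1)" using cov_occ[of "B x" "q + 1" "q + 1"] r20 by simp
  thus False using open1[of 0] L1 by auto
 next
  case True
  show False
  proof (cases "em (B x) (z + 1)")
   case False
   thus ?thesis using fz True \<open>F x z = a\<close> ab by simp
  next
   case True
   obtain pre where pre: "code s = pre @ m" using m(1)[OF s] by (auto simp: suffix_def)
   have lm: "length pre + length m = 2 * r" "0 < length m" using pre len m(2) by auto
   have "occurs (butlast m) x (z + 2 - int (length m))" unfolding occurs_def
   proof (intro allI impI)
    fix i assume i: "i < length (butlast m)"
    have e: "q + int (length pre + i) + 1 = z + 2 - int (length m) + int i" using lm by (auto simp: zi L_def)
    have "x (z + 2 - int (length m) + int i) = F x (q + int (length pre + i))"
     unfolding e[symmetric] using i lm by (intro copy[symmetric]) (auto simp: L_def)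
    also have "\<dots> = m ! i" using occursD[OF o, of "length pre + i"] i lm len pre by (simp add: nth_append)
    finally show "x (z + 2 - int (length m) + int i) = butlast m ! i" using i by (simp add: nth_butlast)
   qed
   thus ?thesis using fz True \<open>F x z = a\<close> ab by (auto simp: flt_def split: if_splits)
  qed
 qed
qed

text \<open>So the blocks along an orbit of \<open>F\<close> evolve autonomously, whatever the
  letters between them, and everything shown for \<open>evolution\<close> applies.\<close>

theorem B_F: "B (F x) = step (B x)"
proof
 fix q
 show "B (F x) q = step (B x) q"
 proof (cases "step (B x) q")
  case (Some s)
  thus ?thesis using F_block[OF Some] step_S[OF Some] by (simp add: B_iff)
 next
  case None
  have "\<not> (s \<in> S \<and> occurs (code s) (F x) q)" for s
  proof
   assume a: "s \<in> S \<and> occurs (code s) (F x) q"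
   hence "placed x q" using no_creation by blast
   hence "occ (B x) (q + 1)" "near (B x) (q + 1)" using None by (auto simp: placed_def occ_def)
   hence "occurs filler (F x) q" using F_filler[of x "q + 1"] by simp
   hence "code s = filler" using a occurs_inj[of "code s" "F x" q filler] wf by auto
   thus False using a filler by blast
  qed
  hence "B (F x) q = None" by (cases "B (F x) q") (auto simp: B_iff)
  thus ?thesis using None by simp
 qed
qed

lemma F_open:
 assumes "\<not> cov (B (F x)) z" "\<not> cov (B x) (z + 1)" shows "F x z = x (z + 1)"
proof -
 have "\<not> placed x (z - int d)" if "d < 2 * r" for d
 proof
  assume "placed x (z - int d)"
  then consider "occ (step (B x)) (z - int d)" | "occ (B x) (z - int d + 1)" by (auto simp: placed_def)
  thus False
  proof cases
   case 1 thus ?thesis using assms(1) cov_occ[of "step (B x)" "z - int d" z] that unfolding B_F by auto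
  next
   case 2 thus ?thesis using assms(2) cov_occ[of "B x" "z - int d + 1" "z + 1"] that by auto
  qed
 qed
 thus ?thesis using F_free[of x z] assms(2) em_cov by auto
qed

lemma F_em:
 assumes "\<not> cov (B (F x)) z" "em (B x) (z + 1)" shows "F x z = flt x z (out (the (B x (z + 1))))"
proof -
 have s: "occ (B x) (z + 1)" "\<not> near (B x) (z + 1)" using assms(2) by (auto simp: em_def surv_def)
 have "\<not> placed x (z - int d)" if "d < 2 * r" for d
 proof
  assume "placed x (z - int d)"
  then consider "occ (step (B x)) (z - int d)" | "occ (B x) (z - int d + 1)" "near (B x) (z - int d + 1)" by (auto simp: placed_def)
  thus False
  proof cases
   case 1 thus ?thesis using assms(1) cov_occ[of "step (B x)" "z - int d" z] that unfolding B_F by auto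
  next
   case 2 thus ?thesis using sep_close[OF sep_B s(1), of "z - int d + 1"] s(2) that by auto
  qed
 qed
 thus ?thesis using F_free[of x z] assms(2) by auto
qed

lemma B_F_pow: "B ((F ^^ Suc t) x) = step (B ((F ^^ t) x))"
proof -
 have e: "(F ^^ Suc t) x = F ((F ^^ t) x)" by simp
 show ?thesis unfolding e by (rule B_F)
qed

lemma evol: "evolution (2 * int r) cb dg upd (\<lambda>t. B ((F ^^ t) x))"
 by (rule evolution.intro[OF placement_axioms], rule evolution_axioms.intro) (rule sep_B[of "(F ^^ 0) x"], rule B_F_pow)

end

section \<open>Locality and shift invariance of the automaton\<close>

lemma open_agree:
 fixes x :: "int => 'b::discrete_topology"
 assumes "finite W" shows "open {y. \<forall>i\<in>W. y i = x i}"
proof -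
 have "{y. \<forall>i\<in>W. y i = x i} = (\<Inter>i\<in>W. (\<lambda>y. y i) -` {x i})" by auto
 moreover have "open ((\<lambda>y :: int => 'b. y i) -` {x i})" for i
  by (rule open_vimage[OF discrete_topology_class.open_discrete continuous_on_product_coordinates])
 ultimately show ?thesis using assms by (simp add: open_INT)
qed

lemma continuous_local:
 fixes f :: "(int => 'b::discrete_topology) => 'c::topological_space"
 assumes "finite W" "\<And>x y. (\<And>i. i \<in> W ==> x i = y i) ==> f x = f y"
 shows "continuous_on UNIV f"
proof -
 have "open (f -` U)" for U
 proof (rule open_subopen[THEN iffD2], rule ballI)
  fix x assume x: "x \<in> f -` U"
  have "{y. \<forall>i\<in>W. y i = x i} \<subseteq> f -` U"
  proof
   fix y assume "y \<in> {y. \<forall>i\<in>W. y i = x i}"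
   hence "f y = f x" by (intro assms(2)) simp
   thus "y \<in> f -` U" using x by simp
  qed
  thus "\<exists>T. open T \<and> x \<in> T \<and> T \<subseteq> f -` U" using open_agree[OF assms(1), of x] by blast
 qed
 thus ?thesis by (simp add: continuous_on_open_vimage)
qed

context placement
begin

definition sh :: "(int => 's option) => int => 's option" where "sh \<beta> p = \<beta> (p + 1)"

lemma occ_sh: "occ (sh \<beta>) p \<longleftrightarrow> occ \<beta> (p + 1)" by (simp add: occ_def sh_def)

lemma lead_sh: "lead (sh \<beta>) p \<longleftrightarrow> lead \<beta> (p + 1)"
proof -
 have e: "p - L + 1 = p + 1 - L" "p - L - 1 + 1 = p + 1 - L - 1" by simp_all
 show ?thesis unfolding lead_def occ_sh e by (rule refl)
qed

lemma near_sh: "near (sh \<beta>) p \<longleftrightarrow> near \<beta> (p + 1)"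
proof -
 have e: "p - L - 2 + 1 = p + 1 - L - 2" "p - L - 3 + 1 = p + 1 - L - 3" by simp_all
 show ?thesis unfolding near_def occ_sh e lead_sh by (rule refl)
qed

lemma hop_sh: "hop (sh \<beta>) p \<longleftrightarrow> hop \<beta> (p + 1)"
proof -
 have e: "p - L - 1 + 1 = p + 1 - L - 1" by simp
 show ?thesis unfolding hop_def occ_sh e lead_sh near_sh sh_def by (rule refl)
qed

lemma mv_sh: "mv (sh \<beta>) p = mv \<beta> (p + 1) - 1"
 by (simp add: mv_def hop_sh)

lemma surv_sh: "surv (sh \<beta>) p \<longleftrightarrow> surv \<beta> (p + 1)"
 by (simp add: surv_def occ_sh near_sh)

lemma nst_sh: "nst (sh \<beta>) p = nst \<beta> (p + 1)"
proof -
 have e: "p - L + 1 = p + 1 - L" "p + L + 1 = p + 1 + L" by simp_all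
 have "lp (sh \<beta>) p + 1 = lp \<beta> (p + 1)" unfolding lp_def occ_sh e by simp
 moreover have "rp (sh \<beta>) p + 1 = rp \<beta> (p + 1)" unfolding rp_def occ_sh e by simp
 ultimately show ?thesis by (simp add: nst_def hop_sh sh_def)
qed

lemma step_sh: "step (sh \<beta>) = sh (step \<beta>)"
proof
 fix p
 have e: "(mv (sh \<beta>) p = p) = (mv \<beta> (p + 1) = p + 1)" "(mv (sh \<beta>) (p + 1) = p) = (mv \<beta> (p + 1 + 1) = p + 1)"
  by (auto simp: mv_sh)
 have "sh (step \<beta>) p = step \<beta> (p + 1)" by (simp add: sh_def)
 thus "step (sh \<beta>) p = sh (step \<beta>) p" unfolding step_def e surv_sh nst_sh by simp
qed

lemma em_sh: "em (sh \<beta>) p \<longleftrightarrow> em \<beta> (p + 1)"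
 by (simp add: em_def surv_sh lead_sh hop_sh)

lemma cov_sh: "cov (sh \<beta>) p \<longleftrightarrow> cov \<beta> (p + 1)"
proof
 assume "cov (sh \<beta>) p"
 then obtain q where "occ \<beta> (q + 1)" "q \<le> p" "p < q + L \<or> p = q + L \<and> occ \<beta> (q + L + 1 + 1)"
  unfolding cov_def occ_sh by blast
 thus "cov \<beta> (p + 1)" unfolding cov_def by (intro exI[of _ "q + 1"]) (auto simp: algebra_simps)
next
 assume "cov \<beta> (p + 1)"
 then obtain q where "occ \<beta> q" "q \<le> p + 1" "p + 1 < q + L \<or> p + 1 = q + L \<and> occ \<beta> (q + L + 1)"
  unfolding cov_def by blast
 thus "cov (sh \<beta>) p" unfolding cov_def occ_sh by (intro exI[of _ "q - 1"]) (auto simp: algebra_simps)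
qed

definition agr :: "int => int => (int => 's option) => (int => 's option) => bool" where
 "agr lo hi \<beta> \<gamma> \<longleftrightarrow> (\<forall>p. lo \<le> p \<and> p \<le> hi --> \<beta> p = \<gamma> p)"

context
 fixes lo hi \<beta> \<gamma> assumes agr: "agr lo hi \<beta> \<gamma>"
begin

lemma agr_eq: "lo \<le> p ==> p \<le> hi ==> \<beta> p = \<gamma> p"
 using agr by (simp add: agr_def)

lemma occ_agr: "lo \<le> p ==> p \<le> hi ==> occ \<beta> p = occ \<gamma> p"
 using agr_eq by (simp add: occ_def)

lemma lead_agr: "lo + L + 1 \<le> p ==> p \<le> hi ==> lead \<beta> p = lead \<gamma> p"
 using L40 occ_agr[of "p - L"] occ_agr[of "p - L - 1"] by (simp add: lead_def)

lemma near_agr: "lo + L + 3 \<le> p ==> p \<le> hi ==> near \<beta> p = near \<gamma> p"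
 using L40 lead_agr[of p] occ_agr[of "p - L - 2"] occ_agr[of "p - L - 3"] by (simp add: near_def)

lemma hop_agr: "lo + L + 3 \<le> p ==> p \<le> hi ==> hop \<beta> p = hop \<gamma> p"
 using L40 lead_agr[of p] near_agr[of p] agr_eq[of p] occ_agr[of "p - L - 1"] by (simp add: hop_def)

lemma surv_agr: "lo + L + 3 \<le> p ==> p \<le> hi ==> surv \<beta> p = surv \<gamma> p"
 using L40 near_agr[of p] occ_agr[of p] by (simp add: surv_def)

lemma nst_agr: assumes "lo + L + 3 \<le> p" "p + L + 1 \<le> hi" shows "nst \<beta> p = nst \<gamma> p"
proof -
 have "lp \<beta> p = lp \<gamma> p" using assms L40 occ_agr[of "p - L"] by (simp add: lp_def)
 moreover have "rp \<beta> p = rp \<gamma> p" using assms L40 occ_agr[of "p + L"] by (simp add: rp_def)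
 moreover have "\<beta> (lp \<gamma> p) = \<gamma> (lp \<gamma> p)" using assms L40 by (intro agr_eq) (auto simp: lp_def)
 moreover have "\<beta> (rp \<gamma> p) = \<gamma> (rp \<gamma> p)" using assms L40 by (intro agr_eq) (auto simp: rp_def)
 moreover have "\<beta> p = \<gamma> p" using assms L40 by (intro agr_eq) auto
 moreover have "hop \<beta> p = hop \<gamma> p" using assms L40 by (intro hop_agr) auto
 ultimately show ?thesis by (simp add: nst_def)
qed

lemma step_agr: assumes "lo + L + 3 \<le> p" "p + L + 2 \<le> hi" shows "step \<beta> p = step \<gamma> p"
proof -
 have "surv \<beta> p = surv \<gamma> p" "surv \<beta> (p + 1) = surv \<gamma> (p + 1)" "hop \<beta> p = hop \<gamma> p" "hop \<beta> (p + 1) = hop \<gamma> (p + 1)"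
  "nst \<beta> p = nst \<gamma> p" "nst \<beta> (p + 1) = nst \<gamma> (p + 1)"
  using assms L40 by (auto intro!: surv_agr hop_agr nst_agr)
 thus ?thesis by (simp add: step_def mv_def)
qed

lemma em_agr: assumes "lo + L + 3 \<le> p" "p \<le> hi" shows "em \<beta> p = em \<gamma> p"
 using assms L40 surv_agr[of p] lead_agr[of p] hop_agr[of p] by (simp add: em_def)

lemma cov_agr: assumes "lo + L \<le> p" "p + L + 1 \<le> hi" shows "cov \<beta> p = cov \<gamma> p"
proof -
 have "(occ \<beta> q \<and> q \<le> p \<and> (p < q + L \<or> p = q + L \<and> occ \<beta> (q + L + 1))) \<longleftrightarrow>
  (occ \<gamma> q \<and> q \<le> p \<and> (p < q + L \<or> p = q + L \<and> occ \<gamma> (q + L + 1)))" for q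
  using assms L40 occ_agr[of q] occ_agr[of "q + L + 1"] by auto
 thus ?thesis by (simp add: cov_def)
qed

end

end

lemma find_cong': "(\<And>d. d < n ==> P d = Q d) ==> find P [0..<n] = find Q [0..<n]"
 by (rule find_cong) auto

lemma occurs_shift: "occurs v (shift_map x) p = occurs v x (p + 1)"
 by (simp add: occurs_def shift_map_def add.assoc add.left_commute add.commute)

context coding
begin

lemma B_shift: "B (shift_map x) = sh (B x)"
 by (rule ext) (simp add: B_def occurs_shift sh_def)

lemma F_shift: "F (shift_map x) = shift_map (F x)"
proof
 fix z
 have e1: "z - int d + 1 = z + 1 - int d" "z + 1 - int d + 1 = z + 1 + 1 - int d" for d by simp_all
 have f: "flt (shift_map x) z e = flt x (z + 1) e" for e
 proof -
  have "z + 2 - int (length m) + 1 = z + 1 + 2 - int (length m)" by simp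
  thus ?thesis unfolding flt_def occurs_shift by (simp only:)
 qed
 show "F (shift_map x) z = shift_map (F x) z"
  unfolding F_def Let_def B_shift step_sh occ_sh em_sh near_sh cov_sh sh_def f e1
  unfolding shift_map_def F_def Let_def by (rule refl)
qed

lemma B_local: "(\<And>i. p \<le> i ==> i < p + L ==> x i = y i) ==> B x p = B y p"
proof -
 assume a: "\<And>i. p \<le> i ==> i < p + L ==> x i = y i"
 have "occurs (code s) x p = occurs (code s) y p" if "s \<in> S" for s
  using wf[of "code s"] that a by (simp add: occurs_def L_def)
 hence e: "s \<in> S \<and> occurs (code s) x p \<longleftrightarrow> s \<in> S \<and> occurs (code s) y p" for s by blast
 have "B x p = Some s \<longleftrightarrow> B y p = Some s" for s unfolding B_iff e ..
 thus ?thesis by (metis option.exhaust)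
qed

lemma F_local:
 assumes S0: "S \<noteq> {}" and e: "\<And>i. z - 4 * L \<le> i ==> i \<le> z + 4 * L ==> x i = y i" shows "F x z = F y z"
proof -
 have L40': "40 \<le> L" using r20 by (simp add: L_def)
 have lm: "int (length m) \<le> L"
 proof -
  obtain s where s: "s \<in> S" using S0 by blast
  have "length m \<le> length (code s)" using m(1)[OF s] by (auto simp: suffix_def)
  thus ?thesis using wf[of "code s"] s by (simp add: L_def)
 qed
 have a: "agr (z - 4 * L) (z + 3 * L) (B x) (B y)" unfolding agr_def
  using e L40' by (auto intro!: B_local)
 have 1: "find (\<lambda>d. occ (step (B x)) (z - int d)) [0..<2 * r] = find (\<lambda>d. occ (step (B y)) (z - int d)) [0..<2 * r]"
 proof (rule find_cong')
  fix d assume "d < 2 * r"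
  hence "step (B x) (z - int d) = step (B y) (z - int d)" using L40' by (intro step_agr[OF a]) (auto simp: L_def)
  thus "occ (step (B x)) (z - int d) = occ (step (B y)) (z - int d)" by (simp add: occ_def)
 qed
 have 2: "code (the (step (B x) (z - int d))) ! d = code (the (step (B y) (z - int d))) ! d" if "d < 2 * r" for d
 proof -
  have "step (B x) (z - int d) = step (B y) (z - int d)" using L40' that by (intro step_agr[OF a]) (auto simp: L_def)
  thus ?thesis by simp
 qed
 have 3: "em (B x) (z + 1) = em (B y) (z + 1)" using L40' by (intro em_agr[OF a]) (auto simp: L_def)
 have 4: "cov (B x) (z + 1) = cov (B y) (z + 1)" using L40' by (intro cov_agr[OF a]) (auto simp: L_def)
 have 5: "find (\<lambda>d. occ (B x) (z + 1 - int d) \<and> near (B x) (z + 1 - int d)) [0..<2 * r]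
   = find (\<lambda>d. occ (B y) (z + 1 - int d) \<and> near (B y) (z + 1 - int d)) [0..<2 * r]"
 proof (rule find_cong')
  fix d assume "d < 2 * r"
  hence "near (B x) (z + 1 - int d) = near (B y) (z + 1 - int d)" "occ (B x) (z + 1 - int d) = occ (B y) (z + 1 - int d)"
   using L40' by (auto intro!: near_agr[OF a] occ_agr[OF a] simp: L_def)
  thus "(occ (B x) (z + 1 - int d) \<and> near (B x) (z + 1 - int d)) = (occ (B y) (z + 1 - int d) \<and> near (B y) (z + 1 - int d))"
   by simp
 qed
 have 6: "B x (z + 1) = B y (z + 1)" using L40' by (intro agr_eq[OF a]) (auto simp: L_def)
 have 7: "flt x z = flt y z"
 proof -
  have "x (z + 2 - int (length m) + int i) = y (z + 2 - int (length m) + int i)" if "i < length (butlast m)" for i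
   using that lm L40' by (intro e) auto
  hence "occurs (butlast m) x (z + 2 - int (length m)) = occurs (butlast m) y (z + 2 - int (length m))"
   unfolding occurs_def by auto
  thus ?thesis unfolding flt_def by simp
 qed
 have 8: "x (z + 1) = y (z + 1)" using L40' by (intro e) auto
 show ?thesis
 proof (cases "find (\<lambda>d. occ (step (B y)) (z - int d)) [0..<2 * r]")
  case None
  thus ?thesis unfolding F_def Let_def 1 3 4 5 6 7 8 by simp
 next
  case (Some d)
  hence "d < 2 * r" by (auto simp: find_Some_iff)
  thus ?thesis using 2[of d] Some unfolding F_def Let_def 1 by simp
 qed
qed

end

lemma cellular_automatonI:
 fixes F :: "(int => 'b::discrete_topology) => (int => 'b)"
 assumes "\<And>x y z. (\<And>i. z - d \<le> i ==> i \<le> z + d ==> x i = y i) ==> F x z = F y z"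
  and "\<And>x. F (shift_map x) = shift_map (F x)"
 shows "cellular_automaton F"
proof -
 have "continuous_on UNIV (\<lambda>x. F x z)" for z
  by (rule continuous_local[of "{z - d..z + d}"], simp, rule assms(1)) simp
 hence "continuous_on UNIV F" by (rule continuous_on_coordinatewise_then_product)
 thus ?thesis unfolding cellular_automaton_def using assms(2) by (simp add: comp_def)
qed

text \<open>If a letter is altered, the filtered letters before it spell \<open>butlast m\<close>
  and contain \<open>u\<close> twice. The intended letters avoid \<open>u\<close>, so each copy
  contains an altered letter, that is, a \<open>b\<close> preceded by \<open>r - 1\<close> letters
  \<open>a\<close>. But the two copies lie within less than \<open>r\<close> cells. This is why
  \<open>m\<close> repeats \<open>u\<close> and ends in a long run of \<open>a\<close>.\<close>

lemma filter_avoid: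
 fixes \<omega> e :: "nat => 'b" and u :: "'b list" and a b :: 'b and r :: nat
 defines "m \<equiv> u @ [b] @ u @ [b] @ replicate r a"
 assumes ab: "a \<noteq> b" and r: "2 * length u + 3 \<le> r"
  and rule: "\<And>z. z < n ==> length m \<le> Suc z ==>
   \<omega> z = (if (\<forall>i<length m - 1. \<omega> (Suc z - length m + i) = m ! i) \<and> e z = a then b else e z)"
  and avoid: "\<And>p. A \<le> p ==> p + length u \<le> C ==> \<exists>i<length u. e (p + i) \<noteq> u ! i"
  and C: "C \<le> n" and z: "A + 2 * length m \<le> z" "z < C"
 shows "\<omega> z = e z"
proof (rule ccontr)
 assume ne: "\<omega> z \<noteq> e z"
 have lm: "length m = 2 * length u + 2 + r" by (simp add: m_def)
 have alt: "\<omega> v = b \<and> (\<forall>k. 1 \<le> k \<and> k < r --> \<omega> (v - k) = a) \<and> (\<forall>i<length m - 1. \<omega> (Suc v - length m + i) = m ! i)"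
  if v: "v < n" "length m \<le> Suc v" "\<omega> v \<noteq> e v" for v
 proof -
  have p: "\<forall>i<length m - 1. \<omega> (Suc v - length m + i) = m ! i" "\<omega> v = b" using rule[OF v(1,2)] v(3) by (auto split: if_splits)
  have "\<omega> (v - k) = a" if k: "1 \<le> k" "k < r" for k
  proof -
   have i: "length m - 1 - k < length m - 1" "Suc v - length m + (length m - 1 - k) = v - k" using k lm v(2) by auto
   have "m ! (length m - 1 - k) = a" unfolding m_def using k by (auto simp: nth_append)
   thus ?thesis using p(1)[rule_format, OF i(1)] unfolding i(2) by simp
  qed
  thus ?thesis using p by blast
 qed
 define p where "p = Suc z - length m"
 have zn: "z < n" "length m \<le> Suc z" using z C by auto
 have pat: "\<omega> (p + i) = m ! i" if "i < length m - 1" for i using alt[OF zn ne] that by (simp add: p_def)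
 have u1: "\<omega> (p + i) = u ! i" if "i < length u" for i
  using pat[of i] that lm by (simp add: m_def nth_append)
 have u2: "\<omega> (p + length u + 1 + i) = u ! i" if "i < length u" for i
 proof -
  have "m ! (length u + 1 + i) = u ! i" using that by (simp add: m_def nth_append)
  thus ?thesis using pat[of "length u + 1 + i"] that lm by (simp add: add.assoc)
 qed
 have pA: "A + length m \<le> p" "p + length m = Suc z" using z by (auto simp: p_def)
 have "\<exists>i<length u. e (p + i) \<noteq> u ! i" using avoid[of p] pA z lm by simp
 then obtain i where i: "i < length u" "\<omega> (p + i) \<noteq> e (p + i)" using u1 by force
 have "\<exists>i<length u. e (p + length u + 1 + i) \<noteq> u ! i" using avoid[of "p + length u + 1"] pA z lm by simp
 then obtain j where j: "j < length u" "\<omega> (p + length u + 1 + j) \<noteq> e (p + length u + 1 + j)" using u2 by force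
 have "\<omega> (p + i) = b" using alt[of "p + i"] i pA z C lm by auto
 moreover have "\<omega> (p + length u + 1 + j - (length u + 1 + j - i)) = a"
 proof -
  have "p + length u + 1 + j < n" "length m \<le> Suc (p + length u + 1 + j)" using j pA zn lm r by auto
  from alt[OF this j(2)] have "\<forall>k. 1 \<le> k \<and> k < r --> \<omega> (p + length u + 1 + j - k) = a" by blast
  moreover have "1 \<le> length u + 1 + j - i \<and> length u + 1 + j - i < r" using i(1) j(1) r by auto
  ultimately show ?thesis by blast
 qed
 moreover have "p + length u + 1 + j - (length u + 1 + j - i) = p + i" using i(1) by simp
 ultimately show False using ab by simp
qed

section \<open>Letters along an orbit of the automaton\<close>

locale orbit = coding S code filler m a b r cb dg upd out
 for S :: "'s set" and code :: "'s => 'b list" and filler m :: "'b list" and a b :: 'b and r :: nat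
  and cb dg :: "'s => bool" and upd :: "'s option => 's => 's option => bool => 's" and out :: "'s => 'b" +
 fixes x :: "int => 'b"

sublocale orbit \<subseteq> evolution "2 * int r" cb dg upd "\<lambda>t. B ((F ^^ t) x)"
 by (rule evol)

context orbit
begin

lemma letter_path: "path t z u ==> (F ^^ t) x z = (F ^^ (t - u)) x (z + int u)"
proof (induction u)
 case (Suc u)
 have p: "path t z u" using path_le[OF Suc.prems] by simp
 define v where "v = t - Suc u"
 have v: "t - u = Suc v" using Suc.prems by (auto simp: path_def v_def)
 have "u \<le> Suc u" by simp
 hence c: "\<not> cov (B ((F ^^ (t - u)) x)) (z + int u)" "\<not> cov (B ((F ^^ v) x)) (z + int (Suc u))"
  using Suc.prems unfolding path_def v_def by blast+
 have e: "z + int (Suc u) = z + int u + 1" "F ((F ^^ v) x) = (F ^^ Suc v) x" by simp_all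
 have "F ((F ^^ v) x) (z + int u) = (F ^^ v) x (z + int u + 1)"
  by (rule F_open) (use c in \<open>simp_all only: e(1)[symmetric] e(2) v\<close>, simp_all)
 thus ?case using Suc.IH[OF p] unfolding v e v_def[symmetric] by simp
qed simp

lemma src_is_path: "src t z = Some (s, y) ==> \<not> cov (B ((F ^^ t) x)) z ==> path t z (t - Suc s)"
proof (induction t arbitrary: z)
 case (Suc t)
 show ?case
 proof (cases "em (B ((F ^^ t) x)) (z + 1)")
  case True
  hence "s = t" using Suc.prems(1) unfolding src.simps by (simp only: if_True option.inject prod.inject)
  thus ?thesis using Suc.prems(2) by (simp add: path_def)
 next
  case False
  hence c: "\<not> cov (B ((F ^^ t) x)) (z + 1)" and sr: "src t (z + 1) = Some (s, y)"
   using Suc.prems(1) unfolding src.simps by (simp_all only: if_False split: if_splits) auto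
  have p: "path t (z + 1) (t - Suc s)" by (rule Suc.IH[OF sr c])
  have st: "s < t" using src_em[OF sr] by blast
  show ?thesis unfolding path_def
  proof (intro conjI allI impI)
   fix v assume v: "v \<le> Suc t - Suc s"
   show "\<not> cov (B ((F ^^ (Suc t - v)) x)) (z + int v)"
   proof (cases v)
    case 0 thus ?thesis using Suc.prems(2) by simp
   next
    case (Suc w)
    have "\<not> cov (B ((F ^^ (t - w)) x)) (z + 1 + int w)" using p v st Suc by (auto simp: path_def)
    moreover have "z + int v = z + 1 + int w" "Suc t - v = t - w" using Suc by simp_all
    ultimately show ?thesis by (simp only:) simp
   qed
  qed simp
 qed
qed simp

lemma letter_src:
 assumes "src t z = Some (s, y)" "\<not> cov (B ((F ^^ t) x)) z"
 shows "(F ^^ t) x z = flt ((F ^^ s) x) (y - 1) (out (the (B ((F ^^ s) x) y)))"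
proof -
 have p: "path t z (t - Suc s)" by (rule src_is_path[OF assms])
 have s: "s < t" "em (B ((F ^^ s) x)) y" "y = z + int (t - s)" using src_em[OF assms(1)] by auto
 have e: "t - (t - Suc s) = Suc s" "z + int (t - Suc s) = y - 1" using s by auto
 have "\<not> cov (B ((F ^^ (t - (t - Suc s))) x)) (z + int (t - Suc s))" using p unfolding path_def by blast
 hence c: "\<not> cov (B (F ((F ^^ s) x))) (y - 1)" unfolding e by simp
 have "(F ^^ t) x z = F ((F ^^ s) x) (y - 1)" using letter_path[OF p] unfolding e by simp
 also have "\<dots> = flt ((F ^^ s) x) (y - 1) (out (the (B ((F ^^ s) x) (y - 1 + 1))))"
  by (rule F_em[OF c]) (use s in simp)
 finally show ?thesis by simp
qed

text \<open>At its emission a letter is filtered against the letters in front of the leader. These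
  were emitted before and have travelled along with it, so the rule can be read off inside the
  window at time \<open>t\<close>.\<close>

lemma letter_rule:
 assumes sq: "\<And>z. z < n ==> src t (int z) = Some (sq z, y z)" "\<And>z. z < n ==> \<not> cov (B ((F ^^ t) x)) (int z)"
  and mono: "\<And>z. Suc z < n ==> sq z < sq (Suc z)"
  and z: "z < n" "length m \<le> Suc z"
 defines "\<omega> \<equiv> \<lambda>z. (F ^^ t) x (int z)" and "e \<equiv> \<lambda>z. out (the (B ((F ^^ sq z) x) (y z)))"
 shows "\<omega> z = (if (\<forall>i<length m - 1. \<omega> (Suc z - length m + i) = m ! i) \<and> e z = a then b else e z)"
proof -
 have mono': "sq z' < sq z''" if "z' < z''" "z'' < n" for z' z''
  using that
 proof (induction z'')
  case (Suc w)
  thus ?case using mono[of w] by (cases "z' = w") auto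
 qed simp
 have yz: "y z = int z + int (t - sq z)" "sq z < t" using src_em[OF sq(1)[OF z(1)]] by auto
 have "(F ^^ sq z) x (y z - 1 + 2 - int (length m) + int i) = \<omega> (Suc z - length m + i)" if i: "i < length m - 1" for i
 proof -
  define w where "w = Suc z - length m + i"
  have w: "w < z" "w < n" using i z by (auto simp: w_def)
  have p: "path t (int w) (t - Suc (sq w))" by (rule src_is_path[OF sq(1)[OF w(2)] sq(2)[OF w(2)]])
  have "path t (int w) (t - sq z)" by (rule path_le[OF p]) (use mono'[OF w(1) z(1)] in simp)
  from letter_path[OF this] have "\<omega> w = (F ^^ sq z) x (int w + int (t - sq z))" using yz by (simp add: \<omega>_def)
  moreover have "int w + int (t - sq z) = y z - 1 + 2 - int (length m) + int i" using i z yz by (simp add: w_def of_nat_diff)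
  ultimately show ?thesis unfolding w_def[symmetric] by (simp only:)
 qed
 hence "occurs (butlast m) ((F ^^ sq z) x) (y z - 1 + 2 - int (length m)) \<longleftrightarrow>
   (\<forall>i<length m - 1. \<omega> (Suc z - length m + i) = m ! i)"
  by (auto simp: occurs_def nth_butlast)
 thus ?thesis using letter_src[OF sq(1)[OF z(1)] sq(2)[OF z(1)]] unfolding flt_def \<omega>_def e_def by simp
qed

end

section \<open>A Turing machine inside a train\<close>

text \<open>
 The cell of index \<open>i\<close>, counted from the head of a train, stores the \<open>i\<close>-th symbol to the left (\<open>fL\<close>) of the
 head of the machine and from the head to the right (\<open>fR\<close>), the unary input (\<open>fI\<close>) and the part of it that still
 delays the output (\<open>fW\<close>), the output word (\<open>fO\<close>) and its part that is still to be copied (\<open>fV\<close>), the pairs of letters of the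
 word under construction (\<open>fE\<close>), the last complete word (\<open>fN\<close>) and the word being emitted, which is rotated
 (\<open>fC\<close>). The marks \<open>fA\<close> and \<open>fB\<close> form unary counters of the length of the train: the machine advances at
 each exhaustion of \<open>fA\<close>, and everything restarts, with \<open>fN\<close> copied to \<open>fC\<close>, at the exhaustion of \<open>fB\<close>. Only the
 control (\<open>fQ\<close>) of cell \<open>0\<close> is ever read.
\<close>

datatype 'b ctl = Run nat | Mv nat direction | Unl "'b option"

datatype 'b mc = MC (fL: "'b tape_symbol") (fR: "'b tape_symbol") (fI: bool) (fW: bool) (fA: bool) (fB: bool)
 (fO: "'b option") (fV: "'b option") (fE: "('b \<times> 'b) option") (fN: "('b \<times> 'b) option") (fC: "('b \<times> 'b) option")
 (fQ: "'b ctl")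

fun letter :: "'b tape_symbol => 'b option" where
 "letter (Letter x) = Some x"
| "letter _ = None"

definition clr :: "'b mc => 'b mc" where
 "clr c = MC Blank Blank False False True True None None None (fN c) (fN c) (Run 0)"

text \<open>A missing right neighbour has both marks \<open>False\<close>; from there the unary
  clocks run down.\<close>

definition bl :: "'b mc option => 'b mc" where
 "bl r = (case r of None => MC Blank Blank False False False False None None None None None (Run 0) | Some c => c)"

text \<open>Equality of \<open>core\<close>s compares the simulated machines and disregards clocks
  and stored words.\<close>

definition core :: "'b mc => 'b mc" where
 "core x = MC (fL x) (fR x) (fI x) (fW x) True True (fO x) (fV x) (fE x) None None (fQ x)"

definition fin :: "'b mc => bool" where "fin c \<longleftrightarrow> fQ c = Unl None \<and> fV c = None"

definition mk where
 "mk L R I W Oo V E Q = MC L R I W True True Oo V E None None Q"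

text \<open>\<open>Unl p\<close> unloads the word from \<open>fV\<close>, one letter per step;
  \<open>p\<close> is the first letter of an unfinished pair, and a finished pair goes to the first
  free cell of \<open>fE\<close>. If the word ends with a letter pending, \<open>fV\<close> is
  reloaded from \<open>fO\<close>, so words of odd length are read twice. Then the input grows by
  one mark and the next round begins.\<close>

definition pstc :: "'b machine => 'b mc => 'b mc option => 'b mc => 'b tape_symbol => 'b tape_symbol => bool => 'b option => 'b mc" where
 "pstc M c l x rL rR rW rV = (case fQ c of
   Run q => (case M (q, fR c) of
     Some (q', s, d) => mk (fL x) (if l = None then s else fR x) (fI x) (fW x) (fO x) (fV x) (fE x) (Mv q' d)
    | None => if fW c then mk (fL x) (fR x) (fI x) rW (fO x) (fV x) (fE x) (Run q)
      else mk (fL x) (fR x) (fI x) (fW x) (letter (fR x)) (letter (fR x)) None (Unl None))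
  | Mv q d => (case d of
     Go_Left => mk rL (case l of None => fL x | Some y => fR y) (fI x) (fW x) (fO x) (fV x) (fE x) (Run q)
    | Stay => mk (fL x) (fR x) (fI x) (fW x) (fO x) (fV x) (fE x) (Run q)
    | Go_Right => mk (case l of None => fR x | Some y => fL y) rR (fI x) (fW x) (fO x) (fV x) (fE x) (Run q))
  | Unl p => (case fV c of
     Some y => (case p of
       None => mk (fL x) (fR x) (fI x) (fW x) (fO x) rV (fE x) (Unl (Some y))
      | Some z => mk (fL x) (fR x) (fI x) (fW x) (fO x) rV
        (if fE x = None \<and> (case l of None => True | Some e => fE e \<noteq> None) then Some (z, y) else fE x) (Unl None))
    | None => (case p of
       Some z => mk (fL x) (fR x) (fI x) (fW x) (fO x) (fO x) (fE x) (Unl p)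
      | None => (let i = (case l of None => True | Some y => fI y) in
        mk Blank (if i then Mark 0 else Blank) i i None None None (Run 0)))))"

definition pst :: "'b machine => 'b mc => 'b mc option => 'b mc => 'b mc option => 'b mc" where
 "pst M c l x r = (let y = pstc M (core c) (map_option core l) (core x) (fL (bl r)) (fR (bl r)) (fW (bl r)) (fV (bl r)) in
   MC (fL y) (fR y) (fI y) (fW y) (fA x) (fB x) (fO y) (fV y) (fE y) (if fin c then fE x else fN x) (fC x) (fQ y))"

text \<open>A cyclic rotation of the nonempty cells: the last of them receives the pair of cell
  0.\<close>

definition rot :: "'b mc => 'b mc => 'b mc option => ('b \<times> 'b) option" where
 "rot c x r = (if fC x = None then None else case fC (bl r) of Some y => Some y | None => fC c)"

definition sA :: "bool => 'b mc => 'b mc" where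
 "sA a x = MC (fL x) (fR x) (fI x) (fW x) a (fB x) (fO x) (fV x) (fE x) (fN x) (fC x) (fQ x)"
definition sB :: "bool => 'b mc => 'b mc" where
 "sB a x = MC (fL x) (fR x) (fI x) (fW x) (fA x) a (fO x) (fV x) (fE x) (fN x) (fC x) (fQ x)"
definition sC :: "('b \<times> 'b) option => 'b mc => 'b mc" where
 "sC a x = MC (fL x) (fR x) (fI x) (fW x) (fA x) (fB x) (fO x) (fV x) (fE x) (fN x) a (fQ x)"

definition phi :: "'b machine => 'b mc => 'b mc option => 'b mc => 'b mc option => 'b mc" where
 "phi M c l x r = (if fA c then sA (fA (bl r)) (sC (rot c x r) x)
   else if fB c then sA True (sB (fB (bl r)) (sC (rot c x r) (pst M c l x r)))
   else clr x)"

definition blk :: "'b mc => bool" where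
 "blk x \<longleftrightarrow> fL x = Blank \<and> fR x = Blank \<and> \<not> fI x \<and> \<not> fW x \<and> fO x = None \<and> fV x = None \<and> fE x = None"

lemma core_eq: "core x = core y \<longleftrightarrow> fL x = fL y \<and> fR x = fR y \<and> fI x = fI y \<and> fW x = fW y \<and> fO x = fO y \<and>
  fV x = fV y \<and> fE x = fE y \<and> fQ x = fQ y"
 by (auto simp: core_def)

lemma core_s [simp]: "core (sA a x) = core x" "core (sB a' x) = core x" "core (sC a'' x) = core x"
 by (simp_all add: core_def sA_def sB_def sC_def)

lemma fs [simp]: "fN (sA a x) = fN x" "fN (sB a x) = fN x" "fN (sC z x) = fN x" "fB (sA a x) = fB x" "fB (sB a x) = a"
 "fA (sA a x) = a" "fC (sA a x) = fC x" "fC (sB a x) = fC x" "fC (sC z x) = z" "fB (sC z x) = fB x"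
 by (simp_all add: sA_def sB_def sC_def)

lemma clr_f [simp]: "fN (clr x) = fN x" "fC (clr x) = fN x" "fA (clr x)" "fB (clr x)"
 by (simp_all add: clr_def)

lemma core_f [simp]: "fL (core x) = fL x" "fR (core x) = fR x" "fI (core x) = fI x" "fW (core x) = fW x"
 "fO (core x) = fO x" "fV (core x) = fV x" "fE (core x) = fE x" "fQ (core x) = fQ x"
 by (simp_all add: core_def)

lemma pst_core:
 assumes "core c = core c'" "core x = core x'" "map_option core l = map_option core l'"
  "fL (bl r) = fL (bl r')" "fR (bl r) = fR (bl r')" "fW (bl r) = fW (bl r')" "fV (bl r) = fV (bl r')"
 shows "core (pst M c l x r) = core (pst M c' l' x' r')"
 unfolding pst_def assms Let_def by (simp add: core_def)

lemma pst_N [simp]: "fN (pst M c l x r) = (if fin c then fE x else fN x)"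
 by (simp add: pst_def Let_def)

lemma pst_ABC [simp]: "fC (pst M c l x r) = fC x" "fA (pst M c l x r) = fA x" "fB (pst M c l x r) = fB x"
 by (simp_all add: pst_def Let_def)

lemma mk_f [simp]: "fL (mk L R I W Oo V E Q) = L" "fR (mk L R I W Oo V E Q) = R" "fI (mk L R I W Oo V E Q) = I"
 "fW (mk L R I W Oo V E Q) = W" "fO (mk L R I W Oo V E Q) = Oo" "fV (mk L R I W Oo V E Q) = V"
 "fE (mk L R I W Oo V E Q) = E" "fQ (mk L R I W Oo V E Q) = Q"
 by (simp_all add: mk_def)

lemma pst_f:
 assumes "y = pstc M (core c) (map_option core l) (core x) (fL (bl r)) (fR (bl r)) (fW (bl r)) (fV (bl r))"
 shows "fL (pst M c l x r) = fL y" "fR (pst M c l x r) = fR y" "fI (pst M c l x r) = fI y" "fW (pst M c l x r) = fW y"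
  "fO (pst M c l x r) = fO y" "fV (pst M c l x r) = fV y" "fE (pst M c l x r) = fE y" "fQ (pst M c l x r) = fQ y"
 using assms by (simp_all add: pst_def Let_def)

lemma pstc_blk:
 assumes "blk x" "blk l" "rL = Blank" "rR = Blank" "\<not> rW" "rV = None"
 shows "blk (pstc M c (Some l) x rL rR rW rV)"
proof -
 note b = assms[unfolded blk_def]
 show ?thesis
 proof (cases "fQ c")
  case (Run q) thus ?thesis using b by (cases "M (q, fR c)") (auto simp: pstc_def blk_def)
 next
  case (Mv q d) thus ?thesis using b by (cases d) (auto simp: pstc_def blk_def)
 next
  case (Unl p) thus ?thesis using b by (cases "fV c"; cases p) (auto simp: pstc_def blk_def Let_def)
 qed
qed

lemma pst_blk:
 assumes "blk x" "blk (bl r)" "blk y" shows "blk (pst M c (Some y) x r)"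
proof -
 have "blk (pstc M (core c) (Some (core y)) (core x) (fL (bl r)) (fR (bl r)) (fW (bl r)) (fV (bl r)))"
  by (rule pstc_blk) (use assms in \<open>auto simp: blk_def\<close>)
 thus ?thesis by (simp add: blk_def pst_f)
qed

section \<open>The infinite array and its truncation to a train\<close>

definition nbl :: "(nat => 'a) => nat => 'a option" where "nbl v i = (if i = 0 then None else Some (v (i - 1)))"
definition nbr :: "nat => (nat => 'a) => nat => 'a option" where "nbr n v i = (if Suc i < n then Some (v (Suc i)) else None)"

definition Pst :: "'b machine => (nat => 'b mc) => nat => 'b mc" where
 "Pst M v i = pst M (v 0) (nbl v i) (v i) (Some (v (Suc i)))"

definition cell0 :: "'b mc" where "cell0 = MC Blank Blank False False True True None None None None None (Run 0)"

definition U :: "'b machine => nat => nat => 'b mc" where "U M s = (Pst M ^^ s) (\<lambda>_. cell0)"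

lemma U_0: "U M 0 = (\<lambda>_. cell0)" by (simp add: U_def)
lemma U_Suc: "U M (Suc s) = Pst M (U M s)" by (simp add: U_def)

lemma U_blk: "s \<le> i ==> blk (U M s i)"
proof (induction s arbitrary: i)
 case 0 thus ?case by (simp add: U_0 cell0_def blk_def)
next
 case (Suc s)
 hence "blk (U M s i)" "blk (U M s (i - 1))" "blk (U M s (Suc i))" "i \<noteq> 0" by auto
 thus ?case unfolding U_Suc Pst_def by (simp add: nbl_def bl_def pst_blk)
qed

text \<open>Activity spreads by at most one cell per step (\<open>U_blk\<close>), so during the
  first \<open>n\<close> steps the cells beyond the train are blank in the reference run, which is
  how \<open>bl\<close> reads a missing neighbour.\<close>

lemma trunc:
 assumes init: "\<And>i. i < n ==> core (Y 0 i) = core cell0"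
  and step: "\<And>s i. s < n ==> i < n ==> core (Y (Suc s) i) = core (pst M (Y s 0) (nbl (Y s) i) (Y s i) (nbr n (Y s) i))"
  and s: "s \<le> n" "i < n"
 shows "core (Y s i) = core (U M s i)"
 using s
proof (induction s arbitrary: i)
 case 0 thus ?case using init by (simp add: U_0)
next
 case (Suc s)
 have IH: "core (Y s i) = core (U M s i)" if "i < n" for i using Suc that by simp
 have "core (Y (Suc s) i) = core (pst M (Y s 0) (nbl (Y s) i) (Y s i) (nbr n (Y s) i))" using step Suc.prems by simp
 also have "\<dots> = core (pst M (U M s 0) (nbl (U M s) i) (U M s i) (Some (U M s (Suc i))))"
 proof (rule pst_core)
  show "core (Y s 0) = core (U M s 0)" "core (Y s i) = core (U M s i)" using IH Suc.prems by auto
  show "map_option core (nbl (Y s) i) = map_option core (nbl (U M s) i)"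
   using IH[of "i - 1"] Suc.prems by (simp add: nbl_def)
  have r: "core (Y s (Suc i)) = core (U M s (Suc i))" if "Suc i < n" using IH that by simp
  have b: "blk (U M s (Suc i))" if "\<not> Suc i < n" using U_blk[of s "Suc i" M] that Suc.prems by simp
  show "fL (bl (nbr n (Y s) i)) = fL (bl (Some (U M s (Suc i))))" "fR (bl (nbr n (Y s) i)) = fR (bl (Some (U M s (Suc i))))"
   using r b by (auto simp: nbr_def bl_def core_eq blk_def)
  show "fW (bl (nbr n (Y s) i)) = fW (bl (Some (U M s (Suc i))))" "fV (bl (nbr n (Y s) i)) = fV (bl (Some (U M s (Suc i))))"
   using r b by (auto simp: nbr_def bl_def core_eq blk_def)
 qed
 finally show ?case by (simp add: U_Suc Pst_def)
qed

text \<open>The initial \<open>fN\<close> of a train is arbitrary; it agrees with the reference run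
  only after a first word has been completed, at some step \<open>s0 < s\<close>.\<close>

lemma trunc_N:
 assumes init: "\<And>i. i < n ==> core (Y 0 i) = core cell0"
  and step: "\<And>s i. s < n ==> i < n ==> core (Y (Suc s) i) = core (pst M (Y s 0) (nbl (Y s) i) (Y s i) (nbr n (Y s) i))"
  and stepN: "\<And>s i. s < n ==> i < n ==> fN (Y (Suc s) i) = fN (pst M (Y s 0) (nbl (Y s) i) (Y s i) (nbr n (Y s) i))"
  and f: "fin (U M s0 0)" "s0 < s" and s: "s \<le> n" "i < n"
 shows "fN (Y s i) = fN (U M s i)"
 using f(2) s(1)
proof (induction s)
 case (Suc s)
 have n: "0 < n" using s by simp
 have c: "core (Y s i) = core (U M s i)" if "i < n" for i using trunc[OF init step, of s i] that Suc.prems by simp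
 have fe: "fin (Y s 0) = fin (U M s 0)" "fE (Y s i) = fE (U M s i)" using c[OF n] c[OF s(2)] by (auto simp: core_eq fin_def)
 have "fN (Y (Suc s) i) = (if fin (Y s 0) then fE (Y s i) else fN (Y s i))" using stepN[of s i] Suc.prems s by (simp add: pst_N)
 also have "\<dots> = (if fin (U M s 0) then fE (U M s i) else fN (U M s i))"
 proof (cases "s = s0")
  case True thus ?thesis using f fe by simp
 next
  case False
  hence "fN (Y s i) = fN (U M s i)" using Suc by simp
  thus ?thesis using fe by simp
 qed
 finally show ?case by (simp add: U_Suc Pst_def pst_N)
qed simp

text \<open>A clock that sets itself from arbitrary marks: \<open>False\<close> enters at the far
  end, so the head is exhausted within \<open>n\<close> steps; this refills all marks at once, and
  the next exhaustion comes \<open>n + 1\<close> steps later.\<close>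

lemma clock:
 fixes f :: "nat => nat => bool"
 assumes rec: "\<And>p i. i < n ==> f (Suc p) i = (if f p 0 then Suc i < n \<and> f p (Suc i) else True)" and n: "0 < n"
 obtains p0 where "p0 \<le> n" "\<And>p. \<not> f (p0 + p) 0 \<longleftrightarrow> Suc n dvd p"
proof -
 have "\<exists>p\<le>n. \<not> f p 0"
 proof (rule ccontr)
  assume a: "\<not> ?thesis"
  have "j \<le> n ==> i < n ==> f j i ==> i + j < n" for i j
  proof (induction j arbitrary: i)
   case (Suc j)
   hence "Suc i < n \<and> f j (Suc i)" using rec[of i j] a by (auto split: if_splits)
   thus ?case using Suc.IH[of "Suc i"] Suc.prems by simp
  qed simp
  from this[of n 0] show False using a n by auto
 qed
 then obtain p0 where p0: "p0 \<le> n" "\<not> f p0 0" by blast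
 have run: "f (p + Suc j) i \<longleftrightarrow> i + j < n" if "\<not> f p 0" "j \<le> n" "i < n" for p j i
  using that(2,3)
 proof (induction j arbitrary: i)
  case 0 thus ?case using rec[of i p] that by simp
 next
  case (Suc j)
  have "f (p + Suc j) 0" using Suc.IH[of 0] Suc.prems n by simp
  hence "f (Suc (p + Suc j)) i \<longleftrightarrow> Suc i < n \<and> f (p + Suc j) (Suc i)" using rec[OF Suc.prems(2)] by simp
  thus ?case using Suc.IH[of "Suc i"] Suc.prems by (cases "Suc i < n") auto
 qed
 have per: "\<not> f (p0 + k * Suc n) 0" for k
 proof (induction k)
  case (Suc k)
  thus ?case using run[OF Suc, of n 0] n by (simp add: algebra_simps)
 qed (use p0 in simp)
 have "\<not> f (p0 + p) 0 \<longleftrightarrow> Suc n dvd p" for p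
 proof (cases "p mod Suc n = 0")
  case True
  hence d: "Suc n dvd p" by (simp only: dvd_eq_mod_eq_0)
  then obtain k where "p = k * Suc n" by (metis dvdE mult.commute)
  thus ?thesis using per[of k] d by (simp only:) simp
 next
  case False
  define j where "j = p mod Suc n - 1"
  have j: "p = p div Suc n * Suc n + Suc j" "j < n" using False mod_less_divisor[of "Suc n" p] div_mult_mod_eq[of p "Suc n"]
   unfolding j_def by linarith+
  have "f (p0 + p div Suc n * Suc n + Suc j) 0" using run[OF per[of "p div Suc n"], of j 0] j n by simp
  hence "f (p0 + p) 0" using j(1) by (metis add.assoc)
  thus ?thesis using False by auto
 qed
 thus thesis using that p0 by blast
qed

section \<open>Simulation of the machine by the infinite array\<close>

definition conf where
 "conf v L R I W Oo V E Q \<longleftrightarrow> (\<forall>i. fL (v i) = L i \<and> fR (v i) = R i \<and> fI (v i) = I i \<and> fW (v i) = W i \<and>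
   fO (v i) = Oo i \<and> fV (v i) = V i \<and> fE (v i) = E i) \<and> fQ (v (0::nat)) = Q"

abbreviation "PC M v i \<equiv> pstc M (core (v 0)) (map_option core (nbl v i)) (core (v i)) (fL (v (Suc i))) (fR (v (Suc i))) (fW (v (Suc i))) (fV (v (Suc i)))"

lemma Pst_f: "fL (Pst M v i) = fL (PC M v i)"
 "fR (Pst M v i) = fR (PC M v i)"
 "fI (Pst M v i) = fI (PC M v i)"
 "fW (Pst M v i) = fW (PC M v i)"
 "fO (Pst M v i) = fO (PC M v i)"
 "fV (Pst M v i) = fV (PC M v i)"
 "fE (Pst M v i) = fE (PC M v i)"
 "fQ (Pst M v i) = fQ (PC M v i)"
 by (simp_all add: Pst_def pst_f bl_def)

lemma Pst_N: "fN (Pst M v i) = (if fin (v 0) then fE (v i) else fN (v i))"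
 by (simp add: Pst_def)

lemma conf_run:
 assumes "conf v L R I W Oo V E (Run q)" "M (q, R 0) = Some (q', s, d)"
 shows "conf (Pst M v) L (R(0 := s)) I W Oo V E (Mv q' d)"
 using assms unfolding conf_def by (simp add: Pst_f pstc_def nbl_def)

lemma conf_mv:
 assumes "conf v L R I W Oo V E (Mv q d)"
 shows "d = Go_Left ==> conf (Pst M v) (\<lambda>i. L (Suc i)) (\<lambda>i. if i = 0 then L 0 else R (i - 1)) I W Oo V E (Run q)"
  "d = Stay ==> conf (Pst M v) L R I W Oo V E (Run q)"
  "d = Go_Right ==> conf (Pst M v) (\<lambda>i. if i = 0 then R 0 else L (i - 1)) (\<lambda>i. R (Suc i)) I W Oo V E (Run q)"
 using assms unfolding conf_def by (simp_all add: Pst_f pstc_def nbl_def)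

lemma conf_wait:
 assumes "conf v L R I W Oo V E (Run q)" "M (q, R 0) = None"
 shows "W 0 ==> conf (Pst M v) L R I (\<lambda>i. W (Suc i)) Oo V E (Run q)"
  "\<not> W 0 ==> conf (Pst M v) L R I W (\<lambda>i. letter (R i)) (\<lambda>i. letter (R i)) (\<lambda>_. None) (Unl None)"
 using assms unfolding conf_def by (simp_all add: Pst_f pstc_def nbl_def)

lemma conf_reload:
 assumes "conf v L R I W Oo V E (Unl (Some z))" "V 0 = None"
 shows "conf (Pst M v) L R I W Oo Oo E (Unl (Some z))"
 using assms unfolding conf_def by (simp add: Pst_f pstc_def nbl_def)

lemma conf_finish:
 assumes "conf v L R I W Oo V E (Unl None)" "V 0 = None"
 shows "conf (Pst M v) (\<lambda>_. Blank) (\<lambda>i. if i = 0 \<or> I (i - 1) then Mark 0 else Blank) (\<lambda>i. i = 0 \<or> I (i - 1))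
  (\<lambda>i. i = 0 \<or> I (i - 1)) (\<lambda>_. None) (\<lambda>_. None) (\<lambda>_. None) (Run 0)"
  "fin (v 0)" "fN (Pst M v i) = E i"
 using assms unfolding conf_def by (simp_all add: Pst_f pstc_def nbl_def Pst_N fin_def Let_def)

text \<open>Letters are stored in pairs because the leader emits two letters from one pass to the
  next, and a pass rotates the word by one cell.\<close>

definition pr :: "'b list => nat => 'b \<times> 'b" where
 "pr w k = (w ! ((2 * k) mod length w), w ! ((2 * k + 1) mod length w))"

definition Ek :: "'b list => nat => nat => ('b \<times> 'b) option" where
 "Ek w k i = (if i < k then Some (pr w i) else None)"

definition lts :: "'b list => nat => 'b option" where
 "lts w i = (if i < length w then Some (w ! i) else None)"

definition pe :: "'b list => nat => 'b option" where
 "pe w t = (if odd t then Some (w ! ((t - 1) mod length w)) else None)"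

lemma conf_consume:
 assumes c: "conf v L R I W Oo (\<lambda>i. lts w (j + i)) (Ek w (t div 2)) (Unl (pe w t))" and j: "j < length w" "t mod length w = j"
 shows "conf (Pst M v) L R I W Oo (\<lambda>i. lts w (Suc j + i)) (Ek w (Suc t div 2)) (Unl (pe w (Suc t)))"
proof (cases "even t")
 case True
 hence "pe w t = None" "pe w (Suc t) = Some (w ! j)" "Suc t div 2 = t div 2" using j by (auto simp: pe_def)
 thus ?thesis using c j(1) unfolding conf_def by (simp add: Pst_f pstc_def nbl_def lts_def)
next
 case False
 then obtain k where k: "t = 2 * k + 1" by (auto elim: oddE)
 have p: "pe w t = Some (w ! ((2 * k) mod length w))" "pe w (Suc t) = None" "t div 2 = k" "Suc t div 2 = Suc k"
  using k by (auto simp: pe_def)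
 have q: "pr w k = (w ! ((2 * k) mod length w), w ! j)" using k j(2) by (simp add: pr_def)
 show ?thesis using c j(1) p q unfolding conf_def by (auto simp: Pst_f pstc_def nbl_def lts_def Ek_def less_Suc_eq) (metis surj_pair)+
qed

text \<open>\<open>fN\<close> is overwritten only at \<open>fin\<close>; forbidding it before the
  end keeps the previous word in place while the next one is computed.\<close>

definition reach :: "'b machine => (nat => 'b mc) => (nat => 'b mc) => nat => bool" where
 "reach M v v' s \<longleftrightarrow> v' = (Pst M ^^ s) v \<and> (\<forall>s'<s. \<not> fin ((Pst M ^^ s') v 0))"

lemma reach_0: "reach M v v 0" by (simp add: reach_def)

lemma reach_Suc: "reach M v v' s ==> \<not> fin (v' 0) ==> reach M v (Pst M v') (Suc s)"
 by (auto simp: reach_def less_Suc_eq)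

lemma reach_trans: assumes "reach M v v' s" "reach M v' v'' s'" shows "reach M v v'' (s + s')"
 unfolding reach_def
proof (intro conjI allI impI)
 have e: "(Pst M ^^ (s + k)) v = (Pst M ^^ k) v'" for k
  using assms(1) by (simp add: reach_def add.commute[of s] funpow_add)
 show "v'' = (Pst M ^^ (s + s')) v" using assms(2) unfolding e by (simp add: reach_def)
 fix k assume k: "k < s + s'"
 show "\<not> fin ((Pst M ^^ k) v 0)"
 proof (cases "k < s")
  case True thus ?thesis using assms(1) by (simp add: reach_def)
 next
  case False
  hence "k = s + (k - s)" "k - s < s'" using k by auto
  thus ?thesis using assms(2) e[of "k - s"] by (simp add: reach_def)
 qed
qed

lemma conf_fin: "conf v L R I W Oo V E Q ==> fin (v 0) \<longleftrightarrow> Q = Unl None \<and> V 0 = None"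
 by (auto simp: conf_def fin_def)

text \<open>The head stays at cell 0 and the two halves of the tape are shifted past it; a machine
  step takes two array steps, one to write and one to move.\<close>

lemma sim_step:
 assumes m: "machine_step M (q, h, T) (q', h', T')"
  and c: "conf v (\<lambda>i. T (h - 1 - int i)) (\<lambda>i. T (h + int i)) I W Oo V E (Run q)"
 shows "\<exists>v' s. reach M v v' s \<and> conf v' (\<lambda>i. T' (h' - 1 - int i)) (\<lambda>i. T' (h' + int i)) I W Oo V E (Run q')"
proof -
 obtain a d where a: "M (q, T h) = Some (q', a, d)" "h' = h + offset d" "T' = T(h := a)"
  using m by (cases rule: machine_step.cases) auto
 have r1: "(\<lambda>i. T (h + int i))(0 := a) = (\<lambda>i. T' (h + int i))" using a(3) by (auto simp: fun_eq_iff)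
 have l1: "(\<lambda>i. T (h - 1 - int i)) = (\<lambda>i. T' (h - 1 - int i))" using a(3) by (auto simp: fun_eq_iff)
 have c1: "conf (Pst M v) (\<lambda>i. T' (h - 1 - int i)) (\<lambda>i. T' (h + int i)) I W Oo V E (Mv q' d)"
  using conf_run[OF c, of M q' a d] a(1) unfolding r1 l1 by simp
 have "reach M v (Pst M (Pst M v)) (Suc (Suc 0))"
  by (intro reach_Suc reach_0) (use conf_fin[OF c] conf_fin[OF c1] in auto)
 moreover have "conf (Pst M (Pst M v)) (\<lambda>i. T' (h' - 1 - int i)) (\<lambda>i. T' (h' + int i)) I W Oo V E (Run q')"
 proof (cases d)
  case Go_Left
  have "(\<lambda>i. T' (h - 1 - int (Suc i))) = (\<lambda>i. T' (h' - 1 - int i))"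
   "(\<lambda>i. if i = 0 then T' (h - 1 - int 0) else T' (h + int (i - 1))) = (\<lambda>i. T' (h' + int i))"
   using Go_Left a(2) by (auto simp: fun_eq_iff algebra_simps of_nat_diff)
  thus ?thesis using conf_mv(1)[OF c1 Go_Left, of M] by (simp only:)
 next
  case Stay thus ?thesis using conf_mv(2)[OF c1 Stay, of M] a(2) by simp
 next
  case Go_Right
  have "(\<lambda>i. T' (h + int (Suc i))) = (\<lambda>i. T' (h' + int i))"
   "(\<lambda>i. if i = 0 then T' (h + int 0) else T' (h - 1 - int (i - 1))) = (\<lambda>i. T' (h' - 1 - int i))"
   using Go_Right a(2) by (auto simp: fun_eq_iff algebra_simps of_nat_diff)
  thus ?thesis using conf_mv(3)[OF c1 Go_Right, of M] by (simp only:)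
 qed
 ultimately show ?thesis by blast
qed

lemma sim:
 assumes "(machine_step M)\<^sup>*\<^sup>* (q, h, T) (q', h', T')"
  and c: "conf v (\<lambda>i. T (h - 1 - int i)) (\<lambda>i. T (h + int i)) I W Oo V E (Run q)"
 shows "\<exists>v' s. reach M v v' s \<and> conf v' (\<lambda>i. T' (h' - 1 - int i)) (\<lambda>i. T' (h' + int i)) I W Oo V E (Run q')"
 using assms(1)
proof (induction "(q', h', T')" arbitrary: q' h' T' rule: rtranclp_induct)
 case base thus ?case using c reach_0 by blast
next
 case (step y)
 obtain q1 h1 T1 where y: "y = (q1, h1, T1)" by (cases y)
 obtain v1 s1 where v1: "reach M v v1 s1" "conf v1 (\<lambda>i. T1 (h1 - 1 - int i)) (\<lambda>i. T1 (h1 + int i)) I W Oo V E (Run q1)"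
  using step(3)[OF y] by blast
 obtain v2 s2 where "reach M v1 v2 s2" "conf v2 (\<lambda>i. T' (h' - 1 - int i)) (\<lambda>i. T' (h' + int i)) I W Oo V E (Run q')"
  using sim_step[OF step(2)[unfolded y] v1(2)] by blast
 thus ?case using reach_trans[OF v1(1)] by blast
qed

definition start :: "nat => (nat => 'b mc) => bool" where
 "start n v \<longleftrightarrow> conf v (\<lambda>_. Blank) (\<lambda>i. if i < n then Mark 0 else Blank) (\<lambda>i. i < n) (\<lambda>i. i < n)
   (\<lambda>_. None) (\<lambda>_. None) (\<lambda>_. None) (Run 0)"

text \<open>The number of pairs after which the repetition of \<open>w\<close> starts again: an odd
  word has to be traversed twice.\<close>

definition ell :: "'b list => nat" where
 "ell w = (if even (length w) then length w div 2 else length w)"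

text \<open>The delay of \<open>n\<close> steps in round \<open>n\<close> makes the rounds grow; it
  is the source of \<open>T n + n < T (Suc n)\<close>, on which \<open>idx_two\<close>
  rests.\<close>

lemma wait_phase:
 assumes "conf v L R I (\<lambda>i. i < k) Oo V E (Run q)" "M (q, R 0) = None"
 shows "\<exists>v'. reach M v v' k \<and> conf v' L R I (\<lambda>_. False) Oo V E (Run q)"
 using assms(1)
proof (induction k arbitrary: v)
 case 0 thus ?case using reach_0 by (intro exI[of _ v]) auto
next
 case (Suc k)
 have "conf (Pst M v) L R I (\<lambda>i. i < k) Oo V E (Run q)" using conf_wait(1)[of v L R I "\<lambda>i. i < Suc k" Oo V E q M] Suc.prems assms(2) by simp
 then obtain v' where v': "reach M (Pst M v) v' k" "conf v' L R I (\<lambda>_. False) Oo V E (Run q)" using Suc.IH by blast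
 have "reach M v (Pst M v) (Suc 0)" by (intro reach_Suc reach_0) (use conf_fin[OF Suc.prems] in auto)
 thus ?case using reach_trans[OF _ v'(1), of v "Suc 0"] v'(2) by auto
qed

lemma consume_phase:
 assumes "conf v L R I W Oo (\<lambda>i. lts w (0 + i)) (Ek w (t div 2)) (Unl (pe w t))" "t mod length w = 0" "c \<le> length w"
 shows "\<exists>v'. reach M v v' c \<and> conf v' L R I W Oo (\<lambda>i. lts w (c + i)) (Ek w ((t + c) div 2)) (Unl (pe w (t + c)))"
 using assms(3)
proof (induction c)
 case 0 thus ?case using assms(1) reach_0 by (intro exI[of _ v]) auto
next
 case (Suc c)
 then obtain v' where v': "reach M v v' c" "conf v' L R I W Oo (\<lambda>i. lts w (c + i)) (Ek w ((t + c) div 2)) (Unl (pe w (t + c)))" by auto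
 have "(t + c) mod length w = c" using assms(2) Suc.prems by (simp add: mod_add_left_eq[of t, symmetric])
 hence "conf (Pst M v') L R I W Oo (\<lambda>i. lts w (Suc c + i)) (Ek w (Suc (t + c) div 2)) (Unl (pe w (Suc (t + c))))"
  using conf_consume[OF v'(2)] Suc.prems by simp
 moreover have "\<not> fin (v' 0)" using conf_fin[OF v'(2)] Suc.prems by (simp add: lts_def)
 ultimately show ?case using reach_Suc[OF v'(1)] by (intro exI[of _ "Pst M v'"]) simp
qed

lemma unload:
 assumes c: "conf v L R I W (lts w) (lts w) (\<lambda>_. None) (Unl None)" and w: "w \<noteq> []"
 shows "\<exists>v' s. reach M v v' s \<and> ell w \<le> s \<and> conf v' L R I W (lts w) (\<lambda>i. lts w (length w + i)) (Ek w (ell w)) (Unl None)"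
proof -
 have e: "Ek w 0 = (\<lambda>_. None)" "pe w 0 = None" by (auto simp: Ek_def pe_def)
 have "conf v L R I W (lts w) (\<lambda>i. lts w (0 + i)) (Ek w (0 div 2)) (Unl (pe w 0))" using c e by simp
 from consume_phase[OF this, of "length w" M]
 obtain v1 where v1: "reach M v v1 (length w)"
  "conf v1 L R I W (lts w) (\<lambda>i. lts w (length w + i)) (Ek w (length w div 2)) (Unl (pe w (length w)))" by auto
 show ?thesis
 proof (cases "even (length w)")
  case True
  hence "pe w (length w) = None" by (simp add: pe_def)
  thus ?thesis using v1 True by (intro exI[of _ v1] exI[of _ "length w"]) (auto simp: ell_def)
 next
  case False
  then obtain z where z: "pe w (length w) = Some z" by (auto simp: pe_def)
  have "conf (Pst M v1) L R I W (lts w) (lts w) (Ek w (length w div 2)) (Unl (Some z))"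
   by (rule conf_reload) (use v1(2) z in \<open>auto simp: lts_def\<close>)
  hence c2: "conf (Pst M v1) L R I W (lts w) (\<lambda>i. lts w (0 + i)) (Ek w (length w div 2)) (Unl (pe w (length w)))" using z by simp
  have r2: "reach M v (Pst M v1) (Suc (length w))" by (rule reach_Suc[OF v1(1)]) (use conf_fin[OF v1(2)] z in auto)
  from consume_phase[OF c2, of "length w" M]
  obtain v2 where v2: "reach M (Pst M v1) v2 (length w)"
   "conf v2 L R I W (lts w) (\<lambda>i. lts w (length w + i)) (Ek w ((length w + length w) div 2)) (Unl (pe w (length w + length w)))" by auto
  have "pe w (length w + length w) = None" "(length w + length w) div 2 = ell w" using False by (auto simp: pe_def ell_def)
  thus ?thesis using v2(2) reach_trans[OF r2 v2(1)] by (intro exI[of _ v2] exI[of _ "Suc (length w) + length w"]) (auto simp: ell_def)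
 qed
qed

lemma round:
 assumes st: "start n v" and w: "w \<noteq> []"
  and m: "(machine_step M)\<^sup>*\<^sup>* (0, 0, input_tape n) (q, h, output_tape w h)" "M (q, output_tape w h h) = None"
 shows "\<exists>v' s. reach M v v' s \<and> n \<le> s \<and> ell w \<le> s \<and> fin (v' 0) \<and> start (Suc n) (Pst M v') \<and> (\<forall>i. fN (Pst M v' i) = Ek w (ell w) i)"
proof -
 have t: "(\<lambda>_. Blank) = (\<lambda>i. input_tape n (0 - 1 - int i))" "(\<lambda>i. if i < n then Mark 0 else Blank) = (\<lambda>i. input_tape n (0 + int i))"
  by (auto simp: input_tape_def fun_eq_iff)
 obtain v1 s1 where v1: "reach M v v1 s1" "conf v1 (\<lambda>i. output_tape w h (h - 1 - int i)) (\<lambda>i. output_tape w h (h + int i))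
   (\<lambda>i. i < n) (\<lambda>i. i < n) (\<lambda>_. None) (\<lambda>_. None) (\<lambda>_. None) (Run q)"
  using sim[OF m(1) st[unfolded start_def t]] by blast
 have mh: "M (q, output_tape w h (h + int 0)) = None" using m(2) by simp
 obtain v2 where v2: "reach M v1 v2 n" "conf v2 (\<lambda>i. output_tape w h (h - 1 - int i)) (\<lambda>i. output_tape w h (h + int i))
   (\<lambda>i. i < n) (\<lambda>_. False) (\<lambda>_. None) (\<lambda>_. None) (\<lambda>_. None) (Run q)"
  using wait_phase[of v1 "\<lambda>i. output_tape w h (h - 1 - int i)" "\<lambda>i. output_tape w h (h + int i)" "\<lambda>i. i < n" n
   "\<lambda>_. None" "\<lambda>_. None" "\<lambda>_. None" q M] v1(2) mh by blast
 have l: "(\<lambda>i. letter (output_tape w h (h + int i))) = lts w" by (auto simp: output_tape_def lts_def fun_eq_iff)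
 have c3: "conf (Pst M v2) (\<lambda>i. output_tape w h (h - 1 - int i)) (\<lambda>i. output_tape w h (h + int i))
   (\<lambda>i. i < n) (\<lambda>_. False) (lts w) (lts w) (\<lambda>_. None) (Unl None)"
  using conf_wait(2)[OF v2(2)] m(2) unfolding l by simp
 have r3: "reach M v (Pst M v2) (Suc (s1 + n))" by (intro reach_Suc reach_trans[OF v1(1) v2(1)]) (use conf_fin[OF v2(2)] in auto)
 from unload[OF c3 w, of M]
 obtain v4 s4 where v4: "reach M (Pst M v2) v4 s4" "ell w \<le> s4" "conf v4 (\<lambda>i. output_tape w h (h - 1 - int i)) (\<lambda>i. output_tape w h (h + int i))
   (\<lambda>i. i < n) (\<lambda>_. False) (lts w) (\<lambda>i. lts w (length w + i)) (Ek w (ell w)) (Unl None)" by blast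
 have z: "lts w (length w + 0) = None" by (simp add: lts_def)
 have i: "(\<lambda>i. i = 0 \<or> i - 1 < n) = (\<lambda>i. i < Suc n)" "(\<lambda>i. if i = 0 \<or> i - 1 < n then Mark 0 else Blank) = (\<lambda>i. if i < Suc n then Mark 0 else Blank)"
  by (auto simp: fun_eq_iff)
 have "start (Suc n) (Pst M v4)" using conf_finish(1)[OF v4(3) z, of M] unfolding start_def i .
 thus ?thesis using conf_finish(2,3)[OF v4(3) z] reach_trans[OF r3 v4(1)] v4(2)
  by (intro exI[of _ v4] exI[of _ "Suc (s1 + n) + s4"]) auto
qed

lemma U_reach: "reach M (U M x) v s ==> v = U M (x + s)"
 by (simp add: reach_def U_def funpow_add add.commute[of x])

text \<open>Word \<open>n\<close> is stored when round \<open>n\<close> ends and stays in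
  \<open>fN\<close> throughout round \<open>n + 1\<close>; hence the index shift in the last
  conclusion.\<close>

lemma schedule:
 assumes w: "\<And>n. w n \<noteq> []"
  and m: "\<And>n. \<exists>q h. (machine_step M)\<^sup>*\<^sup>* (0, 0, input_tape n) (q, h, output_tape (w n) h) \<and> M (q, output_tape (w n) h h) = None"
 obtains T where "T 0 = 0" "\<And>n. T n + n < T (Suc n)" "\<And>n. ell (w n) \<le> T (Suc n)" "\<And>n. fin (U M (T (Suc n) - 1) 0)"
  "\<And>n s i. T (Suc n) \<le> s ==> s < T (Suc (Suc n)) ==> fN (U M s i) = Ek (w n) (ell (w n)) i"
proof -
 define P where "P n x \<longleftrightarrow> start n (U M x) \<and> (n = 0 --> x = 0)" for n x
 define Q where "Q n x y \<longleftrightarrow> x + n < y \<and> ell (w n) \<le> y \<and> fin (U M (y - 1) 0) \<and> (\<forall>s. x \<le> s \<and> s < y - 1 --> \<not> fin (U M s 0))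
  \<and> (\<forall>i. fN (U M y i) = Ek (w n) (ell (w n)) i)" for n x y
 have "\<exists>T. \<forall>n. P n (T n) \<and> Q n (T n) (T (Suc n))"
 proof (rule dependent_nat_choice)
  show "\<exists>x. P 0 x" by (auto simp: P_def start_def U_0 conf_def cell0_def)
  fix x n assume P: "P n x"
  obtain q h where qh: "(machine_step M)\<^sup>*\<^sup>* (0, 0, input_tape n) (q, h, output_tape (w n) h)" "M (q, output_tape (w n) h h) = None"
   using m by blast
  have "start n (U M x)" using P by (simp add: P_def)
  from round[OF this w qh] obtain v' s where s: "reach M (U M x) v' s" "n \<le> s" "ell (w n) \<le> s" "fin (v' 0)" "start (Suc n) (Pst M v')"
   "\<forall>i. fN (Pst M v' i) = Ek (w n) (ell (w n)) i" by blast
  have v': "v' = U M (x + s)" by (rule U_reach[OF s(1)])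
  have nf: "\<not> fin (U M s' 0)" if "x \<le> s'" "s' < x + s" for s'
  proof -
   have "(Pst M ^^ (s' - x)) (U M x) = U M s'" using that by (simp add: U_def funpow_add[symmetric, unfolded comp_def, THEN fun_cong])
   moreover have "s' - x < s" using that by simp
   ultimately show ?thesis using s(1) unfolding reach_def by metis
  qed
  show "\<exists>y. P (Suc n) y \<and> Q n x y"
   using s nf unfolding v' by (intro exI[of _ "Suc (x + s)"]) (auto simp: P_def Q_def U_Suc)
 qed
 then obtain T where T: "\<And>n. P n (T n)" "\<And>n. Q n (T n) (T (Suc n))" by blast
 have N: "fN (U M (T (Suc n) + d) i) = Ek (w n) (ell (w n)) i" if "T (Suc n) + d < T (Suc (Suc n))" for n d i
  using that
 proof (induction d)
  case 0 thus ?case using T(2)[of n] by (simp add: Q_def)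
 next
  case (Suc d)
  hence "\<not> fin (U M (T (Suc n) + d) 0)" using T(2)[of "Suc n"] by (simp add: Q_def)
  thus ?case using Suc by (simp add: U_Suc Pst_N)
 qed
 show thesis
 proof (rule that[of T])
  show "T 0 = 0" using T(1)[of 0] by (simp add: P_def)
  show "T n + n < T (Suc n)" "ell (w n) \<le> T (Suc n)" "fin (U M (T (Suc n) - 1) 0)" for n using T(2)[of n] by (auto simp: Q_def)
  show "fN (U M s i) = Ek (w n) (ell (w n)) i" if "T (Suc n) \<le> s" "s < T (Suc (Suc n))" for n s i
   using N[of n "s - T (Suc n)" i] that by simp
 qed
qed

lemma core_clr [simp]: "core (clr x) = core cell0"
 by (simp add: core_def clr_def cell0_def)

lemma not_dvd_between: "Suc j < g ==> \<not> g dvd q * g + Suc j" for g :: nat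
 using dvd_add_right_iff[of g "q * g" "Suc j"] nat_dvd_not_less[of "Suc j" g] by simp

lemma phi_f:
 "fA (phi M c l x r) \<longleftrightarrow> (if fA c then fA (bl r) else True)"
 "fB (phi M c l x r) \<longleftrightarrow> (if fA c then fB x else if fB c then fB (bl r) else True)"
 "fA c ==> core (phi M c l x r) = core x" "fA c ==> fN (phi M c l x r) = fN x"
 "\<not> fA c ==> fB c ==> core (phi M c l x r) = core (pst M c l x r)"
 "\<not> fA c ==> fB c ==> fN (phi M c l x r) = fN (pst M c l x r)"
 "\<not> fA c ==> \<not> fB c ==> core (phi M c l x r) = core cell0"
 "\<not> fA c ==> \<not> fB c ==> fN (phi M c l x r) = fN x"
 "\<not> fA c ==> \<not> fB c ==> fC (phi M c l x r) = fN x"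
 "fA c \<or> fB c ==> fC (phi M c l x r) = rot c x r"
 by (auto simp: phi_def)

lemma bl_nbr: "fA (bl (nbr n v i)) \<longleftrightarrow> Suc i < n \<and> fA (v (Suc i))" "fB (bl (nbr n v i)) \<longleftrightarrow> Suc i < n \<and> fB (v (Suc i))"
 "fC (bl (nbr n v i)) = (if Suc i < n then fC (v (Suc i)) else None)"
 by (auto simp: bl_def nbr_def)

text \<open>A restart occurs when both clocks are exhausted, once in \<open>(n + 1)\<^sup>2\<close>
  updates. Between two restarts the machine makes exactly \<open>n\<close> steps from
  \<open>cell0\<close>, so at the second one \<open>fN\<close> agrees with \<open>U M n\<close>
  whatever it held at the first. It is then copied to \<open>fC\<close> and rotates until the next
  restart.\<close>

lemma array_stream:
 fixes V :: "nat => nat => 'b mc"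
 assumes rec: "\<And>p i. i < n ==> V (Suc p) i = phi M (V p 0) (nbl (V p) i) (V p i) (nbr n (V p) i)" and n: "0 < n"
  and f: "fin (U M s0 0)" "s0 < n" and N: "\<And>i. fN (U M n i) = Ek w (ell w) i" and w: "w \<noteq> []" "ell w \<le> n"
 obtains P1 where "0 < P1" "P1 \<le> 2 * (n + 1)\<^sup>2"
  "\<And>p. fC (V (P1 + p) 0) = Some (pr w ((p mod (n + 1)\<^sup>2) mod ell w))"
proof -
 define g where "g = Suc n"
 obtain p0 where p0: "p0 \<le> n" "\<And>p. \<not> fA (V (p0 + p) 0) \<longleftrightarrow> g dvd p"
  by (rule clock[of n "\<lambda>p i. fA (V p i)"]) (use rec n in \<open>auto simp: phi_f(1) bl_nbr g_def\<close>)
 define Y where "Y q = V (p0 + q * g)" for q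
 have tick: "\<not> fA (Y q 0)" for q unfolding Y_def p0(2) by simp
 have keep: "core (V (p0 + q * g + Suc j) i) = core (V (Suc (p0 + q * g)) i) \<and>
   fN (V (p0 + q * g + Suc j) i) = fN (V (Suc (p0 + q * g)) i) \<and>
   fB (V (p0 + q * g + Suc j) i) = fB (V (Suc (p0 + q * g)) i)" if "j \<le> n" "i < n" for q j i
  using that(1)
 proof (induction j)
  case (Suc j)
  have "\<not> g dvd q * g + Suc j" using Suc.prems by (intro not_dvd_between) (simp add: g_def)
  hence a: "fA (V (p0 + q * g + Suc j) 0)" using p0(2)[of "q * g + Suc j"] by (simp only: add.assoc) blast
  have "V (p0 + q * g + Suc (Suc j)) i = phi M (V (p0 + q * g + Suc j) 0) (nbl (V (p0 + q * g + Suc j)) i)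
    (V (p0 + q * g + Suc j) i) (nbr n (V (p0 + q * g + Suc j)) i)" using rec[OF that(2), of "p0 + q * g + Suc j"] by simp
  thus ?case using Suc a by (simp add: phi_f)
 qed simp
 have YS: "core (Y (Suc q) i) = core (V (Suc (p0 + q * g)) i)" "fN (Y (Suc q) i) = fN (V (Suc (p0 + q * g)) i)"
  "fB (Y (Suc q) i) = fB (V (Suc (p0 + q * g)) i)" if "i < n" for q i
 proof -
  have e: "p0 + Suc q * g = p0 + q * g + Suc n" by (simp add: g_def)
  show "core (Y (Suc q) i) = core (V (Suc (p0 + q * g)) i)" "fN (Y (Suc q) i) = fN (V (Suc (p0 + q * g)) i)"
   "fB (Y (Suc q) i) = fB (V (Suc (p0 + q * g)) i)"
   using keep[of n i q] that unfolding Y_def e by simp_all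
 qed
 have VY: "V (Suc (p0 + q * g)) i = phi M (Y q 0) (nbl (Y q) i) (Y q i) (nbr n (Y q) i)" if "i < n" for q i
  using rec[OF that, of "p0 + q * g"] by (simp add: Y_def)
 have YB: "fB (Y (Suc q) i) \<longleftrightarrow> (if fB (Y q 0) then Suc i < n \<and> fB (Y q (Suc i)) else True)" if "i < n" for q i
  using YS(3)[OF that, of q] VY[OF that, of q] tick[of q] by (simp add: phi_f(2) bl_nbr)
 obtain q0 where q0: "q0 \<le> n" "\<And>q. \<not> fB (Y (q0 + q) 0) \<longleftrightarrow> g dvd q"
  by (rule clock[of n "\<lambda>q i. fB (Y q i)"]) (use n YB in \<open>auto simp: g_def\<close>)
 have NY: "fN (Y (q0 + Suc k * g) i) = Ek w (ell w) i" if i: "i < n" for k i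
 proof -
  define y where "y = q0 + k * g"
  have ry: "\<not> fB (Y y 0)" unfolding y_def q0(2) by simp
  have nr: "fB (Y (y + Suc s) 0)" if "s < n" for s
  proof -
   have "\<not> g dvd k * g + Suc s" using that by (intro not_dvd_between) (simp add: g_def)
   thus ?thesis using q0(2)[of "k * g + Suc s"] unfolding y_def by (simp only: add.assoc) blast
  qed
  have "fN (Y (y + Suc n) i) = fN (U M n i)"
  proof (rule trunc_N[of n "\<lambda>s. Y (y + Suc s)" M s0 n i])
   show "core (Y (y + Suc 0) i) = core cell0" if "i < n" for i
    using YS(1)[OF that, of y] VY[OF that, of y] tick[of y] ry by (simp add: phi_f)
   show "core (Y (y + Suc (Suc s)) i) = core (pst M (Y (y + Suc s) 0) (nbl (Y (y + Suc s)) i) (Y (y + Suc s) i) (nbr n (Y (y + Suc s)) i))"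
    "fN (Y (y + Suc (Suc s)) i) = fN (pst M (Y (y + Suc s) 0) (nbl (Y (y + Suc s)) i) (Y (y + Suc s) i) (nbr n (Y (y + Suc s)) i))"
    if "s < n" "i < n" for s i
    using YS(1,2)[OF that(2), of "y + Suc s"] VY[OF that(2), of "y + Suc s"] tick[of "y + Suc s"] nr[OF that(1)] by (simp_all add: phi_f)
  qed (use f i in auto)
  moreover have "y + Suc n = q0 + Suc k * g" by (simp add: y_def g_def)
  ultimately show ?thesis using N by simp
 qed
 define c where "c = g * g"
 define rr where "rr k = p0 + q0 * g + k * c" for k
 have rY: "V (rr k) = Y (q0 + k * g)" for k
  unfolding rr_def Y_def c_def by (simp add: algebra_simps)
 have nores: "fA (V (rr k + Suc j) 0) \<or> fB (V (rr k + Suc j) 0)" if j: "Suc j < c" for k j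
 proof (rule ccontr)
  assume a: "\<not> ?thesis"
  have e: "rr k + Suc j = p0 + (q0 * g + k * c + Suc j)" by (simp add: rr_def)
  from a have "g dvd q0 * g + k * c + Suc j" using p0(2) unfolding e by blast
  hence "g dvd Suc j" unfolding c_def by (metis dvd_add_right_iff dvd_triv_right dvd_mult)
  then obtain d where d: "Suc j = g * d" by (auto elim: dvdE)
  have "rr k + Suc j = p0 + (q0 + (k * g + d)) * g" unfolding rr_def c_def d by (simp add: algebra_simps)
  hence "V (rr k + Suc j) = Y (q0 + (k * g + d))" by (simp only: Y_def)
  hence "g dvd k * g + d" using a q0(2)[of "k * g + d"] by simp
  hence "g dvd d" by (metis dvd_add_right_iff dvd_triv_right)
  hence "c dvd Suc j" unfolding c_def d by (rule mult_dvd_mono[OF dvd_refl])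
  thus False using j by (auto dest: dvd_imp_le)
 qed
 define l where "l = ell w"
 have l0: "0 < l"
 proof -
  have "0 < (if even N then N div 2 else N)" if "0 < N" for N :: nat using that by (auto elim: evenE)
  thus ?thesis using w(1) unfolding l_def ell_def by blast
 qed
 have C: "fC (V (rr (Suc k) + Suc j) i) = (if i < l then Some (pr w ((i + j) mod l)) else None)" if "j < c" "i < n" for k j i
  using that
 proof (induction j arbitrary: i)
  case 0
  have "V (Suc (rr (Suc k))) i = phi M (V (rr (Suc k)) 0) (nbl (V (rr (Suc k))) i) (V (rr (Suc k)) i) (nbr n (V (rr (Suc k))) i)"
   by (rule rec[OF 0(2)])
  moreover have "\<not> fA (V (rr (Suc k)) 0)" "\<not> fB (V (rr (Suc k)) 0)" unfolding rY q0(2) using tick by (simp_all del: mult_Suc)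
  moreover have "fN (V (rr (Suc k)) i) = Ek w l i" unfolding rY l_def by (rule NY[OF 0(2)])
  ultimately show ?case by (simp add: phi_f Ek_def)
 next
  case (Suc j)
  have IH: "fC (V (rr (Suc k) + Suc j) i) = (if i < l then Some (pr w ((i + j) mod l)) else None)" if "i < n" for i
   using Suc that by simp
  have nr: "fA (V (rr (Suc k) + Suc j) 0) \<or> fB (V (rr (Suc k) + Suc j) 0)" using nores[of j "Suc k"] Suc.prems by simp
  have "fC (V (rr (Suc k) + Suc (Suc j)) i) = rot (V (rr (Suc k) + Suc j) 0) (V (rr (Suc k) + Suc j) i) (nbr n (V (rr (Suc k) + Suc j)) i)"
   using rec[OF Suc.prems(2), of "rr (Suc k) + Suc j"] phi_f(10)[OF nr] by simp
  moreover have "(i + Suc j) mod l = j mod l" if "Suc i = l"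
  proof -
   have e: "i + Suc j = j + l" using that by simp
   show ?thesis unfolding e by simp
  qed
  ultimately show ?case using IH[OF Suc.prems(2)] IH[of "Suc i"] IH[OF n] l0 w(2) unfolding rot_def bl_nbr
   by (cases "Suc i < l") (auto simp: l_def less_Suc_eq)
 qed
 have cc: "c = (n + 1)\<^sup>2" by (simp add: c_def g_def power2_eq_square)
 show thesis
 proof (rule that[of "rr 1 + 1"])
  show "0 < rr 1 + 1" by simp
  have "p0 + q0 * g \<le> n + n * g" using p0(1) q0(1) by (intro add_mono mult_mono) auto
  thus "rr 1 + 1 \<le> 2 * (n + 1)\<^sup>2" unfolding cc[symmetric] rr_def by (simp add: c_def g_def)
  fix p
  have "p = p div c * c + p mod c" by simp
  moreover have "p mod c < c" by (rule mod_less_divisor) (simp add: c_def g_def)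
  moreover have "rr 1 + 1 + p = rr (Suc (p div c)) + Suc (p mod c)" unfolding rr_def using calculation(1) by simp
  ultimately show "fC (V (rr 1 + 1 + p) 0) = Some (pr w ((p mod (n + 1)\<^sup>2) mod ell w))"
   using C[of "p mod c" 0 "p div c"] n l0 unfolding cc[symmetric] l_def by simp
 qed
qed

text \<open>A pass sweeps the train from head to tail. A block with the token \<open>tok\<close> offers its right neighbour the
 contents, before the pass, of the leading cell (\<open>g0\<close>) and of its own cell (\<open>gl\<close>). The phase \<open>ph\<close>
 selects the letter of the current pair that is emitted.\<close>

datatype 'b st = ST (cm: "'b mc") (g0: "'b mc") (gl: "'b mc") (tok: bool) (ph: bool) (dgt: bool) (cry: bool)

definition updm :: "'b machine => 'b st option => 'b st => 'b st option => bool => 'b st" where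
 "updm M l s r h = (let ci = (case r of None => True | Some s' => cry s'); D = (dgt s \<noteq> ci); Y = (dgt s \<and> ci) in
   case l of
    None => if h then ST (cm s) (g0 s) (gl s) False (ph s) D Y
     else if \<not> ph s then ST (cm s) (g0 s) (gl s) False True D Y
     else ST (phi M (cm s) None (cm s) (map_option cm r)) (cm s) (cm s) True False D Y
   | Some s' => if tok s' then ST (phi M (g0 s') (Some (gl s')) (cm s) (map_option cm r)) (g0 s') (cm s) True (ph s) D Y
     else ST (cm s) (g0 s) (gl s) False (ph s) D Y)"

definition outm :: "'b => 'b st => 'b" where
 "outm b s = (case fC (cm s) of None => b | Some (x, y) => if ph s then y else x)"

section \<open>Passes turn a train into a synchronous array\<close>

locale train_run =
 fixes M :: "'b machine" and n :: nat and X :: "nat => nat => 'b st" and H :: "nat => bool"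
 assumes n: "0 < n" and rec: "\<And>v i. i < n ==> X (Suc v) i = updm M (nbl (X v) i) (X v i) (nbr n (X v) i) (H v)"
  and hh: "\<And>v. \<not> (H v \<and> H (Suc v))"
begin

definition pass :: "nat => bool" where "pass v \<longleftrightarrow> \<not> H v \<and> ph (X v 0)"

lemma ph_rec: "ph (X (Suc v) 0) = (if H v then ph (X v 0) else \<not> ph (X v 0))"
 using rec[OF n, of v] by (simp add: updm_def nbl_def Let_def)

lemma tok_0: "tok (X (Suc v) 0) = pass v"
 using rec[OF n, of v] by (simp add: updm_def nbl_def Let_def pass_def)

lemma tok_Suc: "Suc i < n ==> tok (X (Suc v) (Suc i)) = tok (X v i)"
 using rec[of "Suc i" v] by (simp add: updm_def nbl_def Let_def)

lemma tok_eq: "i < n ==> tok (X (v + Suc i) i) = pass v"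
proof (induction i)
 case 0 thus ?case using tok_0 by simp
next
 case (Suc i) thus ?case using tok_Suc[of i "v + Suc i"] by simp
qed

lemma cm_0: "cm (X (Suc v) 0) = (if pass v then phi M (cm (X v 0)) None (cm (X v 0)) (map_option cm (nbr n (X v) 0)) else cm (X v 0))"
 "pass v ==> g0 (X (Suc v) 0) = cm (X v 0) \<and> gl (X (Suc v) 0) = cm (X v 0)"
 using rec[OF n, of v] by (auto simp: updm_def nbl_def Let_def pass_def)

lemma cm_Suc:
 assumes "Suc i < n"
 shows "cm (X (v + Suc (Suc i)) (Suc i)) = (if pass v then phi M (g0 (X (v + Suc i) i)) (Some (gl (X (v + Suc i) i))) (cm (X (v + Suc i) (Suc i)))
   (map_option cm (nbr n (X (v + Suc i)) (Suc i))) else cm (X (v + Suc i) (Suc i)))"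
  "pass v ==> g0 (X (v + Suc (Suc i)) (Suc i)) = g0 (X (v + Suc i) i) \<and> gl (X (v + Suc (Suc i)) (Suc i)) = cm (X (v + Suc i) (Suc i))"
 using rec[OF assms, of "v + Suc i"] tok_eq[of i v] assms by (auto simp: updm_def nbl_def Let_def)

lemma msg: "pass v ==> i < n ==> g0 (X (v + Suc i) i) = cm (X v 0) \<and> gl (X (v + Suc i) i) = cm (X (v + i) i)"
proof (induction i)
 case 0 thus ?case using cm_0(2) by simp
next
 case (Suc i) thus ?case using cm_Suc(2)[of i v] by simp
qed

lemma cm_nopass: "\<not> pass v ==> i < n ==> cm (X (v + Suc i) i) = cm (X (v + i) i)"
 using cm_0(1)[of v] cm_Suc(1)[of "i - 1" v] by (cases i) auto

text \<open>The pass reaches cell \<open>i\<close> when the cells 0 and \<open>i - 1\<close> have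
  already been updated; their contents before the pass arrive as \<open>g0\<close> and
  \<open>gl\<close>.\<close>

lemma cm_pass:
 assumes "pass v" "i < n"
 shows "cm (X (v + Suc i) i) = phi M (cm (X v 0)) (if i = 0 then None else Some (cm (X (v + i - 1) (i - 1)))) (cm (X (v + i) i))
  (map_option cm (nbr n (X (v + i)) i))"
proof (cases i)
 case 0 thus ?thesis using cm_0(1)[of v] assms by simp
next
 case (Suc k)
 thus ?thesis using cm_Suc(1)[of k v] msg[of v k] assms by simp
qed

lemma cm_const: "(\<And>u. v \<le> u ==> u < v + d ==> \<not> pass u) ==> i < n ==> cm (X (v + d + i) i) = cm (X (v + i) i)"
proof (induction d)
 case (Suc d)
 have "cm (X (v + d + Suc i) i) = cm (X (v + d + i) i)" using Suc by (intro cm_nopass) auto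
 thus ?case using Suc by simp
qed simp

lemma pass_apart: "pass v ==> \<not> pass (Suc v)"
 using ph_rec[of v] by (simp add: pass_def)

lemma nonhop: "\<exists>u. v \<le> u \<and> u \<le> v + 1 \<and> \<not> H u \<and> ph (X u 0) = ph (X v 0)"
proof (cases "H v")
 case True
 thus ?thesis using hh[of v] ph_rec[of v] by (intro exI[of _ "Suc v"]) auto
qed (intro exI[of _ v], auto)

lemma pass_soon: "\<exists>u. v \<le> u \<and> u \<le> v + 3 \<and> pass u"
proof -
 obtain u where u: "v \<le> u" "u \<le> v + 1" "\<not> H u" "ph (X u 0) = ph (X v 0)" using nonhop by blast
 show ?thesis
 proof (cases "ph (X v 0)")
  case True thus ?thesis using u by (intro exI[of _ u]) (auto simp: pass_def)
 next
  case False
  hence "ph (X (Suc u) 0)" using ph_rec[of u] u by simp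
  moreover obtain u' where "Suc u \<le> u'" "u' \<le> Suc u + 1" "\<not> H u'" "ph (X u' 0) = ph (X (Suc u) 0)" using nonhop by blast
  ultimately show ?thesis using u by (intro exI[of _ u']) (auto simp: pass_def)
 qed
qed

text \<open>A pass at time 0 is left out because \<open>W_rec\<close> inspects the step before each
  pass.\<close>

definition PS :: "nat set" where "PS = {v. 1 \<le> v \<and> pass v}"

lemma PS_inf: "infinite PS"
 unfolding infinite_nat_iff_unbounded_le
proof
 fix k
 obtain u where "Suc k \<le> u" "pass u" using pass_soon by blast
 thus "\<exists>n\<ge>k. n \<in> PS" by (intro exI[of _ u]) (auto simp: PS_def)
qed

definition \<tau> :: "nat => nat" where "\<tau> = enumerate PS"

lemma \<tau>_pass: "pass (\<tau> p)" "1 \<le> \<tau> p"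
 using enumerate_in_set[OF PS_inf, of p] by (auto simp: \<tau>_def PS_def)

lemma \<tau>_less: "\<tau> p < \<tau> (Suc p)"
 unfolding \<tau>_def by (rule enumerate_step[OF PS_inf])

lemma \<tau>_between: "\<tau> p < v ==> v < \<tau> (Suc p) ==> \<not> pass v"
proof
 assume a: "\<tau> p < v" "v < \<tau> (Suc p)" "pass v"
 have "\<tau> (Suc p) = (LEAST s. s \<in> PS \<and> \<tau> p < s)" unfolding \<tau>_def by (rule enumerate_Suc''[OF PS_inf])
 also have "\<dots> \<le> v" using a \<tau>_pass(2)[of p] by (intro Least_le) (auto simp: PS_def)
 finally show False using a by simp
qed

lemma \<tau>_bound: "\<tau> p \<le> 4 * (p + 1)"
proof (induction p)
 case 0
 obtain u where u: "1 \<le> u" "u \<le> 1 + 3" "pass u" using pass_soon by blast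
 have "\<tau> 0 = (LEAST s. s \<in> PS)" unfolding \<tau>_def by (rule enumerate_0)
 also have "\<dots> \<le> u" using u by (intro Least_le) (auto simp: PS_def)
 finally show ?case using u by simp
next
 case (Suc p)
 obtain u where u: "Suc (\<tau> p) \<le> u" "u \<le> Suc (\<tau> p) + 3" "pass u" using pass_soon by blast
 have "\<tau> (Suc p) \<le> u" using \<tau>_between[of p u] u by linarith
 thus ?case using Suc u by simp
qed

text \<open>Time is skewed by one step per cell: each cell is read at the moment when pass
  \<open>p\<close> reaches it. In this frame a pass is a simultaneous update of all cells.\<close>

definition W :: "nat => nat => 'b mc" where "W p i = cm (X (\<tau> p + i) i)"

lemma W_Suc: assumes "i < n" shows "W (Suc p) i = cm (X (\<tau> p + Suc i) i)"
proof -
 define d where "d = \<tau> (Suc p) - Suc (\<tau> p)"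
 have d: "\<tau> (Suc p) = Suc (\<tau> p) + d" using \<tau>_less[of p] by (simp add: d_def)
 have "cm (X (Suc (\<tau> p) + d + i) i) = cm (X (Suc (\<tau> p) + i) i)"
  by (rule cm_const[OF _ assms]) (use \<tau>_between[of p] d in auto)
 thus ?thesis unfolding W_def d by simp
qed

lemma W_rec: assumes "i < n" shows "W (Suc p) i = phi M (W p 0) (nbl (W p) i) (W p i) (nbr n (W p) i)"
proof -
 \<comment> \<open>Cell \<open>i + 1\<close> is read one step too early here. This is harmless
   because passes are at least two steps apart: none started at \<open>\<tau> p - 1\<close>, so the
   cell does not change in that step.\<close>
 have r: "cm (X (\<tau> p + i) (Suc i)) = W p (Suc i)" if "Suc i < n"
 proof -
  define v where "v = \<tau> p - 1"
  have v: "\<tau> p = Suc v" using \<tau>_pass(2)[of p] by (simp add: v_def)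
  have "\<not> pass v" using pass_apart[of v] \<tau>_pass(1)[of p] v by auto
  from cm_nopass[OF this that] show ?thesis unfolding W_def v by simp
 qed
 have l: "(if i = 0 then None else Some (cm (X (\<tau> p + i - 1) (i - 1)))) = nbl (W p) i"
  by (cases i) (auto simp: nbl_def W_def)
 have "map_option cm (nbr n (X (\<tau> p + i)) i) = nbr n (W p) i" using r by (auto simp: nbr_def)
 thus ?thesis using cm_pass[OF \<tau>_pass(1) assms, of p] W_Suc[OF assms] unfolding l by (simp add: W_def)
qed

text \<open>A leader emits a letter in exactly the steps without a hop, so this is the running
  number of the letter emitted at \<open>v\<close>.\<close>

definition cnt :: "nat => nat => nat" where "cnt a v = card {u. a \<le> u \<and> u < v \<and> \<not> H u}"

lemma cnt_Suc: "a \<le> v ==> cnt a (Suc v) = (if H v then cnt a v else Suc (cnt a v))"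
proof -
 assume "a \<le> v"
 hence "{u. a \<le> u \<and> u < Suc v \<and> \<not> H u} = (if H v then {u. a \<le> u \<and> u < v \<and> \<not> H u} else insert v {u. a \<le> u \<and> u < v \<and> \<not> H u})"
  by (auto simp: less_Suc_eq)
 thus ?thesis by (simp add: cnt_def)
qed

lemma sync:
 fixes P d :: nat
 defines "a \<equiv> \<tau> P + 1"
 defines "v \<equiv> a + d"
 shows "\<tau> (P + cnt a v div 2) < v \<and> v \<le> \<tau> (Suc (P + cnt a v div 2)) \<and> ph (X v 0) = odd (cnt a v)"
 unfolding v_def
proof (induction d)
 case 0
 have "ph (X a 0) = False" using ph_rec[of "\<tau> P"] \<tau>_pass(1)[of P] by (simp add: a_def pass_def)
 moreover have "cnt a (a + 0) = 0" by (simp add: cnt_def)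
 ultimately show ?case using \<tau>_less[of P] by (simp add: a_def)
next
 case (Suc d)
 define v where "v = a + d"
 define q where "q = P + cnt a v div 2"
 have IH: "\<tau> q < v" "v \<le> \<tau> (Suc q)" "ph (X v 0) = odd (cnt a v)" using Suc by (auto simp: v_def q_def)
 have c: "cnt a (Suc v) = (if H v then cnt a v else Suc (cnt a v))" by (rule cnt_Suc) (simp add: v_def)
 show ?case
 proof (cases "pass v")
  case False
  hence "v \<noteq> \<tau> (Suc q)" using \<tau>_pass(1) by metis
  hence "Suc v \<le> \<tau> (Suc q)" using IH by simp
  moreover have "cnt a (Suc v) div 2 = cnt a v div 2" using c False IH(3) by (auto simp: pass_def)
  moreover have "ph (X (Suc v) 0) = odd (cnt a (Suc v))" using ph_rec[of v] c IH(3) by auto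
  ultimately show ?thesis using IH(1) unfolding q_def v_def by (simp only: add_Suc_right) simp
 next
  case True
  hence "v = \<tau> (Suc q)" using \<tau>_between[of q v] IH by linarith
  hence "\<tau> (Suc q) < Suc v" "Suc v \<le> \<tau> (Suc (Suc q))" using \<tau>_less[of "Suc q"] by auto
  moreover have "P + cnt a (Suc v) div 2 = Suc q" using c True IH(3) by (auto simp: pass_def q_def elim!: oddE)
  moreover have "ph (X (Suc v) 0) = odd (cnt a (Suc v))" using ph_rec[of v] c IH(3) by auto
  ultimately show ?thesis unfolding v_def by (simp only: add_Suc_right)
 qed
qed

text \<open>The bound on \<open>a\<close> comes from at most \<open>2 * (n + 1)\<^sup>2\<close>
  passes until \<open>array_stream\<close> takes effect, at most 4 steps each
  (\<open>\<tau>_bound\<close>).\<close>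

theorem train_stream:
 assumes f: "fin (U M s0 0)" "s0 < n" and N: "\<And>i. fN (U M n i) = Ek w (ell w) i" and w: "w \<noteq> []" "ell w \<le> n"
 obtains a where "a \<le> 8 * (n + 1)\<^sup>2 + 1"
  "\<And>v. a \<le> v ==> \<not> H v ==> outm b (X v 0) = w ! ((cnt a v mod (2 * (n + 1)\<^sup>2)) mod length w)"
proof -
 obtain P1 where P1: "0 < P1" "P1 \<le> 2 * (n + 1)\<^sup>2" "\<And>p. fC (W (P1 + p) 0) = Some (pr w ((p mod (n + 1)\<^sup>2) mod ell w))"
  using array_stream[of n W M s0 w, OF W_rec n f N w] by blast
 define P where "P = P1 - 1"
 define a where "a = \<tau> P + 1"
 define c where "c = (n + 1)\<^sup>2"
 have le: "length w dvd 2 * ell w" by (auto simp: ell_def)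
 have "outm b (X v 0) = w ! ((cnt a v mod (2 * c)) mod length w)" if v: "a \<le> v" "\<not> H v" for v
 proof -
  define k where "k = cnt a v"
  have s: "\<tau> (P + k div 2) < v" "v \<le> \<tau> (Suc (P + k div 2))" "ph (X v 0) = odd k"
   using sync[of P "v - a"] v(1) unfolding k_def a_def by auto
  have "W (Suc (P + k div 2)) 0 = cm (X (Suc (\<tau> (P + k div 2))) 0)" using W_Suc[OF n, of "P + k div 2"] by simp
  also have "\<dots> = cm (X v 0)"
  proof -
   have e: "v = Suc (\<tau> (P + k div 2)) + (v - Suc (\<tau> (P + k div 2))) + 0" using s by simp
   have "cm (X (Suc (\<tau> (P + k div 2)) + (v - Suc (\<tau> (P + k div 2))) + 0) 0) = cm (X (Suc (\<tau> (P + k div 2)) + 0) 0)"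
    by (rule cm_const[OF _ n]) (use \<tau>_between[of "P + k div 2"] s in auto)
   thus ?thesis using e by simp
  qed
  finally have "fC (cm (X v 0)) = Some (pr w ((k div 2 mod c) mod ell w))"
   using P1(3)[of "k div 2"] P1(1) by (simp add: P_def c_def)
  hence "outm b (X v 0) = w ! ((2 * ((k div 2 mod c) mod ell w) + (if odd k then 1 else 0)) mod length w)"
   using s(3) by (simp add: outm_def pr_def)
  also have "(2 * ((k div 2 mod c) mod ell w) + (if odd k then 1 else 0)) mod length w
    = (2 * (k div 2 mod c) + (if odd k then 1 else 0)) mod length w"
  proof -
   have "2 * ((k div 2 mod c) mod ell w) = (2 * (k div 2 mod c)) mod (2 * ell w)" by (rule mult_mod_right)
   hence "(2 * ((k div 2 mod c) mod ell w)) mod length w = (2 * (k div 2 mod c)) mod length w"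
    by (simp only: mod_mod_cancel[OF le])
   thus ?thesis by (rule mod_add_cong[OF _ refl])
  qed
  also have "2 * (k div 2 mod c) + (if odd k then 1 else 0) = k mod (2 * c)"
  proof -
   have p: "(if odd k then 1 else 0) = k mod 2" by (simp add: mod2_eq_if)
   show ?thesis unfolding p by (rule mod_mult2_eq[symmetric])
  qed
  finally show ?thesis by (simp add: k_def)
 qed
 moreover have "a \<le> 8 * (n + 1)\<^sup>2 + 1" using \<tau>_bound[of P] P1(1,2) by (simp add: a_def P_def)
 ultimately show thesis using that unfolding c_def by blast
qed

end

section \<open>Trains of the automaton as runs of the array\<close>

context evolution
begin

text \<open>Cells are counted from the head and blocks from the tail, hence
  \<open>i - k\<close>.\<close>

lemma cell_step:
 assumes a: "alive (Suc t) e i" and nl: "\<not> alive t e (Suc i)" and k: "k \<le> i"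
 defines "X \<equiv> \<lambda>t k. the (bt t (pos t e (i - k)))"
 shows "X (Suc t) k = upd (nbl (X t) k) (X t k) (nbr (Suc i) (X t) k) (hA t e (i - k))"
proof -
 have at: "alive t e i" using alive_antimono[OF a] by simp
 have ak: "alive (Suc t) e (i - k)" "alive t e (i - k)" using alive_mono[OF a] alive_mono[OF at] by auto
 have s: "surv (bt t) (pos t e (i - k))" using alive_surv[OF ak(1)] .
 have "bt (Suc t) (pos (Suc t) e (i - k)) = Some (nst (bt t) (pos t e (i - k)))"
  using step_mv[OF sept s] by (simp add: btS pos_def)
 hence X: "X (Suc t) k = nst (bt t) (pos t e (i - k))" by (simp add: X_def)
 have l: "bt t (lp (bt t) (pos t e (i - k))) = nbl (X t) k"
 proof (cases k)
  case 0
  have "lead (bt t) (pos t e i)" using lead_iff[OF at] nl by simp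
  hence "\<not> occ (bt t) (lp (bt t) (pos t e i))" by (auto simp: lead_def lp_def)
  thus ?thesis using 0 by (simp add: nbl_def occ_def)
 next
  case (Suc k')
  have e: "i - k' = Suc (i - k)" using Suc k by simp
  have al: "alive t e (Suc (i - k))" using alive_mono[OF at, of "i - k'"] e by simp
  have "lp (bt t) (rp (bt t) (pos t e (Suc (i - k)))) = pos t e (Suc (i - k))"
   by (rule link(3)[OF sept alive_occ[OF al] alive_Suc(3)[OF al]])
  hence "lp (bt t) (pos t e (i - k)) = pos t e (i - k')" using alive_Suc(2)[OF al] e by simp
  thus ?thesis using Suc alive_occ[OF al] e by (auto simp: nbl_def X_def occ_def)
 qed
 have r: "bt t (rp (bt t) (pos t e (i - k))) = nbr (Suc i) (X t) k"
 proof (cases "k = i")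
  case True
  have "tail (bt t) (pos t e 0)" using alive_tail alive_mono[OF at] by blast
  hence "\<not> occ (bt t) (rp (bt t) (pos t e 0))" by (auto simp: tail_def rp_def)
  thus ?thesis using True by (simp add: nbr_def occ_def)
 next
  case False
  hence e: "i - k = Suc (i - Suc k)" using k by simp
  have al: "alive t e (Suc (i - Suc k))" using ak(2) e by simp
  have "rp (bt t) (pos t e (i - k)) = pos t e (i - Suc k)" using alive_Suc(2)[OF al] e by simp
  thus ?thesis using False k alive_occ[OF alive_Suc(1)[OF al]] by (auto simp: nbr_def X_def occ_def)
 qed
 show ?thesis unfolding X unfolding nst_def l r by (simp add: X_def hA_def)
qed

text \<open>A carry resets the digit of the leader, so the next step cannot produce a carry
  again.\<close>

lemma hop_twice:
 assumes "alive (Suc (Suc (Suc t))) e i" "\<not> alive (Suc t) e (Suc i)"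
 shows "\<not> (hA (Suc t) e i \<and> hA (Suc (Suc t)) e i)"
proof
 assume h: "hA (Suc t) e i \<and> hA (Suc (Suc t)) e i"
 have a: "alive (Suc (Suc t)) e i" "alive (Suc t) e i" using alive_antimono[OF assms(1)] by auto
 have n: "\<not> alive (Suc (Suc t)) e (Suc i)" using assms(2) alive_antimono[of "Suc (Suc t)" e "Suc i" "Suc t"] by auto
 have "cA (Suc t) e i" "cA (Suc (Suc t)) e i" using hop_lead[OF a(1) assms(2)] hop_lead[OF assms(1) n] h by auto
 thus False using carry_rec[OF a(2)] carry_rec(1)[OF a(1)] by auto
qed

end

section \<open>A finite set of states closed under the update\<close>

definition QS :: "'b machine => nat set" where
 "QS M = insert 0 (fst ` dom M \<union> (\<lambda>p. fst (the (M p))) ` dom M)"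

definition SY :: "'b machine => 'b tape_symbol set" where
 "SY M = {Blank, Mark 0} \<union> range Letter \<union> (\<lambda>p. fst (snd (the (M p)))) ` dom M"

definition CT :: "'b machine => 'b ctl set" where
 "CT M = Run ` QS M \<union> (\<lambda>(q, d). Mv q d) ` (QS M \<times> UNIV) \<union> range Unl"

definition SMC :: "'b machine => 'b mc set" where
 "SMC M = {c. fL c \<in> SY M \<and> fR c \<in> SY M \<and> fQ c \<in> CT M}"

definition SS :: "'b machine => 'b st set" where
 "SS M = {s. cm s \<in> SMC M \<and> g0 s \<in> SMC M \<and> gl s \<in> SMC M}"

lemma finite_dir: "finite (UNIV :: direction set)"
 by (rule finite_subset[of _ "{Go_Left, Stay, Go_Right}"]) (use direction.exhaust in auto)

lemma finite_SMC:
 assumes "finite (dom (M :: 'b::finite machine))" shows "finite (SMC M)"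
proof -
 have f: "finite (QS M)" "finite (SY M)" using assms by (auto simp: QS_def SY_def)
 hence c: "finite (CT M)" using finite_dir by (auto simp: CT_def)
 define g where "g c = ((fL c, fR c, fQ c), (fI c, fW c, fA c, fB c), (fO c, fV c, fE c, fN c, fC c))" for c :: "'b mc"
 have "inj g" by (rule injI) (auto simp: g_def intro: mc.expand)
 moreover have "finite (g ` SMC M)"
  by (rule finite_subset[of _ "(SY M \<times> SY M \<times> CT M) \<times> UNIV"]) (use f c in \<open>auto simp: g_def SMC_def\<close>)
 ultimately show ?thesis using finite_imageD inj_on_subset by blast
qed

lemma finite_SS:
 assumes "finite (dom (M :: 'b::finite machine))" shows "finite (SS M)"
proof -
 define g where "g s = ((cm s, g0 s, gl s), (tok s, ph s, dgt s, cry s))" for s :: "'b st"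
 have "inj g" by (rule injI) (auto simp: g_def intro: st.expand)
 moreover have "finite (g ` SS M)"
  by (rule finite_subset[of _ "(SMC M \<times> SMC M \<times> SMC M) \<times> UNIV"]) (use finite_SMC[OF assms] in \<open>auto simp: g_def SS_def\<close>)
 ultimately show ?thesis using finite_imageD inj_on_subset by blast
qed

lemma SY_0: "Blank \<in> SY M" "Mark 0 \<in> SY M" and QS_0: "0 \<in> QS M"
 by (auto simp: SY_def QS_def)

lemma M_SY: "M (q, s) = Some (q', s', d) ==> s' \<in> SY M \<and> q' \<in> QS M"
 unfolding SY_def QS_def by (force simp: dom_def image_iff)

lemma CT_iff: "Run q \<in> CT M \<longleftrightarrow> q \<in> QS M" "Mv q d \<in> CT M \<longleftrightarrow> q \<in> QS M" "Unl p \<in> CT M"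
 by (auto simp: CT_def)

lemma pstc_SMC:
 assumes "c \<in> SMC M" "x \<in> SMC M" "\<And>y. l = Some y ==> y \<in> SMC M" "rL \<in> SY M" "rR \<in> SY M"
 shows "pstc M c l x rL rR rW rV \<in> SMC M"
proof -
 have l: "case l of None => True | Some y => fL y \<in> SY M \<and> fR y \<in> SY M" using assms(3) by (auto simp: SMC_def split: option.split)
 have x: "fL x \<in> SY M" "fR x \<in> SY M" "fQ c \<in> CT M" using assms by (auto simp: SMC_def)
 show ?thesis
 proof (cases "fQ c")
  case (Run q)
  show ?thesis
  proof (cases "M (q, fR c)")
   case None thus ?thesis using x Run by (auto simp: pstc_def SMC_def CT_iff)
  next
   case (Some p)
   obtain q' s' d where p: "p = (q', s', d)" by (cases p)
   thus ?thesis using x Run Some M_SY[of M q "fR c" q' s' d] by (auto simp: pstc_def SMC_def CT_iff)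
  qed
 next
  case (Mv q d)
  thus ?thesis using x l assms(4,5) by (cases d; cases l) (auto simp: pstc_def SMC_def CT_iff)
 next
  case (Unl p)
  thus ?thesis using x SY_0[of M] QS_0[of M] by (cases p; cases "fV c"; cases l) (auto simp: pstc_def SMC_def CT_iff Let_def)
 qed
qed

lemma phi_SMC:
 assumes "c \<in> SMC M" "x \<in> SMC M" "\<And>y. l = Some y ==> y \<in> SMC M" "\<And>y. r = Some y ==> y \<in> SMC M"
 shows "phi M c l x r \<in> SMC M"
proof -
 have r: "fL (bl r) \<in> SY M" "fR (bl r) \<in> SY M" using assms(4) SY_0[of M] by (cases r; simp add: bl_def SMC_def)+
 have core: "core y \<in> SMC M \<longleftrightarrow> y \<in> SMC M" for y by (simp add: SMC_def)
 have "pstc M (core c) (map_option core l) (core x) (fL (bl r)) (fR (bl r)) (fW (bl r)) (fV (bl r)) \<in> SMC M"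
  using assms(1-3) r by (intro pstc_SMC) (auto simp: core)
 hence p: "pst M c l x r \<in> SMC M" by (simp add: SMC_def pst_f)
 have "core (phi M c l x r) \<in> SMC M"
 proof (cases "fA c")
  case True thus ?thesis using assms(2) phi_f(3)[of c M l x r] by (simp add: core)
 next
  case False
  thus ?thesis using p phi_f(5,7)[of c M l x r] SY_0[of M] QS_0[of M]
   by (cases "fB c") (auto simp: core, simp add: SMC_def cell0_def CT_iff)
 qed
 thus ?thesis by (simp add: core)
qed

lemma updm_SS:
 assumes "s \<in> SS M" "\<And>y. l = Some y ==> y \<in> SS M" "\<And>y. r = Some y ==> y \<in> SS M"
 shows "updm M l s r h \<in> SS M"
proof -
 have s: "cm s \<in> SMC M" "g0 s \<in> SMC M" "gl s \<in> SMC M" using assms(1) by (auto simp: SS_def)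
 have r: "y \<in> SMC M" if "map_option cm r = Some y" for y using that assms(3) by (auto simp: SS_def)
 show ?thesis
 proof (cases l)
  case None
  thus ?thesis using s r phi_SMC[of "cm s" M "cm s" None "map_option cm r"] by (auto simp: updm_def SS_def Let_def)
 next
  case (Some l')
  hence "cm l' \<in> SMC M" "g0 l' \<in> SMC M" "gl l' \<in> SMC M" using assms(2) by (auto simp: SS_def)
  thus ?thesis using Some s r phi_SMC[of "g0 l'" M "cm s" "Some (gl l')" "map_option cm r"] by (auto simp: updm_def SS_def Let_def)
 qed
qed

lemma updm_cd: "cry (updm M l s r h) \<longleftrightarrow> dgt s \<and> (case r of None => True | Some s' => cry s')"
 "dgt (updm M l s r h) \<longleftrightarrow> dgt s \<noteq> (case r of None => True | Some s' => cry s')"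
 by (auto simp: updm_def Let_def split: option.split)

lemma updm_h: "l \<noteq> None ==> updm M l s r h = updm M l s r h'"
 by (auto simp: updm_def)

section \<open>The stream of letters emitted by a train\<close>

text \<open>\<open>T n\<close> is the time at which the simulation starts to compute \<open>w n\<close>.\<close>

locale system =
 fixes M :: "'b::finite machine" and w :: "nat => 'b list" and a b :: 'b and u :: "'b list" and T :: "nat => nat"
 assumes fd: "finite (dom M)" and ab': "a \<noteq> b" and w0: "\<And>n. w n \<noteq> []"
  and avoid: "\<And>n p. \<not> occurs u (periodic (w n)) p"
  and T: "T 0 = 0" "\<And>n. T n + n < T (Suc n)" "\<And>n. ell (w n) \<le> T (Suc n)" "\<And>n. fin (U M (T (Suc n) - 1) 0)"
   "\<And>n s i. T (Suc n) \<le> s ==> s < T (Suc (Suc n)) ==> fN (U M s i) = Ek (w n) (ell (w n)) i"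
begin

definition idxS :: "'b st => nat" where "idxS = (SOME f. inj_on f (SS M) \<and> f ` SS M \<subseteq> {..<card (SS M)})"

lemma idxS: "inj_on idxS (SS M)" "s \<in> SS M ==> idxS s < card (SS M)"
proof -
 obtain f n where "f ` SS M = {i::nat. i < n}" "inj_on f (SS M)" using finite_imp_inj_to_nat_seg[OF finite_SS[OF fd]] by blast
 hence "inj_on f (SS M) \<and> f ` SS M \<subseteq> {..<card (SS M)}" using card_image[of f "SS M"] by (simp add: lessThan_def)
 hence "inj_on idxS (SS M) \<and> idxS ` SS M \<subseteq> {..<card (SS M)}" unfolding idxS_def
  by (rule someI[where P = "\<lambda>f. inj_on f (SS M) \<and> f ` SS M \<subseteq> {..<card (SS M)}"])
 thus "inj_on idxS (SS M)" "s \<in> SS M ==> idxS s < card (SS M)" by auto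
qed

definition NN :: nat where "NN = card (SS M) + 40"
text \<open>Half of the code length: exactly the length of
  \<open>b # enc s @ u @ [b] @ u @ [b]\<close>, after which the run of \<open>rr\<close> letters
  \<open>a\<close> follows.\<close>

definition rr :: nat where "rr = NN + 2 * length u + 3"

text \<open>The position of the single \<open>a\<close> encodes the state; its presence in the first
  half also tells a code word from \<open>fillS\<close>.\<close>

definition enc :: "'b st => 'b list" where
 "enc s = replicate (idxS s) b @ [a] @ replicate (NN - 1 - idxS s) b"

definition mm :: "'b list" where "mm = u @ [b] @ u @ [b] @ replicate rr a"
definition codeS :: "'b st => 'b list" where "codeS s = b # enc s @ mm"
definition fillS :: "'b list" where "fillS = replicate rr b @ replicate rr a"

lemma enc_len: "s \<in> SS M ==> length (enc s) = NN"
 using idxS(2)[of s] by (simp add: enc_def NN_def)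

lemma enc_nth: "s \<in> SS M ==> i < NN ==> enc s ! i = a \<longleftrightarrow> i = idxS s"
 using idxS(2)[of s] ab' by (auto simp: enc_def nth_append nth_Cons' NN_def)

lemma codeS_wf: "s \<in> SS M ==> length (codeS s) = 2 * rr \<and> codeS s ! 0 = b \<and> codeS s ! (rr - 1) = b \<and> (\<forall>i. rr \<le> i \<and> i < 2 * rr --> codeS s ! i = a)"
proof -
 assume s: "s \<in> SS M"
 have c: "codeS s = (b # enc s @ u @ [b] @ u) @ [b] @ replicate rr a" by (simp add: codeS_def mm_def)
 have l: "length (b # enc s @ u @ [b] @ u) = rr - 1" using enc_len[OF s] by (simp add: rr_def)
 have r0: "0 < rr" by (simp add: rr_def)
 have "codeS s ! (rr - 1) = b" unfolding c by (simp only: nth_append l) simp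
 moreover have "codeS s ! i = a" if "rr \<le> i" "i < 2 * rr" for i
  unfolding c nth_append l using that r0 by (auto simp: nth_Cons')
 moreover have "length (codeS s) = 2 * rr" unfolding c using l r0 by simp
 ultimately show ?thesis by (simp add: codeS_def)
qed

lemma codeS_inj: "inj_on codeS (SS M)"
proof (rule inj_onI)
 fix s s' assume s: "s \<in> SS M" "s' \<in> SS M" "codeS s = codeS s'"
 have "enc s = enc s'" using s enc_len by (simp add: codeS_def)
 hence "idxS s = idxS s'" using enc_nth[OF s(1), of "idxS s"] enc_nth[OF s(2), of "idxS s"] idxS(2)[OF s(1)] by (simp add: NN_def)
 thus "s = s'" using idxS(1) s by (auto dest: inj_onD)
qed

lemma fill_notin: "fillS \<notin> codeS ` SS M"
proof
 assume "fillS \<in> codeS ` SS M"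
 then obtain s where s: "s \<in> SS M" "fillS = codeS s" by auto
 have i: "idxS s < NN" using idxS(2)[OF s(1)] by (simp add: NN_def)
 have "codeS s ! Suc (idxS s) = a" using enc_nth[OF s(1) i] i enc_len[OF s(1)] by (simp add: codeS_def nth_append)
 moreover have "fillS ! Suc (idxS s) = b" using i by (simp add: fillS_def nth_append rr_def)
 ultimately show False using s ab' by simp
qed

sublocale coding "SS M" codeS fillS mm a b rr cry dgt "updm M" "outm b"
proof
 show "20 \<le> rr" by (simp add: rr_def NN_def)
 show "a \<noteq> b" by (rule ab')
 show "length v = 2 * rr \<and> v ! 0 = b \<and> v ! (rr - 1) = b \<and> (\<forall>i. rr \<le> i \<and> i < 2 * rr --> v ! i = a)"
  if v: "v \<in> insert fillS (codeS ` SS M)" for v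
 proof -
  consider "v = fillS" | s where "s \<in> SS M" "v = codeS s" using v by auto
  thus ?thesis
  proof cases
   case 1 thus ?thesis by (auto simp: fillS_def nth_append rr_def)
  next
   case 2 thus ?thesis using codeS_wf by blast
  qed
 qed
 show "inj_on codeS (SS M)" by (rule codeS_inj)
 show "fillS \<notin> codeS ` SS M" by (rule fill_notin)
 show "suffix mm (codeS s)" if "s \<in> SS M" for s by (auto simp: codeS_def suffix_def intro: exI[of _ "b # enc s"])
 show "mm \<noteq> []" by (simp add: mm_def)
 show "last mm = a" by (simp add: mm_def rr_def)
 show "updm M l s r h \<in> SS M" if "s \<in> SS M" "\<And>l'. l = Some l' ==> l' \<in> SS M" "\<And>r'. r = Some r' ==> r' \<in> SS M" for s l r h
  using that by (intro updm_SS) auto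
 show "cry (updm M l s r h) = (dgt s \<and> (case r of None => True | Some s' => cry s'))"
  "dgt (updm M l s r h) = (dgt s \<noteq> (case r of None => True | Some s' => cry s'))" for l s r h
  by (rule updm_cd)+
qed

definition idx :: "nat => nat" where "idx K = (LEAST d. K < T (Suc (Suc d)))"

lemma T_mono: "m \<le> n ==> T m \<le> T n"
proof (induction n)
 case (Suc n) thus ?case using T(2)[of n] by (cases "m = Suc n") auto
qed simp

lemma T_ge: "n \<le> T n"
proof (induction n)
 case (Suc n) thus ?case using T(2)[of n] by simp
qed simp

lemma idx_upper: "K < T (Suc (Suc (idx K)))"
 unfolding idx_def by (rule LeastI[of _ K]) (use T_ge[of "Suc (Suc K)"] in simp)

lemma idx_lower: "T 1 \<le> K ==> T (Suc (idx K)) \<le> K"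
proof (cases "idx K")
 case (Suc d)
 hence "\<not> K < T (Suc (Suc d))" using not_less_Least[of d "\<lambda>d. K < T (Suc (Suc d))"] by (simp add: idx_def)
 thus ?thesis using Suc by simp
qed simp

lemma idx_eqI: "T (Suc d) \<le> K ==> K < T (Suc (Suc d)) ==> idx K = d"
 unfolding idx_def
proof (rule Least_equality)
 fix y assume "T (Suc d) \<le> K" "K < T (Suc (Suc y))"
 thus "d \<le> y" using T_mono[of "Suc (Suc y)" "Suc d"] by (cases "d \<le> y") auto
qed

lemma idx_mono: "K \<le> K' ==> idx K \<le> idx K'"
 unfolding idx_def[of K] by (rule Least_le) (use idx_upper[of K'] in simp)

end

locale system_orbit = system M w a b u T for M :: "'b::finite machine" and w :: "nat => 'b list" and a b :: 'b and u T +
 fixes x :: "int => 'b"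

sublocale system_orbit \<subseteq> orbit "SS M" codeS fillS mm a b rr cry dgt "updm M" "outm b" x
 by unfold_locales

context system_orbit
begin

text \<open>The leader found by \<open>good_window\<close> has led long enough for
  \<open>train_stream\<close>, and all steps between two emissions are hops, so the running number
  of letters advances with the cell. The two conditions with \<open>length mm\<close> keep away from
  the left margin of the window and from restarts, where the letters seen by the filter need not be
  consecutive letters of the repeated word.\<close>

theorem window_stream:
 assumes "0 < n" and g: "\<And>z. z < n ==> \<not> cov (B ((F ^^ t) x)) (int z) \<and> good j h st t (int z)"
  and st: "8 * (h + 1)\<^sup>2 + 2 \<le> st" and j: "T 1 \<le> Suc j"
 obtains K c where "j < K" "K \<le> h" "ell (w (idx K)) \<le> K"
  "\<And>z. z < n ==> 2 * length mm \<le> z ==> 2 * length mm \<le> (z + c) mod (2 * (K + 1)\<^sup>2) ==>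
    (F ^^ t) x (int z) = w (idx K) ! (((z + c) mod (2 * (K + 1)\<^sup>2)) mod length (w (idx K)))"
proof -
 define bt where "bt = (\<lambda>t. B ((F ^^ t) x))"
 obtain e i sq where gw: "j \<le> i" "i < h" "st \<le> sq 0" "\<not> alive (sq 0 - st) e (Suc i)" "alive (sq (n - 1)) e i"
  and src: "\<And>z. z < n ==> src t (int z) = Some (sq z, pos (sq z) e i)"
  and gap: "\<And>z. Suc z < n ==> sq z < sq (Suc z) \<and> (\<forall>v. sq z < v \<and> v < sq (Suc z) --> hA v e i)"
  by (rule good_window[OF assms(1) g], assumption) (rule that)
 define K where "K = Suc i"
 define d where "d = idx K"
 define E where "E = sq (n - 1)"
 \<comment> \<open>The \<open>Suc\<close> provides one counter step under the present leader before
   \<open>v0\<close>, which \<open>hop_twice\<close> uses to exclude two hops in a row.\<close>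
 define v0 where "v0 = Suc (sq 0 - st)"
 have TK: "T (Suc d) \<le> K" "K < T (Suc (Suc d))" using idx_lower[of K] idx_upper[of K] j gw(1) by (auto simp: d_def K_def)
 have sq_mono: "z \<le> z' ==> z' < n ==> sq z \<le> sq z'" for z z'
 proof (induction z')
  case (Suc z') thus ?case using gap[of z'] by (cases "z = Suc z'") auto
 qed simp
 have sqE: "sq z \<le> E" "sq 0 \<le> sq z" if "z < n" for z using sq_mono[of z "n - 1"] sq_mono[of 0 z] that by (auto simp: E_def)
 \<comment> \<open>After \<open>E\<close> the train may be eroded; the abstract run goes on without
   hops so that it is defined for all times.\<close>
 define Hh where "Hh v \<longleftrightarrow> v0 + v < E \<and> hA (v0 + v) e i" for v
 define X where "X = rec_nat (\<lambda>k. the (bt v0 (pos v0 e (i - k)))) (\<lambda>v y k. updm M (nbl y k) (y k) (nbr K y k) (Hh v))"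
 have X0: "X 0 = (\<lambda>k. the (bt v0 (pos v0 e (i - k))))" by (simp add: X_def)
 have XS: "X (Suc v) = (\<lambda>k. updm M (nbl (X v) k) (X v k) (nbr K (X v) k) (Hh v))" for v by (simp add: X_def)
 have aliveE: "alive v e i" if "v \<le> E" for v using alive_antimono[OF gw(5)] that by (simp add: E_def)
 have leadv: "\<not> alive v e (Suc i)" if "sq 0 - st \<le> v" for v using alive_antimono[of v e "Suc i"] gw(4) that by blast
 have hh: "\<not> (Hh v \<and> Hh (Suc v))" for v
 proof
  assume h: "Hh v \<and> Hh (Suc v)"
  have e: "v0 + v = Suc (sq 0 - st + v)" by (simp add: v0_def)
  have "\<not> (hA (Suc (sq 0 - st + v)) e i \<and> hA (Suc (Suc (sq 0 - st + v))) e i)"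
   by (rule hop_twice) (use h e in \<open>auto simp: Hh_def intro!: aliveE leadv\<close>)
  thus False using h by (simp add: Hh_def e)
 qed
 interpret tr: train_run M K X Hh
  by unfold_locales (auto simp: K_def XS hh)
 have Xeq: "X v k = the (bt (v0 + v) (pos (v0 + v) e (i - k)))" if "v0 + v \<le> E" "k < K" for v k
  using that
 proof (induction v arbitrary: k)
  case 0 thus ?case by (simp add: X0)
 next
  case (Suc v)
  have k: "k \<le> i" using Suc.prems by (simp add: K_def)
  have cs: "the (bt (Suc (v0 + v)) (pos (Suc (v0 + v)) e (i - k))) =
    updm M (nbl (\<lambda>k. the (bt (v0 + v) (pos (v0 + v) e (i - k)))) k) (the (bt (v0 + v) (pos (v0 + v) e (i - k))))
     (nbr (Suc i) (\<lambda>k. the (bt (v0 + v) (pos (v0 + v) e (i - k)))) k) (hA (v0 + v) e (i - k))"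
   unfolding bt_def by (rule cell_step[OF aliveE leadv k]) (use Suc.prems in \<open>auto simp: v0_def\<close>)
  have IH: "X v k' = the (bt (v0 + v) (pos (v0 + v) e (i - k')))" if "k' < K" for k' using Suc that by simp
  have n1: "nbl (X v) k = nbl (\<lambda>k. the (bt (v0 + v) (pos (v0 + v) e (i - k)))) k"
   using IH[of "k - 1"] Suc.prems(2) by (simp add: nbl_def)
  have n2: "nbr K (X v) k = nbr (Suc i) (\<lambda>k. the (bt (v0 + v) (pos (v0 + v) e (i - k)))) k"
   using IH[of "Suc k"] by (simp add: nbr_def K_def)
  have "updm M l s r (Hh v) = updm M l s r (hA (v0 + v) e (i - k))" if "l = nbl (X v) k" for l s r
  proof (cases k)
   case 0 thus ?thesis using Suc.prems(1) by (simp add: Hh_def)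
  next
   case (Suc k') thus ?thesis using that by (intro updm_h) (simp add: nbl_def)
  qed
  thus ?case using cs IH[OF Suc.prems(2)] unfolding XS n1[symmetric] n2[symmetric] by simp
 qed
 have d1: "0 < T (Suc d)" using T_ge[of "Suc d"] by simp
 have len: "ell (w d) \<le> K" using T(3)[of d] TK by simp
 have NU: "fN (U M K i') = Ek (w d) (ell (w d)) i'" for i' by (rule T(5)[OF TK])
 have "T (Suc d) - 1 < K" using TK d1 by simp
 from tr.train_stream[OF T(4) this NU w0 len, of b]
 obtain a' where a': "a' \<le> 8 * (K + 1)\<^sup>2 + 1"
  "\<And>v. a' \<le> v ==> \<not> Hh v ==> outm b (X v 0) = w d ! ((tr.cnt a' v mod (2 * (K + 1)\<^sup>2)) mod length (w d))" by blast
 have "(K + 1)\<^sup>2 \<le> (h + 1)\<^sup>2" using gw(2) by (intro power_mono) (auto simp: K_def)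
 hence "a' \<le> 8 * (h + 1)\<^sup>2 + 1" using a'(1) by linarith
 hence a0: "v0 + a' \<le> sq 0" using st gw(3) unfolding v0_def by linarith
 define q where "q = 2 * (K + 1)\<^sup>2"
 define c where "c = tr.cnt a' (sq 0 - v0)"
 have nh: "\<not> Hh (sq z - v0)" if "z < n" for z
 proof -
  have "em (B ((F ^^ sq z) x)) (pos (sq z) e i)" using src_em[OF src[OF that]] by blast
  hence "\<not> hA (sq z) e i" by (simp add: em_def hA_def)
  moreover have "v0 + (sq z - v0) = sq z" using a0 sqE[OF that] by simp
  ultimately show ?thesis by (simp add: Hh_def)
 qed
 have cnt: "tr.cnt a' (sq z - v0) = z + c" if "z < n" for z
  using that
 proof (induction z)
  case 0 thus ?case by (simp add: c_def)
 next
  case (Suc z)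
  have g1: "sq z < sq (Suc z)" "\<And>v. sq z < v ==> v < sq (Suc z) ==> hA v e i" using gap[OF Suc.prems] by auto
  have ge: "v0 + a' \<le> sq z" using a0 sqE[of z] Suc.prems by simp
  have "tr.cnt a' (Suc (sq z - v0) + k) = Suc (tr.cnt a' (sq z - v0))" if "Suc (sq z) + k \<le> sq (Suc z)" for k
   using that
  proof (induction k)
   case 0 thus ?case using tr.cnt_Suc[of a' "sq z - v0"] nh[of z] Suc.prems ge by simp
  next
   case (Suc k)
   have "sq (Suc z) \<le> E" using sqE \<open>Suc z < n\<close> by blast
   hence "Hh (Suc (sq z - v0) + k)" using g1(2)[of "Suc (sq z) + k"] Suc.prems ge by (simp add: Hh_def)
   thus ?case using tr.cnt_Suc[of a' "Suc (sq z - v0) + k"] Suc ge by simp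
  qed
  from this[of "sq (Suc z) - Suc (sq z)"] have A: "tr.cnt a' (Suc (sq z - v0) + (sq (Suc z) - Suc (sq z))) = Suc (z + c)"
   using g1(1) Suc by simp
  have e: "Suc (sq z - v0) + (sq (Suc z) - Suc (sq z)) = sq (Suc z) - v0" using g1(1) ge by linarith
  show ?case using A unfolding e by simp
 qed
 define ee where "ee z = outm b (the (B ((F ^^ sq z) x) (pos (sq z) e i)))" for z
 have ee: "ee z = w d ! (((z + c) mod q) mod length (w d))" if "z < n" for z
 proof -
  have v: "v0 + (sq z - v0) = sq z" "a' \<le> sq z - v0" using a0 sqE[OF that] by auto
  have "X (sq z - v0) 0 = the (bt (sq z) (pos (sq z) e i))" using Xeq[of "sq z - v0" 0] v(1) sqE[OF that] by (simp add: K_def)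
  thus ?thesis using a'(2)[OF v(2) nh[OF that]] cnt[OF that] by (simp add: ee_def bt_def q_def)
 qed
 define om where "om z = (F ^^ t) x (int z)" for z
 have rule: "om z = (if (\<forall>i<length mm - 1. om (Suc z - length mm + i) = mm ! i) \<and> ee z = a then b else ee z)"
  if "z < n" "length mm \<le> Suc z" for z
  unfolding om_def ee_def by (rule letter_rule[where n = n]) (use that src g gap in auto)
 show thesis
 proof (rule that[of K c])
  show "j < K" "K \<le> h" "ell (w (idx K)) \<le> K" using gw len by (auto simp: K_def d_def)
  fix z assume z: "z < n" "2 * length mm \<le> z" "2 * length mm \<le> (z + c) mod (2 * (K + 1)\<^sup>2)"
  define f where "f = (z + c) mod q"
  have f: "2 * length mm \<le> f" using z(3) by (simp add: f_def q_def)
  have q0: "0 < q" by (simp add: q_def)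
  \<comment> \<open>No restart falls on the last \<open>2 * length mm\<close> letters up to
    \<open>z\<close>, so the intended letters there form a factor of the periodic configuration,
    which avoids \<open>u\<close>.\<close>
  have eh: "ee (z - k) = periodic (w d) (int (f - k))" if k: "k \<le> 2 * length mm" for k
  proof -
   have "z + c = (z + c) div q * q + f" by (simp add: f_def)
   hence "z - k + c = (z + c) div q * q + (f - k)" using k f z(2) by linarith
   moreover have "f - k < q" using q0 by (simp add: f_def less_imp_diff_less)
   ultimately have "(z - k + c) mod q = f - k" by simp
   thus ?thesis using ee[of "z - k"] z(1) by (simp add: periodic_def zmod_int[symmetric] less_imp_diff_less)
  qed
  have "om z = ee z"
  proof (rule filter_avoid[of a b u rr n om ee "z - 2 * length mm" "Suc z" z])
   show "a \<noteq> b" by (rule ab')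
   show "2 * length u + 3 \<le> rr" by (simp add: rr_def)
   show "om z = (if (\<forall>i<length (u @ [b] @ u @ [b] @ replicate rr a) - 1. om (Suc z - length (u @ [b] @ u @ [b] @ replicate rr a) + i) =
     (u @ [b] @ u @ [b] @ replicate rr a) ! i) \<and> ee z = a then b else ee z)"
    if "z < n" "length (u @ [b] @ u @ [b] @ replicate rr a) \<le> Suc z" for z
    using rule[of z] that unfolding mm_def by blast
   show "\<exists>i<length u. ee (p + i) \<noteq> u ! i" if p: "z - 2 * length mm \<le> p" "p + length u \<le> Suc z" for p
   proof (rule ccontr)
    assume nn: "\<not> ?thesis"
    have "occurs u (periodic (w d)) (int (f - (z - p)))" unfolding occurs_def
    proof (intro allI impI)
     fix i assume i: "i < length u"
     have "ee (p + i) = u ! i" using nn i by blast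
     moreover have "z - (z - (p + i)) = p + i" "z - (p + i) \<le> 2 * length mm" using p i by auto
     moreover have "int (f - (z - (p + i))) = int (f - (z - p)) + int i" using p i f by auto
     ultimately show "periodic (w d) (int (f - (z - p)) + int i) = u ! i" using eh[of "z - (p + i)"] by simp
    qed
    thus False using avoid by blast
   qed
   show "Suc z \<le> n" using z by simp
   show "z - 2 * length mm + 2 * length (u @ [b] @ u @ [b] @ replicate rr a) \<le> z" using z(2) unfolding mm_def by simp
  qed simp
  thus "(F ^^ t) x (int z) = w (idx K) ! (((z + c) mod (2 * (K + 1)\<^sup>2)) mod length (w (idx K)))"
   using ee[OF z(1)] by (simp add: om_def d_def q_def)
 qed
qed

end

section \<open>Mixing measures\<close>

definition shi :: "int => (int => 'b) => int => 'b" where "shi q x = (\<lambda>i. x (i + q))"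

lemma shi_shi: "shi p (shi q x) = shi (p + q) x"
 by (simp add: shi_def add.assoc)

lemma shi_0 [simp]: "shi 0 x = x" by (simp add: shi_def)

lemma shi_1: "shi 1 = shift_map" by (simp add: shi_def shift_map_def fun_eq_iff)

lemma covariant_shi:
 assumes "\<And>x z T. P (shift_map x) z T \<longleftrightarrow> P x (z + 1) (T + 1)"
 shows "P (shi q x) z T \<longleftrightarrow> P x (z + q) (T + (q::int))"
proof -
 have pos: "P (shi (int n) x) z T \<longleftrightarrow> P x (z + int n) (T + int n)" for n x z T
 proof (induction n arbitrary: x z T)
  case (Suc n)
  have "shi (int (Suc n)) x = shi (int n) (shift_map x)" by (simp add: shi_1[symmetric] shi_shi add.commute)
  thus ?case using Suc[of "shift_map x" z T] assms by (simp add: add.assoc add.commute[of 1])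
 qed simp
 show ?thesis
 proof (cases "0 \<le> q")
  case True thus ?thesis using pos[of "nat q" x z T] by simp
 next
  case False
  have "P (shi (int (nat (- q))) (shi q x)) (z + q) (T + q) \<longleftrightarrow> P (shi q x) (z + q + int (nat (- q))) (T + q + int (nat (- q)))"
   by (rule pos)
  thus ?thesis using False by (simp add: shi_shi)
 qed
qed

definition dep :: "int set => (int => 'b) set => bool" where
 "dep W A \<longleftrightarrow> (\<forall>x y. (\<forall>i\<in>W. x i = y i) --> x \<in> A --> y \<in> A)"

lemma depI: "(\<And>x y. (\<And>i. i \<in> W ==> x i = y i) ==> x \<in> A ==> y \<in> A) ==> dep W A"
 by (auto simp: dep_def)

lemma depD: "dep W A ==> (\<And>i. i \<in> W ==> x i = y i) ==> x \<in> A \<longleftrightarrow> y \<in> A"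
 unfolding dep_def by metis

lemma dep_mono: "dep W A ==> W \<subseteq> W' ==> dep W' A"
 by (auto simp: dep_def)

lemma dep_Int: "dep W A ==> dep W B ==> dep W (A \<inter> B)"
 unfolding dep_def by blast

lemma dep_UN: "(\<And>i. i \<in> I ==> dep W (A i)) ==> dep W (\<Union>i\<in>I. A i)"
 unfolding dep_def by blast

lemma dep_Compl: assumes "dep W A" shows "dep W (- A)"
proof (rule depI)
 fix x y :: "int => 'a" assume "\<And>i. i \<in> W ==> x i = y i" "x \<in> - A"
 thus "y \<in> - A" using depD[OF assms, of x y] by auto
qed

lemma dep_shi: "dep W A ==> dep ((\<lambda>i. i + q) ` W) (shi q -` A)"
proof (rule depI)
 fix x y :: "int => 'a" assume d: "dep W A" and e: "\<And>i. i \<in> (\<lambda>i. i + q) ` W ==> x i = y i" and x: "x \<in> shi q -` A"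
 have "shi q x \<in> A \<longleftrightarrow> shi q y \<in> A" by (rule depD[OF d]) (use e in \<open>auto simp: shi_def\<close>)
 thus "y \<in> shi q -` A" using x by simp
qed

lemma dep_atoms:
 assumes "dep W A"
 shows "A = (\<Union>a\<in>(\<lambda>x. restrict x W) ` A. {x. \<forall>i\<in>W. x i = a i})"
proof (intro equalityI subsetI)
 fix y assume "y \<in> (\<Union>a\<in>(\<lambda>x. restrict x W) ` A. {x. \<forall>i\<in>W. x i = a i})"
 then obtain x where x: "x \<in> A" "\<forall>i\<in>W. y i = restrict x W i" by auto
 thus "y \<in> A" using depD[OF assms, of y x] by auto
qed auto

lemma finite_atoms: "finite W ==> finite ((\<lambda>x. restrict x W) ` (A :: (int => 'b::finite) set))"
 by (rule finite_subset[OF _ finite_PiE[of W "\<lambda>_. UNIV"]]) auto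

lemma dep_cylinder:
 fixes A :: "(int => 'b::finite) set"
 assumes "finite W" "W \<subseteq> V" "dep W A" shows "A \<in> cylinder_algebra V"
proof -
 have "(\<Union>a\<in>(\<lambda>x. restrict x W) ` A. {x. \<forall>i\<in>W. x i = a i}) \<in> cylinder_algebra V"
  unfolding cylinder_algebra_def
  by (rule sigma_sets_UNION) (use assms(1,2) finite_atoms[OF assms(1)] in \<open>auto intro!: countable_finite sigma_sets.Basic\<close>)
 thus ?thesis using dep_atoms[OF assms(3)] by simp
qed

lemma dep_open:
 fixes A :: "(int => 'b::{finite, discrete_topology}) set"
 assumes "finite W" "dep W A" shows "open A"
proof -
 have "open (\<Union>a\<in>(\<lambda>x. restrict x W) ` A. {x. \<forall>i\<in>W. x i = a i})"
  by (intro open_UN ballI open_agree[OF assms(1)])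
 thus ?thesis using dep_atoms[OF assms(2)] by simp
qed

lemma dep_borel:
 fixes A :: "(int => 'b::{finite, discrete_topology}) set"
 shows "finite W ==> dep W A ==> A \<in> sets borel"
 by (intro borel_open dep_open)

lemma shi_measurable: "(shi q :: (int => 'b::discrete_topology) => int => 'b) \<in> borel_measurable borel"
proof -
 have "continuous_on UNIV (shi q :: (int => 'b) => int => 'b)"
  unfolding shi_def by (intro continuous_on_coordinatewise_then_product continuous_on_product_coordinates)
 thus ?thesis by (rule borel_measurable_continuous_onI)
qed

locale mixing =
 fixes \<mu> :: "(int => 'b::{finite, discrete_topology}) measure"
 assumes mu: "\<mu> \<in> full_mixing_measures"
begin

lemma sets_mu: "sets \<mu> = sets borel" and space_mu: "space \<mu> = UNIV" and prob: "prob_space \<mu>" and inv: "distr \<mu> borel shift_map = \<mu>"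
 and psi: "psi_coefficient \<mu> \<longlonglongrightarrow> 0" and full: "0 < measure \<mu> (cylinder v)"
 using mu sets_eq_imp_space_eq[of \<mu> borel]
 by (auto simp: full_mixing_measures_def invariant_measures_def psi_mixing_def full_support_def pushforward_def)

sublocale prob_space \<mu> by (rule prob)

lemma meas_dep: "finite W ==> dep W A ==> A \<in> sets \<mu>"
 unfolding sets_mu by (rule dep_borel)

lemma inv_1: "A \<in> sets \<mu> ==> measure \<mu> (shift_map -` A) = measure \<mu> A"
proof -
 assume A: "A \<in> sets \<mu>"
 have "shift_map \<in> measurable \<mu> borel" using shi_measurable[of 1] sets_mu by (simp add: shi_1 cong: measurable_cong_sets)
 hence "measure (distr \<mu> borel shift_map) A = measure \<mu> (shift_map -` A \<inter> space \<mu>)"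
  using A by (intro measure_distr) (auto simp: sets_mu)
 thus ?thesis by (simp add: inv space_mu)
qed

lemma shi_sets: "A \<in> sets \<mu> ==> shi q -` A \<in> sets \<mu>"
 using measurable_sets[OF shi_measurable, of A q] by (simp add: sets_mu)

lemma inv_shi: "A \<in> sets \<mu> ==> measure \<mu> (shi q -` A) = measure \<mu> A"
proof -
 assume A: "A \<in> sets \<mu>"
 have pos: "measure \<mu> (shi (int n) -` A) = measure \<mu> A" if "A \<in> sets \<mu>" for n A
  using that
 proof (induction n arbitrary: A)
  case (Suc n)
  have "shi (int (Suc n)) -` A = shift_map -` (shi (int n) -` A)" by (auto simp: shi_1[symmetric] shi_shi add.commute)
  thus ?case using Suc inv_1[OF shi_sets[OF Suc.prems]] by simp
 qed (simp add: vimage_def)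
 show ?thesis
 proof (cases "0 \<le> q")
  case True thus ?thesis using pos[OF A, of "nat q"] by simp
 next
  case False
  have "shi (int (nat (- q))) -` (shi q -` A) = A" using False by (auto simp: shi_shi)
  thus ?thesis using pos[OF shi_sets[OF A, of q], of "nat (- q)"] by simp
 qed
qed

text \<open>The error is relative to the product. This matters below, where the events themselves
  have exponentially small probability.\<close>

lemma mix:
 assumes "0 < \<delta>"
 obtains g where "\<And>A C W W' c. finite W ==> finite W' ==> dep W A ==> dep W' C ==> W \<subseteq> {..c} ==> W' \<subseteq> {c + int g..} ==>
  \<bar>measure \<mu> (A \<inter> C) - measure \<mu> A * measure \<mu> C\<bar> \<le> \<delta> * (measure \<mu> A * measure \<mu> C)"
proof -
 have "eventually (\<lambda>n. psi_coefficient \<mu> n < ereal \<delta>) sequentially"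
  using order_tendstoD(2)[OF psi, of "ereal \<delta>"] assms by simp
 then obtain g where g: "psi_coefficient \<mu> g < ereal \<delta>" using eventually_happens by fastforce
 have "\<bar>measure \<mu> (A \<inter> C) - measure \<mu> A * measure \<mu> C\<bar> \<le> \<delta> * (measure \<mu> A * measure \<mu> C)"
  if h: "finite W" "finite W'" "dep W A" "dep W' C" "W \<subseteq> {..c}" "W' \<subseteq> {c + int g..}" for A C W W' c
 proof -
  define A' where "A' = shi (- c) -` A"
  define C' where "C' = shi (- c) -` C"
  have A: "A \<in> sets \<mu>" "C \<in> sets \<mu>" using h meas_dep by blast+
  have m: "measure \<mu> A' = measure \<mu> A" "measure \<mu> C' = measure \<mu> C" "measure \<mu> (A' \<inter> C') = measure \<mu> (A \<inter> C)"
   using inv_shi[OF A(1), of "- c"] inv_shi[OF A(2), of "- c"] inv_shi[of "A \<inter> C" "- c"] A by (auto simp: A'_def C'_def)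
  have cA: "A' \<in> cylinder_algebra {..0}" unfolding A'_def
   by (rule dep_cylinder[OF _ _ dep_shi[OF h(3)]]) (use h(1,5) in auto)
  have cC: "C' \<in> cylinder_algebra {int g..}" unfolding C'_def
   by (rule dep_cylinder[OF _ _ dep_shi[OF h(4)]]) (use h(2,6) in auto)
  show ?thesis
  proof (cases "measure \<mu> A > 0 \<and> measure \<mu> C > 0")
   case True
   have "ereal \<bar>measure \<mu> (A' \<inter> C') / (measure \<mu> A' * measure \<mu> C') - 1\<bar> \<le> psi_coefficient \<mu> g"
    unfolding psi_coefficient_def
    by (rule Sup_upper, rule CollectI, rule exI[of _ A'], rule exI[of _ C']) (use cA cC True m in auto)
   from le_less_trans[OF this g]
   have r: "\<bar>measure \<mu> (A \<inter> C) / (measure \<mu> A * measure \<mu> C) - 1\<bar> \<le> \<delta>" unfolding m by simp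
   have pos: "0 < measure \<mu> A * measure \<mu> C" using True by simp
   have "measure \<mu> (A \<inter> C) - measure \<mu> A * measure \<mu> C
     = (measure \<mu> (A \<inter> C) / (measure \<mu> A * measure \<mu> C) - 1) * (measure \<mu> A * measure \<mu> C)"
    using True by (simp add: field_simps)
   hence e: "\<bar>measure \<mu> (A \<inter> C) - measure \<mu> A * measure \<mu> C\<bar>
     = \<bar>measure \<mu> (A \<inter> C) / (measure \<mu> A * measure \<mu> C) - 1\<bar> * (measure \<mu> A * measure \<mu> C)"
    using pos by (simp only: abs_mult) simp
   show ?thesis unfolding e by (rule mult_right_mono[OF r]) (use pos in linarith)
  next
   case False
   have "measure \<mu> (A \<inter> C) \<le> measure \<mu> A" "measure \<mu> (A \<inter> C) \<le> measure \<mu> C"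
    using A by (auto intro!: finite_measure_mono)
   moreover have "measure \<mu> A = 0 \<or> measure \<mu> C = 0" using False measure_nonneg[of \<mu> A] measure_nonneg[of \<mu> C] by linarith
   moreover have "0 \<le> measure \<mu> (A \<inter> C)" by simp
   ultimately have "measure \<mu> (A \<inter> C) = 0" by linarith
   thus ?thesis using \<open>measure \<mu> A = 0 \<or> measure \<mu> C = 0\<close> by auto
  qed
 qed
 thus thesis by (rule that)
qed

definition brk :: "'b list => int => (int => 'b) set" where "brk v p = {x. occurs v x p}"

lemma brk_dep: "dep {p..<p + int (length v)} (brk v p)"
 unfolding brk_def occurs_def by (rule depI) auto

lemma brk_pos: "measure \<mu> (brk v p) = measure \<mu> (cylinder v)"
proof -
 have "brk v p = shi p -` cylinder v" by (auto simp: brk_def occurs_def cylinder_def shi_def add.commute)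
 moreover have "cylinder v \<in> sets \<mu>"
 proof -
  have "cylinder v = brk v 0" by (auto simp: brk_def occurs_def cylinder_def)
  thus ?thesis using meas_dep[OF _ brk_dep, of 0 v] by simp
 qed
 ultimately show ?thesis using inv_shi by simp
qed

definition nobrk :: "'b list => int => int => nat => (int => 'b) set" where
 "nobrk v G p K = {x. \<forall>k<K. \<not> occurs v x (p + int k * G)}"

lemma nobrk_dep: "0 \<le> G ==> dep {p..<p + int K * G + int (length v)} (nobrk v G p K)"
proof (rule depI)
 fix x y :: "int => 'b" assume G: "0 \<le> G" and e: "\<And>i. i \<in> {p..<p + int K * G + int (length v)} ==> x i = y i" and x: "x \<in> nobrk v G p K"
 have "occurs v x (p + int k * G) \<longleftrightarrow> occurs v y (p + int k * G)" if k: "k < K" for k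
 proof -
  have "int k * G \<le> int K * G" using k G by (intro mult_right_mono) auto
  moreover have "0 \<le> int k * G" using G by simp
  ultimately have "x (p + int k * G + int i) = y (p + int k * G + int i)" if "i < length v" for i
   using that by (intro e) auto
  thus ?thesis by (simp add: occurs_def)
 qed
 thus "y \<in> nobrk v G p K" using x by (simp add: nobrk_def)
qed

text \<open>The spacing \<open>G\<close> leaves room for the word and for the mixing gap belonging
  to \<open>p0 / 2\<close>; every further test then contributes a factor
  \<open>(1 + p0 / 2) * (1 - p0)\<close>, at most \<open>1 - p0 / 2\<close>.\<close>

lemma nobrk_decay:
 obtains G \<theta> where "int (length v) \<le> G" "0 < \<theta>" "\<theta> < 1" "\<And>p K. measure \<mu> (nobrk v G p K) \<le> \<theta> ^ K"
proof -
 define p0 where "p0 = measure \<mu> (cylinder v)"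
 have p0: "0 < p0" "p0 \<le> 1" using full by (auto simp: p0_def)
 obtain g where g: "\<And>A C W W' c. finite W ==> finite W' ==> dep W A ==> dep W' C ==> W \<subseteq> {..c} ==> W' \<subseteq> {c + int g..} ==>
  \<bar>measure \<mu> (A \<inter> C) - measure \<mu> A * measure \<mu> C\<bar> \<le> p0 / 2 * (measure \<mu> A * measure \<mu> C)"
  by (rule mix[of "p0 / 2"]) (use p0 in auto)
 define G where "G = int (length v) + int g + 1"
 define \<theta> where "\<theta> = 1 - p0 / 2"
 have "measure \<mu> (nobrk v G p K) \<le> \<theta> ^ K" for p K
 proof (induction K arbitrary: p)
  case (Suc K)
  have s: "nobrk v G p (Suc K) = (- brk v p) \<inter> nobrk v G (p + G) K"
   by (auto simp: nobrk_def brk_def less_Suc_eq_0_disj algebra_simps)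
  have G0: "0 \<le> G" by (simp add: G_def)
  have "\<bar>measure \<mu> ((- brk v p) \<inter> nobrk v G (p + G) K) - measure \<mu> (- brk v p) * measure \<mu> (nobrk v G (p + G) K)\<bar>
    \<le> p0 / 2 * (measure \<mu> (- brk v p) * measure \<mu> (nobrk v G (p + G) K))"
   by (rule g[OF _ _ dep_Compl[OF brk_dep[of p v]] nobrk_dep[OF G0, of "p + G" K v], of "p + int (length v)"]) (auto simp: G_def)
  hence "measure \<mu> (nobrk v G p (Suc K)) \<le> (1 + p0 / 2) * (measure \<mu> (- brk v p) * measure \<mu> (nobrk v G (p + G) K))"
   unfolding s distrib_right mult_1_left by (metis abs_le_D1 diff_le_eq add.commute)
  also have "measure \<mu> (- brk v p) = 1 - p0"
  proof -
   have "brk v p \<in> sets \<mu>" using meas_dep[OF _ brk_dep] by simp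
   thus ?thesis using prob_compl[of "brk v p"] by (simp add: space_mu brk_pos p0_def Compl_eq_Diff_UNIV)
  qed
  also have "(1 + p0 / 2) * ((1 - p0) * measure \<mu> (nobrk v G (p + G) K)) = ((1 + p0 / 2) * (1 - p0)) * measure \<mu> (nobrk v G (p + G) K)"
   by simp
  also have "\<dots> \<le> \<theta> * \<theta> ^ K"
  proof (rule mult_mono)
   have "(1 + p0 / 2) * (1 - p0) = 1 - p0 / 2 - p0 * p0 / 2" by (simp add: field_simps)
   moreover have "0 \<le> p0 * p0" by simp
   ultimately show "(1 + p0 / 2) * (1 - p0) \<le> \<theta>" unfolding \<theta>_def by linarith
  qed (use Suc p0 in \<open>auto simp: \<theta>_def\<close>)
  finally show ?case by simp
 qed simp
 moreover have "int (length v) \<le> G" "0 < \<theta>" "\<theta> < 1" using p0 by (auto simp: G_def \<theta>_def)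
 ultimately show thesis by (intro that)
qed

end

section \<open>Shift covariance of trains and charges\<close>

context placement
begin

lemma tail_sh: "tail (sh \<beta>) p \<longleftrightarrow> tail \<beta> (p + 1)"
proof -
 have e: "p + L + 1 = p + 1 + L" "p + L + 1 + 1 = p + 1 + L + 1" by simp_all
 show ?thesis unfolding tail_def occ_sh e by simp
qed

lemma lp_sh: "lp (sh \<beta>) p = lp \<beta> (p + 1) - 1"
proof -
 have e: "p - L + 1 = p + 1 - L" by simp
 show ?thesis unfolding lp_def occ_sh e by simp
qed

end

context evolution
begin

context
 assumes sev: "evolution L cb dg upd (\<lambda>t. sh (bt t))"
begin

interpretation s: evolution L cb dg upd "\<lambda>t. sh (bt t)" by (rule sev)

lemma wl_sh: "s.wl t p = wl t (p + 1) - 1"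
 by (induction t) (simp_all add: mv_sh)

lemma al_sh: "s.al t p \<longleftrightarrow> al t (p + 1)"
 by (induction t) (simp_all add: occ_sh near_sh wl_sh)

lemma ini_sh: "s.ini e i = ini (e + 1) i - 1"
 by (induction i) (simp_all add: lp_sh)

lemma train_sh: "s.train e i \<longleftrightarrow> train (e + 1) i"
 by (simp add: train_def s.train_def tail_sh occ_sh ini_sh)

lemma alive_sh: "s.alive t e i \<longleftrightarrow> alive t (e + 1) i"
 by (simp add: alive_def s.alive_def train_sh ini_sh al_sh)

lemma pos_sh: "s.pos t e i = pos t (e + 1) i - 1"
 by (simp add: pos_def s.pos_def ini_sh wl_sh)

lemma bigs_sh: "card (s.bigs j a' b') = card (bigs j (a' + 1) (b' + 1))"
proof -
 have "bigs j (a' + 1) (b' + 1) = (\<lambda>f. f + 1) ` s.bigs j a' b'"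
 proof (intro equalityI subsetI)
  fix f assume "f \<in> bigs j (a' + 1) (b' + 1)"
  thus "f \<in> (\<lambda>f. f + 1) ` s.bigs j a' b'" by (intro image_eqI[of _ _ "f - 1"]) (auto simp: bigs_def s.bigs_def train_sh)
 qed (auto simp: bigs_def s.bigs_def train_sh)
 thus ?thesis by (simp add: card_image)
qed

lemma charged_sh: "s.charged t j Bd Md z T \<longleftrightarrow> charged t j Bd Md (z + 1) (T + 1)"
proof -
 have q: "(\<forall>f. r < f \<and> f < T --> \<not> alive t (f + 1) j) \<longleftrightarrow> (\<forall>f. r + 1 < f \<and> f < T + 1 --> \<not> alive t f j)" for r
 proof
  assume a: "\<forall>f. r < f \<and> f < T --> \<not> alive t (f + 1) j"
  show "\<forall>f. r + 1 < f \<and> f < T + 1 --> \<not> alive t f j"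
  proof (intro allI impI)
   fix f assume "r + 1 < f \<and> f < T + 1"
   thus "\<not> alive t f j" using a[rule_format, of "f - 1"] by simp
  qed
 qed auto
 define Q where "Q r \<longleftrightarrow> train r (Suc j) \<and> alive t r j \<and> T + 1 - Md < r \<and> r < T + 1 \<and> (\<forall>f. r < f \<and> f < T + 1 --> \<not> alive t f j)
   \<and> int (card (bigs j r (T + 1 - 1))) * Bd \<le> z + 1 - pos t r 0 \<and> z + 1 - pos t r 0 < (int (card (bigs j r (T + 1 - 1))) + 1) * Bd" for r
 have "s.charged t j Bd Md z T \<longleftrightarrow> (\<exists>r. Q (r + 1))"
  unfolding s.charged_def Q_def train_sh alive_sh pos_sh bigs_sh q
  by (rule arg_cong[of _ _ Ex]) (auto simp: fun_eq_iff algebra_simps)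
 also have "\<dots> \<longleftrightarrow> (\<exists>r. Q r)"
 proof
  assume "\<exists>r. Q r"
  then obtain r where "Q r" by blast
  thus "\<exists>r. Q (r + 1)" by (intro exI[of _ "r - 1"]) simp
 qed blast
 also have "\<dots> \<longleftrightarrow> charged t j Bd Md (z + 1) (T + 1)" unfolding Q_def charged_def ..
 finally show ?thesis .
qed

end

end

section \<open>Measurability of the combinatorial events\<close>

lemma measurable_card_finite:
 assumes "finite A" "\<And>f. f \<in> A ==> Measurable.pred N (P f)"
 shows "(\<lambda>x. card {f \<in> A. P f x}) \<in> measurable N (count_space UNIV)"
 using assms
proof (induction A)
 case (insert a A)
 have "card {f \<in> insert a A. P f x} = (if P a x then Suc (card {f \<in> A. P f x}) else card {f \<in> A. P f x})" for x
 proof -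
  have "{f \<in> insert a A. P f x} = (if P a x then insert a {f \<in> A. P f x} else {f \<in> A. P f x})" by auto
  thus ?thesis using insert.hyps by (auto simp: card_insert_if)
 qed
 moreover have [measurable]: "Measurable.pred N (P a)" "(\<lambda>x. card {f \<in> A. P f x}) \<in> measurable N (count_space UNIV)"
  using insert by auto
 ultimately show ?case by simp
qed simp

lemma pred_count: "f \<in> measurable N (count_space UNIV) ==> Measurable.pred N (\<lambda>x. P (f x))"
 by (rule measurable_compose) auto

lemma (in system) SS_ne: "SS M \<noteq> {}"
proof -
 have "ST cell0 cell0 cell0 False False False False \<in> SS M"
  using SY_0[of M] QS_0[of M] by (simp add: SS_def SMC_def cell0_def CT_iff)
 thus ?thesis by blast
qed

locale sysmix = system M w a b u T + mixing \<mu>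
 for M :: "'b::{finite, discrete_topology} machine" and w :: "nat => 'b list" and a b :: 'b and u T and \<mu> :: "(int => 'b) measure"
begin

abbreviation LL :: int where "LL \<equiv> 2 * int rr"

definition bx :: "(int => 'b) => nat => int => 'b st option" where "bx x t = B ((F ^^ t) x)"

lemma ev: "evolution LL cry dgt (updm M) (bx x)"
 unfolding bx_def by (rule evol)

lemma F_pow_shift: "(F ^^ t) (shift_map x) = shift_map ((F ^^ t) x)"
 by (induction t) (simp_all add: F_shift)

lemma bx_shift: "bx (shift_map x) = (\<lambda>t. sh (bx x t))"
 by (rule ext) (simp only: bx_def F_pow_shift B_shift)

lemma F_pow_local: "(\<And>i. z - 4 * LL * int t \<le> i ==> i \<le> z + 4 * LL * int t ==> x i = y i) ==> (F ^^ t) x z = (F ^^ t) y z"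
proof (induction t arbitrary: z)
 case (Suc t)
 have "F ((F ^^ t) x) z = F ((F ^^ t) y) z"
 proof (rule F_local[OF SS_ne])
  fix i assume i: "z - 4 * L \<le> i" "i \<le> z + 4 * L"
  show "(F ^^ t) x i = (F ^^ t) y i"
  proof (rule Suc.IH, rule Suc.prems)
   fix k assume "i - 4 * LL * int t \<le> k" "k \<le> i + 4 * LL * int t"
   thus "z - 4 * LL * int (Suc t) \<le> k" "k \<le> z + 4 * LL * int (Suc t)" using i unfolding L_def by (auto simp: algebra_simps)
  qed
 qed
 thus ?case by simp
qed simp

lemma bx_dep: "dep {p - 4 * LL * int t..p + LL + 4 * LL * int t} {x. P (bx x t p)}"
proof (rule depI)
 fix x y :: "int => 'b" assume e: "\<And>i. i \<in> {p - 4 * LL * int t..p + LL + 4 * LL * int t} ==> x i = y i" and P: "x \<in> {x. P (bx x t p)}"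
 have "B ((F ^^ t) x) p = B ((F ^^ t) y) p"
 proof (rule B_local, rule F_pow_local)
  fix i k assume "p \<le> i" "i < p + L" "i - 4 * LL * int t \<le> k" "k \<le> i + 4 * LL * int t"
  thus "x k = y k" unfolding L_def by (intro e) auto
 qed
 thus "y \<in> {x. P (bx x t p)}" using P by (simp add: bx_def)
qed

lemma bx_meas [measurable]: "(\<lambda>x. bx x t p) \<in> measurable \<mu> (count_space UNIV)"
proof (rule measurableI)
 fix A :: "'b st option set"
 show "(\<lambda>x. bx x t p) -` A \<inter> space \<mu> \<in> sets \<mu>"
  using meas_dep[OF _ bx_dep[where P = "\<lambda>v. v \<in> A"], of p t] by (simp add: space_mu vimage_def)
qed simp

lemma occ_meas [measurable]: "Measurable.pred \<mu> (\<lambda>x. occ (bx x t) p)"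
 unfolding occ_def by (rule pred_count[OF bx_meas])

lemma lead_meas [measurable]: "Measurable.pred \<mu> (\<lambda>x. lead (bx x t) p)"
 unfolding lead_def by measurable

lemma tail_meas [measurable]: "Measurable.pred \<mu> (\<lambda>x. tail (bx x t) p)"
 unfolding tail_def by measurable

lemma near_meas [measurable]: "Measurable.pred \<mu> (\<lambda>x. near (bx x t) p)"
 unfolding near_def by measurable

lemma hop_meas [measurable]: "Measurable.pred \<mu> (\<lambda>x. hop (bx x t) p)"
proof -
 have [measurable]: "Measurable.pred \<mu> (\<lambda>x. cry (the (bx x t p)))" by (rule pred_count[OF bx_meas])
 have "hop (bx x t) p \<longleftrightarrow> (lead (bx x t) p \<and> \<not> near (bx x t) p \<and> cry (the (bx x t p))) \<or> (\<not> lead (bx x t) p \<and> occ (bx x t) (p - LL - 1))" for x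
  by (simp add: hop_def)
 thus ?thesis by simp
qed

lemma mv_meas [measurable]: "(\<lambda>x. mv (bx x t) p) \<in> measurable \<mu> (count_space UNIV)"
 unfolding mv_def by measurable

lemma lp_meas [measurable]: "(\<lambda>x. lp (bx x t) p) \<in> measurable \<mu> (count_space UNIV)"
 unfolding lp_def by measurable

lemma wl_meas [measurable]: "(\<lambda>x. evolution.wl LL cry (bx x) t p) \<in> measurable \<mu> (count_space UNIV)"
proof (induction t)
 case 0 thus ?case by (simp add: evolution.wl.simps[OF ev])
next
 case (Suc t)
 show ?case unfolding evolution.wl.simps[OF ev]
  by (rule measurable_compose_countable[OF mv_meas Suc])
qed

lemma al_meas [measurable]: "Measurable.pred \<mu> (\<lambda>x. evolution.al LL cry (bx x) t p)"
proof (induction t)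
 case 0 thus ?case by (simp add: evolution.al.simps[OF ev])
next
 case (Suc t)
 have [measurable]: "Measurable.pred \<mu> (\<lambda>x. near (bx x t) (evolution.wl LL cry (bx x) t p))"
  by (rule measurable_compose_countable[OF near_meas wl_meas])
 note Suc[measurable]
 show ?case unfolding evolution.al.simps[OF ev] by measurable
qed

lemma ini_meas [measurable]: "(\<lambda>x. evolution.ini LL (bx x) e i) \<in> measurable \<mu> (count_space UNIV)"
proof (induction i)
 case 0 thus ?case by (simp add: evolution.ini.simps[OF ev])
next
 case (Suc i)
 show ?case unfolding evolution.ini.simps[OF ev]
  by (rule measurable_compose_countable[OF lp_meas Suc])
qed

lemma train_meas [measurable]: "Measurable.pred \<mu> (\<lambda>x. evolution.train LL (bx x) e i)"
proof -
 have [measurable]: "Measurable.pred \<mu> (\<lambda>x. occ (bx x 0) (evolution.ini LL (bx x) e k))" for k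
  by (rule measurable_compose_countable[OF occ_meas ini_meas])
 show ?thesis unfolding evolution.train_def[OF ev] by measurable
qed

lemma alive_meas [measurable]: "Measurable.pred \<mu> (\<lambda>x. evolution.alive LL cry (bx x) t e i)"
proof -
 have [measurable]: "Measurable.pred \<mu> (\<lambda>x. evolution.al LL cry (bx x) t (evolution.ini LL (bx x) e i))"
  by (rule measurable_compose_countable[OF al_meas ini_meas])
 show ?thesis unfolding evolution.alive_def[OF ev] by measurable
qed

lemma pos_meas [measurable]: "(\<lambda>x. evolution.pos LL cry (bx x) t e i) \<in> measurable \<mu> (count_space UNIV)"
 unfolding evolution.pos_def[OF ev] by (rule measurable_compose_countable[OF wl_meas ini_meas])

lemma bigs_meas [measurable]: "(\<lambda>x. card (evolution.bigs LL (bx x) j a' b')) \<in> measurable \<mu> (count_space UNIV)"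
proof -
 have "evolution.bigs LL (bx x) j a' b' = {f \<in> {a'<..b'}. evolution.train LL (bx x) f (Suc j)}" for x
  unfolding evolution.bigs_def[OF ev] by auto
 thus ?thesis using measurable_card_finite[of "{a'<..b'}" "\<lambda>f x. evolution.train LL (bx x) f (Suc j)" \<mu>] by simp
qed

lemma charged_meas [measurable]: "Measurable.pred \<mu> (\<lambda>x. evolution.charged LL cry (bx x) t j Bd Md z e)"
proof -
 have [measurable]: "Measurable.pred \<mu> (\<lambda>x. int (card (evolution.bigs LL (bx x) j r (e - 1))) * Bd \<le> z - evolution.pos LL cry (bx x) t r 0)"
  "Measurable.pred \<mu> (\<lambda>x. z - evolution.pos LL cry (bx x) t r 0 < (int (card (evolution.bigs LL (bx x) j r (e - 1))) + 1) * Bd)" for r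
 proof -
  have "(\<lambda>x. (\<lambda>n x. int n * Bd \<le> z - evolution.pos LL cry (bx x) t r 0) (card (evolution.bigs LL (bx x) j r (e - 1))) x) \<in> measurable \<mu> (count_space UNIV)"
   by (rule measurable_compose_countable[OF pred_count[OF pos_meas] bigs_meas])
  thus "Measurable.pred \<mu> (\<lambda>x. int (card (evolution.bigs LL (bx x) j r (e - 1))) * Bd \<le> z - evolution.pos LL cry (bx x) t r 0)" by simp
  have "(\<lambda>x. (\<lambda>n x. z - evolution.pos LL cry (bx x) t r 0 < (int n + 1) * Bd) (card (evolution.bigs LL (bx x) j r (e - 1))) x) \<in> measurable \<mu> (count_space UNIV)"
   by (rule measurable_compose_countable[OF pred_count[OF pos_meas] bigs_meas])
  thus "Measurable.pred \<mu> (\<lambda>x. z - evolution.pos LL cry (bx x) t r 0 < (int (card (evolution.bigs LL (bx x) j r (e - 1))) + 1) * Bd)" by simp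
 qed
 show ?thesis unfolding evolution.charged_def[OF ev] by measurable
qed

lemma train_shi: "evolution.train LL (bx (shi q x)) e i \<longleftrightarrow> evolution.train LL (bx x) (e + q) i"
proof -
 have "evolution.train LL (bx (shift_map x)) e i \<longleftrightarrow> evolution.train LL (bx x) (e + 1) i" for x z e
  using evolution.train_sh[OF ev, of x e i] ev[of "shift_map x"] unfolding bx_shift by blast
 from covariant_shi[of "\<lambda>x z e. evolution.train LL (bx x) e i", OF this] show ?thesis .
qed

lemma charged_shi: "evolution.charged LL cry (bx (shi q x)) t j Bd Md z e \<longleftrightarrow> evolution.charged LL cry (bx x) t j Bd Md (z + q) (e + q)"
proof -
 have "evolution.charged LL cry (bx (shift_map x)) t j Bd Md z e \<longleftrightarrow> evolution.charged LL cry (bx x) t j Bd Md (z + 1) (e + 1)" for x z e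
  using evolution.charged_sh[OF ev, of x t j Bd Md z e] ev[of "shift_map x"] unfolding bx_shift by blast
 from covariant_shi[of "\<lambda>x z e. evolution.charged LL cry (bx x) t j Bd Md z e", OF this] show ?thesis .
qed

lemma near_cell_shi: "(evolution.alive LL cry (bx (shi q x)) t e 0 \<and> c1 \<le> z - evolution.pos LL cry (bx (shi q x)) t e 0 \<and> z - evolution.pos LL cry (bx (shi q x)) t e 0 \<le> c2)
 \<longleftrightarrow> (evolution.alive LL cry (bx x) t (e + q) 0 \<and> c1 \<le> z + q - evolution.pos LL cry (bx x) t (e + q) 0 \<and> z + q - evolution.pos LL cry (bx x) t (e + q) 0 \<le> c2)"
proof -
 have "(evolution.alive LL cry (bx (shift_map x)) t e 0 \<and> c1 \<le> z - evolution.pos LL cry (bx (shift_map x)) t e 0 \<and> z - evolution.pos LL cry (bx (shift_map x)) t e 0 \<le> c2)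
 \<longleftrightarrow> (evolution.alive LL cry (bx x) t (e + 1) 0 \<and> c1 \<le> z + 1 - evolution.pos LL cry (bx x) t (e + 1) 0 \<and> z + 1 - evolution.pos LL cry (bx x) t (e + 1) 0 \<le> c2)" for x z e
  using evolution.alive_sh[OF ev, of x t e 0] evolution.pos_sh[OF ev, of x t e 0] ev[of "shift_map x"] unfolding bx_shift by auto
 from covariant_shi[of "\<lambda>x z e. evolution.alive LL cry (bx x) t e 0 \<and> c1 \<le> z - evolution.pos LL cry (bx x) t e 0 \<and> z - evolution.pos LL cry (bx x) t e 0 \<le> c2", OF this] show ?thesis .
qed

end

section \<open>Density of trains\<close>

context sysmix
begin

abbreviation tr :: "(int => 'b) => int => nat => bool" where "tr x e i \<equiv> evolution.train LL (bx x) e i"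
abbreviation inx :: "(int => 'b) => int => nat => int" where "inx x e i \<equiv> evolution.ini LL (bx x) e i"

text \<open>The density of tails of trains with at least \<open>i + 1\<close> blocks.\<close>

definition \<rho> :: "nat => real" where "\<rho> i = measure \<mu> {x. tr x 0 i}"

lemma tr_sets: "{x. tr x e i} \<in> sets \<mu>"
 using train_meas[of e i] by (simp add: pred_def space_mu)

lemma tr_measure: "measure \<mu> {x. tr x q i} = \<rho> i"
proof -
 have "{x. tr x q i} = shi q -` {x. tr x 0 i}" using train_shi[of q _ 0 i] by auto
 thus ?thesis using inv_shi[OF tr_sets] by (simp add: \<rho>_def)
qed

lemma tr_Suc: "tr x e (Suc i) \<longleftrightarrow> tr x e i \<and> occ (bx x 0) (inx x e (Suc i))"
 by (auto simp: evolution.train_def[OF ev] le_Suc_eq)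

lemma tr_0: "tr x e 0 \<longleftrightarrow> tail (bx x 0) e \<and> occ (bx x 0) e"
 by (simp add: evolution.train_def[OF ev] evolution.ini.simps[OF ev])

lemma inx_Suc: "inx x e (Suc i) = (if occ (bx x 0) (inx x e i - LL) then inx x e i - LL else inx x e i - LL - 1)"
 by (simp add: evolution.ini.simps[OF ev] lp_def)

lemma inx_0 [simp]: "inx x e 0 = e"
 by (simp add: evolution.ini.simps[OF ev])

lemma inx_bounds: "e - int i * (LL + 1) \<le> inx x e i" "inx x e i \<le> e - int i * LL"
proof (induction i)
 case (Suc i)
 { case 1 thus ?case using Suc by (auto simp: inx_Suc algebra_simps) }
 { case 2 thus ?case using Suc by (auto simp: inx_Suc algebra_simps) }
qed simp_all

lemma inx_anti: "j \<le> i ==> inx x e i \<le> inx x e j"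
proof (induction i)
 case (Suc i)
 have "inx x e (Suc i) \<le> inx x e i" by (simp add: inx_Suc)
 thus ?case using Suc by (cases "j = Suc i") auto
qed simp

text \<open>Fixing the position \<open>p\<close> of block \<open>i\<close> localises the event on
  the cells from \<open>p\<close> on (\<open>E_dep\<close>), so mixing applies to it and to events
  further left.\<close>

definition E :: "nat => int => (int => 'b) set" where "E i p = {x. tr x 0 i \<and> inx x 0 i = p}"

lemma occ_dep: "dep {p..p + LL} {x. occ (bx x 0) p}"
 using bx_dep[of p 0 "\<lambda>v. v \<noteq> None"] by (simp add: occ_def)

lemma occ_dep': "W = {p..p + LL} ==> W \<subseteq> V ==> dep V {x. occ (bx x 0) p}"
 using dep_mono[OF occ_dep] by simp

lemma dep_Un: "dep W A ==> dep W C ==> dep W (A \<union> C)"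
 unfolding dep_def by blast

lemma E_dep: "p \<le> 0 ==> dep {p..2 * LL + 1} (E i p)"
proof (induction i arbitrary: p)
 case 0
 have r: "0 < rr" by (simp add: rr_def)
 have "E 0 p = (if p = 0 then {x. occ (bx x 0) 0} \<inter> (- {x. occ (bx x 0) LL} \<inter> - {x. occ (bx x 0) (LL + 1)}) else {})"
  by (auto simp: E_def tr_0 tail_def)
 moreover have "dep {0..2 * LL + 1} ({x. occ (bx x 0) 0} \<inter> (- {x. occ (bx x 0) LL} \<inter> - {x. occ (bx x 0) (LL + 1)}))"
  using r by (intro dep_Int dep_Compl occ_dep'[OF refl]) auto
 moreover have "dep {p..2 * LL + 1} {}" by (simp add: dep_def)
 ultimately show ?case by (cases "p = 0") simp_all
next
 case (Suc i)
 have "E (Suc i) p = (E i (p + LL) \<inter> {x. occ (bx x 0) p}) \<union> (E i (p + LL + 1) \<inter> (- {x. occ (bx x 0) (p + 1)} \<inter> {x. occ (bx x 0) p}))"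
  by (auto simp: E_def tr_Suc inx_Suc split: if_splits)
 moreover have A: "dep {p..2 * LL + 1} (E i q \<inter> A)" if q: "q = p + LL \<or> q = p + LL + 1" "dep {p..p + LL + 1} A" for q A
 proof (cases "q \<le> 0")
  case True
  hence "dep {p..2 * LL + 1} (E i q)" using q(1) by (intro dep_mono[OF Suc.IH[OF True]]) auto
  moreover have "dep {p..2 * LL + 1} A" using True q(1) by (intro dep_mono[OF q(2)]) auto
  ultimately show ?thesis by (rule dep_Int)
 next
  case False
  have "E i q = {}"
  proof -
   have "inx x 0 i \<le> 0" for x using inx_anti[of 0 i x 0] by simp
   thus ?thesis using False by (auto simp: E_def)
  qed
  thus ?thesis by (simp add: dep_def)
 qed
 moreover have "dep {p..2 * LL + 1} (E i (p + LL) \<inter> {x. occ (bx x 0) p})"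
  by (rule A[OF disjI1[OF refl] occ_dep'[OF refl]]) auto
 moreover have "dep {p..2 * LL + 1} (E i (p + LL + 1) \<inter> (- {x. occ (bx x 0) (p + 1)} \<inter> {x. occ (bx x 0) p}))"
  by (rule A[OF disjI2[OF refl]], intro dep_Int dep_Compl occ_dep'[OF refl]) auto
 ultimately show ?case using dep_Un by simp
qed

lemma E_sets: "p \<le> 0 ==> E i p \<in> sets \<mu>"
 by (rule meas_dep[OF _ E_dep]) simp

lemma tr_E: "{x. tr x 0 i} = (\<Union>p\<in>{- (int i * (LL + 1))..0}. E i p)"
proof -
 have "- (int i * (LL + 1)) \<le> inx x 0 i \<and> inx x 0 i \<le> 0" for x using inx_bounds(1)[of 0 i x] inx_anti[of 0 i x 0] by simp
 thus ?thesis by (auto simp: E_def)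
qed

lemma \<rho>_sum: "\<rho> i = (\<Sum>p\<in>{- (int i * (LL + 1))..0}. measure \<mu> (E i p))"
 unfolding \<rho>_def tr_E
 by (rule finite_measure_finite_Union) (use E_sets in \<open>auto simp: disjoint_family_on_def E_def\<close>)

lemma tr_dep: "dep {- (int i * (LL + 1))..2 * LL + 1} {x. tr x 0 i}"
 unfolding tr_E by (rule dep_UN, rule dep_mono[OF E_dep]) auto

text \<open>Consecutive blocks start at most \<open>LL + 1\<close> cells apart and each contains the
  letter \<open>a\<close> at offset \<open>rr\<close>, so three block lengths of \<open>b\<close>
  cannot occur inside a train.\<close>

definition bw :: "'b list" where "bw = replicate (3 * (2 * rr)) b"

lemma occ_a: "occ (bx x 0) p ==> x (p + int rr) = a"
proof -
 assume "occ (bx x 0) p"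
 hence "Q x p" using B_Q[of x p] by (simp add: bx_def)
 moreover have "0 < rr" by (simp add: rr_def)
 ultimately show ?thesis using Q_letters(3)[of x p "int rr"] by (simp add: L_def)
qed

lemma chain_nobreak:
 assumes "tr x e i" "j \<le> i" "inx x e i \<le> v" "v < inx x e j" shows "\<not> occurs bw x v"
proof -
 have "\<exists>k<i. inx x e (Suc k) \<le> v \<and> v < inx x e k"
  using assms(1-3)
 proof (induction i)
  case 0 thus ?case using assms(4) by simp
 next
  case (Suc i)
  show ?case
  proof (cases "v < inx x e i")
   case True thus ?thesis using Suc.prems by blast
  next
   case False
   hence "j \<le> i" using Suc.prems assms(4) inx_anti[of j "Suc i"] by (cases "j = Suc i") auto
   thus ?thesis using Suc.IH Suc.prems False by (auto simp: tr_Suc less_Suc_eq)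
  qed
 qed
 then obtain k where k: "k < i" "inx x e (Suc k) \<le> v" "v < inx x e k" by blast
 have "tr x e k" using assms(1) k(1) evolution.train_mono[OF ev] by (metis less_imp_le)
 hence "occ (bx x 0) (inx x e k)" by (cases k) (auto simp: tr_Suc tr_0)
 hence aa: "x (inx x e k + int rr) = a" by (rule occ_a)
 have le: "inx x e k \<le> v + LL + 1" using k(2) by (auto simp: inx_Suc split: if_splits)
 define d where "d = nat (inx x e k + int rr - v)"
 have d: "d < 3 * (2 * rr)" "v + int d = inx x e k + int rr" using le k(3) by (auto simp: d_def rr_def)
 show ?thesis
 proof
  assume "occurs bw x v"
  hence "x (v + int d) = bw ! d" using d(1) by (intro occursD) (auto simp: bw_def)
  thus False using aa d ab' by (simp add: bw_def)
 qed
qed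

text \<open>A train with \<open>r\<close> blocks beyond block \<open>i\<close> keeps
  \<open>r * LL\<close> cells left of that block free of \<open>bw\<close>. That event and
  \<open>E i p\<close> depend on separated sets of cells, and mixing with error 1 gives the factor
  2.\<close>

lemma \<rho>_decay:
 obtains G \<theta> c where "0 < \<theta>" "\<theta> < (1::real)" "\<And>i K. \<rho> (i + (K * G + c)) \<le> 2 * \<theta> ^ K * \<rho> i"
proof -
 obtain G \<theta> where G: "int (length bw) \<le> G" "0 < \<theta>" "\<theta> < 1" "\<And>p K. measure \<mu> (nobrk bw G p K) \<le> \<theta> ^ K"
  by (rule nobrk_decay[of bw]) (rule that)
 obtain g where g: "\<And>A C W W' c. finite W ==> finite W' ==> dep W A ==> dep W' C ==> W \<subseteq> {..c} ==> W' \<subseteq> {c + int g..} ==>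
  \<bar>measure \<mu> (A \<inter> C) - measure \<mu> A * measure \<mu> C\<bar> \<le> 1 * (measure \<mu> A * measure \<mu> C)"
  using mix[of 1] by auto
 have G0: "0 \<le> G" using G(1) by linarith
 define c where "c = g + 4"
 have L1: "1 \<le> LL" by (simp add: rr_def)
 have "\<rho> (i + (K * nat G + c)) \<le> 2 * \<theta> ^ K * \<rho> i" for i K
 proof -
  define r where "r = K * nat G + c"
  define v0 where "v0 p = p - int r * LL" for p
  have rL: "int K * G + (3 * LL + int g + LL) \<le> int r * LL"
  proof -
   have "int r = int K * G + (int g + 4)" using G0 by (simp add: r_def c_def)
   hence "int r * LL = int K * G * LL + int g * LL + 4 * LL" by (simp add: algebra_simps)
   moreover have "int K * G * 1 \<le> int K * G * LL" using L1 G0 by (intro mult_left_mono) auto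
   moreover have "int g * 1 \<le> int g * LL" using L1 by (intro mult_left_mono) auto
   ultimately show ?thesis by linarith
  qed
  have bwl: "int (length bw) = 3 * LL" by (simp add: bw_def)
  have sub: "{x. tr x 0 (i + r)} \<subseteq> (\<Union>p\<in>{- (int i * (LL + 1))..0}. nobrk bw G (v0 p) K \<inter> E i p)"
  proof
   fix x assume "x \<in> {x. tr x 0 (i + r)}"
   hence t: "tr x 0 (i + r)" by simp
   have ti: "tr x 0 i" using evolution.train_mono[OF ev t] by simp
   define p where "p = inx x 0 i"
   have "x \<in> E i p" using ti by (simp add: E_def p_def)
   moreover have "p \<in> {- (int i * (LL + 1))..0}" using inx_bounds(1)[of 0 i x] inx_anti[of 0 i x 0] by (simp add: p_def)
   moreover have "x \<in> nobrk bw G (v0 p) K" unfolding nobrk_def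
   proof (intro CollectI allI impI)
    fix k assume k: "k < K"
    have ir: "inx x 0 (i + r) \<le> p - int r * LL"
    proof -
     have "inx x e (i + s) \<le> inx x e i - int s * LL" for e s
      by (induction s) (auto simp: inx_Suc algebra_simps)
     thus ?thesis by (simp add: p_def)
    qed
    have "int k * G \<le> int K * G" using k G0 by (intro mult_right_mono) auto
    moreover have "0 \<le> int k * G" using G0 by simp
    ultimately have "inx x 0 (i + r) \<le> v0 p + int k * G" "v0 p + int k * G < inx x 0 i"
     unfolding v0_def using ir rL L1 p_def by linarith+
    thus "\<not> occurs bw x (v0 p + int k * G)" by (intro chain_nobreak[OF t, of i]) auto
   qed
   ultimately show "x \<in> (\<Union>p\<in>{- (int i * (LL + 1))..0}. nobrk bw G (v0 p) K \<inter> E i p)" by blast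
  qed
  have nb: "nobrk bw G p K \<in> sets \<mu>" for p by (rule meas_dep[OF _ nobrk_dep[OF G0]]) simp
  have "\<rho> (i + r) \<le> measure \<mu> (\<Union>p\<in>{- (int i * (LL + 1))..0}. nobrk bw G (v0 p) K \<inter> E i p)"
   unfolding \<rho>_def by (rule finite_measure_mono[OF sub]) (use nb E_sets in auto)
  also have "\<dots> \<le> (\<Sum>p\<in>{- (int i * (LL + 1))..0}. measure \<mu> (nobrk bw G (v0 p) K \<inter> E i p))"
   by (rule finite_measure_subadditive_finite) (use nb E_sets in auto)
  also have "\<dots> \<le> (\<Sum>p\<in>{- (int i * (LL + 1))..0}. 2 * \<theta> ^ K * measure \<mu> (E i p))"
  proof (rule sum_mono)
   fix p assume p: "p \<in> {- (int i * (LL + 1))..0}"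
   hence p0: "p \<le> 0" by simp
   have "\<bar>measure \<mu> (nobrk bw G (v0 p) K \<inter> E i p) - measure \<mu> (nobrk bw G (v0 p) K) * measure \<mu> (E i p)\<bar>
     \<le> 1 * (measure \<mu> (nobrk bw G (v0 p) K) * measure \<mu> (E i p))"
    by (rule g[OF _ _ nobrk_dep[OF G0, of "v0 p" K bw] E_dep[OF p0, of i], of "p - int g"]) (use p rL L1 in \<open>auto simp: v0_def bwl\<close>)
   hence "measure \<mu> (nobrk bw G (v0 p) K \<inter> E i p) \<le> 2 * (measure \<mu> (nobrk bw G (v0 p) K) * measure \<mu> (E i p))" by linarith
   also have "\<dots> \<le> 2 * (\<theta> ^ K * measure \<mu> (E i p))" using G(4) by (intro mult_left_mono mult_right_mono) auto
   finally show "measure \<mu> (nobrk bw G (v0 p) K \<inter> E i p) \<le> 2 * \<theta> ^ K * measure \<mu> (E i p)" by simp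
  qed
  also have "\<dots> = 2 * \<theta> ^ K * \<rho> i" by (simp add: \<rho>_sum sum_distrib_left)
  finally show ?thesis by (simp add: r_def)
 qed
 thus thesis by (rule that[OF G(2,3)])
qed

lemma \<rho>_nonneg: "0 \<le> \<rho> i" by (simp add: \<rho>_def)

lemma \<rho>_anti: "i \<le> j ==> \<rho> j \<le> \<rho> i"
proof -
 assume "i \<le> j"
 hence "{x. tr x 0 j} \<subseteq> {x. tr x 0 i}" using evolution.train_mono[OF ev] by blast
 thus ?thesis unfolding \<rho>_def by (rule finite_measure_mono) (rule tr_sets)
qed

text \<open>By full support it suffices to exhibit one word that forces the event:
  \<open>i + 1\<close> code words, followed by letters \<open>b\<close> that prevent a further
  block.\<close>

lemma \<rho>_pos: "0 < \<rho> i"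
proof -
 obtain s where s: "s \<in> SS M" using SS_ne by blast
 define v where "v = concat (replicate (Suc i) (codeS s)) @ replicate (3 * (2 * rr)) b"
 have lc: "length (codeS s) = 2 * rr" using codeS_wf[OF s] by blast
 have rp: "0 < rr" by (simp add: rr_def)
 define e where "e = int i * LL"
 have "tr x e i" if x: "occurs v x 0" for x
 proof -
  have lcc: "length (concat (replicate n (codeS s))) = n * (2 * rr)" for n
   by (induction n) (auto simp: lc)
  have nc: "concat (replicate n (codeS s)) ! (k * (2 * rr) + l) = codeS s ! l" if "k < n" "l < 2 * rr" for n k l
   using that
  proof (induction n arbitrary: k)
   case (Suc n)
   thus ?case by (cases k) (auto simp: nth_append lc)
  qed simp
  have o: "occ (bx x 0) (int k * LL)" if "k \<le> i" for k
  proof -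
   have "occurs (codeS s) x (int k * LL)" unfolding occurs_def
   proof (intro allI impI)
    fix l assume l: "l < length (codeS s)"
    have "k * (2 * rr) + l < Suc i * (2 * rr)"
    proof -
     have "k * (2 * rr) \<le> i * (2 * rr)" using that by (intro mult_right_mono) auto
     moreover have "Suc i * (2 * rr) = 2 * rr + i * (2 * rr)" by simp
     ultimately show ?thesis using l lc by linarith
    qed
    hence "x (0 + int (k * (2 * rr) + l)) = codeS s ! l"
     using occursD[OF x, of "k * (2 * rr) + l"] nc[of k "Suc i" l] that l lcc[of "Suc i"] lc by (simp add: v_def nth_append del: replicate_Suc)
    thus "x (int k * LL + int l) = codeS s ! l" by (simp add: algebra_simps)
   qed
   thus ?thesis using s by (auto simp: occ_def bx_def B_iff)
  qed
  have no: "\<not> occ (bx x 0) (e + LL + d)" if "0 \<le> d" "d < LL" for d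
  proof
   assume "occ (bx x 0) (e + LL + d)"
   from occ_a[OF this] have "x (e + LL + d + int rr) = a" .
   moreover have "e + LL + d + int rr = 0 + int (Suc i * (2 * rr) + nat (d + int rr))"
    using that by (simp add: e_def algebra_simps)
   moreover have "x (0 + int (Suc i * (2 * rr) + nat (d + int rr))) = b"
    using occursD[OF x, of "Suc i * (2 * rr) + nat (d + int rr)"] that lcc[of "Suc i"] by (simp add: v_def nth_append del: replicate_Suc mult_Suc)
   ultimately show False using ab' by (simp del: mult_Suc)
  qed
  have ini: "inx x e k = e - int k * LL" if "k \<le> i" for k
   using that
  proof (induction k)
   case (Suc k)
   have "e - int k * LL - LL = int (i - Suc k) * LL" using Suc.prems by (simp add: e_def algebra_simps of_nat_diff)
   hence o': "occ (bx x 0) (e - int k * LL - LL)" using o[of "i - Suc k"] by simp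
   have ik: "inx x e k = e - int k * LL" using Suc by simp
   show ?case unfolding inx_Suc ik using o' by (simp add: algebra_simps)
  qed simp
  have "occ (bx x 0) (inx x e k)" if "k \<le> i" for k
  proof -
   have "e - int k * LL = int (i - k) * LL" unfolding e_def using that by (simp add: algebra_simps of_nat_diff)
   hence "inx x e k = int (i - k) * LL" using ini[OF that] by simp
   thus ?thesis using o[of "i - k"] by simp
  qed
  moreover have "tail (bx x 0) e" using no[of 0] no[of 1] rp by (simp add: tail_def)
  ultimately show ?thesis by (simp add: evolution.train_def[OF ev])
 qed
 hence "brk v 0 \<subseteq> {x. tr x e i}" by (auto simp: brk_def)
 hence "measure \<mu> (brk v 0) \<le> \<rho> i" using finite_measure_mono[OF _ tr_sets] tr_measure by metis
 thus ?thesis using full[of v] by (simp add: brk_pos)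
qed

lemma \<rho>_ratio: assumes "0 < \<epsilon>" shows "\<exists>r. \<forall>i. \<rho> (i + r) \<le> \<epsilon> * \<rho> i"
proof -
 obtain G \<theta> c where d: "0 < \<theta>" "\<theta> < (1::real)" "\<And>i K. \<rho> (i + (K * G + c)) \<le> 2 * \<theta> ^ K * \<rho> i"
  by (rule \<rho>_decay) (rule that)
 obtain K where K: "\<theta> ^ K < \<epsilon> / 2" using real_arch_pow_inv[of "\<epsilon> / 2" \<theta>] assms d by auto
 have "\<rho> (i + (K * G + c)) \<le> \<epsilon> * \<rho> i" for i
 proof -
  have "2 * \<theta> ^ K * \<rho> i \<le> \<epsilon> * \<rho> i" using K \<rho>_nonneg by (intro mult_right_mono) auto
  thus ?thesis using d(3)[of i K] by linarith
 qed
 thus ?thesis by blast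
qed

text \<open>The exponent 6 covers the cubic window length \<open>lam\<close> times the quadratic
  charge \<open>Bd\<close>, with one power to spare.\<close>

lemma poly_decay: "(\<lambda>j. real (j + k) ^ 6 * \<rho> j) \<longlonglongrightarrow> 0"
proof -
 obtain r0 where r0: "\<And>i. \<rho> (i + r0) \<le> 1 / 2 * \<rho> i" using \<rho>_ratio[of "1 / 2"] by auto
 define r where "r = r0 + k + 1"
 have r: "\<rho> (i + r) \<le> 1 / 2 * \<rho> i" for i using r0[of i] \<rho>_anti[of "i + r0" "i + r"] by (simp add: r_def)
 have \<rho>1: "\<rho> i \<le> 1" for i by (simp add: \<rho>_def)
 have pow: "\<rho> (n * r) \<le> (1 / 2) ^ n" for n
 proof (induction n)
  case (Suc n)
  have "\<rho> (Suc n * r) \<le> 1 / 2 * \<rho> (n * r)" using r[of "n * r"] by (simp add: add.commute)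
  thus ?case using Suc by simp
 qed (simp add: \<rho>1)
 define y where "y = root 6 2"
 have y: "1 < y" "y ^ 6 = 2" by (simp_all add: y_def)
 have l1: "(\<lambda>n. real n / y ^ n) \<longlonglongrightarrow> 0" using lim_n_over_pown[of y] y(1) by simp
 hence "(\<lambda>n. (real n / y ^ n) ^ 6) \<longlonglongrightarrow> 0 ^ 6" by (rule tendsto_power)
 moreover have "(real n / y ^ n) ^ 6 = real n ^ 6 * (1 / 2) ^ n" for n
 proof -
  have "(y ^ n) ^ 6 = 2 ^ n" unfolding power_mult[symmetric] mult.commute[of n] by (simp add: power_mult y(2))
  thus ?thesis by (simp add: power_divide power_one_over field_simps)
 qed
 ultimately have l2: "(\<lambda>n. real n ^ 6 * (1 / 2) ^ n) \<longlonglongrightarrow> 0" by simp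
 have "(\<lambda>n. real (Suc n) ^ 6 * (1 / 2) ^ Suc n) \<longlonglongrightarrow> 0" by (rule LIMSEQ_Suc[OF l2])
 hence "(\<lambda>n. 2 * real r ^ 6 * (real (Suc n) ^ 6 * (1 / 2) ^ Suc n)) \<longlonglongrightarrow> 2 * real r ^ 6 * 0" by (intro tendsto_mult tendsto_const)
 hence l3: "(\<lambda>n. 2 * real r ^ 6 * (real (Suc n) ^ 6 * (1 / 2) ^ Suc n)) \<longlonglongrightarrow> 0" by simp
 have fl: "filterlim (\<lambda>j. (j + k) div r) at_top sequentially"
  unfolding filterlim_at_top
 proof
  fix Z
  show "\<forall>\<^sub>F j in sequentially. Z \<le> (j + k) div r"
   using eventually_ge_at_top[of "Z * r"]
  proof eventually_elim
   case (elim j)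
   hence "Z * r div r \<le> (j + k) div r" by (intro div_le_mono) simp
   moreover have "0 < r" by (simp add: r_def)
   ultimately show ?case by simp
  qed
 qed
 have up: "real (j + k) ^ 6 * \<rho> j \<le> 2 * real r ^ 6 * (real (Suc ((j + k) div r)) ^ 6 * (1 / 2) ^ Suc ((j + k) div r)) * 2" for j
 proof -
  define n where "n = (j + k) div r"
  have jr: "j + k < Suc n * r" using dividend_less_div_times[of r "j + k"] by (simp add: n_def r_def)
  have a: "real (j + k) ^ 6 \<le> (real (Suc n) * real r) ^ 6" using jr by (intro power_mono) (simp_all only: of_nat_mult[symmetric] of_nat_le_iff less_imp_le of_nat_0_le_iff)
  have b: "\<rho> j \<le> 2 * (1 / 2) ^ n"
  proof (cases n)
   case 0 thus ?thesis using \<rho>1[of j] by simp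
  next
   case (Suc n')
   have "n * r \<le> j + k" by (simp add: n_def)
   hence "n' * r \<le> j" using Suc by (simp add: r_def)
   hence "\<rho> j \<le> \<rho> (n' * r)" by (rule \<rho>_anti)
   also have "\<dots> \<le> (1 / 2) ^ n'" by (rule pow)
   finally show ?thesis using Suc by simp
  qed
  have "real (j + k) ^ 6 * \<rho> j \<le> (real (Suc n) * real r) ^ 6 * (2 * (1 / 2) ^ n)"
   using a b \<rho>_nonneg by (intro mult_mono) auto
  also have "\<dots> = 2 * real r ^ 6 * (real (Suc n) ^ 6 * (1 / 2) ^ Suc n) * 2" by (simp add: power_mult_distrib)
  finally show ?thesis unfolding n_def .
 qed
 have "(\<lambda>j. 2 * real r ^ 6 * (real (Suc ((j + k) div r)) ^ 6 * (1 / 2) ^ Suc ((j + k) div r)) * 2) \<longlonglongrightarrow> 0"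
  using tendsto_mult[OF filterlim_compose[OF l3 fl] tendsto_const[of 2]] by simp
 from tendsto_sandwich[OF always_eventually always_eventually tendsto_const this] show ?thesis
  using up \<rho>_nonneg by simp
qed

definition none :: "int => int => nat => (int => 'b) set" where
 "none c d i = {x. \<forall>q. c \<le> q \<and> q < d --> \<not> tr x q i}"

lemma none_sets: "none c d i \<in> sets \<mu>"
proof -
 have "Measurable.pred \<mu> (\<lambda>x. \<forall>q. c \<le> q \<and> q < d --> \<not> tr x q i)" by measurable
 thus ?thesis by (simp add: none_def pred_def space_mu)
qed

lemma none_shi: "shi q -` none c d i = none (c + q) (d + q) i"
proof -
 have "(\<forall>p. c \<le> p \<and> p < d --> \<not> tr x (p + q) i) \<longleftrightarrow> (\<forall>p. c + q \<le> p \<and> p < d + q --> \<not> tr x p i)" for x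
 proof
  assume a: "\<forall>p. c \<le> p \<and> p < d --> \<not> tr x (p + q) i"
  show "\<forall>p. c + q \<le> p \<and> p < d + q --> \<not> tr x p i"
  proof (intro allI impI)
   fix p assume "c + q \<le> p \<and> p < d + q"
   thus "\<not> tr x p i" using a[rule_format, of "p - q"] by simp
  qed
 qed auto
 thus ?thesis by (auto simp: none_def train_shi)
qed

lemma tr_dep_at: "dep {q - int i * (LL + 1)..q + 2 * LL + 1} {x. tr x q i}"
proof -
 have e: "{x. tr x q i} = shi q -` {x. tr x 0 i}" using train_shi[of q _ 0 i] by auto
 show ?thesis unfolding e by (rule dep_mono[OF dep_shi[OF tr_dep]]) auto
qed

lemma none_dep: "dep {c - int i * (LL + 1)..d + 2 * LL + 1} (none c d i)"
proof -
 have e: "none c d i = - (\<Union>q\<in>{c..<d}. {x. tr x q i})" by (auto simp: none_def)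
 show ?thesis unfolding e by (intro dep_Compl dep_UN dep_mono[OF tr_dep_at]) auto
qed

lemma no_cross: assumes "tr x 0 i" "tr x d i" "1 \<le> d" "k \<le> i" shows "1 \<le> inx x d k"
 using assms(4)
proof (induction k)
 case (Suc k)
 have sep: "sep (bx x 0)" by (simp add: bx_def sep_B)
 have o0: "occ (bx x 0) 0" "tail (bx x 0) 0" using assms(1) evolution.train_mono[OF ev assms(1), of 0] by (auto simp: tr_0)
 have ok: "occ (bx x 0) (inx x d k)" using assms(2) Suc.prems by (simp add: evolution.train_def[OF ev])
 have "LL \<le> inx x d k" using sepD[OF sep o0(1) ok] Suc by simp
 moreover have "inx x d k \<noteq> LL" "inx x d k \<noteq> LL + 1" using o0(2) ok by (auto simp: tail_def)
 ultimately have "LL + 2 \<le> inx x d k" by linarith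
 thus ?case by (auto simp: inx_Suc)
qed (use assms in simp)

text \<open>Decomposition by the last tail: the events \<open>R m\<close>, that \<open>m\<close> is
  the last tail in the interval, are disjoint. By mixing each of the \<open>N\<close> events has
  probability at least \<open>\<rho> i * (f / 2 - \<eta> i)\<close>, where \<open>f\<close> is the
  probability to see no tail; their sum is at most 1. The term \<open>\<eta>\<close> accounts for a
  second tail too close for mixing.\<close>

lemma existence:
 obtains \<eta> where "\<eta> \<longlonglongrightarrow> (0::real)" "\<And>i N. 0 < N ==> measure \<mu> (none 0 (int N) i) \<le> 2 / (real N * \<rho> i) + 2 * \<eta> i"
proof -
 obtain G \<theta> where G: "int (length bw) \<le> G" "0 < \<theta>" "\<theta> < 1" "\<And>p K. measure \<mu> (nobrk bw G p K) \<le> \<theta> ^ K"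
  by (rule nobrk_decay[of bw]) (rule that)
 have G0: "0 \<le> G" using G(1) by linarith
 have Gp: "0 < G" using G(1) by (simp add: bw_def rr_def)
 obtain g where g: "\<And>A C W W' c. finite W ==> finite W' ==> dep W A ==> dep W' C ==> W \<subseteq> {..c} ==> W' \<subseteq> {c + int g..} ==>
  \<bar>measure \<mu> (A \<inter> C) - measure \<mu> A * measure \<mu> C\<bar> \<le> 1 / 2 * (measure \<mu> A * measure \<mu> C)"
  by (rule mix[of "1 / 2"]) auto
 \<comment> \<open>From the distance \<open>s i\<close> on, the event of a second train is separated
   by \<open>g\<close> cells from the event of a train at 0.\<close>
 define s where "s i = int i * (LL + 1) + 2 * LL + 3 + int g" for i :: nat
 define P0 where "P0 i = int i + 2 * LL + 3 + int g" for i :: nat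
 define K where "K i = nat ((int i * LL - P0 i) div G)" for i
 define \<eta> where "\<eta> i = 2 * \<theta> ^ K i" for i
 have LL2: "2 \<le> LL" by (simp add: rr_def)
 have Klim: "filterlim K at_top sequentially" unfolding filterlim_at_top
 proof
  fix Z :: nat
  show "\<forall>\<^sub>F i in sequentially. Z \<le> K i"
   using eventually_ge_at_top[of "nat (int Z * G + 2 * LL + 3 + int g)"]
  proof eventually_elim
   case (elim i)
   have "int Z * G + 2 * LL + 3 + int g \<le> int i" using elim by simp
   moreover have "2 * int i \<le> int i * LL" using LL2 mult_left_mono[of 2 LL "int i"] by simp
   ultimately have "int Z * G \<le> int i * LL - P0 i" unfolding P0_def by linarith
   hence "int Z \<le> (int i * LL - P0 i) div G" using Gp by (simp add: pos_le_divide_eq zdiv_mono1[of "int Z * G" _ G, simplified])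
   thus ?case by (simp add: K_def)
  qed
 qed
 have "(\<lambda>n. \<theta> ^ n) \<longlonglongrightarrow> 0" using G by (intro LIMSEQ_realpow_zero) auto
 hence "(\<lambda>i. \<theta> ^ K i) \<longlonglongrightarrow> 0" by (rule filterlim_compose[OF _ Klim])
 hence \<eta>: "\<eta> \<longlonglongrightarrow> 0" unfolding \<eta>_def using tendsto_mult[OF tendsto_const[of 2]] by fastforce
 \<comment> \<open>A second tail closer than \<open>s i\<close> belongs to a train squeezed between
   0 and itself; its blocks leave no room for \<open>bw\<close> on a stretch of about
   \<open>i * (LL - 1)\<close> cells, away from the cells that decide about the train at 0.\<close>
 have adj: "measure \<mu> ({x. tr x 0 i} \<inter> - none 1 (s i) i) \<le> \<eta> i * \<rho> i" for i
 proof -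
  have sub: "{x. tr x 0 i} \<inter> - none 1 (s i) i \<subseteq> {x. tr x 0 i} \<inter> nobrk bw G (P0 i) (K i)"
  proof
   fix x assume "x \<in> {x. tr x 0 i} \<inter> - none 1 (s i) i"
   then obtain d where d: "tr x 0 i" "1 \<le> d" "d < s i" "tr x d i" by (auto simp: none_def)
   have i1: "1 \<le> inx x d i" by (rule no_cross[OF d(1,4,2)]) simp
   have i2: "inx x d i \<le> d - int i * LL" by (rule inx_bounds)
   have i3: "inx x d i \<le> P0 i" using i2 d(3) unfolding s_def P0_def by (simp add: algebra_simps)
   have "\<not> occurs bw x (P0 i + int k * G)" if k: "k < K i" for k
   proof (rule chain_nobreak[OF d(4), of 0])
    have kg: "0 \<le> int k * G" using G0 by simp
    show "inx x d i \<le> P0 i + int k * G" using i3 kg by linarith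
    have kK: "int k < (int i * LL - P0 i) div G" using k by (simp add: K_def)
    have "int k * G < (int i * LL - P0 i) div G * G" using kK Gp by (intro mult_strict_right_mono) auto
    also have "\<dots> \<le> int i * LL - P0 i" using div_mult_mod_eq[of "int i * LL - P0 i" G] pos_mod_sign[OF Gp, of "int i * LL - P0 i"] by linarith
    finally show "P0 i + int k * G < inx x d 0" using i1 i2 by simp
   qed simp
   thus "x \<in> {x. tr x 0 i} \<inter> nobrk bw G (P0 i) (K i)" using d(1) by (simp add: nobrk_def)
  qed
  have nb: "nobrk bw G (P0 i) (K i) \<in> sets \<mu>" by (rule meas_dep[OF _ nobrk_dep[OF G0]]) simp
  have "measure \<mu> ({x. tr x 0 i} \<inter> - none 1 (s i) i) \<le> measure \<mu> ({x. tr x 0 i} \<inter> nobrk bw G (P0 i) (K i))"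
   by (rule finite_measure_mono[OF sub]) (use nb tr_sets in auto)
  moreover have "\<bar>measure \<mu> ({x. tr x 0 i} \<inter> nobrk bw G (P0 i) (K i)) - measure \<mu> {x. tr x 0 i} * measure \<mu> (nobrk bw G (P0 i) (K i))\<bar>
    \<le> 1 / 2 * (measure \<mu> {x. tr x 0 i} * measure \<mu> (nobrk bw G (P0 i) (K i)))"
   by (rule g[OF _ _ tr_dep[of i] nobrk_dep[OF G0, of "P0 i" "K i" bw], of "2 * LL + 1"]) (auto simp: P0_def)
  moreover have "0 \<le> measure \<mu> {x. tr x 0 i} * measure \<mu> (nobrk bw G (P0 i) (K i))" by simp
  ultimately have "measure \<mu> ({x. tr x 0 i} \<inter> - none 1 (s i) i) \<le> 2 * (measure \<mu> {x. tr x 0 i} * measure \<mu> (nobrk bw G (P0 i) (K i)))"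
   by linarith
  also have "\<dots> \<le> 2 * (\<rho> i * \<theta> ^ K i)" unfolding \<rho>_def[symmetric] using G(4) \<rho>_nonneg by (intro mult_left_mono) auto
  finally show ?thesis by (simp add: \<eta>_def mult.commute mult.left_commute)
 qed
 have "measure \<mu> (none 0 (int N) i) \<le> 2 / (real N * \<rho> i) + 2 * \<eta> i" if N: "0 < N" for i N
 proof -
  define f where "f = measure \<mu> (none 0 (int N) i)"
  define R where "R m = {x. tr x (int m) i} \<inter> none (int m + 1) (int N) i" for m :: nat
  have Rs: "R m \<in> sets \<mu>" for m unfolding R_def using tr_sets none_sets by blast
  have low: "\<rho> i * f / 2 - \<eta> i * \<rho> i \<le> measure \<mu> (R m)" if m: "m < N" for m
  proof -
   define C where "C = none (s i) (int N - int m) i"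
   have Cs: "C \<in> sets \<mu>" unfolding C_def by (rule none_sets)
   have "\<bar>measure \<mu> ({x. tr x 0 i} \<inter> C) - measure \<mu> {x. tr x 0 i} * measure \<mu> C\<bar> \<le> 1 / 2 * (measure \<mu> {x. tr x 0 i} * measure \<mu> C)"
    unfolding C_def by (rule g[OF _ _ tr_dep[of i] none_dep[of "s i" i "int N - int m"], of "2 * LL + 1"]) (auto simp: s_def)
   hence 1: "\<rho> i * measure \<mu> C / 2 \<le> measure \<mu> ({x. tr x 0 i} \<inter> C)" unfolding \<rho>_def[symmetric] by linarith
   have "0 \<le> s i" by (simp add: s_def)
   hence "none 0 (int N) i \<subseteq> C" by (auto simp: C_def none_def)
   hence "f \<le> measure \<mu> C" unfolding f_def using Cs by (rule finite_measure_mono)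
   hence 2: "\<rho> i * f / 2 \<le> \<rho> i * measure \<mu> C / 2" using \<rho>_nonneg by (simp add: mult_left_mono)
   have sub: "{x. tr x 0 i} \<inter> C \<subseteq> ({x. tr x 0 i} \<inter> - none 1 (s i) i) \<union> ({x. tr x 0 i} \<inter> none 1 (int N - int m) i)"
    by (auto simp: C_def none_def) (metis not_le)
   have ns: "- none 1 (s i) i \<in> sets \<mu>" using none_sets[of 1 "s i" i] by (metis sets.compl_sets space_mu Compl_eq_Diff_UNIV)
   have "measure \<mu> ({x. tr x 0 i} \<inter> C) \<le> measure \<mu> (({x. tr x 0 i} \<inter> - none 1 (s i) i) \<union> ({x. tr x 0 i} \<inter> none 1 (int N - int m) i))"
    by (rule finite_measure_mono[OF sub]) (use ns tr_sets none_sets in blast)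
   also have "\<dots> \<le> measure \<mu> ({x. tr x 0 i} \<inter> - none 1 (s i) i) + measure \<mu> ({x. tr x 0 i} \<inter> none 1 (int N - int m) i)"
    by (rule measure_Un_le) (use ns tr_sets none_sets in blast)+
   also have "measure \<mu> ({x. tr x 0 i} \<inter> none 1 (int N - int m) i) = measure \<mu> (R m)"
   proof -
    have "R m = shi (int m) -` ({x. tr x 0 i} \<inter> none 1 (int N - int m) i)"
     using none_shi[of "int m" 1 "int N - int m" i] by (auto simp: R_def train_shi add.commute)
    thus ?thesis using inv_shi[of "{x. tr x 0 i} \<inter> none 1 (int N - int m) i" "int m"] tr_sets none_sets by auto
   qed
   finally show ?thesis using adj[of i] 1 2 by linarith
  qed
  have "real N * (\<rho> i * f / 2 - \<eta> i * \<rho> i) = (\<Sum>m<N. \<rho> i * f / 2 - \<eta> i * \<rho> i)" by simp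
  also have "\<dots> \<le> (\<Sum>m<N. measure \<mu> (R m))" using low by (intro sum_mono) auto
  also have "\<dots> = measure \<mu> (\<Union>m<N. R m)"
  proof (rule finite_measure_finite_Union[symmetric])
   show "disjoint_family_on R {..<N}" unfolding disjoint_family_on_def
   proof (intro ballI impI)
    fix m m' assume m: "m \<in> {..<N}" "m' \<in> {..<N}" "m \<noteq> m'"
    have "False" if "x \<in> R k" "x \<in> R l" "k < l" "l < N" for x k l
     using that by (auto simp: R_def none_def)
    thus "R m \<inter> R m' = {}" using m by (metis disjoint_iff lessThan_iff linorder_neqE_nat)
   qed
  qed (use Rs in auto)
  also have "\<dots> \<le> 1" by (rule prob_le_1)
  finally have h: "real N * (\<rho> i * f / 2 - \<eta> i * \<rho> i) \<le> 1" .
  have pos: "0 < real N * \<rho> i" using N \<rho>_pos by simp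
  have "(real N * \<rho> i) * (f / 2 - \<eta> i) \<le> 1" using h by (simp add: algebra_simps)
  hence "f / 2 - \<eta> i \<le> 1 / (real N * \<rho> i)" using pos by (simp add: pos_le_divide_eq mult.commute)
  thus ?thesis unfolding f_def[symmetric] by simp
 qed
 thus thesis using that[OF \<eta>] by blast
qed

text \<open>Mass transport: by invariance, the probabilities that \<open>e\<close> charges
  \<open>z\<close>, summed over \<open>e\<close>, equal the expected number of cells among the
  \<open>z - e\<close> charged by a train at 0.\<close>

lemma transport:
 fixes P :: "(int => 'b) => int => int => bool"
 assumes sh: "\<And>q x z e. P (shi q x) z e \<longleftrightarrow> P x (z + q) (e + q)" and [measurable]: "\<And>z e. Measurable.pred \<mu> (\<lambda>x. P x z e)"
  and c: "\<And>x. finite {z. P x z 0} \<and> int (card {z. P x z 0}) \<le> Bd" and I: "finite I"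
 shows "measure \<mu> {x. \<exists>e\<in>I. tr x e i \<and> P x z e} \<le> of_int Bd * \<rho> i"
proof -
 have ms: "{x. tr x e i \<and> P x z e} \<in> sets \<mu>" for z e
 proof -
  have "Measurable.pred \<mu> (\<lambda>x. tr x e i \<and> P x z e)" by measurable
  thus ?thesis by (simp add: pred_def space_mu)
 qed
 have "{x. \<exists>e\<in>I. tr x e i \<and> P x z e} = (\<Union>e\<in>I. {x. tr x e i \<and> P x z e})" by auto
 moreover have "(\<lambda>e. {x. tr x e i \<and> P x z e}) ` I \<subseteq> sets \<mu>" using ms by blast
 ultimately have "measure \<mu> {x. \<exists>e\<in>I. tr x e i \<and> P x z e} \<le> (\<Sum>e\<in>I. measure \<mu> {x. tr x e i \<and> P x z e})"
  using finite_measure_subadditive_finite[OF I, of "\<lambda>e. {x. tr x e i \<and> P x z e}"] by (simp only:)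
 also have "\<dots> = (\<Sum>e\<in>I. measure \<mu> {x. tr x 0 i \<and> P x (z - e) 0})"
 proof (rule sum.cong[OF refl])
  fix e
  have "{x. tr x e i \<and> P x z e} = shi e -` {x. tr x 0 i \<and> P x (z - e) 0}" using sh[of e _ "z - e" 0] train_shi[of e _ 0 i] by auto
  thus "measure \<mu> {x. tr x e i \<and> P x z e} = measure \<mu> {x. tr x 0 i \<and> P x (z - e) 0}" using inv_shi[OF ms] by simp
 qed
 also have "\<dots> = (\<Sum>e\<in>I. \<integral>x. indicator {x. tr x 0 i \<and> P x (z - e) 0} x \<partial>\<mu>)"
  using ms by (simp add: space_mu)
 also have "\<dots> = (\<integral>x. (\<Sum>e\<in>I. indicator {x. tr x 0 i \<and> P x (z - e) 0} x) \<partial>\<mu>)"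
  by (rule Bochner_Integration.integral_sum[symmetric]) (use ms in \<open>auto intro!: integrable_real_indicator simp: emeasure_finite less_top[symmetric]\<close>)
 also have "\<dots> \<le> (\<integral>x. of_int Bd * indicator {x. tr x 0 i} x \<partial>\<mu>)"
 proof (rule integral_mono)
  show "integrable \<mu> (\<lambda>x. \<Sum>e\<in>I. indicator {x. tr x 0 i \<and> P x (z - e) 0} x :: real)"
   by (intro Bochner_Integration.integrable_sum integrable_real_indicator) (use ms in \<open>auto simp: emeasure_finite less_top[symmetric]\<close>)
  show "integrable \<mu> (\<lambda>x. of_int Bd * indicator {x. tr x 0 i} x :: real)"
   by (intro integrable_mult_right integrable_real_indicator) (use tr_sets in \<open>auto simp: emeasure_finite less_top[symmetric]\<close>)
  fix x
  show "(\<Sum>e\<in>I. indicator {x. tr x 0 i \<and> P x (z - e) 0} x) \<le> (of_int Bd * indicator {x. tr x 0 i} x :: real)"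
  proof (cases "tr x 0 i")
   case True
   have "(\<Sum>e\<in>I. indicator {x. tr x 0 i \<and> P x (z - e) 0} x :: real) = (\<Sum>e\<in>I. if P x (z - e) 0 then 1 else 0)"
    using True by (intro sum.cong) (auto simp: indicator_def)
   also have "\<dots> = real (card {e \<in> I. P x (z - e) 0})" using I by (simp add: sum.If_cases Int_def)
   also have "\<dots> \<le> of_int Bd"
   proof -
    have "card {e \<in> I. P x (z - e) 0} = card ((\<lambda>e. z - e) ` {e \<in> I. P x (z - e) 0})" by (simp add: card_image inj_on_def)
    also have "\<dots> \<le> card {z. P x z 0}" using c by (intro card_mono) auto
    finally have "int (card {e \<in> I. P x (z - e) 0}) \<le> Bd" using c[of x] by linarith
    hence "real_of_int (int (card {e \<in> I. P x (z - e) 0})) \<le> of_int Bd" by (simp only: of_int_le_iff)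
    thus ?thesis by simp
   qed
   finally show ?thesis using True by simp
  next
   case False thus ?thesis by simp
  qed
 qed
 also have "\<dots> = of_int Bd * \<rho> i" using tr_sets by (simp add: \<rho>_def space_mu)
 finally show ?thesis .
qed

end

section \<open>Windows written by long trains\<close>

context sysmix
begin

text \<open>Cubic, so that a window contains many periods \<open>2 * (K + 1)\<^sup>2\<close> between
  restarts.\<close>

definition lam :: "nat => nat" where "lam h = (h + 1) ^ 3"
text \<open>The waiting time of \<open>train_stream\<close>, and one more step for the start of the
  run in \<open>window_stream\<close>.\<close>

definition stt :: "nat => nat" where "stt h = 8 * (h + 1)\<^sup>2 + 2"
definition Bd :: "nat => int" where "Bd h = evolution.b2 LL h (stt h)"
definition gd :: "(int => 'b) => nat => nat => nat => int => bool" where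
 "gd x j h t z \<longleftrightarrow> \<not> cov (bx x t) z \<and> evolution.good LL cry (bx x) j h (stt h) t z"

lemma Bd_eq: "Bd h = 2 * (int h * (LL + 5) + LL + 12) + 8 * (int h + 1)\<^sup>2 + 4"
 by (simp add: Bd_def evolution.b2_def[OF ev] evolution.b1_def[OF ev] stt_def add.commute)

lemma Bd_low: "1 \<le> Bd h" "int h * (LL + 1) + LL + 1 \<le> Bd h"
proof -
 have "0 \<le> int h * (LL + 5)" "0 \<le> (int h + 1)\<^sup>2" "int h * (LL + 1) \<le> int h * (LL + 5)" by (auto intro: mult_left_mono)
 moreover have "1 \<le> 2 * (p + l + 12) + 8 * s + 4 \<and> q + l + 1 \<le> 2 * (p + l + 12) + 8 * s + 4"
  if "0 \<le> p" "0 \<le> s" "q \<le> p" "0 \<le> l" for p q s l :: int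
  using that by (simp add: distrib_left)
 moreover have "0 \<le> LL" by simp
 ultimately show "1 \<le> Bd h" "int h * (LL + 1) + LL + 1 \<le> Bd h" unfolding Bd_eq by blast+
qed

lemma Bd_up: "Bd h \<le> (4 * LL + 46) * (int h + 1)\<^sup>2"
proof -
 have 1: "1 \<le> (int h + 1)\<^sup>2" by (rule one_le_power) simp
 have 2: "int h \<le> (int h + 1)\<^sup>2" by (simp add: power2_eq_square algebra_simps)
 have "int h * (LL + 5) \<le> (int h + 1)\<^sup>2 * (LL + 5)" using 2 by (intro mult_right_mono) auto
 moreover have "1 * (LL + 14) \<le> (int h + 1)\<^sup>2 * (LL + 14)" using 1 by (intro mult_right_mono) auto
 ultimately show ?thesis unfolding Bd_eq by (simp add: algebra_simps)
qed

text \<open>The second alternative is an interval containing all cells covered by a train of at most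
  \<open>h\<close> blocks with tail \<open>e\<close>.\<close>

definition chP :: "nat => nat => nat => int => (int => 'b) => int => int => bool" where
 "chP t j h Md x z e \<longleftrightarrow> evolution.charged LL cry (bx x) t j (Bd h) Md z e \<or>
  (evolution.alive LL cry (bx x) t e 0 \<and> - (int h * (LL + 1)) \<le> z - evolution.pos LL cry (bx x) t e 0
   \<and> z - evolution.pos LL cry (bx x) t e 0 \<le> LL)"

lemma chP_meas [measurable]: "Measurable.pred \<mu> (\<lambda>x. chP t j h Md x z e)"
proof -
 have [measurable]: "Measurable.pred \<mu> (\<lambda>x. - (int h * (LL + 1)) \<le> z - evolution.pos LL cry (bx x) t e 0 \<and> z - evolution.pos LL cry (bx x) t e 0 \<le> LL)"
  by (rule pred_count[OF pos_meas])
 show ?thesis unfolding chP_def by measurable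
qed

lemma chP_card: "finite {z. chP t j h Md x z 0} \<and> int (card {z. chP t j h Md x z 0}) \<le> 2 * Bd h"
proof -
 define A where "A = {z. evolution.charged LL cry (bx x) t j (Bd h) Md z 0}"
 define p where "p = evolution.pos LL cry (bx x) t 0 0"
 define C where "C = {p - int h * (LL + 1)..p + LL}"
 have cA: "finite A" "int (card A) \<le> Bd h" using evolution.charged_card[OF ev, of "Bd h" x t j Md 0] Bd_low[of h] unfolding A_def by auto
 have cC: "finite C" "int (card C) \<le> Bd h" using Bd_low(2)[of h] Bd_low(1)[of h] by (auto simp: C_def)
 have s: "{z. chP t j h Md x z 0} \<subseteq> A \<union> C" unfolding chP_def A_def C_def p_def by auto
 have f: "finite (A \<union> C)" using cA(1) cC(1) by simp
 have "card {z. chP t j h Md x z 0} \<le> card (A \<union> C)" by (rule card_mono[OF f s])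
 moreover have "card (A \<union> C) \<le> card A + card C" by (rule card_Un_le)
 ultimately show ?thesis using finite_subset[OF s f] cA(2) cC(2) by linarith
qed

lemma charge_bound:
 assumes "finite I"
 shows "measure \<mu> {x. \<exists>e\<in>I. tr x e i \<and> chP t j h Md x z e} \<le> of_int (2 * Bd h) * \<rho> i"
proof (rule transport[of "chP t j h Md", OF _ chP_meas chP_card assms])
 show "chP t j h Md (shi q x) z e \<longleftrightarrow> chP t j h Md x (z + q) (e + q)" for q x z e
  unfolding chP_def charged_shi near_cell_shi ..
qed

text \<open>Markov's inequality; the expected number of tails is the length of the interval times
  their density.\<close>

lemma bigs_expect:
 fixes Y X :: int
 assumes "0 < c" "Y \<le> X"
 shows "measure \<mu> {x. c \<le> real (card (evolution.bigs LL (bx x) j Y X))} \<le> of_int (X - Y) * \<rho> (Suc j) / c"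
proof -
 have [measurable]: "Measurable.pred \<mu> (\<lambda>x. c \<le> real (card (evolution.bigs LL (bx x) j Y X)))" by (rule pred_count[OF bigs_meas])
 have ms: "{x. c \<le> real (card (evolution.bigs LL (bx x) j Y X))} \<in> sets \<mu>"
  using \<open>Measurable.pred \<mu> (\<lambda>x. c \<le> real (card (evolution.bigs LL (bx x) j Y X)))\<close> by (simp add: pred_def space_mu)
 have b: "evolution.bigs LL (bx x) j Y X = {f \<in> {Y<..X}. tr x f (Suc j)}" for x
  unfolding evolution.bigs_def[OF ev] by auto
 have "c * measure \<mu> {x. c \<le> real (card (evolution.bigs LL (bx x) j Y X))}
   = (\<integral>x. c * indicator {x. c \<le> real (card (evolution.bigs LL (bx x) j Y X))} x \<partial>\<mu>)"
  using ms by (simp add: space_mu)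
 also have "\<dots> \<le> (\<integral>x. (\<Sum>f\<in>{Y<..X}. indicator {x. tr x f (Suc j)} x) \<partial>\<mu>)"
 proof (rule integral_mono)
  show "integrable \<mu> (\<lambda>x. c * indicator {x. c \<le> real (card (evolution.bigs LL (bx x) j Y X))} x :: real)"
   by (intro integrable_mult_right integrable_real_indicator) (use ms in \<open>auto simp: emeasure_finite less_top[symmetric]\<close>)
  show "integrable \<mu> (\<lambda>x. \<Sum>f\<in>{Y<..X}. indicator {x. tr x f (Suc j)} x :: real)"
   by (intro Bochner_Integration.integrable_sum integrable_real_indicator) (use tr_sets in \<open>auto simp: emeasure_finite less_top[symmetric]\<close>)
  fix x
  have "real (card (evolution.bigs LL (bx x) j Y X)) = (\<Sum>f\<in>{Y<..X}. indicator {x. tr x f (Suc j)} x)"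
   unfolding b by (simp add: indicator_def sum.If_cases Int_def)
  thus "c * indicator {x. c \<le> real (card (evolution.bigs LL (bx x) j Y X))} x \<le> (\<Sum>f\<in>{Y<..X}. indicator {x. tr x f (Suc j)} x :: real)"
   using assms(1) by (auto simp: indicator_def)
 qed
 also have "\<dots> = (\<Sum>f\<in>{Y<..X}. measure \<mu> {x. tr x f (Suc j)})"
  by (subst Bochner_Integration.integral_sum) (use tr_sets in \<open>auto intro!: integrable_real_indicator simp: emeasure_finite less_top[symmetric] space_mu\<close>)
 also have "\<dots> = of_int (X - Y) * \<rho> (Suc j)" using assms(2) by (simp add: tr_measure)
 finally show ?thesis using assms(1) by (simp add: pos_le_divide_eq mult.commute)
qed

text \<open>At time \<open>\<tau> j\<close> a stretch of length \<open>D = t / 2 ^ (j + 2)\<close>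
  contains about \<open>A\<close> tails of trains with \<open>j + 3\<close> or more blocks, enough
  to find one. Up to \<open>\<tau> (Suc j)\<close> the expected number of tails with one block more
  stays below \<open>2 * A\<close>, so by \<open>\<rho>_ratio\<close> trains with more than
  \<open>j + r\<close> blocks are unlikely to occur at all.\<close>

theorem good_prob:
 assumes \<epsilon>: "0 < \<epsilon>" "\<epsilon> \<le> 1"
 obtains r \<tau> j0 where "strict_mono (\<tau> :: nat => nat)" "0 < r"
  "\<And>j t. j0 \<le> j ==> \<tau> j \<le> t ==> t < \<tau> (Suc j) ==>
   \<exists>G\<in>sets \<mu>. 1 - \<epsilon> \<le> measure \<mu> G \<and> (\<forall>x\<in>G. \<forall>z<lam (j + r). gd x j (j + r) t (int z))"
proof -
 \<comment> \<open>The search interval in \<open>m1\<close> has length at least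
   \<open>9 / 100 * D\<close>, so 200 makes the first term of \<open>existence\<close> at most
   \<open>\<epsilon> / 9\<close>.\<close>
 define A where "A = 200 / \<epsilon>"
 have A: "200 \<le> A" using \<epsilon> by (simp add: A_def pos_le_divide_eq)
 obtain \<eta> where \<eta>: "\<eta> \<longlonglongrightarrow> 0" "\<And>i N. 0 < N ==> measure \<mu> (none 0 (int N) i) \<le> 2 / (real N * \<rho> i) + 2 * \<eta> i"
  by (rule existence) (rule that)
 \<comment> \<open>In \<open>m2\<close> a stretch of length at most \<open>3 * D\<close> meets the
   bound \<open>2 * A\<close>, so 48 leaves a total of \<open>\<epsilon> / 8\<close>.\<close>
 have "0 < \<epsilon> / (48 * A)" using \<epsilon> A by simp
 then obtain r0 where r0: "\<And>i. \<rho> (i + r0) \<le> \<epsilon> / (48 * A) * \<rho> i" using \<rho>_ratio by blast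
 define r where "r = r0 + 3"
 define CC :: real where "CC = 8000 * of_int (4 * LL + 46)"
 have CC: "0 < CC" by (simp add: CC_def add_pos_nonneg)
 have "(\<lambda>j. real (Suc j + r) ^ 6 * \<rho> (Suc j)) \<longlonglongrightarrow> 0" by (rule LIMSEQ_Suc[OF poly_decay])
 hence "(\<lambda>j. CC * (real (Suc j + r) ^ 6 * \<rho> (Suc j))) \<longlonglongrightarrow> CC * 0" by (intro tendsto_mult tendsto_const)
 hence e1: "\<forall>\<^sub>F j in sequentially. CC * (real (Suc j + r) ^ 6 * \<rho> (Suc j)) < \<epsilon>" using \<epsilon>(1) by (auto dest: order_tendstoD(2))
 have "(\<lambda>j. \<eta> (j + 2)) \<longlonglongrightarrow> 0" by (rule LIMSEQ_ignore_initial_segment[OF \<eta>(1)])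
 hence e2: "\<forall>\<^sub>F j in sequentially. \<eta> (j + 2) < \<epsilon> / 16" using \<epsilon>(1) by (auto dest: order_tendstoD(2)[where a = "\<epsilon> / 16"])
 obtain j0 where j0: "\<And>j. j0 \<le> j ==> CC * (real (Suc j + r) ^ 6 * \<rho> (Suc j)) < \<epsilon>" "\<And>j. j0 \<le> j ==> \<eta> (j + 2) < \<epsilon> / 16"
  using eventually_conj[OF e1 e2] unfolding eventually_sequentially by blast
 define yy where "yy j = A * 2 ^ (j + 2) / \<rho> (j + 2)" for j
 define \<tau> where "\<tau> j = nat \<lceil>yy j\<rceil>" for j
 have yy1: "1 \<le> yy j" for j
 proof -
  have "\<rho> (j + 2) \<le> 1" by (simp add: \<rho>_def)
  moreover have "1 * 1 \<le> A * 2 ^ (j + 2)" using A by (intro mult_mono one_le_power) auto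
  ultimately show ?thesis unfolding yy_def using \<rho>_pos[of "j + 2"] by (simp add: pos_le_divide_eq)
 qed
 have yy2: "2 * yy j \<le> yy (Suc j)" for j
 proof -
  have "A * 2 ^ (Suc j + 2) / \<rho> (j + 2) \<le> A * 2 ^ (Suc j + 2) / \<rho> (Suc j + 2)"
   using \<rho>_anti[of "j + 2" "Suc j + 2"] \<rho>_pos A by (intro divide_left_mono mult_pos_pos) auto
  thus ?thesis unfolding yy_def by (simp add: mult_ac)
 qed
 have "\<tau> j < \<tau> (Suc j)" for j
 proof -
  have "yy j + 1 \<le> yy (Suc j)" using yy1[of j] yy2[of j] by linarith
  hence "\<lceil>yy j\<rceil> < \<lceil>yy (Suc j)\<rceil>" by linarith
  moreover have "0 \<le> \<lceil>yy j\<rceil>" using yy1[of j] by linarith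
  ultimately show ?thesis unfolding \<tau>_def by linarith
 qed
 hence mono: "strict_mono \<tau>" by (rule strict_mono_Suc_iff[THEN iffD2, rule_format])
 have main: "\<exists>G\<in>sets \<mu>. 1 - \<epsilon> \<le> measure \<mu> G \<and> (\<forall>x\<in>G. \<forall>z<lam (j + r). gd x j (j + r) t (int z))"
  if j: "j0 \<le> j" and t: "\<tau> j \<le> t" "t < \<tau> (Suc j)" for j t
 proof -
  define h where "h = j + r"
  define n where "n = lam h"
  define Bh where "Bh = real_of_int (Bd h)"
  define \<rho>1 where "\<rho>1 = \<rho> (Suc j)"
  define D where "D = real t / 2 ^ Suc (Suc j)"
  have \<rho>1p: "0 < \<rho>1" by (simp add: \<rho>1_def \<rho>_pos)
  have n1: "1 \<le> real n" by (simp add: n_def lam_def)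
  have B1: "1 \<le> Bh" using Bd_low(1)[of h] by (simp add: Bh_def)
  have V: "8000 * (real n * Bh * \<rho>1) \<le> \<epsilon>"
  proof -
   have "Bh \<le> of_int ((4 * LL + 46) * (int h + 1)\<^sup>2)" unfolding Bh_def using Bd_up[of h] by (simp only: of_int_le_iff)
   hence "Bh \<le> of_int (4 * LL + 46) * (real h + 1)\<^sup>2" by (simp add: add.commute)
   moreover have "real n = (real h + 1) ^ 3" by (simp add: n_def lam_def add.commute)
   ultimately have "real n * Bh \<le> (real h + 1) ^ 3 * (of_int (4 * LL + 46) * (real h + 1)\<^sup>2)"
    by (simp only:) (rule mult_left_mono, simp_all)
   also have "\<dots> = of_int (4 * LL + 46) * ((real h + 1) ^ 5 * 1)" by (simp add: power2_eq_square power3_eq_cube eval_nat_numeral)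
   also have "\<dots> \<le> of_int (4 * LL + 46) * ((real h + 1) ^ 5 * (real h + 1))" by (intro mult_left_mono) auto
   also have "\<dots> = of_int (4 * LL + 46) * real (Suc j + r) ^ 6" by (simp add: h_def eval_nat_numeral algebra_simps)
   finally have "8000 * (real n * Bh) \<le> 8000 * (of_int (4 * LL + 46) * real (Suc j + r) ^ 6)" by (rule mult_left_mono) simp
   hence "8000 * (real n * Bh) \<le> CC * real (Suc j + r) ^ 6" unfolding CC_def mult.assoc .
   hence "8000 * (real n * Bh) * \<rho>1 \<le> CC * real (Suc j + r) ^ 6 * \<rho>1" using \<rho>1p by (intro mult_right_mono) auto
   thus ?thesis using j0(1)[OF j] unfolding \<rho>1_def by (simp add: mult.assoc)
  qed
  have nB: "real n \<le> real n * Bh" "Bh \<le> real n * Bh" "\<rho>1 * Bh \<le> real n * Bh * \<rho>1"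
  proof -
   show a: "real n \<le> real n * Bh" using mult_left_mono[OF B1, of "real n"] by simp
   show b: "Bh \<le> real n * Bh" using mult_right_mono[OF n1, of Bh] B1 by simp
   show "\<rho>1 * Bh \<le> real n * Bh * \<rho>1" using mult_right_mono[OF b, of \<rho>1] \<rho>1p by (simp add: mult.commute)
  qed
  have D1: "A \<le> D * \<rho> (j + 2)"
  proof -
   have "yy j \<le> real t" using t(1) yy1[of j] unfolding \<tau>_def by linarith
   hence "A * 2 ^ (j + 2) \<le> real t * \<rho> (j + 2)" unfolding yy_def using \<rho>_pos[of "j + 2"] by (simp add: pos_divide_le_eq)
   thus ?thesis by (simp add: D_def field_simps)
  qed
  have D2: "D * \<rho> (j + 3) \<le> 2 * A"
  proof -
   have "real t \<le> yy (Suc j)" using t(2) yy1[of "Suc j"] unfolding \<tau>_def by linarith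
   hence "real t * \<rho> (Suc j + 2) \<le> A * 2 ^ (Suc j + 2)" unfolding yy_def using \<rho>_pos[of "Suc j + 2"] by (simp add: pos_le_divide_eq)
   thus ?thesis by (simp add: D_def field_simps numeral_3_eq_3)
  qed
  have D0: "0 \<le> D" by (simp add: D_def)
  have Dp: "A \<le> D * \<rho>1"
  proof -
   have "D * \<rho> (j + 2) \<le> D * \<rho>1" unfolding \<rho>1_def using D0 by (intro mult_left_mono \<rho>_anti) auto
   thus ?thesis using D1 by linarith
  qed
  have Dbig: "1600000 * (real n * Bh) \<le> D"
  proof -
   have "1600000 * (real n * Bh) * \<rho>1 \<le> D * \<rho>1" using V Dp A \<epsilon>(2) by (simp add: mult.assoc)
   thus ?thesis using \<rho>1p by simp
  qed
  have Dl: "1600000 \<le> D" "1600000 * real n \<le> D" "1600000 * Bh \<le> D"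
   using Dbig nB n1 by linarith+
  define X where "X = \<lfloor>12 / 10 * D\<rfloor>"
  define aa where "aa = \<lceil>11 / 10 * D\<rceil>"
  define Y where "Y = - \<lceil>D\<rceil>"
  have X: "of_int X \<le> 12 / 10 * D" "12 / 10 * D < of_int X + 1" unfolding X_def by linarith+
  have aa: "11 / 10 * D \<le> of_int aa" "of_int aa < 11 / 10 * D + 1" unfolding aa_def by linarith+
  have Y: "D \<le> - of_int Y" "- of_int Y < D + 1" unfolding Y_def by linarith+
  have XY: "Y \<le> X"
  proof -
   have "(of_int Y :: real) \<le> of_int X" using X Y Dl(1) by linarith
   thus ?thesis by simp
  qed
  have XYl: "of_int (X - Y) \<le> 3 * D" using X Y Dl(1) by simp
  \<comment> \<open>The ways to fail: no train of \<open>j + 3\<close> blocks starts at the right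
    distance, some train is too long, there are too many trains for the room on the left, or the
    cell is charged to a train.\<close>
  define A1 where "A1 = none aa (X + 1) (j + 2)"
  define A2 where "A2 = {x. \<exists>f\<in>{Y<..X}. tr x f h}"
  define A3 where "A3 = {x. D / (40 * Bh) \<le> real (card (evolution.bigs LL (bx x) j Y X))}"
  define A4 where "A4 z = {x. \<exists>e\<in>{Y<..X}. tr x e (Suc j) \<and> chP t j h (X - Y) x z e}" for z
  have A1s: "A1 \<in> sets \<mu>" unfolding A1_def by (rule none_sets)
  have A2s: "A2 \<in> sets \<mu>"
  proof -
   have "A2 = (\<Union>f\<in>{Y<..X}. {x. tr x f h})" by (auto simp: A2_def)
   thus ?thesis using tr_sets by auto
  qed
  have A3s: "A3 \<in> sets \<mu>" using pred_count[OF bigs_meas, of "\<lambda>n. D / (40 * Bh) \<le> real n" j Y X] by (simp add: A3_def pred_def space_mu)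
  have A4s: "A4 z \<in> sets \<mu>" for z
  proof -
   have "Measurable.pred \<mu> (\<lambda>x. \<exists>e\<in>{Y<..X}. tr x e (Suc j) \<and> chP t j h (X - Y) x z e)" by measurable
   thus ?thesis by (simp add: A4_def pred_def space_mu)
  qed
  have m1: "measure \<mu> A1 \<le> \<epsilon> / 9 + \<epsilon> / 8"
  proof -
   define N where "N = nat (X + 1 - aa)"
   have Nr: "9 / 100 * D \<le> real_of_int (X + 1 - aa)" using X aa Dl(1) by simp
   hence "0 < X + 1 - aa" using Dl(1) by linarith
   hence N: "int N = X + 1 - aa" "0 < N" by (auto simp: N_def)
   have NrN: "9 / 100 * D \<le> real N" using Nr N(1) by (metis of_int_of_nat_eq)
   have "shi aa -` none 0 (int N) (j + 2) = A1" unfolding none_shi A1_def using N(1) by simp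
   hence "measure \<mu> A1 = measure \<mu> (none 0 (int N) (j + 2))" using inv_shi[OF none_sets] by metis
   also have "\<dots> \<le> 2 / (real N * \<rho> (j + 2)) + 2 * \<eta> (j + 2)" by (rule \<eta>(2)[OF N(2)])
   also have "2 / (real N * \<rho> (j + 2)) \<le> \<epsilon> / 9"
   proof -
    have "9 / 100 * D * \<rho> (j + 2) \<le> real N * \<rho> (j + 2)" using NrN \<rho>_nonneg by (intro mult_right_mono) auto
    hence l: "18 / \<epsilon> \<le> real N * \<rho> (j + 2)" using D1 by (simp add: A_def)
    have "2 / (real N * \<rho> (j + 2)) \<le> 2 / (18 / \<epsilon>)" using l \<epsilon> N(2) \<rho>_pos[of "j + 2"] by (intro divide_left_mono mult_pos_pos) auto
    thus ?thesis by simp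
   qed
   finally show ?thesis using j0(2)[OF j] by linarith
  qed
  have m2: "measure \<mu> A2 \<le> \<epsilon> / 8"
  proof -
   have e: "A2 = (\<Union>f\<in>{Y<..X}. {x. tr x f h})" by (auto simp: A2_def)
   have "measure \<mu> A2 \<le> (\<Sum>f\<in>{Y<..X}. measure \<mu> {x. tr x f h})"
    unfolding e by (rule finite_measure_subadditive_finite) (use tr_sets in auto)
   also have "\<dots> = of_int (X - Y) * \<rho> h" using XY by (simp add: tr_measure)
   also have "\<dots> \<le> 3 * D * \<rho> h" using XYl \<rho>_nonneg by (intro mult_right_mono) auto
   also have "\<dots> \<le> 3 * D * (\<epsilon> / (48 * A) * \<rho> (j + 3))" using r0[of "j + 3"] D0 by (intro mult_left_mono) (auto simp: h_def r_def ac_simps)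
   also have "\<dots> = 3 * (\<epsilon> / (48 * A)) * (D * \<rho> (j + 3))" by simp
   also have "\<dots> \<le> 3 * (\<epsilon> / (48 * A)) * (2 * A)" using D2 \<epsilon> A by (intro mult_left_mono) auto
   also have "\<dots> = \<epsilon> / 8" using A by simp
   finally show ?thesis .
  qed
  have m3: "measure \<mu> A3 \<le> \<epsilon> / 8"
  proof -
   have c: "0 < D / (40 * Bh)" using Dl(1) B1 by simp
   have "measure \<mu> A3 \<le> of_int (X - Y) * \<rho> (Suc j) / (D / (40 * Bh))" unfolding A3_def by (rule bigs_expect[OF c XY])
   also have "\<dots> \<le> 3 * D * \<rho> (Suc j) / (D / (40 * Bh))" using XYl \<rho>_nonneg c by (intro divide_right_mono mult_right_mono) auto
   also have "\<dots> = 120 * (\<rho>1 * Bh)" using Dl(1) B1 by (simp add: \<rho>1_def)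
   also have "\<dots> \<le> \<epsilon> / 8" using nB(3) V \<epsilon> by linarith
   finally show ?thesis .
  qed
  have m4: "measure \<mu> (\<Union>z<n. A4 (int z)) \<le> \<epsilon> / 8"
  proof -
   have "measure \<mu> (\<Union>z<n. A4 (int z)) \<le> (\<Sum>z<n. measure \<mu> (A4 (int z)))"
    by (rule finite_measure_subadditive_finite) (use A4s in auto)
   also have "\<dots> \<le> (\<Sum>z<n. of_int (2 * Bd h) * \<rho> (Suc j))"
    unfolding A4_def by (intro sum_mono charge_bound) simp
   also have "\<dots> = 2 * (real n * Bh * \<rho>1)" by (simp add: Bh_def \<rho>1_def)
   also have "\<dots> \<le> \<epsilon> / 8" using V \<epsilon> by linarith
   finally show ?thesis .
  qed
  define BB where "BB = A1 \<union> A2 \<union> A3 \<union> (\<Union>z<n. A4 (int z))"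
  have A4u: "(\<Union>z<n. A4 (int z)) \<in> sets \<mu>" using A4s by auto
  have BBs: "BB \<in> sets \<mu>" unfolding BB_def using A1s A2s A3s A4u by blast
  have "measure \<mu> BB \<le> measure \<mu> A1 + measure \<mu> A2 + measure \<mu> A3 + measure \<mu> (\<Union>z<n. A4 (int z))"
  proof -
   have "measure \<mu> BB \<le> measure \<mu> (A1 \<union> A2 \<union> A3) + measure \<mu> (\<Union>z<n. A4 (int z))"
    unfolding BB_def by (rule measure_Un_le) (use A1s A2s A3s A4u in auto)
   moreover have "measure \<mu> (A1 \<union> A2 \<union> A3) \<le> measure \<mu> (A1 \<union> A2) + measure \<mu> A3" by (rule measure_Un_le) (use A1s A2s A3s in auto)
   moreover have "measure \<mu> (A1 \<union> A2) \<le> measure \<mu> A1 + measure \<mu> A2" by (rule measure_Un_le) (use A1s A2s in auto)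
   ultimately show ?thesis by linarith
  qed
  hence mB: "measure \<mu> BB \<le> \<epsilon>" using m1 m2 m3 m4 \<epsilon> by linarith
  have G: "- BB \<in> sets \<mu>" using sets.compl_sets[OF BBs] by (simp add: space_mu Compl_eq_Diff_UNIV)
  have "measure \<mu> (- BB) = 1 - measure \<mu> BB" using prob_compl[OF BBs] by (simp add: space_mu Compl_eq_Diff_UNIV)
  hence mG: "1 - \<epsilon> \<le> measure \<mu> (- BB)" using mB by simp
  have "gd x j h t (int z)" if x: "x \<in> - BB" and z: "z < n" for x z
  proof -
   have nA: "x \<notin> A1" "x \<notin> A2" "x \<notin> A3" "x \<notin> A4 (int z)" using x z by (auto simp: BB_def)
   obtain q where q: "aa \<le> q" "q < X + 1" "tr x q (j + 2)" using nA(1) by (auto simp: A1_def none_def)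
   have q': "tr x q (Suc (Suc j))" "11 / 10 * D \<le> of_int q" "q \<le> X"
   proof -
    have "(of_int aa :: real) \<le> of_int q" using q(1) by simp
    thus "11 / 10 * D \<le> of_int q" using aa(1) by linarith
   qed (use q in auto)
   have reg: "\<And>f. Y < f ==> f \<le> X ==> \<not> tr x f h" using nA(2) by (auto simp: A2_def)
   define cc where "cc = card (evolution.bigs LL (bx x) j Y X)"
   have ccb: "real cc \<le> D / (40 * Bh)" using nA(3) by (simp add: A3_def cc_def)
   have room2: "of_int (Bd h * (int cc + 1)) + real n \<le> D / 20"
   proof -
    have "Bh * real cc \<le> Bh * (D / (40 * Bh))" using ccb B1 by (intro mult_left_mono) auto
    also have "\<dots> = D / 40" using B1 by simp
    finally have "Bh * (real cc + 1) \<le> D / 40 + Bh" by (simp add: distrib_left)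
    moreover have "of_int (Bd h * (int cc + 1)) = Bh * (real cc + 1)" by (simp add: Bh_def)
    ultimately show ?thesis using Dl by linarith
   qed
   have room: "Y < - (Bd h * (int cc + 1))"
   proof -
    have "real_of_int (Bd h * (int cc + 1)) < - of_int Y" using room2 Y(1) Dl(1) n1 by linarith
    hence "real_of_int Y < real_of_int (- (Bd h * (int cc + 1)))" by simp
    thus ?thesis by (simp only: of_int_less_iff)
   qed
   have "\<not> cov (bx x t) (int z) \<and> evolution.good LL cry (bx x) j h (stt h) t (int z) \<or>
    (\<exists>e. tr x e (Suc j) \<and> Y < e \<and> e \<le> X \<and> (evolution.charged LL cry (bx x) t j (Bd h) (X - Y) (int z) e \<or>
    evolution.alive LL cry (bx x) t e 0 \<and> - (int h * (LL + 1)) \<le> int z - evolution.pos LL cry (bx x) t e 0 \<and> int z - evolution.pos LL cry (bx x) t e 0 \<le> LL))"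
    unfolding Bd_def
    by (rule evolution.cell_dichotomy[OF ev D_def q' X(1) reg room[unfolded Bd_def cc_def] room2[unfolded Bd_def cc_def]]) (use z in auto)
   thus ?thesis using nA(4) unfolding gd_def A4_def chP_def by auto
  qed
  thus ?thesis using G mG unfolding h_def[symmetric] n_def[symmetric] by blast
 qed
 show thesis by (rule that[OF mono _ main]) (simp_all add: r_def)
qed

end

section \<open>Local functions and the weak* topology\<close>

definition loc :: "nat => ((int => 'b) => real) => bool" where
 "loc R f \<longleftrightarrow> (\<forall>x y. (\<forall>i. 0 \<le> i \<and> i \<le> int R --> x i = y i) --> f x = f y)"

lemma locD: "loc R f ==> (\<And>i. 0 \<le> i ==> i \<le> int R ==> x i = y i) ==> f x = f y"
 unfolding loc_def by blast

lemma loc_mono: "loc R f ==> R \<le> R' ==> loc R' f"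
 by (intro loc_def[THEN iffD2] allI impI, erule locD) auto

lemma loc_dep: "loc R f ==> dep {0..int R} (f -` V)"
proof (rule depI)
 fix x y :: "int => 'a" assume l: "loc R f" and e: "\<And>i. i \<in> {0..int R} ==> x i = y i" and x: "x \<in> f -` V"
 have "f x = f y" by (rule locD[OF l]) (use e in auto)
 thus "y \<in> f -` V" using x by simp
qed

lemma loc_continuous:
 fixes f :: "(int => 'b::{finite, discrete_topology}) => real"
 assumes "loc R f" shows "continuous_on UNIV f"
proof -
 have "open (f -` V)" for V by (rule dep_open[OF _ loc_dep[OF assms]]) simp
 thus ?thesis by (simp add: continuous_on_open_vimage)
qed

lemma loc_range:
 fixes f :: "(int => 'b::finite) => real"
 assumes "loc R f" shows "finite (range f)"
proof -
 have "range f \<subseteq> f ` ((\<lambda>x. restrict x {0..int R}) ` UNIV)"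
 proof
  fix v assume "v \<in> range f"
  then obtain x where v: "v = f x" by auto
  have "f x = f (restrict x {0..int R})" by (rule locD[OF assms]) simp
  thus "v \<in> f ` ((\<lambda>x. restrict x {0..int R}) ` UNIV)" using v by blast
 qed
 thus ?thesis by (rule finite_subset) (intro finite_imageI finite_atoms finite_atLeastAtMost_int)
qed

lemma loc_bound:
 fixes f :: "(int => 'b::finite) => real"
 assumes "loc R f" obtains C where "0 \<le> C" "\<And>x. \<bar>f x\<bar> \<le> C"
proof -
 have fin: "finite (insert 0 (abs ` range f))" using loc_range[OF assms] by simp
 show thesis
  by (rule that[of "Max (insert 0 (abs ` range f))"]; rule Max_ge[OF fin]; simp)
qed

text \<open>Compactness of the full shift turns the windows found at single points into one window
  for all points.\<close>

lemma uniform_window: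
 fixes f :: "(int => 'b::{finite, discrete_topology}) => real"
 assumes f: "continuous_on UNIV f" and e: "0 < e"
 obtains R where "\<forall>x y. (\<forall>i. - int R \<le> i \<and> i \<le> int R --> x i = y i) --> \<bar>f x - f y\<bar> < e"
proof -
 have "compact_space (product_topology (\<lambda>_::int. euclidean :: 'b topology) UNIV)"
  unfolding compact_space_product_topology by (simp add: compact_space_def finite_imp_compact)
 hence cmp: "compact (UNIV :: (int => 'b) set)"
  by (simp add: euclidean_product_topology compact_space_def)
 have "\<exists>n. \<forall>y. (\<forall>i. - int n \<le> i \<and> i \<le> int n --> y i = x i) --> \<bar>f y - f x\<bar> < e / 2" for x
 proof -
  have "open (f -` {v. \<bar>v - f x\<bar> < e / 2})"
  proof -
   have "{v. \<bar>v - f x\<bar> < e / 2} = ball (f x) (e / 2)" by (auto simp: dist_real_def abs_minus_commute)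
   thus ?thesis using f by (metis continuous_on_open_vimage open_UNIV open_ball inf_top_right)
  qed
  hence "openin (product_topology (\<lambda>_. euclidean) UNIV) (f -` {v. \<bar>v - f x\<bar> < e / 2})"
   by (simp add: euclidean_product_topology)
  moreover have "x \<in> f -` {v. \<bar>v - f x\<bar> < e / 2}" using e by simp
  ultimately obtain X where X: "x \<in> Pi\<^sub>E UNIV X" "finite {i. X i \<noteq> topspace euclidean}"
    "Pi\<^sub>E UNIV X \<subseteq> f -` {v. \<bar>v - f x\<bar> < e / 2}"
   by (rule product_topology_open_contains_basis[THEN exE]) blast
  define n where "n = nat (Max (insert 0 (abs ` {i. X i \<noteq> UNIV})))"
  have bnd: "\<bar>i\<bar> \<le> int n" if "X i \<noteq> UNIV" for i
  proof -
   have "\<bar>i\<bar> \<le> Max (insert 0 (abs ` {i. X i \<noteq> UNIV}))" by (rule Max_ge) (use that X(2) in auto)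
   thus ?thesis unfolding n_def by linarith
  qed
  have "y \<in> Pi\<^sub>E UNIV X" if y: "\<forall>i. - int n \<le> i \<and> i \<le> int n --> y i = x i" for y
  proof -
   have "y i \<in> X i" for i
   proof (cases "X i = UNIV")
    case False
    hence "y i = x i" using bnd[of i] y by (simp add: abs_le_iff)
    thus ?thesis using X(1) by (auto simp: PiE_def Pi_def)
   qed simp
   thus ?thesis by auto
  qed
  thus ?thesis using X(3) by (intro exI[of _ n] allI impI) (drule meta_spec, drule meta_mp, assumption, drule subsetD, assumption, simp)
 qed
 then obtain n where n: "\<And>x y. (\<And>i. - int (n x) \<le> i ==> i \<le> int (n x) ==> y i = x i) ==> \<bar>f y - f x\<bar> < e / 2" by metis
 define A where "A x = {y. \<forall>i\<in>{- int (n x)..int (n x)}. y i = x i}" for x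
 have op: "open (A x)" for x unfolding A_def by (rule open_agree) simp
 obtain D where D: "finite D" "UNIV \<subseteq> (\<Union>x\<in>D. A x)"
 proof (rule compactE_image[OF cmp, of UNIV A])
  show "UNIV \<subseteq> (\<Union>c\<in>UNIV. A c)" unfolding A_def by blast
 qed (use op that in auto)
 define R where "R = Max (insert 0 (n ` D))"
 have R: "n x \<le> R" if "x \<in> D" for x unfolding R_def by (rule Max_ge) (use that D(1) in auto)
 show thesis
 proof (rule that, intro allI impI)
  fix x y :: "int => 'b" assume xy: "\<forall>i. - int R \<le> i \<and> i \<le> int R --> x i = y i"
  obtain c where c: "c \<in> D" "x \<in> A c" using D(2) by blast
  have x: "\<bar>f x - f c\<bar> < e / 2" by (rule n) (use c(2) in \<open>auto simp: A_def\<close>)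
  have y: "\<bar>f y - f c\<bar> < e / 2"
  proof (rule n)
   fix i assume i: "- int (n c) \<le> i" "i \<le> int (n c)"
   hence "x i = y i" using R[OF c(1)] xy by auto
   thus "y i = c i" using c(2) i by (auto simp: A_def)
  qed
  show "\<bar>f x - f y\<bar> < e" using x y by linarith
 qed
qed

section \<open>Integrals of local functions under invariant measures\<close>

lemma invD:
 assumes "\<nu> \<in> invariant_measures"
 shows "sets \<nu> = sets borel" "space \<nu> = UNIV" "prob_space \<nu>" "distr \<nu> borel shift_map = \<nu>"
 using assms sets_eq_imp_space_eq[of \<nu> borel] by (auto simp: invariant_measures_def pushforward_def)

lemma inv_integral_shi:
 fixes f :: "(int => 'b::{finite, discrete_topology}) => real"
 assumes nu: "\<nu> \<in> invariant_measures" and f: "f \<in> borel_measurable borel"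
 shows "(\<integral>x. f (shi (int n) x) \<partial>\<nu>) = (\<integral>x. f x \<partial>\<nu>)"
proof (induction n)
 case (Suc n)
 have s: "shift_map \<in> measurable \<nu> borel" using shi_measurable[of 1] invD(1)[OF nu] by (simp add: shi_1 cong: measurable_cong_sets)
 have m: "(\<lambda>x. f (shi (int n) x)) \<in> borel_measurable borel" using measurable_compose[OF shi_measurable f] .
 have "(\<integral>x. f (shi (int (Suc n)) x) \<partial>\<nu>) = (\<integral>x. f (shi (int n) (shift_map x)) \<partial>\<nu>)"
  by (simp add: shi_1[symmetric] shi_shi add.commute)
 also have "\<dots> = (\<integral>x. f (shi (int n) x) \<partial>distr \<nu> borel shift_map)" by (rule integral_distr[OF s m, symmetric])
 finally show ?case using Suc invD(4)[OF nu] by simp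
qed simp

lemma inv_integral_bound:
 fixes f g :: "(int => 'b::{finite, discrete_topology}) => real"
 assumes nu: "\<nu> \<in> invariant_measures" and "integrable \<nu> f" "integrable \<nu> g" "\<And>x. \<bar>f x - g x\<bar> \<le> e"
 shows "\<bar>(\<integral>x. f x \<partial>\<nu>) - (\<integral>x. g x \<partial>\<nu>)\<bar> \<le> e"
proof -
 interpret prob_space \<nu> by (rule invD(3)[OF nu])
 have d: "integrable \<nu> (\<lambda>x. f x - g x)" by (intro Bochner_Integration.integrable_diff assms)
 have p: "f x - g x \<le> e" "- e \<le> f x - g x" for x using assms(4)[of x] by linarith+
 have "(\<integral>x. f x - g x \<partial>\<nu>) \<le> e" by (rule integral_le_const[OF d]) (simp add: p)
 moreover have "- e \<le> (\<integral>x. f x - g x \<partial>\<nu>)" by (rule integral_ge_const[OF d]) (simp add: p)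
 moreover have "(\<integral>x. f x - g x \<partial>\<nu>) = (\<integral>x. f x \<partial>\<nu>) - (\<integral>x. g x \<partial>\<nu>)" by (intro Bochner_Integration.integral_diff assms)
 ultimately show ?thesis by linarith
qed

lemma loc_integrable:
 fixes f :: "(int => 'b::{finite, discrete_topology}) => real"
 assumes "loc R f" "\<nu> \<in> invariant_measures" shows "integrable \<nu> f"
proof -
 interpret prob_space \<nu> by (rule invD(3)[OF assms(2)])
 obtain C where C: "\<And>x. \<bar>f x\<bar> \<le> C" using loc_bound[OF assms(1)] by metis
 have "f \<in> borel_measurable \<nu>"
  using borel_measurable_continuous_onI[OF loc_continuous[OF assms(1)]] invD(1)[OF assms(2)] by (simp cong: measurable_cong_sets)
 thus ?thesis using C by (intro integrable_const_bound[of _ C]) auto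
qed

text \<open>Uniform continuity gives a symmetric window; invariance of the measures allows to shift
  it to the right, into the form of \<open>loc\<close>.\<close>

lemma local_approximation:
 fixes f :: "(int => 'b::{finite, discrete_topology}) => real"
 assumes f: "continuous_on UNIV f" and e: "0 < e"
 obtains R g where "loc R g" "\<And>\<nu>. \<nu> \<in> invariant_measures ==> \<bar>(\<integral>x. f x \<partial>\<nu>) - (\<integral>x. g x \<partial>\<nu>)\<bar> \<le> e"
proof -
 obtain R where R: "\<forall>x y. (\<forall>i. - int R \<le> i \<and> i \<le> int R --> x i = y i) --> \<bar>f x - f y\<bar> < e"
  by (rule uniform_window[OF f e]) (rule that)
 define h where "h x = f (\<lambda>i. if - int R \<le> i \<and> i \<le> int R then x i else undefined)" for x
 have fh: "\<bar>f x - h x\<bar> \<le> e" for x unfolding h_def by (rule less_imp_le, rule R[rule_format]) simp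
 define g where "g x = h (shi (int R) x)" for x
 have g: "loc (2 * R) g" unfolding loc_def
 proof (intro allI impI)
  fix x y :: "int => 'b" assume xy: "\<forall>i. 0 \<le> i \<and> i \<le> int (2 * R) --> x i = y i"
  have "(\<lambda>i. if - int R \<le> i \<and> i \<le> int R then shi (int R) x i else undefined)
    = (\<lambda>i. if - int R \<le> i \<and> i \<le> int R then shi (int R) y i else undefined)"
   using xy by (auto simp: shi_def fun_eq_iff)
  thus "g x = g y" unfolding g_def h_def by simp
 qed
 have gR: "g (shi (- int R) x) = h x" for x by (simp add: g_def shi_shi)
 have "\<bar>(\<integral>x. f x \<partial>\<nu>) - (\<integral>x. g x \<partial>\<nu>)\<bar> \<le> e" if nu: "\<nu> \<in> invariant_measures" for \<nu>
 proof -
  interpret prob_space \<nu> by (rule invD(3)[OF nu])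
  obtain C where C: "\<And>x. \<bar>g x\<bar> \<le> C" using loc_bound[OF g] by metis
  have gm: "g \<in> borel_measurable borel" by (rule borel_measurable_continuous_onI[OF loc_continuous[OF g]])
  have hm0: "h \<in> borel_measurable borel" using measurable_compose[OF shi_measurable gm, of "- int R"] by (simp add: gR)
  have hm: "h \<in> borel_measurable \<nu>" using hm0 invD(1)[OF nu] by (simp cong: measurable_cong_sets)
  have gh: "(\<integral>x. g x \<partial>\<nu>) = (\<integral>x. h x \<partial>\<nu>)" unfolding g_def by (rule inv_integral_shi[OF nu hm0])
  have hb: "\<bar>h x\<bar> \<le> C" for x using C[of "shi (- int R) x"] by (simp add: gR)
  have hi: "integrable \<nu> h" by (rule integrable_const_bound[of _ C]) (use hb hm in auto)
  have fm: "f \<in> borel_measurable \<nu>"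
   using borel_measurable_continuous_onI[OF f] invD(1)[OF nu] by (simp cong: measurable_cong_sets)
  have fb: "\<bar>f x\<bar> \<le> C + e" for x using fh[of x] hb[of x] by linarith
  have fi: "integrable \<nu> f" by (rule integrable_const_bound[of _ "C + e"]) (use fb fm in auto)
  show ?thesis unfolding gh by (rule inv_integral_bound[OF nu fi hi fh])
 qed
 thus thesis by (rule that[OF g])
qed

lemma loc_sets:
 fixes f :: "(int => 'b::{finite, discrete_topology}) => real"
 assumes "loc R f" shows "f -` V \<in> sets borel"
 by (rule dep_borel[OF _ loc_dep[OF assms]]) simp

lemma loc_integral:
 fixes f :: "(int => 'b::{finite, discrete_topology}) => real"
 assumes "loc R f" "\<nu> \<in> invariant_measures"
 shows "(\<integral>x. f x \<partial>\<nu>) = (\<Sum>v\<in>range f. v * measure \<nu> (f -` {v}))"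
proof -
 interpret prob_space \<nu> by (rule invD(3)[OF assms(2)])
 have fin: "finite (range f)" by (rule loc_range[OF assms(1)])
 have s: "f -` {v} \<in> sets \<nu>" for v using loc_sets[OF assms(1)] invD(1)[OF assms(2)] by simp
 have "f x = (\<Sum>v\<in>range f. v * indicator (f -` {v}) x)" for x
  using fin by (simp add: indicator_def if_distrib[of "\<lambda>c. _ * c"] cong: if_cong)
 hence "(\<integral>x. f x \<partial>\<nu>) = (\<integral>x. (\<Sum>v\<in>range f. v * indicator (f -` {v}) x) \<partial>\<nu>)" by (rule Bochner_Integration.integral_cong[OF refl])
 also have "\<dots> = (\<Sum>v\<in>range f. \<integral>x. v * indicator (f -` {v}) x \<partial>\<nu>)"
  by (rule Bochner_Integration.integral_sum, intro integrable_mult_right integrable_real_indicator s) (simp add: emeasure_finite less_top[symmetric])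
 also have "\<dots> = (\<Sum>v\<in>range f. v * measure \<nu> (f -` {v}))"
  using invD(2)[OF assms(2)] by (intro sum.cong refl) simp
 finally show ?thesis .
qed

section \<open>Periodic measures, convex combinations and image measures\<close>

lemma shift_map_funpow: "(shift_map ^^ i) x = shi (int i) x"
 by (induction i) (simp_all add: shi_1[symmetric] shi_shi)

lemma shi_periodic: "w \<noteq> [] ==> shi (int (length w)) (periodic w) = periodic w"
 by (simp add: shi_def periodic_def)

lemma periodic_measure_emeasure:
 fixes w :: "'b::topological_space list"
 assumes "E \<in> sets borel"
 shows "emeasure (periodic_measure w) E = (\<Sum>i<length w. indicator E (shi (int i) (periodic w))) / of_nat (length w)"
 using emeasure_periodic_measure[OF assms, of w] assms by (simp add: shift_map_funpow)

lemma periodic_measure_inv: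
 fixes w :: "'b::{finite, discrete_topology} list"
 assumes "w \<noteq> []" shows "periodic_measure w \<in> invariant_measures"
proof -
 have s: "sets (periodic_measure w) = sets borel"
  unfolding periodic_measure_def using sets.sigma_sets_eq[of "borel :: 'b configuration measure"] by (simp add: sets_measure_of_conv)
 hence sp: "space (periodic_measure w) = UNIV" using sets_eq_imp_space_eq[of "periodic_measure w" borel] by simp
 have "emeasure (periodic_measure w) UNIV = 1"
  using assms by (simp add: periodic_measure_emeasure ennreal_of_nat_eq_real_of_nat divide_ennreal)
 hence p: "prob_space (periodic_measure w)" by (intro prob_spaceI) (simp add: sp)
 have sm: "shift_map \<in> measurable (periodic_measure w) borel" using shi_measurable[of 1] s by (simp add: shi_1 cong: measurable_cong_sets)
 have "distr (periodic_measure w) borel shift_map = periodic_measure w"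
 proof (rule measure_eqI)
  fix E assume "E \<in> sets (distr (periodic_measure w) borel shift_map)"
  hence E: "E \<in> sets borel" by simp
  have E': "shift_map -` E \<in> sets borel" using measurable_sets[OF sm, of E] E by (simp add: sp s)
  define g :: "nat => ennreal" where "g i = indicator E (shi (int i) (periodic w))" for i
  have "g (length w) = g 0" by (simp add: g_def shi_periodic[OF assms])
  hence "(\<Sum>i<length w. g (Suc i)) = (\<Sum>i<length w. g i)"
   using assms by (cases "length w") (simp_all add: sum.lessThan_Suc_shift[of g] sum.lessThan_Suc[of "\<lambda>i. g (Suc i)"] add.commute del: sum.lessThan_Suc)
  moreover have "indicator (shift_map -` E) (shi (int i) (periodic w)) = g (Suc i)" for i
   by (simp add: g_def indicator_def shi_1[symmetric] shi_shi)
  ultimately have "emeasure (periodic_measure w) (shift_map -` E) = emeasure (periodic_measure w) E"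
   by (simp add: periodic_measure_emeasure[OF E] periodic_measure_emeasure[OF E'] g_def[symmetric])
  thus "emeasure (distr (periodic_measure w) borel shift_map) E = emeasure (periodic_measure w) E"
   using emeasure_distr[OF sm E] by (simp add: sp)
 qed (simp add: s)
 thus ?thesis using s p by (simp add: invariant_measures_def pushforward_def)
qed

lemma periodic_measure_integral:
 fixes w :: "'b::{finite, discrete_topology} list"
 assumes "w \<noteq> []" "loc R f"
 shows "(\<integral>x. f x \<partial>periodic_measure w) = (\<Sum>i<length w. f (shi (int i) (periodic w))) / real (length w)"
proof -
 have l: "0 < length w" using assms by simp
 have m: "measure (periodic_measure w) (f -` {v}) = (\<Sum>i<length w. indicator (f -` {v}) (shi (int i) (periodic w))) / real (length w)" for v
 proof -
  have "emeasure (periodic_measure w) (f -` {v}) = ennreal (\<Sum>i<length w. indicator (f -` {v}) (shi (int i) (periodic w))) / ennreal (real (length w))"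
   unfolding periodic_measure_emeasure[OF loc_sets[OF assms(2)]]
   by (simp add: sum_ennreal[symmetric] ennreal_indicator ennreal_of_nat_eq_real_of_nat)
  also have "\<dots> = ennreal ((\<Sum>i<length w. indicator (f -` {v}) (shi (int i) (periodic w))) / real (length w))"
   by (rule divide_ennreal) (use l in \<open>auto intro!: sum_nonneg\<close>)
  finally show ?thesis by (simp add: measure_def sum_nonneg)
 qed
 have "(\<integral>x. f x \<partial>periodic_measure w) = (\<Sum>v\<in>range f. \<Sum>i<length w. v * indicator (f -` {v}) (shi (int i) (periodic w)) / real (length w))"
  unfolding loc_integral[OF assms(2) periodic_measure_inv[OF assms(1)]] m
  by (simp add: sum_distrib_left sum_divide_distrib)
 also have "\<dots> = (\<Sum>i<length w. \<Sum>v\<in>range f. v * indicator (f -` {v}) (shi (int i) (periodic w)) / real (length w))"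
  by (rule sum.swap)
 also have "\<dots> = (\<Sum>i<length w. f (shi (int i) (periodic w)) / real (length w))"
  using loc_range[OF assms(2)]
  by (intro sum.cong refl) (simp add: indicator_def of_bool_def if_distrib[of "\<lambda>c. _ * c"] if_distrib[of "\<lambda>c. c / _"] cong: if_cong)
 finally show ?thesis by (simp add: sum_divide_distrib)
qed

lemma convex_inv:
 fixes \<mu> \<nu> :: "'b::{finite, discrete_topology} configuration measure"
 assumes "\<mu> \<in> invariant_measures" "\<nu> \<in> invariant_measures" "0 \<le> s" "s \<le> 1"
 shows "convex_combination s \<mu> \<nu> \<in> invariant_measures"
proof -
 let ?c = "convex_combination s \<mu> \<nu>"
 note e = emeasure_convex_combination[OF invD(1)[OF assms(1)] invD(1)[OF assms(2)], of _ s]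
 have s: "sets ?c = sets borel"
  unfolding convex_combination_def using sets.sigma_sets_eq[of "borel :: 'b configuration measure"] by (simp add: sets_measure_of_conv)
 hence sp: "space ?c = UNIV" using sets_eq_imp_space_eq[of ?c borel] by simp
 have "emeasure \<mu> UNIV = 1" "emeasure \<nu> UNIV = 1"
  using prob_space.emeasure_space_1[OF invD(3)[OF assms(1)]] prob_space.emeasure_space_1[OF invD(3)[OF assms(2)]] invD(2)[OF assms(1)] invD(2)[OF assms(2)] by auto
 hence "emeasure ?c UNIV = ennreal s + ennreal (1 - s)" by (simp add: e)
 also have "\<dots> = 1" using assms(3,4) by (simp add: ennreal_plus[symmetric] del: ennreal_plus)
 finally have p: "prob_space ?c" by (intro prob_spaceI) (simp add: sp)
 have sm: "shift_map \<in> measurable \<rho> borel" if "sets \<rho> = sets borel" for \<rho> :: "'b configuration measure"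
  using shi_measurable[of 1] that by (simp add: shi_1 cong: measurable_cong_sets)
 have "distr ?c borel shift_map = ?c"
 proof (rule measure_eqI)
  fix E assume "E \<in> sets (distr ?c borel shift_map)"
  hence E: "E \<in> sets borel" by simp
  have E': "shift_map -` E \<in> sets borel" using measurable_sets[OF sm[OF refl], of E] E by simp
  have i: "emeasure \<rho> (shift_map -` E) = emeasure \<rho> E" if "\<rho> \<in> invariant_measures" for \<rho>
   using emeasure_distr[OF sm[OF invD(1)[OF that]] E] invD(2,4)[OF that] by simp
  show "emeasure (distr ?c borel shift_map) E = emeasure ?c E"
   using emeasure_distr[OF sm[OF s] E] by (simp add: sp e[OF E] e[OF E'] i assms)
 qed (simp add: s)
 thus ?thesis using s p by (simp add: invariant_measures_def pushforward_def)
qed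

lemma convex_integral:
 fixes \<mu> \<nu> :: "'b::{finite, discrete_topology} configuration measure"
 assumes "\<mu> \<in> invariant_measures" "\<nu> \<in> invariant_measures" "0 \<le> s" "s \<le> 1" "loc R f"
 shows "(\<integral>x. f x \<partial>convex_combination s \<mu> \<nu>) = s * (\<integral>x. f x \<partial>\<mu>) + (1 - s) * (\<integral>x. f x \<partial>\<nu>)"
proof -
 have f: "finite_measure \<rho>" if "\<rho> \<in> invariant_measures" for \<rho> :: "'b configuration measure"
  using invD(3)[OF that] by (simp add: prob_space.finite_measure)
 have "measure (convex_combination s \<mu> \<nu>) (f -` {v}) = s * measure \<mu> (f -` {v}) + (1 - s) * measure \<nu> (f -` {v})" for v
 proof -
  have "emeasure (convex_combination s \<mu> \<nu>) (f -` {v}) = ennreal (s * measure \<mu> (f -` {v}) + (1 - s) * measure \<nu> (f -` {v}))"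
   unfolding emeasure_convex_combination[OF invD(1)[OF assms(1)] invD(1)[OF assms(2)] loc_sets[OF assms(5)]]
   using assms(3,4) finite_measure.emeasure_eq_measure[OF f[OF assms(1)]] finite_measure.emeasure_eq_measure[OF f[OF assms(2)]]
   by (simp add: ennreal_mult'[symmetric] ennreal_plus[symmetric] del: ennreal_plus)
  thus ?thesis by (rule measure_eq_emeasure_eq_ennreal[rotated]) (use assms(3,4) in simp)
 qed
 note m = this
 show ?thesis
  unfolding loc_integral[OF assms(5,1)] loc_integral[OF assms(5,2)] loc_integral[OF assms(5) convex_inv[OF assms(1-4)]]
  unfolding m by (simp add: sum_distrib_left sum.distrib[symmetric] algebra_simps)
qed

lemma pushforward_iter:
 fixes F :: "'b::{finite, discrete_topology} configuration => 'b configuration"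
 assumes F: "cellular_automaton F" and mu: "\<mu> \<in> invariant_measures"
 shows "(pushforward F ^^ t) \<mu> \<in> invariant_measures"
  and "loc R f ==> (\<integral>x. f x \<partial>(pushforward F ^^ t) \<mu>) = (\<integral>x. f ((F ^^ t) x) \<partial>\<mu>)"
proof -
 have c: "continuous_on UNIV (F ^^ t)" and s: "F ^^ t \<circ> shift_map = shift_map \<circ> F ^^ t" for t
 proof (induction t)
  case (Suc t)
  case 1 show ?case using continuous_on_compose[OF Suc(1), of F] F
    by (auto simp: cellular_automaton_def o_def intro: continuous_on_subset)
  case 2
  have a: "(F ^^ t) (shift_map x) = shift_map ((F ^^ t) x)" "F (shift_map x) = shift_map (F x)" for x
   using fun_cong[OF Suc(2), of x] F by (auto simp: cellular_automaton_def dest: fun_cong[of "F \<circ> shift_map" "shift_map \<circ> F" x])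
  show ?case by (rule ext) (simp add: a)
 qed (simp_all add: id_def fun_eq_iff)
 have Fm: "F ^^ t \<in> borel_measurable borel" for t by (rule borel_measurable_continuous_onI[OF c])
 have sm: "shift_map \<in> borel_measurable (borel :: 'b configuration measure)" using shi_measurable[of 1] by (simp add: shi_1)
 have Fmu: "F ^^ t \<in> measurable \<mu> borel" for t using Fm[of t] invD(1)[OF mu] by (simp cong: measurable_cong_sets)
 have d: "(pushforward F ^^ t) \<mu> = distr \<mu> borel (F ^^ t)"
 proof (induction t)
  case 0
  have "distr \<mu> borel (\<lambda>x. x) = \<mu>" by (rule distr_id2[OF invD(1)[OF mu, symmetric]])
  thus ?case by (simp add: id_def)
 next
  case (Suc t)
  thus ?case using distr_distr[OF Fm[of 1] Fmu[of t]] by (simp add: pushforward_def o_def)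
 qed
 have "distr (distr \<mu> borel (F ^^ t)) borel shift_map = distr \<mu> borel (F ^^ t)"
 proof -
  have sm': "shift_map \<in> measurable \<mu> borel" using sm invD(1)[OF mu] by (simp cong: measurable_cong_sets)
  have "distr (distr \<mu> borel (F ^^ t)) borel shift_map = distr (distr \<mu> borel shift_map) borel (F ^^ t)"
   using distr_distr[OF sm Fmu[of t]] distr_distr[OF Fm[of t] sm'] s[of t] by simp
  thus ?thesis by (simp add: invD(4)[OF mu])
 qed
 moreover have "prob_space (distr \<mu> borel (F ^^ t))" by (rule prob_space.prob_space_distr[OF invD(3)[OF mu] Fmu])
 ultimately show "(pushforward F ^^ t) \<mu> \<in> invariant_measures" unfolding d by (simp add: invariant_measures_def pushforward_def)
 assume l: "loc R f"
 have "f \<in> borel_measurable borel" by (rule borel_measurable_continuous_onI[OF loc_continuous[OF l]])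
 thus "(\<integral>x. f x \<partial>(pushforward F ^^ t) \<mu>) = (\<integral>x. f ((F ^^ t) x) \<partial>\<mu>)" unfolding d by (rule integral_distr[OF Fmu])
qed

section \<open>Weak* neighbourhoods given by finitely many local functions\<close>

lemma weak_star_neighbourhood:
 fixes U :: "'b::{finite, discrete_topology} configuration measure set"
 assumes "openin weak_star U" "\<nu> \<in> U"
 obtains R \<Phi> e where "finite \<Phi>" "\<And>f. f \<in> \<Phi> ==> loc R f" "0 < e"
  "\<forall>\<nu>'\<in>invariant_measures. (\<forall>f\<in>\<Phi>. \<bar>(\<integral>x. f x \<partial>\<nu>') - (\<integral>x. f x \<partial>\<nu>)\<bar> < e) --> \<nu>' \<in> U"
proof -
 define P where "P U \<nu> R \<Phi> e \<longleftrightarrow> finite \<Phi> \<and> (\<forall>f\<in>\<Phi>. loc R f) \<and> 0 < e \<and>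
   (\<forall>\<nu>'\<in>invariant_measures. (\<forall>f\<in>\<Phi>. \<bar>(\<integral>x. f x \<partial>\<nu>') - (\<integral>x. f x \<partial>\<nu>)\<bar> < e) --> \<nu>' \<in> U)"
  for U :: "'b configuration measure set" and \<nu> R \<Phi> and e :: real
 have "generate_topology_on {{\<mu> \<in> invariant_measures. (\<integral>x. f x \<partial>\<mu>) \<in> V} |
    (f :: 'b configuration => real) V. continuous_on UNIV f \<and> open V} U"
  using assms(1) by (simp add: weak_star_def openin_topology_generated_by_iff)
 hence "\<forall>\<nu>\<in>U. \<exists>R \<Phi> e. P U \<nu> R \<Phi> e"
 proof induction
  case (Int A C)
  show ?case
  proof
   fix \<nu> assume "\<nu> \<in> A \<inter> C"
   then obtain R \<Phi> e R' \<Phi>' e' where p: "P A \<nu> R \<Phi> e" "P C \<nu> R' \<Phi>' e'" using Int.IH by blast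
   have "P (A \<inter> C) \<nu> (max R R') (\<Phi> \<union> \<Phi>') (min e e')"
    using p unfolding P_def by (auto intro: loc_mono)
   thus "\<exists>R \<Phi> e. P (A \<inter> C) \<nu> R \<Phi> e" by blast
  qed
 next
  case (UN K)
  show ?case
  proof
   fix \<nu> assume "\<nu> \<in> \<Union>K"
   then obtain k where k: "k \<in> K" "\<nu> \<in> k" by blast
   then obtain R \<Phi> e where p: "P k \<nu> R \<Phi> e" using UN.IH by blast
   have "P (\<Union>K) \<nu> R \<Phi> e" using p k(1) unfolding P_def by blast
   thus "\<exists>R \<Phi> e. P (\<Union>K) \<nu> R \<Phi> e" by blast
  qed
 next
  case (Basis A)
  then obtain f V where f: "A = {\<mu> \<in> invariant_measures. (\<integral>x. f x \<partial>\<mu>) \<in> V}" "continuous_on UNIV (f :: 'b configuration => real)" "open V" by blast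
  show ?case
  proof
   fix \<nu> assume nu: "\<nu> \<in> A"
   hence V: "(\<integral>x. f x \<partial>\<nu>) \<in> V" "\<nu> \<in> invariant_measures" using f(1) by auto
   obtain d where d: "0 < d" "ball (\<integral>x. f x \<partial>\<nu>) d \<subseteq> V" using f(3) V(1) open_contains_ball by metis
   have d3: "0 < d / 3" using d(1) by simp
   obtain R g where g: "loc R g" "\<And>\<nu>. \<nu> \<in> invariant_measures ==> \<bar>(\<integral>x. f x \<partial>\<nu>) - (\<integral>x. g x \<partial>\<nu>)\<bar> \<le> d / 3"
    by (rule local_approximation[OF f(2) d3]) (rule that)
   have "\<nu>' \<in> A" if n: "\<nu>' \<in> invariant_measures" and c: "\<bar>(\<integral>x. g x \<partial>\<nu>') - (\<integral>x. g x \<partial>\<nu>)\<bar> < d / 3" for \<nu>'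
   proof -
    have "\<bar>(\<integral>x. f x \<partial>\<nu>) - (\<integral>x. f x \<partial>\<nu>')\<bar> < d" using g(2)[OF n] g(2)[OF V(2)] c by linarith
    hence "(\<integral>x. f x \<partial>\<nu>') \<in> ball (\<integral>x. f x \<partial>\<nu>) d" by (simp add: dist_real_def)
    thus ?thesis using d(2) n f(1) by blast
   qed
   hence "P A \<nu> R {g} (d / 3)" using g(1) d3 unfolding P_def by simp
   thus "\<exists>R \<Phi> e. P A \<nu> R \<Phi> e" by blast
  qed
 qed simp
 then obtain R \<Phi> e where "P U \<nu> R \<Phi> e" using assms(2) by blast
 thus thesis unfolding P_def by (intro that[of \<Phi> R e]) auto
qed

lemma weak_star_open:
 fixes \<nu> :: "'b::{finite, discrete_topology} configuration measure"
 assumes "finite \<Phi>" "\<And>f. f \<in> \<Phi> ==> loc R f" "0 < e"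
 shows "openin weak_star {\<nu>' \<in> invariant_measures. \<forall>f\<in>\<Phi>. \<bar>(\<integral>x. f x \<partial>\<nu>') - (\<integral>x. f x \<partial>\<nu>)\<bar> < e}"
 using assms(1,2)
proof (induction \<Phi>)
 case empty
 show ?case using openin_topspace[of "weak_star :: 'b configuration measure topology"] by (simp add: topspace_weak_star)
next
 case (insert f \<Phi>)
 have "{\<nu>' \<in> invariant_measures. (\<integral>x. f x \<partial>\<nu>') \<in> ball (\<integral>x. f x \<partial>\<nu>) e}
   \<in> {{\<mu> \<in> invariant_measures. (\<integral>x. f x \<partial>\<mu>) \<in> V} | (f :: 'b configuration => real) V. continuous_on UNIV f \<and> open V}"
  using loc_continuous[of R f] insert.prems by blast
 hence "openin weak_star {\<nu>' \<in> invariant_measures. (\<integral>x. f x \<partial>\<nu>') \<in> ball (\<integral>x. f x \<partial>\<nu>) e}"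
  unfolding weak_star_def by (rule topology_generated_by_Basis)
 moreover have "{\<nu>' \<in> invariant_measures. \<forall>g\<in>insert f \<Phi>. \<bar>(\<integral>x. g x \<partial>\<nu>') - (\<integral>x. g x \<partial>\<nu>)\<bar> < e}
   = {\<nu>' \<in> invariant_measures. (\<integral>x. f x \<partial>\<nu>') \<in> ball (\<integral>x. f x \<partial>\<nu>) e} \<inter>
    {\<nu>' \<in> invariant_measures. \<forall>g\<in>\<Phi>. \<bar>(\<integral>x. g x \<partial>\<nu>') - (\<integral>x. g x \<partial>\<nu>)\<bar> < e}"
  by (auto simp: dist_real_def abs_minus_commute)
 ultimately show ?case using insert by (metis (no_types, lifting) insert_iff openin_Int)
qed

definition seg :: "(nat => 'b::topological_space list) => nat => real => ('b configuration => real) => real" where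
 "seg w n s f = s * (\<integral>x. f x \<partial>periodic_measure (w n)) + (1 - s) * (\<integral>x. f x \<partial>periodic_measure (w (n + 1)))"

text \<open>Each inclusion uses one hypothesis: late images are close to late segments, and all
  points of late segments are close to late images. Half of the tolerance is spent on the hypothesis
  and half on the cluster or closure point.\<close>

lemma limit_measures_eq:
 fixes F :: "'b::{finite, discrete_topology} configuration => 'b configuration" and w :: "nat => 'b list"
 assumes inv: "\<And>t. (pushforward F ^^ t) \<mu> \<in> invariant_measures" and w: "\<And>n. w n \<noteq> []"
  and upper: "\<And>R \<Phi> e N. finite \<Phi> ==> (\<And>f. f \<in> \<Phi> ==> loc R f) ==> 0 < e ==>
   \<exists>t0. \<forall>t\<ge>t0. \<exists>n\<ge>N. \<exists>s\<in>{0..1}. \<forall>f\<in>\<Phi>. \<bar>(\<integral>x. f x \<partial>(pushforward F ^^ t) \<mu>) - seg w n s f\<bar> \<le> e"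
  and lower: "\<And>R \<Phi> e t0. finite \<Phi> ==> (\<And>f. f \<in> \<Phi> ==> loc R f) ==> 0 < e ==>
   \<exists>N. \<forall>n\<ge>N. \<forall>s\<in>{0..1}. \<exists>t\<ge>t0. \<forall>f\<in>\<Phi>. \<bar>(\<integral>x. f x \<partial>(pushforward F ^^ t) \<mu>) - seg w n s f\<bar> \<le> e"
 shows "limit_measures F \<mu> = limit_of_words w"
proof (intro equalityI subsetI)
 let ?c = "\<lambda>n s. convex_combination s (periodic_measure (w n)) (periodic_measure (w (n + 1)))"
 have ci: "?c n s \<in> invariant_measures" if "s \<in> {0..1}" for n s
  using that by (intro convex_inv periodic_measure_inv w) auto
 have ce: "(\<integral>x. f x \<partial>?c n s) = seg w n s f" if "s \<in> {0..1}" "loc R f" for n s R f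
  unfolding seg_def by (rule convex_integral[OF periodic_measure_inv[OF w] periodic_measure_inv[OF w] _ _ that(2)]) (use that(1) in auto)
 {
  fix \<nu> assume nu: "\<nu> \<in> limit_measures F \<mu>"
  show "\<nu> \<in> limit_of_words w" unfolding limit_of_words_def
  proof (rule INT_I)
   fix N :: nat
   show "\<nu> \<in> weak_star closure_of (\<Union>n\<in>{N..}. measure_segment (w n) (w (n + 1)))"
    unfolding in_closure_of
   proof (intro conjI allI impI)
    show "\<nu> \<in> topspace weak_star" using nu by (simp add: limit_measures_def)
    fix U assume U: "\<nu> \<in> U \<and> openin weak_star U"
    obtain R \<Phi> e where n: "finite \<Phi>" "\<And>f. f \<in> \<Phi> ==> loc R f" "0 < e"
     "\<forall>\<nu>'\<in>invariant_measures. (\<forall>f\<in>\<Phi>. \<bar>(\<integral>x. f x \<partial>\<nu>') - (\<integral>x. f x \<partial>\<nu>)\<bar> < e) --> \<nu>' \<in> U"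
     by (rule weak_star_neighbourhood[OF U[THEN conjunct2] U[THEN conjunct1]]) (rule that)
    have e2: "0 < e / 2" using n(3) by simp
    define V where "V = {\<nu>' \<in> invariant_measures. \<forall>f\<in>\<Phi>. \<bar>(\<integral>x. f x \<partial>\<nu>') - (\<integral>x. f x \<partial>\<nu>)\<bar> < e / 2}"
    have V: "openin weak_star V" unfolding V_def by (rule weak_star_open[OF n(1,2) e2])
    have "\<nu> \<in> V" using nu e2 by (simp add: V_def limit_measures_def topspace_weak_star)
    hence "\<exists>\<^sub>F t in sequentially. (pushforward F ^^ t) \<mu> \<in> V" using nu V by (simp add: limit_measures_def)
    moreover obtain t0 where t0: "\<forall>t\<ge>t0. \<exists>n\<ge>N. \<exists>s\<in>{0..1}. \<forall>f\<in>\<Phi>. \<bar>(\<integral>x. f x \<partial>(pushforward F ^^ t) \<mu>) - seg w n s f\<bar> \<le> e / 2"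
     using upper[OF n(1,2) e2] by blast
    ultimately obtain t where t: "t0 \<le> t" "(pushforward F ^^ t) \<mu> \<in> V" unfolding frequently_sequentially by blast
    obtain k s where k: "N \<le> k" "s \<in> {0..1}" "\<forall>f\<in>\<Phi>. \<bar>(\<integral>x. f x \<partial>(pushforward F ^^ t) \<mu>) - seg w k s f\<bar> \<le> e / 2" using t0 t(1) by blast
    have "?c k s \<in> U"
    proof (rule n(4)[rule_format, OF ci[OF k(2)]])
     fix f assume f: "f \<in> \<Phi>"
     have "\<bar>(\<integral>x. f x \<partial>(pushforward F ^^ t) \<mu>) - (\<integral>x. f x \<partial>\<nu>)\<bar> < e / 2" using t(2) f by (simp add: V_def)
     moreover have "\<bar>(\<integral>x. f x \<partial>(pushforward F ^^ t) \<mu>) - seg w k s f\<bar> \<le> e / 2" using k(3) f by blast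
     ultimately show "\<bar>(\<integral>x. f x \<partial>?c k s) - (\<integral>x. f x \<partial>\<nu>)\<bar> < e" unfolding ce[OF k(2) n(2)[OF f]] by linarith
    qed
    moreover have "?c k s \<in> (\<Union>n\<in>{N..}. measure_segment (w n) (w (n + 1)))" using k(1,2) unfolding measure_segment_def by blast
    ultimately show "\<exists>y. y \<in> (\<Union>n\<in>{N..}. measure_segment (w n) (w (n + 1))) \<and> y \<in> U" by blast
   qed
  qed
 next
  fix \<nu> assume nu: "\<nu> \<in> limit_of_words w"
  hence nuc: "\<nu> \<in> weak_star closure_of (\<Union>n\<in>{Suc N..}. measure_segment (w n) (w (n + 1)))" for N
   unfolding limit_of_words_def by blast
  have top: "\<nu> \<in> topspace weak_star" using nuc[of 0] by (simp add: in_closure_of)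
  show "\<nu> \<in> limit_measures F \<mu>" unfolding limit_measures_def
  proof (intro CollectI conjI allI impI top)
   fix U assume U: "openin weak_star U \<and> \<nu> \<in> U"
   obtain R \<Phi> e where n: "finite \<Phi>" "\<And>f. f \<in> \<Phi> ==> loc R f" "0 < e"
    "\<forall>\<nu>'\<in>invariant_measures. (\<forall>f\<in>\<Phi>. \<bar>(\<integral>x. f x \<partial>\<nu>') - (\<integral>x. f x \<partial>\<nu>)\<bar> < e) --> \<nu>' \<in> U"
    by (rule weak_star_neighbourhood[OF U[THEN conjunct1] U[THEN conjunct2]]) (rule that)
   have e2: "0 < e / 2" using n(3) by simp
   define V where "V = {\<nu>' \<in> invariant_measures. \<forall>f\<in>\<Phi>. \<bar>(\<integral>x. f x \<partial>\<nu>') - (\<integral>x. f x \<partial>\<nu>)\<bar> < e / 2}"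
   have V: "openin weak_star V" unfolding V_def by (rule weak_star_open[OF n(1,2) e2])
   have nV: "\<nu> \<in> V" using top e2 by (simp add: V_def topspace_weak_star)
   show "\<exists>\<^sub>F t in sequentially. (pushforward F ^^ t) \<mu> \<in> U"
    unfolding frequently_sequentially
   proof
    fix t0
    obtain N where N: "\<forall>n\<ge>N. \<forall>s\<in>{0..1}. \<exists>t\<ge>t0. \<forall>f\<in>\<Phi>. \<bar>(\<integral>x. f x \<partial>(pushforward F ^^ t) \<mu>) - seg w n s f\<bar> \<le> e / 2"
     using lower[OF n(1,2) e2] by blast
    obtain y where y: "y \<in> (\<Union>n\<in>{Suc N..}. measure_segment (w n) (w (n + 1)))" "y \<in> V"
     using nuc[of N] V nV unfolding in_closure_of by blast
    then obtain k s where k: "N \<le> k" "s \<in> {0..1}" "y = ?c k s" unfolding measure_segment_def by (auto dest: Suc_leD)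
    obtain t where t: "t0 \<le> t" "\<forall>f\<in>\<Phi>. \<bar>(\<integral>x. f x \<partial>(pushforward F ^^ t) \<mu>) - seg w k s f\<bar> \<le> e / 2" using N k(1,2) by blast
    have "(pushforward F ^^ t) \<mu> \<in> U"
    proof (rule n(4)[rule_format, OF inv])
     fix f assume f: "f \<in> \<Phi>"
     have "\<bar>seg w k s f - (\<integral>x. f x \<partial>\<nu>)\<bar> < e / 2" using y(2) f unfolding V_def k(3) ce[OF k(2) n(2)[OF f], symmetric] by blast
     moreover have "\<bar>(\<integral>x. f x \<partial>(pushforward F ^^ t) \<mu>) - seg w k s f\<bar> \<le> e / 2" using t(2) f by blast
     ultimately show "\<bar>(\<integral>x. f x \<partial>(pushforward F ^^ t) \<mu>) - (\<integral>x. f x \<partial>\<nu>)\<bar> < e" by linarith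
    qed
    thus "\<exists>t\<ge>t0. (pushforward F ^^ t) \<mu> \<in> U" using t(1) by blast
   qed
  qed
 }
qed

section \<open>Averages over periodic sequences\<close>

lemma periodic_sum:
 fixes G :: "nat => real"
 assumes "0 < q"
 shows "(\<Sum>z<k. G (z mod q)) = real (k div q) * (\<Sum>p<q. G p) + (\<Sum>p<k mod q. G p)"
proof (induction k)
 case (Suc k)
 show ?case
 proof (cases "Suc (k mod q) = q")
  case True
  have "(\<Sum>p<q. G p) = (\<Sum>p<k mod q. G p) + G (k mod q)" using sum.lessThan_Suc[of G "k mod q"] True by simp
  moreover have "Suc k div q = Suc (k div q)" "Suc k mod q = 0" using True by (auto simp: div_Suc mod_Suc)
  ultimately show ?thesis using Suc by (simp add: distrib_right)
 next
  case False
  hence "Suc k div q = k div q" "Suc k mod q = Suc (k mod q)" using assms by (auto simp: div_Suc mod_Suc)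
  thus ?thesis using Suc by simp
 qed
qed simp

lemma periodic_sum_bound:
 fixes G :: "nat => real"
 assumes q: "0 < q" and S: "\<And>k. k \<le> q ==> \<bar>\<Sum>p<k. G p\<bar> \<le> S"
 shows "\<bar>\<Sum>z<N. G ((z + c) mod q)\<bar> \<le> S * (real N / real q + 3)"
proof -
 define H where "H k = (\<Sum>z<k. G (z mod q))" for k
 have "(\<Sum>z<N. G ((z + c) mod q)) = H (N + c) - H c"
  unfolding H_def by (induction N) simp_all
 also have "\<dots> = (real ((N + c) div q) - real (c div q)) * (\<Sum>p<q. G p) + (\<Sum>p<(N + c) mod q. G p) - (\<Sum>p<c mod q. G p)"
  unfolding H_def periodic_sum[OF q] by (simp add: left_diff_distrib)
 finally have e: "(\<Sum>z<N. G ((z + c) mod q)) = \<dots>" .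
 have d: "0 \<le> real ((N + c) div q) - real (c div q)" by (simp add: div_le_mono)
 have d2: "real ((N + c) div q) - real (c div q) \<le> real N / real q + 1"
 proof -
  have "real ((N + c) div q) \<le> real (N + c) / real q" by (rule of_nat_div_le_of_nat)
  moreover have "real c / real q \<le> real (c div q) + 1"
  proof -
   have "c \<le> (c div q + 1) * q" using dividend_less_div_times[OF q, of c] by (simp add: distrib_right)
   hence "real c \<le> (real (c div q) + 1) * real q" by (metis of_nat_1 of_nat_add of_nat_le_iff of_nat_mult)
   thus ?thesis using q by (simp add: pos_divide_le_eq)
  qed
  ultimately show ?thesis by (simp add: add_divide_distrib)
 qed
 have "\<bar>(real ((N + c) div q) - real (c div q)) * (\<Sum>p<q. G p)\<bar> \<le> (real N / real q + 1) * S"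
  unfolding abs_mult using S[of q] d d2 by (intro mult_mono) auto
 moreover have "\<bar>\<Sum>p<(N + c) mod q. G p\<bar> \<le> S" "\<bar>\<Sum>p<c mod q. G p\<bar> \<le> S" using q by (intro S less_imp_le[OF mod_less_divisor]; simp)+
 ultimately show ?thesis unfolding e by (simp add: algebra_simps)
qed

section \<open>Limit measures\<close>

lemma strict_mono_bracket:
 fixes \<tau> :: "nat => nat"
 assumes "strict_mono \<tau>" "\<tau> j0 \<le> t"
 obtains j where "j0 \<le> j" "\<tau> j \<le> t" "t < \<tau> (Suc j)"
proof -
 have "\<exists>j\<ge>j0. \<tau> j \<le> t \<and> t < \<tau> (Suc j)"
  using assms(2)
 proof (induction t rule: dec_induct)
  case base thus ?case using strict_monoD[OF assms(1), of j0 "Suc j0"] by auto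
 next
  case (step t)
  then obtain j where j: "j0 \<le> j" "\<tau> j \<le> t" "t < \<tau> (Suc j)" by blast
  have "\<tau> (Suc j) < \<tau> (Suc (Suc j))" by (rule strict_monoD[OF assms(1)]) simp
  thus ?case using j by (cases "Suc t < \<tau> (Suc j)") (auto intro: exI[of _ j] exI[of _ "Suc j"])
 qed
 thus thesis using that by blast
qed

text \<open>A sequence with steps of at most \<open>e\<close> cannot jump over the band of radius
  \<open>e\<close> around \<open>v\<close>.\<close>

lemma discrete_ivt:
 fixes g :: "nat => real"
 assumes "p \<le> q" and step: "\<And>t. p \<le> t ==> t < q ==> \<bar>g (Suc t) - g t\<bar> \<le> e"
  and "min (g p) (g q) - e \<le> v" "v \<le> max (g p) (g q) + e"
 obtains t where "p \<le> t" "t \<le> q" "\<bar>g t - v\<bar> \<le> e"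
proof (rule ccontr)
 assume "\<not> thesis"
 hence no: "\<not> \<bar>g t - v\<bar> \<le> e" if "p \<le> t" "t \<le> q" for t using that \<open>\<And>t. p \<le> t ==> t \<le> q ==> \<bar>g t - v\<bar> \<le> e ==> thesis\<close> by blast
 have up: "v + e < g t" if "v + e < g p" "p \<le> t" "t \<le> q" for t
  using that(2,3)
 proof (induction t rule: dec_induct)
  case (step t) thus ?case using assms(2)[of t] no[of "Suc t"] by linarith
 qed (use that in simp)
 have down: "g t < v - e" if "g p < v - e" "p \<le> t" "t \<le> q" for t
  using that(2,3)
 proof (induction t rule: dec_induct)
  case (step t) thus ?case using assms(2)[of t] no[of "Suc t"] by linarith
 qed (use that in simp)
 show False using up[of q] down[of q] no[of p] assms(1,3,4) by linarith
qed

text \<open>Cells to discard are the first \<open>m\<close> and the last \<open>R\<close> of the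
  window and of each restart period; in addition each period may break off inside a copy of
  \<open>v\<close>. With about \<open>N / q\<close> periods of length
  \<open>q = 2 * (K + 1)\<^sup>2\<close> and \<open>length v \<le> 2 * K\<close>, their share is of
  order \<open>1 / (K + 1)\<close>.\<close>

lemma window_average:
 fixes f :: "(int => 'b::finite) => real" and y :: "int => 'b"
 assumes f: "loc R f" "\<And>x. \<bar>f x\<bar> \<le> C" and v: "v \<noteq> []" "length v \<le> 2 * K" and N: "(K + 1) ^ 3 \<le> N"
  and y: "\<And>z. z < N ==> m \<le> z ==> m \<le> (z + c) mod (2 * (K + 1)\<^sup>2) ==> y (int z) = v ! (((z + c) mod (2 * (K + 1)\<^sup>2)) mod length v)"
 shows "\<bar>(\<Sum>z<N. f (shi (int z) y)) / real N - (\<Sum>i<length v. f (shi (int i) (periodic v))) / real (length v)\<bar>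
  \<le> 10 * C * (real m + real R + 2) / (real K + 1)"
proof -
 define q where "q = 2 * (K + 1)\<^sup>2"
 define l where "l = length v"
 define g where "g p = f (shi (int p) (periodic v))" for p
 define av where "av = (\<Sum>i<l. g i) / real l"
 have q0: "0 < q" and l0: "0 < l" using v(1) by (simp_all add: q_def l_def)
 have C0: "0 \<le> C" using f(2)[of undefined] by linarith
 have gC: "\<bar>g p\<bar> \<le> C" for p by (simp add: g_def f(2))
 have avC: "\<bar>av\<bar> \<le> C"
 proof -
  have "\<bar>\<Sum>i<l. g i\<bar> \<le> (\<Sum>i<l. C)" by (rule order_trans[OF sum_abs sum_mono]) (rule gC)
  thus ?thesis using l0 by (simp add: av_def pos_divide_le_eq mult.commute)
 qed
 have G: "\<bar>\<Sum>z<N. g ((z + c) mod q) - av\<bar> \<le> 2 * C * real l * (real N / real q + 3)"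
 proof (rule periodic_sum_bound[OF q0, of "\<lambda>p. g p - av"])
  fix k
  have "shi (int p) (periodic v) = shi (int (p mod l)) (periodic v)" for p
   by (simp add: shi_def periodic_def l_def of_nat_mod mod_add_right_eq)
  hence "(\<Sum>p<k. g p - av) = (\<Sum>p<k. g (p mod l) - av)" unfolding g_def by metis
  also have "\<dots> = real (k div l) * (\<Sum>p<l. g p - av) + (\<Sum>p<k mod l. g p - av)" by (rule periodic_sum[OF l0])
  also have "(\<Sum>p<l. g p - av) = 0" using l0 by (simp add: sum_subtractf av_def)
  finally have "\<bar>\<Sum>p<k. g p - av\<bar> \<le> (\<Sum>p<k mod l. \<bar>g p - av\<bar>)" by simp
  also have "\<dots> \<le> (\<Sum>p<k mod l. 2 * C)"
  proof (rule sum_mono)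
   fix p show "\<bar>g p - av\<bar> \<le> 2 * C" using gC[of p] avC by linarith
  qed
  also have "\<dots> = real (k mod l) * (2 * C)" by simp
  also have "\<dots> \<le> real l * (2 * C)" using l0 C0 by (intro mult_right_mono) (auto intro: less_imp_le)
  finally show "\<bar>\<Sum>p<k. g p - av\<bar> \<le> 2 * C * real l" by (simp add: mult.commute)
 qed
 have c1: "(\<Sum>z<n. of_bool (z < m)) \<le> real m" for n
 proof -
  have "card ({..<n} \<inter> {z. z < m}) \<le> card {..<m}" by (rule card_mono) auto
  thus ?thesis by (simp add: of_bool_def sum.If_cases)
 qed
 have c2: "(\<Sum>z<n. of_bool (n' \<le> z + R)) \<le> real R" if "n \<le> n'" for n n'
 proof -
  have "card ({..<n} \<inter> {z. n' \<le> z + R}) \<le> card {n' - R..<n'}" by (rule card_mono) (use that in auto)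
  thus ?thesis by (simp add: of_bool_def sum.If_cases)
 qed
 define bad :: "nat => real" where "bad p = of_bool (p < m) + of_bool (q \<le> p + R)" for p
 have bad0: "0 \<le> bad p" for p by (simp add: bad_def)
 have B: "\<bar>\<Sum>z<N. bad ((z + c) mod q)\<bar> \<le> (real m + real R) * (real N / real q + 3)"
 proof (rule periodic_sum_bound[OF q0])
  fix k assume "k \<le> q"
  hence "(\<Sum>p<k. bad p) \<le> real m + real R" unfolding bad_def sum.distrib by (intro add_mono c1 c2)
  thus "\<bar>\<Sum>p<k. bad p\<bar> \<le> real m + real R" using bad0 by (simp add: sum_nonneg)
 qed
 have D: "\<bar>f (shi (int z) y) - g ((z + c) mod q)\<bar> \<le> 2 * C * (of_bool (z < m) + of_bool (N \<le> z + R) + bad ((z + c) mod q))"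
  if "z < N" for z
 proof (cases "z < m \<or> N \<le> z + R \<or> (z + c) mod q < m \<or> q \<le> (z + c) mod q + R")
  case True
  hence "1 \<le> of_bool (z < m) + of_bool (N \<le> z + R) + bad ((z + c) mod q)" by (auto simp: bad_def)
  hence "2 * C * 1 \<le> 2 * C * (of_bool (z < m) + of_bool (N \<le> z + R) + bad ((z + c) mod q))" using C0 by (intro mult_left_mono) auto
  moreover have "\<bar>f (shi (int z) y) - g ((z + c) mod q)\<bar> \<le> 2 * C" using gC[of "(z + c) mod q"] f(2)[of "shi (int z) y"] by linarith
  ultimately show ?thesis by simp
 next
  case False
  have "f (shi (int z) y) = g ((z + c) mod q)" unfolding g_def
  proof (rule locD[OF f(1)])
   fix i assume i: "0 \<le> i" "i \<le> int R"
   define k where "k = nat i"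
   have k: "i = int k" "k \<le> R" using i by (auto simp: k_def)
   have "(z + k + c) mod q = ((z + c) mod q + k) mod q" using mod_add_left_eq[of "z + c" q k] by (simp add: add.commute add.left_commute)
   also have "\<dots> = (z + c) mod q + k" using False k(2) by simp
   finally have e: "(z + k + c) mod q = (z + c) mod q + k" .
   have "y (int (z + k)) = v ! (((z + k + c) mod q) mod l)" unfolding q_def l_def
    by (rule y) (use False k(2) e in \<open>auto simp: q_def\<close>)
   thus "shi (int z) y i = shi (int ((z + c) mod q)) (periodic v) i"
    unfolding e by (simp add: shi_def periodic_def k(1) l_def add.commute zmod_int[symmetric] flip: of_nat_add)
  qed
  thus ?thesis using C0 bad0 by simp
 qed
 have "\<bar>\<Sum>z<N. f (shi (int z) y) - g ((z + c) mod q)\<bar> \<le> (\<Sum>z<N. 2 * C * (of_bool (z < m) + of_bool (N \<le> z + R) + bad ((z + c) mod q)))"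
  by (rule order_trans[OF sum_abs sum_mono]) (use D in simp)
 also have "\<dots> = 2 * C * ((\<Sum>z<N. of_bool (z < m)) + (\<Sum>z<N. of_bool (N \<le> z + R)) + (\<Sum>z<N. bad ((z + c) mod q)))"
  by (simp add: sum_distrib_left sum.distrib distrib_left)
 also have "\<dots> \<le> 2 * C * (real m + real R + (real m + real R) * (real N / real q + 3))"
  using C0 B by (intro mult_left_mono add_mono c1 c2) auto
 finally have D': "\<bar>\<Sum>z<N. f (shi (int z) y) - g ((z + c) mod q)\<bar> \<le> 2 * C * ((real m + real R) * (real N / real q + 4))"
  by (simp add: algebra_simps)
 define k where "k = real K + 1"
 have k1: "1 \<le> k" by (simp add: k_def)
 have N3: "k ^ 3 \<le> real N" using N of_nat_mono[OF N, where ?'a = real] by (simp add: k_def add.commute)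
 have N0: "0 < real N" using N3 one_le_power[OF k1, of 3] by linarith
 have qk: "real q = 2 * k\<^sup>2" by (simp add: q_def k_def add.commute)
 have "\<bar>(\<Sum>z<N. f (shi (int z) y)) - real N * av\<bar> \<le> 2 * C * ((real m + real R) * (real N / real q + 4)) + 2 * C * (real l * (real N / real q + 3))"
  using D' G by (simp add: sum_subtractf mult.assoc)
 also have "\<dots> \<le> 2 * C * ((real m + real R) * (real N / real q + 4)) + 2 * C * (real l * (real N / real q + 4))"
  using C0 by (intro add_left_mono mult_left_mono) auto
 also have "\<dots> = 2 * C * ((real m + real R + real l) * (real N / real q + 4))" by (simp only: distrib_left distrib_right)
 finally have X: "\<bar>(\<Sum>z<N. f (shi (int z) y)) - real N * av\<bar> \<le> 2 * C * ((real m + real R + real l) * (real N / real q + 4))" .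
 have s1: "real m + real R + real l \<le> (real m + real R + 2) * k"
 proof -
  have "real l \<le> 2 * k" using v(2) by (simp add: l_def k_def)
  moreover have "(real m + real R) * 1 \<le> (real m + real R) * k" using k1 by (intro mult_left_mono) auto
  ultimately show ?thesis by (simp add: distrib_right)
 qed
 have s2: "real N / real q + 4 \<le> real N * (5 / k\<^sup>2)"
 proof -
  have "4 * k\<^sup>2 \<le> 4 * real N"
  proof -
   have "k\<^sup>2 \<le> k ^ 3" using k1 by (intro power_increasing) auto
   thus ?thesis using N3 by linarith
  qed
  hence "4 \<le> 4 * real N / k\<^sup>2" using k1 by (simp add: pos_le_divide_eq)
  moreover have "real N / real q \<le> real N / k\<^sup>2" using k1 unfolding qk by (intro divide_left_mono) auto
  moreover have "real N * (5 / k\<^sup>2) = real N / k\<^sup>2 + 4 * real N / k\<^sup>2" by (simp add: add_divide_distrib[symmetric])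
  ultimately show ?thesis by linarith
 qed
 have "\<bar>(\<Sum>z<N. f (shi (int z) y)) - real N * av\<bar> \<le> 2 * C * ((real m + real R + 2) * k * (real N * (5 / k\<^sup>2)))"
  by (rule order_trans[OF X mult_left_mono[OF mult_mono[OF s1 s2]]]) (use C0 k1 in auto)
 also have "\<dots> = real N * (10 * C * (real m + real R + 2) / k)" using k1 by (simp add: power2_eq_square field_simps)
 finally have Y: "\<bar>(\<Sum>z<N. f (shi (int z) y)) - real N * av\<bar> \<le> real N * (10 * C * (real m + real R + 2) / k)" .
 have "(\<Sum>z<N. f (shi (int z) y)) / real N - av = ((\<Sum>z<N. f (shi (int z) y)) - real N * av) / real N" using N0 by (simp add: diff_divide_distrib)
 hence "\<bar>(\<Sum>z<N. f (shi (int z) y)) / real N - av\<bar> \<le> 10 * C * (real m + real R + 2) / k"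
  using Y N0 by (simp add: abs_divide pos_divide_le_eq mult.commute)
 thus ?thesis by (simp add: av_def l_def g_def k_def)
qed

text \<open>Meant for windows that show one of two words: \<open>A\<close> tells which, and the
  complement of \<open>G\<close> collects the bad configurations.\<close>

lemma (in prob_space) split_average:
 fixes g :: "'a => real"
 assumes g: "g \<in> borel_measurable M" "\<And>x. \<bar>g x\<bar> \<le> C" and ab: "\<bar>a\<bar> \<le> C" "\<bar>b\<bar> \<le> C"
  and G: "G \<in> events" "1 - \<epsilon> \<le> prob G" and A: "A \<in> events" and k: "0 \<le> \<kappa>"
  and "\<And>x. x \<in> G ==> x \<in> A ==> \<bar>g x - a\<bar> \<le> \<kappa>" "\<And>x. x \<in> G ==> x \<notin> A ==> \<bar>g x - b\<bar> \<le> \<kappa>"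
 shows "\<bar>expectation g - (prob A * a + (1 - prob A) * b)\<bar> \<le> \<kappa> + 2 * C * \<epsilon>"
proof -
 define h where "h x = a * indicator A x + b * indicator (space M - A) x" for x
 define e where "e x = \<kappa> * indicator (space M) x + 2 * C * indicator (space M - G) x" for x
 have C0: "0 \<le> C" using ab by linarith
 have gi: "integrable M g" by (rule integrable_const_bound[of _ C]) (use g in auto)
 have ii: "integrable M (indicator X :: 'a => real)" if "X \<in> events" for X
  by (rule integrable_real_indicator[OF that]) (simp add: emeasure_finite less_top[symmetric])
 have hi: "integrable M h" unfolding h_def by (intro Bochner_Integration.integrable_add integrable_mult_right ii) (use A in auto)
 have ei: "integrable M e" unfolding e_def by (intro Bochner_Integration.integrable_add integrable_mult_right ii) (use G in auto)
 have hE: "expectation h = prob A * a + (1 - prob A) * b"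
 proof -
  have "expectation h = a * prob A + b * prob (space M - A)"
   unfolding h_def by (subst Bochner_Integration.integral_add) (use A in \<open>auto intro!: integrable_mult_right ii\<close>)
  thus ?thesis by (simp add: prob_compl[OF A] mult.commute)
 qed
 have eE: "expectation e \<le> \<kappa> + 2 * C * \<epsilon>"
 proof -
  have "expectation e = \<kappa> * prob (space M) + 2 * C * prob (space M - G)"
   unfolding e_def by (subst Bochner_Integration.integral_add) (use G in \<open>auto intro!: integrable_mult_right ii\<close>)
  also have "\<dots> = \<kappa> + 2 * C * (1 - prob G)" by (simp add: prob_compl[OF G(1)] prob_space)
  also have "\<dots> \<le> \<kappa> + 2 * C * \<epsilon>" using C0 G(2) by (intro add_left_mono mult_left_mono) auto
  finally show ?thesis .
 qed
 have p: "\<bar>g x - h x\<bar> \<le> e x" if x: "x \<in> space M" for x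
 proof (cases "x \<in> G")
  case True
  thus ?thesis using assms(9,10)[of x] x k C0 by (cases "x \<in> A") (auto simp: h_def e_def)
 next
  case False
  have "\<bar>h x\<bar> \<le> C" using ab x by (cases "x \<in> A") (auto simp: h_def)
  thus ?thesis using False x g(2)[of x] k by (simp add: e_def)
 qed
 have "expectation g - expectation h \<le> expectation e" "expectation h - expectation g \<le> expectation e"
  using integral_mono[OF Bochner_Integration.integrable_diff[OF gi hi] ei] integral_mono[OF Bochner_Integration.integrable_diff[OF hi gi] ei]
   p gi hi by (auto simp: abs_le_iff)
 thus ?thesis using eE unfolding hE by linarith
qed

section \<open>Image measures follow the segments\<close>

context sysmix
begin

definition dd :: "nat => ((int => 'b) => real) => real" where
 "dd n f = (\<Sum>i<length (w n). f (shi (int i) (periodic (w n)))) / real (length (w n))"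

definition ee :: "nat => ((int => 'b) => real) => real" where
 "ee t f = (\<integral>x. f ((F ^^ t) x) \<partial>\<mu>)"

definition avg :: "nat => nat => ((int => 'b) => real) => (int => 'b) => real" where
 "avg N t f x = (\<Sum>z<N. f (shi (int z) ((F ^^ t) x))) / real N"

lemma muI: "\<mu> \<in> invariant_measures"
 using mu by (simp add: full_mixing_measures_def)

lemma F_ca: "cellular_automaton F"
proof (rule cellular_automatonI)
 show "F x z = F y z" if "\<And>i. z - 4 * L \<le> i ==> i \<le> z + 4 * L ==> x i = y i" for x y z
  by (rule F_local[OF SS_ne that])
qed (rule F_shift)

lemma loc_shi: "loc R f ==> loc (R + n) (\<lambda>x. f (shi (int n) x))"
 unfolding loc_def[of "R + n"] by (intro allI impI, erule locD) (simp add: shi_def)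

lemma dd_bound: assumes "\<And>x. \<bar>f x\<bar> \<le> C" shows "\<bar>dd n f\<bar> \<le> C"
proof -
 have "\<bar>\<Sum>i<length (w n). f (shi (int i) (periodic (w n)))\<bar> \<le> (\<Sum>i<length (w n). C)" by (rule order_trans[OF sum_abs sum_mono]) (rule assms)
 thus ?thesis using w0[of n] by (simp add: dd_def pos_divide_le_eq mult.commute)
qed

lemma loc_F:
 assumes "loc R f"
 shows "(\<lambda>x. f ((F ^^ t) x)) \<in> borel_measurable \<mu>"
  and "integrable \<mu> (\<lambda>x. f ((F ^^ t) x))"
proof -
 have "dep {- 4 * LL * int t..int R + 4 * LL * int t} ((\<lambda>x. f ((F ^^ t) x)) -` V)" for V
 proof (rule depI)
  fix x y :: "int => 'b" assume e: "\<And>i. i \<in> {- 4 * LL * int t..int R + 4 * LL * int t} ==> x i = y i" and x: "x \<in> (\<lambda>x. f ((F ^^ t) x)) -` V"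
  have "f ((F ^^ t) x) = f ((F ^^ t) y)" by (rule locD[OF assms], rule F_pow_local, rule e) auto
  thus "y \<in> (\<lambda>x. f ((F ^^ t) x)) -` V" using x by simp
 qed
 hence s: "(\<lambda>x. f ((F ^^ t) x)) -` V \<in> sets \<mu>" for V by (rule meas_dep[rotated]) simp
 show m: "(\<lambda>x. f ((F ^^ t) x)) \<in> borel_measurable \<mu>" by (rule measurableI) (use s in \<open>auto simp: space_mu\<close>)
 obtain C where C: "\<And>x. \<bar>f x\<bar> \<le> C" using loc_bound[OF assms] by metis
 show "integrable \<mu> (\<lambda>x. f ((F ^^ t) x))" by (rule integrable_const_bound[of _ C]) (use C m in auto)
qed

lemma ee_shi: assumes "loc R f" shows "(\<integral>x. f (shi (int n) ((F ^^ t) x)) \<partial>\<mu>) = ee t f"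
proof -
 note p = pushforward_iter(1)[OF F_ca muI, of t] pushforward_iter(2)[OF F_ca muI, of _ _ t]
 have "(\<integral>x. f (shi (int n) ((F ^^ t) x)) \<partial>\<mu>) = (\<integral>x. f (shi (int n) x) \<partial>(pushforward F ^^ t) \<mu>)"
  by (rule p(2)[OF loc_shi[OF assms], symmetric])
 also have "\<dots> = (\<integral>x. f x \<partial>(pushforward F ^^ t) \<mu>)"
  by (rule inv_integral_shi[OF p(1) borel_measurable_continuous_onI[OF loc_continuous[OF assms]]])
 finally show ?thesis using p(2)[OF assms] by (simp add: ee_def)
qed

lemma avg_expect: assumes "loc R f" "0 < N" shows "expectation (avg N t f) = ee t f"
proof -
 have "expectation (avg N t f) = (\<Sum>z<N. \<integral>x. f (shi (int z) ((F ^^ t) x)) \<partial>\<mu>) / real N"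
  unfolding avg_def by (simp add: Bochner_Integration.integral_sum loc_F(2)[OF loc_shi[OF assms(1)]])
 thus ?thesis using assms(2) by (simp add: ee_shi[OF assms(1)])
qed

lemma avg_measurable: assumes "loc R f" shows "avg N t f \<in> borel_measurable \<mu>"
 unfolding avg_def by (intro borel_measurable_divide borel_measurable_sum borel_measurable_const loc_F(1)[OF loc_shi[OF assms]])

lemma avg_bound: assumes "\<And>x. \<bar>f x\<bar> \<le> C" "0 < N" shows "\<bar>avg N t f x\<bar> \<le> C"
proof -
 have "\<bar>\<Sum>z<N. f (shi (int z) ((F ^^ t) x))\<bar> \<le> (\<Sum>z<N. C)" by (rule order_trans[OF sum_abs sum_mono]) (rule assms)
 thus ?thesis using assms(2) by (simp add: avg_def pos_divide_le_eq mult.commute)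
qed

lemma good_average:
 assumes g: "\<And>z. z < lam h ==> gd x j h t (int z)" and j: "T 1 \<le> Suc j"
 obtains K where "j < K" "K \<le> h" "\<forall>R f C. loc R f --> (\<forall>x. \<bar>f x\<bar> \<le> C) -->
  \<bar>avg (lam h) t f x - dd (idx K) f\<bar> \<le> 10 * C * (real (2 * length mm) + real R + 2) / (real K + 1)"
proof -
 have so: "system_orbit M w a b u T" by unfold_locales
 have g': "\<not> cov (B ((F ^^ t) x)) (int z) \<and> evolution.good LL cry (\<lambda>t. B ((F ^^ t) x)) j h (stt h) t (int z)" if "z < lam h" for z
  using g[OF that] unfolding gd_def bx_def by simp
 show thesis
 proof (rule system_orbit.window_stream[OF so _ g' _ j])
  show "0 < lam h" by (simp add: lam_def)
  show "8 * (h + 1)\<^sup>2 + 2 \<le> stt h" by (simp add: stt_def)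
  fix K c assume K: "j < K" "K \<le> h" "ell (w (idx K)) \<le> K"
   and y: "\<And>z. z < lam h ==> 2 * length mm \<le> z ==> 2 * length mm \<le> (z + c) mod (2 * (K + 1)\<^sup>2) ==>
     (F ^^ t) x (int z) = w (idx K) ! (((z + c) mod (2 * (K + 1)\<^sup>2)) mod length (w (idx K)))"
  have lw: "length (w (idx K)) \<le> 2 * K" using K(3) by (auto simp: ell_def split: if_splits)
  have lamK: "(K + 1) ^ 3 \<le> lam h" unfolding lam_def by (rule power_mono) (use K(2) in auto)
  show thesis
  proof (rule that[OF K(1,2)], intro allI impI)
   fix R f and C :: real assume f: "loc R f" and "\<forall>x :: int => 'b. \<bar>f x\<bar> \<le> C"
   hence fC: "\<And>x. \<bar>f x\<bar> \<le> C" by blast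
   show "\<bar>avg (lam h) t f x - dd (idx K) f\<bar> \<le> 10 * C * (real (2 * length mm) + real R + 2) / (real K + 1)"
    unfolding avg_def dd_def by (rule window_average[OF f fC w0 lw lamK y])
  qed
 qed
qed

text \<open>A range of \<open>r\<close> sizes that begins this late cannot contain a whole round,
  since round \<open>n\<close> takes more than \<open>n\<close> steps and here
  \<open>n \<ge> r\<close>; so at most two consecutive indices occur in it.\<close>

lemma idx_two:
 assumes "T (Suc r) \<le> Suc j" "Suc j \<le> K" "K \<le> j + r"
 shows "idx (Suc j) \<le> idx K" "idx K \<le> Suc (idx (Suc j))"
proof -
 define n where "n = idx (Suc j)"
 show "idx (Suc j) \<le> idx K" by (rule idx_mono[OF assms(2)])
 have "T (Suc (Suc r)) > T (Suc r)" using T(2)[of "Suc r"] by simp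
 hence "idx (T (Suc r)) = r" by (intro idx_eqI) auto
 hence rn: "r \<le> n" using idx_mono[OF assms(1)] by (simp add: n_def)
 have "Suc j < T (Suc (Suc n))" using idx_upper[of "Suc j"] by (simp add: n_def)
 hence K: "K < T (Suc (Suc (Suc n)))" using T(2)[of "Suc (Suc n)"] rn assms(3) by linarith
 show "idx K \<le> Suc (idx (Suc j))"
 proof (rule ccontr)
  assume "\<not> idx K \<le> Suc (idx (Suc j))"
  hence "T (Suc (Suc (Suc n))) \<le> T (Suc (idx K))" by (intro T_mono) (simp add: n_def)
  moreover have "T 1 \<le> K" using T_mono[of 1 "Suc r"] assms(1,2) by linarith
  ultimately show False using idx_lower[of K] K by linarith
 qed
qed

text \<open>The weight \<open>s\<close> is the probability that the window shows the earlier of the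
  two words; it serves all test functions at once. Successive images differ little because on cells
  uncovered at both times \<open>F\<close> acts as the shift, which preserves the integrals.\<close>

theorem segment_path:
 assumes fin: "finite \<Phi>" and loc: "\<And>f. f \<in> \<Phi> ==> loc R f" and e: "0 < e"
 obtains r \<tau> j1 where "strict_mono (\<tau> :: nat => nat)" "0 < r"
  "\<And>j t. j1 \<le> j ==> \<tau> j \<le> t ==> t < \<tau> (Suc j) ==>
    \<exists>s\<in>{0..1}. \<forall>f\<in>\<Phi>. \<bar>ee t f - (s * dd (idx (Suc j)) f + (1 - s) * dd (Suc (idx (Suc j))) f)\<bar> \<le> e"
  "\<And>j t. j1 \<le> j ==> \<tau> j \<le> t ==> t < \<tau> (Suc j) ==> idx (j + r) = idx (Suc j) ==>
    \<forall>f\<in>\<Phi>. \<bar>ee t f - dd (idx (Suc j)) f\<bar> \<le> e"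
  "\<And>t f. \<tau> j1 \<le> t ==> f \<in> \<Phi> ==> \<bar>ee (Suc t) f - ee t f\<bar> \<le> e"
proof -
 have "\<exists>C. \<forall>f\<in>\<Phi>. \<forall>x. \<bar>f x\<bar> \<le> C"
  using fin loc
 proof (induction \<Phi>)
  case (insert f \<Phi>)
  then obtain C where C: "\<forall>g\<in>\<Phi>. \<forall>x. \<bar>g x\<bar> \<le> C" by blast
  obtain C' where C': "\<And>x. \<bar>f x\<bar> \<le> C'" using loc_bound[OF insert.prems[of f]] by blast
  show ?case by (rule exI[of _ "max C C'"]) (use C C' in \<open>auto simp: le_max_iff_disj\<close>)
 qed simp
 then obtain C0 where C0: "\<forall>f\<in>\<Phi>. \<forall>x. \<bar>f x\<bar> \<le> C0" by blast
 define C where "C = max C0 1"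
 have C: "\<bar>f x\<bar> \<le> C" if "f \<in> \<Phi>" for f x using C0 that by (auto simp: C_def le_max_iff_disj)
 have C1: "1 \<le> C" by (simp add: C_def)
 define \<epsilon> where "\<epsilon> = min 1 (e / (8 * C))"
 have \<epsilon>: "0 < \<epsilon>" "\<epsilon> \<le> 1" "8 * C * \<epsilon> \<le> e"
 proof -
  show "0 < \<epsilon>" "\<epsilon> \<le> 1" using e C1 by (auto simp: \<epsilon>_def)
  have "8 * C * \<epsilon> \<le> 8 * C * (e / (8 * C))" using C1 by (intro mult_left_mono) (auto simp: \<epsilon>_def)
  thus "8 * C * \<epsilon> \<le> e" using C1 by simp
 qed
 obtain r \<tau> j0 where \<tau>: "strict_mono (\<tau> :: nat => nat)" "0 < r"
  and G: "\<And>j t. j0 \<le> j ==> \<tau> j \<le> t ==> t < \<tau> (Suc j) ==>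
   \<exists>G\<in>sets \<mu>. 1 - \<epsilon> \<le> measure \<mu> G \<and> (\<forall>x\<in>G. \<forall>z<lam (j + r). gd x j (j + r) t (int z))"
  by (rule good_prob[OF \<epsilon>(1,2)]) (rule that)
 define Q where "Q = 10 * C * (real (2 * length mm) + real R + 2)"
 obtain j2 where j2: "2 * Q / e < real j2" using reals_Archimedean2 by blast
 \<comment> \<open>Beyond the thresholds of \<open>good_prob\<close> (\<open>j0\<close>), of the
   error in \<open>window_average\<close> (\<open>j2\<close>) and of \<open>idx_two\<close>;
   \<open>R + 1\<close> makes the window contain the cells on which the test functions
   depend.\<close>
 define j1 where "j1 = max (max j0 j2) (T (Suc r) + R + 1)"
 have j1: "j0 \<le> j" "T (Suc r) \<le> Suc j" "T 1 \<le> Suc j" "R + 1 \<le> j" "\<And>K. j < K ==> Q / (real K + 1) \<le> e / 2" if "j1 \<le> j" for j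
 proof -
  have a: "j0 \<le> j" "j2 \<le> j" "T (Suc r) + R + 1 \<le> j" using that by (auto simp: j1_def)
  show "j0 \<le> j" "T (Suc r) \<le> Suc j" "R + 1 \<le> j" using a by auto
  show "T 1 \<le> Suc j" using T_mono[of 1 "Suc r"] a by simp
  fix K assume "j < K"
  hence "2 * Q / e \<le> real K + 1" using j2 a(2) by linarith
  hence "2 * Q \<le> (real K + 1) * e" using e by (simp add: pos_divide_le_eq)
  hence "Q \<le> e / 2 * (real K + 1)" by (simp add: algebra_simps)
  thus "Q / (real K + 1) \<le> e / 2" by (simp add: pos_divide_le_eq)
 qed
 have lam0: "0 < lam h" for h by (simp add: lam_def)
 have eC: "e / 2 + 2 * C * \<epsilon> \<le> e" using \<epsilon>(3) e by linarith
 have K: "\<exists>K. j < K \<and> K \<le> j + r \<and> (\<forall>f\<in>\<Phi>. \<bar>avg (lam (j + r)) t f x - dd (idx K) f\<bar> \<le> e / 2)"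
  if j: "j1 \<le> j" and x: "\<forall>z<lam (j + r). gd x j (j + r) t (int z)" for j t x
 proof -
  have x': "\<And>z. z < lam (j + r) ==> gd x j (j + r) t (int z)" using x by blast
  obtain K where K: "j < K" "K \<le> j + r" "\<forall>R f C. loc R f --> (\<forall>x. \<bar>f x\<bar> \<le> C) -->
    \<bar>avg (lam (j + r)) t f x - dd (idx K) f\<bar> \<le> 10 * C * (real (2 * length mm) + real R + 2) / (real K + 1)"
   by (rule good_average[OF x' j1(3)[OF j]], assumption) (rule that)
  have "\<bar>avg (lam (j + r)) t f x - dd (idx K) f\<bar> \<le> e / 2" if f: "f \<in> \<Phi>" for f
   using order_trans[OF K(3)[rule_format, OF loc[OF f] C[OF f]] j1(5)[OF j K(1), unfolded Q_def]] .
  thus ?thesis using K(1,2) by blast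
 qed
 show thesis
 proof (rule that[of \<tau> r j1, OF \<tau>])
  fix j t assume j: "j1 \<le> j" and t: "\<tau> j \<le> t" "t < \<tau> (Suc j)"
  define n where "n = idx (Suc j)"
  define N where "N = lam (j + r)"
  obtain G where G: "G \<in> sets \<mu>" "1 - \<epsilon> \<le> measure \<mu> G" "\<And>x. x \<in> G ==> \<forall>z<lam (j + r). gd x j (j + r) t (int z)"
   using G[OF j1(1)[OF j] t] by blast
  \<comment> \<open>The condition runs over all test functions, so that the resulting weight does
    not depend on one of them. Outside of \<open>A\<close> a good window must show the word with
    index \<open>n + 1\<close>.\<close>
  define A where "A = {x. \<forall>f\<in>\<Phi>. \<bar>avg N t f x - dd n f\<bar> \<le> e / 2}"
  have As: "A \<in> sets \<mu>"
  proof -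
   have "Measurable.pred \<mu> (\<lambda>x. \<forall>f\<in>\<Phi>. \<bar>avg N t f x - dd n f\<bar> \<le> e / 2)"
   proof (rule pred_intros_finite(3)[OF fin])
    fix f assume "f \<in> \<Phi>"
    note avg_measurable[OF loc[OF this], measurable]
    show "Measurable.pred \<mu> (\<lambda>x. \<bar>avg N t f x - dd n f\<bar> \<le> e / 2)" by measurable
   qed
   thus ?thesis by (simp add: A_def pred_def space_mu)
  qed
  have idx2: "n \<le> idx K \<and> idx K \<le> Suc n" if "j < K" "K \<le> j + r" for K
   using idx_two[OF j1(2)[OF j], of K] that by (simp add: n_def)
  have cA: "\<bar>avg N t f x - dd (Suc n) f\<bar> \<le> e / 2" if f: "f \<in> \<Phi>" and x: "x \<in> G" and xA: "x \<notin> A" for f x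
  proof -
   obtain K where K: "j < K" "K \<le> j + r" "\<forall>f\<in>\<Phi>. \<bar>avg (lam (j + r)) t f x - dd (idx K) f\<bar> \<le> e / 2"
    using K[OF j G(3)[OF x]] by blast
   have "idx K \<noteq> n" using xA K(3) by (auto simp: A_def N_def)
   hence "idx K = Suc n" using idx2[OF K(1,2)] by linarith
   thus ?thesis using K(3) f by (simp add: N_def)
  qed
  have main: "\<bar>ee t f - (measure \<mu> A' * dd n f + (1 - measure \<mu> A') * dd (Suc n) f)\<bar> \<le> e"
   if f: "f \<in> \<Phi>" and A': "A' \<in> sets \<mu>" and c1: "\<And>x. x \<in> G ==> x \<in> A' ==> \<bar>avg N t f x - dd n f\<bar> \<le> e / 2"
    and c2: "\<And>x. x \<in> G ==> x \<notin> A' ==> \<bar>avg N t f x - dd (Suc n) f\<bar> \<le> e / 2" for f A'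
  proof -
   have "\<bar>expectation (avg N t f) - (measure \<mu> A' * dd n f + (1 - measure \<mu> A') * dd (Suc n) f)\<bar> \<le> e / 2 + 2 * C * \<epsilon>"
    by (rule split_average[OF avg_measurable[OF loc[OF f]] avg_bound[OF C[OF f]] dd_bound[OF C[OF f]] dd_bound[OF C[OF f]] G(1,2) A' _ c1 c2])
     (use lam0 e in \<open>auto simp: N_def\<close>)
   thus ?thesis using eC unfolding avg_expect[OF loc[OF f] lam0, folded N_def] by (simp add: N_def avg_expect[OF loc[OF f] lam0])
  qed
  show "\<exists>s\<in>{0..1}. \<forall>f\<in>\<Phi>. \<bar>ee t f - (s * dd (idx (Suc j)) f + (1 - s) * dd (Suc (idx (Suc j))) f)\<bar> \<le> e"
  proof (intro bexI ballI)
   show "measure \<mu> A \<in> {0..1}" by simp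
   fix f assume f: "f \<in> \<Phi>"
   show "\<bar>ee t f - (measure \<mu> A * dd (idx (Suc j)) f + (1 - measure \<mu> A) * dd (Suc (idx (Suc j))) f)\<bar> \<le> e"
    unfolding n_def[symmetric] by (rule main[OF f As _ cA[OF f]]) (use f in \<open>auto simp: A_def\<close>)
  qed
  assume one: "idx (j + r) = idx (Suc j)"
  show "\<forall>f\<in>\<Phi>. \<bar>ee t f - dd (idx (Suc j)) f\<bar> \<le> e"
  proof
   fix f assume f: "f \<in> \<Phi>"
   have "\<bar>ee t f - (measure \<mu> UNIV * dd n f + (1 - measure \<mu> UNIV) * dd (Suc n) f)\<bar> \<le> e"
   proof (rule main[OF f])
    show "UNIV \<in> sets \<mu>" using sets.top[of \<mu>] by (simp add: space_mu)
    fix x assume x: "x \<in> G"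
    obtain K where K: "j < K" "K \<le> j + r" "\<forall>f\<in>\<Phi>. \<bar>avg (lam (j + r)) t f x - dd (idx K) f\<bar> \<le> e / 2"
     using K[OF j G(3)[OF x]] by blast
    have "idx K = n" using idx2[OF K(1,2)] idx_mono[OF K(2)] one by (simp add: n_def)
    thus "\<bar>avg N t f x - dd n f\<bar> \<le> e / 2" using K(3) f by (simp add: N_def)
   qed simp
   thus "\<bar>ee t f - dd (idx (Suc j)) f\<bar> \<le> e" using prob_space by (simp add: space_mu n_def)
  qed
 next
  fix t f assume t: "\<tau> j1 \<le> t" and f: "f \<in> \<Phi>"
  have w: "\<exists>G\<in>sets \<mu>. 1 - \<epsilon> \<le> measure \<mu> G \<and> (\<forall>x\<in>G. \<forall>z\<le>R + 1. \<not> cov (bx x t) (int z))" if t': "\<tau> j1 \<le> t" for t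
  proof -
   obtain j where j: "j1 \<le> j" "\<tau> j \<le> t" "t < \<tau> (Suc j)" by (rule strict_mono_bracket[OF \<tau>(1) t'])
   have "R + 1 < lam (j + r)"
   proof -
    have "(j + r + 1) ^ 1 \<le> (j + r + 1) ^ 3" by (rule power_increasing) auto
    thus ?thesis using j1(4)[OF j(1)] by (simp add: lam_def)
   qed
   thus ?thesis using G[OF j1(1)[OF j(1)] j(2,3)] unfolding gd_def by (meson le_less_trans)
  qed
  obtain G1 G2 where G1: "G1 \<in> sets \<mu>" "1 - \<epsilon> \<le> measure \<mu> G1" "\<And>x z. x \<in> G1 ==> z \<le> R + 1 ==> \<not> cov (bx x t) (int z)"
   and G2: "G2 \<in> sets \<mu>" "1 - \<epsilon> \<le> measure \<mu> G2" "\<And>x z. x \<in> G2 ==> z \<le> R + 1 ==> \<not> cov (bx x (Suc t)) (int z)"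
   using w[OF t] w[of "Suc t"] t by (meson le_SucI)
  have eq: "f ((F ^^ Suc t) x) = f (shi (int 1) ((F ^^ t) x))" if x: "x \<in> G1 \<inter> G2" for x
  proof (rule locD[OF loc[OF f]])
   fix i assume i: "0 \<le> i" "i \<le> int R"
   have "\<not> cov (bx x (Suc t)) (int (nat i))" by (rule G2(3)) (use x i in auto)
   moreover have "\<not> cov (bx x t) (int (nat i + 1))" by (rule G1(3)) (use x i in auto)
   ultimately have "F ((F ^^ t) x) i = (F ^^ t) x (i + 1)" using i by (intro F_open) (simp_all add: bx_def add.commute)
   thus "(F ^^ Suc t) x i = shi (int 1) ((F ^^ t) x) i" by (simp add: shi_def)
  qed
  have Gs: "G1 \<inter> G2 \<in> sets \<mu>" using G1(1) G2(1) by blast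
  have mG: "1 - 2 * \<epsilon> \<le> measure \<mu> (G1 \<inter> G2)"
  proof -
   have "measure \<mu> (G1 \<union> G2) = measure \<mu> G1 + measure \<mu> G2 - measure \<mu> (G1 \<inter> G2)"
    by (rule measure_Un3) (use G1(1) G2(1) in \<open>auto simp: fmeasurable_eq_sets\<close>)
   moreover have "measure \<mu> (G1 \<union> G2) \<le> 1" by simp
   ultimately show ?thesis using G1(2) G2(2) by linarith
  qed
  define g where "g x = f ((F ^^ Suc t) x) - f (shi (int 1) ((F ^^ t) x))" for x
  have g1: "g \<in> borel_measurable \<mu>" unfolding g_def
   by (intro borel_measurable_diff loc_F(1)[OF loc_shi[OF loc[OF f]]] loc_F(1)[OF loc[OF f]])
  have gb: "\<bar>g x\<bar> \<le> 2 * C" for x unfolding g_def using C[OF f, of "(F ^^ Suc t) x"] C[OF f, of "shi (int 1) ((F ^^ t) x)"] by linarith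
  have "\<bar>expectation g - (measure \<mu> (G1 \<inter> G2) * 0 + (1 - measure \<mu> (G1 \<inter> G2)) * 0)\<bar> \<le> 0 + 2 * (2 * C) * (2 * \<epsilon>)"
   by (rule split_average[OF g1 gb _ _ Gs mG Gs]) (use C1 eq in \<open>auto simp: g_def\<close>)
  moreover have "expectation g = ee (Suc t) f - ee t f"
   unfolding g_def by (subst Bochner_Integration.integral_diff) (use loc_F(2)[OF loc_shi[OF loc[OF f], of 1]] loc_F(2)[OF loc[OF f], of "Suc t"] loc_F(2)[OF loc[OF f]] ee_shi[OF loc[OF f], of 1] in \<open>auto simp: ee_def\<close>)
  ultimately show "\<bar>ee (Suc t) f - ee t f\<bar> \<le> e" using \<epsilon>(3) by simp
 qed
qed

theorem limit_measures_F: "limit_measures F \<mu> = limit_of_words w"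
proof (rule limit_measures_eq)
 note inv = pushforward_iter(1)[OF F_ca muI]
 have sg: "seg w n s f = s * dd n f + (1 - s) * dd (Suc n) f"
  and ee: "(\<integral>x. f x \<partial>(pushforward F ^^ t) \<mu>) = ee t f" if "loc R f" for R f s n t
  using periodic_measure_integral[OF w0 that] pushforward_iter(2)[OF F_ca muI that] by (simp_all add: seg_def dd_def ee_def)
 show "(pushforward F ^^ t) \<mu> \<in> invariant_measures" for t by (rule inv)
 show "w n \<noteq> []" for n by (rule w0)
 {
  fix R \<Phi> and e :: real and N
  assume a: "finite \<Phi>" "\<And>f. f \<in> \<Phi> ==> loc R (f :: (int => 'b) => real)" "0 < e"
  obtain r \<tau> j1 where \<tau>: "strict_mono (\<tau> :: nat => nat)"
   and seg: "\<And>j t. j1 \<le> j ==> \<tau> j \<le> t ==> t < \<tau> (Suc j) ==>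
    \<exists>s\<in>{0..1}. \<forall>f\<in>\<Phi>. \<bar>ee t f - (s * dd (idx (Suc j)) f + (1 - s) * dd (Suc (idx (Suc j))) f)\<bar> \<le> e"
   by (rule segment_path[OF a], assumption) (rule that)
  have "\<exists>n\<ge>N. \<exists>s\<in>{0..1}. \<forall>f\<in>\<Phi>. \<bar>(\<integral>x. f x \<partial>(pushforward F ^^ t) \<mu>) - seg w n s f\<bar> \<le> e"
   if t: "\<tau> (max j1 (T (Suc N))) \<le> t" for t
  proof -
   obtain j where j: "max j1 (T (Suc N)) \<le> j" "\<tau> j \<le> t" "t < \<tau> (Suc j)" by (rule strict_mono_bracket[OF \<tau> t])
   have "idx (T (Suc N)) = N" using T(2)[of "Suc N"] by (intro idx_eqI) auto
   hence "N \<le> idx (Suc j)" using idx_mono[of "T (Suc N)" "Suc j"] j(1) by simp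
   moreover obtain s where "s \<in> {0..1}" "\<forall>f\<in>\<Phi>. \<bar>ee t f - (s * dd (idx (Suc j)) f + (1 - s) * dd (Suc (idx (Suc j))) f)\<bar> \<le> e"
    using seg[OF _ j(2,3)] j(1) by auto
   ultimately show ?thesis using sg[OF a(2)] ee[OF a(2)] by (intro exI[of _ "idx (Suc j)"] conjI bexI[of _ s]) auto
  qed
  thus "\<exists>t0. \<forall>t\<ge>t0. \<exists>n\<ge>N. \<exists>s\<in>{0..1}. \<forall>f\<in>\<Phi>. \<bar>(\<integral>x. f x \<partial>(pushforward F ^^ t) \<mu>) - seg w n s f\<bar> \<le> e" by blast
 next
  fix R \<Phi> and e :: real and t0
  assume a: "finite \<Phi>" "\<And>f. f \<in> \<Phi> ==> loc R (f :: (int => 'b) => real)" "0 < e"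
  define c where "c = e / 3"
  have c0: "0 < c" using a(3) by (simp add: c_def)
  obtain r \<tau> j1 where \<tau>: "strict_mono (\<tau> :: nat => nat)" and r0: "0 < r"
   and seg: "\<And>j t. j1 \<le> j ==> \<tau> j \<le> t ==> t < \<tau> (Suc j) ==>
    \<exists>s\<in>{0..1}. \<forall>f\<in>\<Phi>. \<bar>ee t f - (s * dd (idx (Suc j)) f + (1 - s) * dd (Suc (idx (Suc j))) f)\<bar> \<le> c"
   and one: "\<And>j t. j1 \<le> j ==> \<tau> j \<le> t ==> t < \<tau> (Suc j) ==> idx (j + r) = idx (Suc j) ==>
    \<forall>f\<in>\<Phi>. \<bar>ee t f - dd (idx (Suc j)) f\<bar> \<le> c"
   and step: "\<And>t f. \<tau> j1 \<le> t ==> f \<in> \<Phi> ==> \<bar>ee (Suc t) f - ee t f\<bar> \<le> c"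
   by (rule segment_path[OF a(1,2) c0], assumption) (rule that)
  have main: "\<exists>t\<ge>t0. \<forall>f\<in>\<Phi>. \<bar>ee t f - (s * dd n f + (1 - s) * dd (Suc n) f)\<bar> \<le> e"
   if n: "max (max j1 t0) r + 1 \<le> n" and s: "0 \<le> s" "s \<le> 1" for n s
  proof (cases "\<Phi> = {}")
   case False
   define gap where "gap f = \<bar>dd n f - dd (Suc n) f\<bar>" for f
   \<comment> \<open>The test function that separates the two ends of the segment best: a bound on
     \<open>\<bar>s' - s\<bar>\<close> times its gap holds for the gaps of all other functions as
     well.\<close>
   obtain f0 where f0: "f0 \<in> \<Phi>" "\<And>f. f \<in> \<Phi> ==> gap f \<le> gap f0"
   proof -
    have "Max (gap ` \<Phi>) \<in> gap ` \<Phi>" using a(1) False by (intro Max_in) auto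
    then obtain f0 where "f0 \<in> \<Phi>" "Max (gap ` \<Phi>) = gap f0" by auto
    thus thesis using that[of f0] Max_ge[of "gap ` \<Phi>"] a(1) by auto
   qed
   \<comment> \<open>At \<open>ja\<close> all train sizes in the range \<open>ja + 1\<close> to
     \<open>ja + r\<close> carry the index \<open>n\<close>, at \<open>jb\<close> all carry
     \<open>n + 1\<close>; so the image measures are close to the two ends of the segment there, and
     in between they stay close to the segment.\<close>
   define ja where "ja = T (Suc n) - 1"
   define jb where "jb = T (Suc (Suc n)) - 1"
   have Tn: "Suc n \<le> T (Suc n)" "T (Suc n) + Suc n < T (Suc (Suc n))" "T (Suc (Suc n)) + Suc (Suc n) < T (Suc (Suc (Suc n)))"
    using T_ge[of "Suc n"] T(2)[of "Suc n"] T(2)[of "Suc (Suc n)"] by auto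
   have ja: "Suc ja = T (Suc n)" and jb: "Suc jb = T (Suc (Suc n))" using Tn by (simp_all add: ja_def jb_def)
   have jj: "j1 \<le> ja" "t0 \<le> ja" "ja < jb" "r \<le> n" using n Tn ja jb by linarith+
   have ida: "idx (Suc j) = n" if "ja \<le> j" "j < jb" for j
    by (rule idx_eqI) (use that ja jb in auto)
   have idr: "idx (ja + r) = n" by (rule idx_eqI; use ja jj(4) Tn r0 in linarith)
   have idb: "idx (Suc jb) = Suc n" "idx (jb + r) = idx (Suc jb)"
   proof -
    show b: "idx (Suc jb) = Suc n" by (rule idx_eqI; use jb Tn in linarith)
    show "idx (jb + r) = idx (Suc jb)" unfolding b by (rule idx_eqI; use jb jj(4) Tn r0 in linarith)
   qed
   have \<tau>m: "\<tau> j < \<tau> j'" if "j < j'" for j j' using strict_monoD[OF \<tau> that] .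
   have A: "\<bar>ee (\<tau> ja) f - dd n f\<bar> \<le> c" if "f \<in> \<Phi>" for f
    using one[OF jj(1) order_refl \<tau>m[of ja "Suc ja"]] idr ida[of ja] jj(3) that by simp
   have B: "\<bar>ee (\<tau> jb) f - dd (Suc n) f\<bar> \<le> c" if "f \<in> \<Phi>" for f
    using one[OF _ order_refl \<tau>m[of jb "Suc jb"]] idb jj(1,3) that by simp
   define v where "v = s * dd n f0 + (1 - s) * dd (Suc n) f0"
   have v: "min (dd n f0) (dd (Suc n) f0) \<le> v" "v \<le> max (dd n f0) (dd (Suc n) f0)"
    unfolding v_def using s convex_bound_le[of "dd n f0" "max (dd n f0) (dd (Suc n) f0)" "dd (Suc n) f0" s "1 - s"]
     convex_bound_le[of "- dd n f0" "- min (dd n f0) (dd (Suc n) f0)" "- dd (Suc n) f0" s "1 - s"] by auto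
   obtain t where t: "\<tau> ja \<le> t" "t \<le> \<tau> jb" "\<bar>ee t f0 - v\<bar> \<le> c"
   proof (rule discrete_ivt[of "\<tau> ja" "\<tau> jb" "\<lambda>t. ee t f0" c v])
    show "\<tau> ja \<le> \<tau> jb" using \<tau>m[OF jj(3)] by simp
    have "\<tau> j1 \<le> \<tau> ja" using strict_mono_less_eq[OF \<tau>] jj(1) by simp
    thus "\<bar>ee (Suc t) f0 - ee t f0\<bar> \<le> c" if "\<tau> ja \<le> t" for t using step[OF _ f0(1)] that by simp
    show "min (ee (\<tau> ja) f0) (ee (\<tau> jb) f0) - c \<le> v" "v \<le> max (ee (\<tau> ja) f0) (ee (\<tau> jb) f0) + c"
     using v A[OF f0(1)] B[OF f0(1)] by linarith+
   qed (rule that)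
   have "\<exists>s'\<in>{0..1}. \<forall>f\<in>\<Phi>. \<bar>ee t f - (s' * dd n f + (1 - s') * dd (Suc n) f)\<bar> \<le> c"
   proof (cases "t = \<tau> jb")
    case True thus ?thesis using B by (intro bexI[of _ 0]) auto
   next
    case False
    obtain j where j: "ja \<le> j" "\<tau> j \<le> t" "t < \<tau> (Suc j)" by (rule strict_mono_bracket[OF \<tau> t(1)])
    have "\<tau> j < \<tau> jb" using j(2) t(2) False by linarith
    hence "j < jb" using strict_mono_less[OF \<tau>] by simp
    thus ?thesis using seg[OF _ j(2,3)] ida[OF j(1)] j(1) jj(1) by simp
   qed
   then obtain s' where s': "\<And>f. f \<in> \<Phi> ==> \<bar>ee t f - (s' * dd n f + (1 - s') * dd (Suc n) f)\<bar> \<le> c" by blast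
   have d: "(s' * dd n f + (1 - s') * dd (Suc n) f) - (s * dd n f + (1 - s) * dd (Suc n) f) = (s' - s) * (dd n f - dd (Suc n) f)" for f
    by (simp add: algebra_simps)
   have "\<bar>(s' - s) * (dd n f0 - dd (Suc n) f0)\<bar> \<le> 2 * c" using s'[OF f0(1)] t(3) unfolding v_def d[symmetric] by linarith
   hence g: "\<bar>s' - s\<bar> * gap f0 \<le> 2 * c" by (simp add: gap_def abs_mult)
   have "\<bar>ee t f - (s * dd n f + (1 - s) * dd (Suc n) f)\<bar> \<le> e" if f: "f \<in> \<Phi>" for f
   proof -
    have "\<bar>s' - s\<bar> * gap f \<le> \<bar>s' - s\<bar> * gap f0" by (rule mult_left_mono[OF f0(2)[OF f]]) simp
    hence "\<bar>(s' - s) * (dd n f - dd (Suc n) f)\<bar> \<le> 2 * c" using g by (simp add: gap_def abs_mult)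
    thus ?thesis using s'[OF f] unfolding d[symmetric] c_def by linarith
   qed
   moreover have "t0 \<le> t" using t(1) jj(2) strict_mono_imp_increasing[OF \<tau>, of ja] by linarith
   ultimately show ?thesis by blast
  qed auto
  have "\<exists>t\<ge>t0. \<forall>f\<in>\<Phi>. \<bar>(\<integral>x. f x \<partial>(pushforward F ^^ t) \<mu>) - seg w n s f\<bar> \<le> e"
   if "max (max j1 t0) r + 1 \<le> n" "s \<in> {0..1}" for n s
   using main[OF that(1), of s] that(2) sg[OF a(2)] ee[OF a(2)] by auto
  thus "\<exists>N. \<forall>n\<ge>N. \<forall>s\<in>{0..1}. \<exists>t\<ge>t0. \<forall>f\<in>\<Phi>. \<bar>(\<integral>x. f x \<partial>(pushforward F ^^ t) \<mu>) - seg w n s f\<bar> \<le> e" by blast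
 }
qed

end

text \<open>If \<open>w n\<close> is at most twice as long as \<open>u0\<close>, its period carries
  the final \<open>b\<close> back into the run of letters \<open>a\<close>. If it is longer, at most
  one seam between copies of \<open>w n\<close> falls into \<open>u0 @ u0\<close>, so one of the two
  copies of \<open>u0\<close> lies within \<open>w n\<close>.\<close>

lemma avoiding_word:
 fixes w :: "nat => 'b list"
 assumes w: "\<And>n. w n \<noteq> []" and u0: "\<And>n. \<not> sublist u0 (w n)" and ab: "a \<noteq> b"
 shows "\<not> occurs (u0 @ u0 @ replicate (2 * length u0) a @ [b]) (periodic (w n)) p"
proof
 define k where "k = length u0"
 define v where "v = w n"
 define l where "l = length v"
 assume o: "occurs (u0 @ u0 @ replicate (2 * length u0) a @ [b]) (periodic (w n)) p"
 have val: "periodic v (p + int i) = (u0 @ u0 @ replicate (2 * k) a @ [b]) ! i" if "i \<le> 4 * k" for i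
  using occursD[OF o, of i] that by (simp add: k_def v_def)
 have l0: "0 < l" using w[of n] by (simp add: l_def v_def)
 show False
 proof (cases "l \<le> 2 * k")
  case True
  have "periodic v (p + int (4 * k - l)) = a" using val[of "4 * k - l"] True l0 by (auto simp: nth_append k_def)
  moreover have "periodic v (p + int (4 * k)) = b" using val[of "4 * k"] by (simp add: nth_append k_def)
  moreover have "periodic v (p + int (4 * k)) = periodic v (p + int (4 * k - l))"
  proof -
   have "(p + int (4 * k)) mod int l = (p + int (4 * k - l)) mod int l"
   proof -
    have "p + int (4 * k) = p + int (4 * k - l) + int l" using True by simp
    thus ?thesis by (metis mod_add_self2)
   qed
   thus ?thesis by (simp add: periodic_def l_def)
  qed
  ultimately show False using ab by simp
 next
  case False
  define s where "s = nat (p mod int l)"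
  have s: "int s = p mod int l" "s < l" using l0 by (auto simp: s_def nat_less_iff)
  have pv: "periodic v (p + int i) = v ! ((s + i) mod l)" for i
  proof -
   have "(p + int i) mod int l = int ((s + i) mod l)" unfolding of_nat_mod of_nat_add s(1) by (simp add: mod_add_left_eq)
   thus ?thesis by (simp add: periodic_def l_def)
  qed
  have sub: "sublist u0 v" if c: "c + k \<le> l" and e: "\<And>i. i < k ==> v ! (c + i) = u0 ! i" for c
  proof -
   have "take k (drop c v) = u0" using c e by (intro nth_equalityI) (auto simp: k_def l_def)
   hence "v = take c v @ u0 @ drop k (drop c v)" by (metis append_take_drop_id)
   thus ?thesis unfolding sublist_def by blast
  qed
  have "sublist u0 v"
  proof (cases "s + k \<le> l")
   case True
   show ?thesis
   proof (rule sub[OF True])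
    fix i assume i: "i < k"
    hence "v ! (s + i) = periodic v (p + int i)" using True by (simp add: pv)
    thus "v ! (s + i) = u0 ! i" using val[of i] i by (simp add: nth_append k_def)
   qed
  next
   case c: False
   show ?thesis
   proof (rule sub[of "s + k - l"])
    show "s + k - l + k \<le> l" using s(2) False by simp
    fix i assume i: "i < k"
    have "(s + (k + i)) mod l = s + k - l + i" using c s(2) False i by (simp add: mod_if) linarith
    hence "v ! (s + k - l + i) = periodic v (p + int (k + i))" unfolding pv by simp
    thus "v ! (s + k - l + i) = u0 ! i" using val[of "k + i"] i by (simp add: nth_append k_def)
   qed
  qed
  thus False using u0[of n] by (simp add: v_def)
 qed
qed

text \<open>With a single letter there is only one configuration, and all integrals in question
  agree. The case is separate because the coding distinguishes two letters.\<close>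

lemma one_letter:
 fixes w :: "nat => 'b::{finite, discrete_topology} list"
 assumes one: "\<And>a b :: 'b. a = b" and w: "\<And>n. w n \<noteq> []" and mu: "\<mu> \<in> invariant_measures"
 shows "limit_measures id \<mu> = limit_of_words w"
proof (rule limit_measures_eq[OF _ w])
 have c: "x = y" for x y :: "int => 'b" using one by blast
 have id: "(pushforward id ^^ t) \<mu> = \<mu>" for t
 proof (induction t)
  case (Suc t)
  have "distr \<mu> borel id = \<mu>" using distr_id2[OF invD(1)[OF mu, symmetric]] by (simp add: id_def)
  thus ?case using Suc by (simp add: pushforward_def id_def)
 qed simp
 show "(pushforward id ^^ t) \<mu> \<in> invariant_measures" for t using mu by (simp add: id)
 have i: "(\<integral>x. f x \<partial>\<nu>) = f y" if "\<nu> \<in> invariant_measures" for f :: "(int => 'b) => real" and \<nu> y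
 proof -
  interpret prob_space \<nu> by (rule invD(3)[OF that])
  have "(\<integral>x. f x \<partial>\<nu>) = (\<integral>x. f y \<partial>\<nu>)" by (rule Bochner_Integration.integral_cong[OF refl], rule arg_cong[of _ _ f], rule c)
  thus ?thesis using prob_space by simp
 qed
 have e: "\<bar>(\<integral>x. f x \<partial>(pushforward id ^^ t) \<mu>) - seg w n s f\<bar> \<le> e"
  if "0 < e" for f t s n and e :: real
  unfolding seg_def id i[OF mu, where f = f and y = undefined] i[OF periodic_measure_inv[OF w], where f = f and y = undefined] using that by (simp add: algebra_simps)
 show "\<exists>t0. \<forall>t\<ge>t0. \<exists>n\<ge>N. \<exists>s\<in>{0..1}. \<forall>f\<in>\<Phi>. \<bar>(\<integral>x. f x \<partial>(pushforward id ^^ t) \<mu>) - seg w n s f\<bar> \<le> e"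
  if "0 < e" for N \<Phi> and e :: real
  by (rule exI[of _ 0], intro allI impI, rule exI[of _ N], intro conjI order_refl bexI[of _ 0] ballI e[OF that]) simp
 show "\<exists>N. \<forall>n\<ge>N. \<forall>s\<in>{0..1}. \<exists>t\<ge>t0. \<forall>f\<in>\<Phi>. \<bar>(\<integral>x. f x \<partial>(pushforward id ^^ t) \<mu>) - seg w n s f\<bar> \<le> e"
  if "0 < e" for t0 \<Phi> and e :: real
  by (rule exI[of _ 0], intro allI impI ballI, rule exI[of _ t0], intro conjI order_refl ballI e[OF that])
qed

theorem theorem2:
  fixes w :: "nat \<Rightarrow> 'b::{finite, discrete_topology} list"
  assumes "\<And>n. w n \<noteq> []"
    and "uniformly_computable w"
    and "\<exists>u. \<forall>n. \<not> sublist u (w n)"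
  shows "\<exists>F :: 'b configuration \<Rightarrow> 'b configuration. cellular_automaton F \<and>
           (\<forall>\<mu> \<in> full_mixing_measures. limit_measures F \<mu> = limit_of_words w)"
proof (cases "\<exists>a b :: 'b. a \<noteq> b")
 case False
 hence "\<And>a b :: 'b. a = b" by blast
 from one_letter[OF this assms(1)] show ?thesis
  by (intro exI[of _ id]) (auto simp: cellular_automaton_def full_mixing_measures_def id_def)
next
 case True
 then obtain a b :: 'b where ab: "a \<noteq> b" by blast
 obtain u0 where "\<forall>n. \<not> sublist u0 (w n)" using assms(3) by blast
 hence u0: "\<And>n. \<not> sublist u0 (w n)" by blast
 \<comment> \<open>\<open>u0\<close> might occur across the seam of two copies of
   \<open>w n\<close>; this longer word occurs in none of the periodic configurations.\<close>
 define u where "u = u0 @ u0 @ replicate (2 * length u0) a @ [b]"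
 obtain M where M: "finite (dom M)"
  "\<And>n. \<exists>q h. (machine_step M)\<^sup>*\<^sup>* (0, 0, input_tape n) (q, h, output_tape (w n) h) \<and> M (q, output_tape (w n) h h) = None"
  using assms(2) unfolding uniformly_computable_def by blast
 obtain T where T: "T 0 = 0" "\<And>n. T n + n < T (Suc n)" "\<And>n. ell (w n) \<le> T (Suc n)" "\<And>n. fin (U M (T (Suc n) - 1) 0)"
  "\<And>n s i. T (Suc n) \<le> s \<Longrightarrow> s < T (Suc (Suc n)) \<Longrightarrow> fN (U M s i) = Ek (w n) (ell (w n)) i"
  using schedule[of w M, OF assms(1) M(2)] by blast
 have av: "\<not> occurs u (periodic (w n)) p" for n p unfolding u_def by (rule avoiding_word[OF assms(1) u0 ab])
 interpret system M w a b u T by unfold_locales (use M(1) ab assms(1) av T in auto)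
 have sm: "sysmix M w a b u T \<mu>" if "\<mu> \<in> full_mixing_measures" for \<mu> by unfold_locales (rule that)
 have "cellular_automaton F"
 proof (rule cellular_automatonI)
  show "F x z = F y z" if "\<And>i. z - 4 * L \<le> i \<Longrightarrow> i \<le> z + 4 * L \<Longrightarrow> x i = y i" for x y z
   by (rule F_local[OF SS_ne that])
 qed (rule F_shift)
 thus ?thesis using sysmix.limit_measures_F[OF sm] by blast
qed

end
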